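(* Let $G=\mathbf{SL}(2,\mathbb{R})\times\mathbf{SL}(2,\mathbb{R})$ and let $l=(l_1,l_2),n=(n_1,n_2)\in\mathbb{Z}^2\cong\widehat{K}$ with $l_1\equiv n_1\pmod 2$ and $l_2\equiv n_2\pmod 2$. A function $\varphi\in\mathrm{Hol}(\mathfrak{a}^*_{\mathbb{C}},\mathrm{Hom}_M(E_l,E_n))$ satisfies the intertwining condition (D.3) (with $\gamma=l$, $\tau=n$) if and only if there exists a holomorphic function $h$ on $\mathfrak{a}^*_{\mathbb{C}}\cong\mathbb{C}^2$ with $h(\lambda_1,\lambda_2)=h(-\lambda_1,\lambda_2)=h(\lambda_1,-\lambda_2)$ such that $$\varphi(\lambda_1,\lambda_2)=h(\lambda_1,\lambda_2)\cdot q_{l,n}(\lambda_1,\lambda_2),\qquad q_{l,n}(\lambda_1,\lambda_2):=q_{l_1,n_1}(\lambda_1)\,q_{l_2,n_2}(\lambda_2).$$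
   Context: Setting. $G=G'\times G'$, $G'=\mathbf{SL}(2,\mathbb{R})=K'A'N'$ with $K'=\mathbf{SO}(2)=\{k_\theta=\begin{pmatrix}\cos\theta&\sin\theta\\-\sin\theta&\cos\theta\end{pmatrix}\}$, $A'=\{\mathrm{diag}(e^t,e^{-t})\}$, $N'$ upper triangular unipotent, $M'=\{\pm\mathrm{Id}\}$; $K=K'\times K'$, $A=A'\times A'$, $N=N'\times N'$, $M=M'\times M'$. $\widehat{K'}=\{\delta_n:n\in\mathbb{Z}\}$, $\delta_n(k_\theta)=e^{in\theta}$; for $n=(n_1,n_2)\in\mathbb{Z}^2$ the $K$-representation $n$ on $E_n\cong\mathbb{C}$ is $\delta_{n_1}\otimes\delta_{n_2}$. With $\alpha(\mathrm{diag}(t,-t))=2t$ identify $(\mathfrak{a}')^*_{\mathbb{C}}\cong\mathbb{C}$ via $z\alpha\mapsto z$, so $\mathfrak{a}^*_{\mathbb{C}}\cong\mathbb{C}^2$, $\rho=(\frac12,\frac12)$; $a^\nu=e^{\nu(\log a)}$. Under the parity condition $\mathrm{Hom}_M(E_l,E_n)\cong\mathbb{C}$. Polynomials. For integers $p\equiv q\pmod2$ and $\lambda\in\mathbb{C}$: $$q_{p,q}(\lambda)=\begin{cases}1,&p=q,\\(\lambda+\frac{|q|+1}2)(\lambda+\frac{|q|+3}2)\cdots(\lambda+\frac{|p|-1}2),&|p|>|q|\text{ and same signs},\\(\lambda-\frac{|p|+1}2)(\lambda-\frac{|p|+3}2)\cdots(\lambda-\frac{|q|-1}2),&|p|<|q|\text{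 and same signs},\\(\lambda+\frac{|p|-1}2)(\lambda+\frac{|p|-3}2)\cdots(\lambda-\frac{|q|-1}2),&\text{else (different signs)},\end{cases}$$ with consecutive factors whose constant terms differ by $1$ (if one of $p,q$ is $0$ the formulas agree). Principal series. For $\sigma\in\widehat{M}$ on $E_\sigma$ and $\lambda\in\mathfrak{a}^*_{\mathbb{C}}$: $H^{\sigma,\lambda}_\infty$ is the space of smooth $f:G\to E_\sigma$ with $f(gman)=a^{-(\lambda+\rho)}\sigma(m)^{-1}f(g)$, $G$ acting by left translation $\pi_{\sigma,\lambda}$; restriction to $K$ identifies it with $H^\sigma_\infty=\{f\in C^\infty(K,E_\sigma):f(km)=\sigma(m)^{-1}f(k)\}$. Derived representations. For $d\in\mathbb{N}_0$ let $H^\sigma_{[\lambda]}$ be the germs at $\lambda$ of holomorphic maps $\mu\mapsto\phi_\mu\in H^\sigma_\infty$ with $(g\phi)_\mu=\pi_{\sigma,\mu}(g)\phi_\mu$, $m_\lambda$ the maximal ideal of the ring of holomorphic germs at $\lambda$, $H^{\sigma,\lambda}_{\infty,(d)}:=H^\sigma_{[\lambda]}/m_\lambda^{d+1}H^\sigma_{[\lambda]}$. Similarly $\mathrm{Hom}_M(E_\tau,E_\sigma)^\lambda_{(d)}$ is the space of holomorphic $\mathrm{Hom}_M(E_\tau,E_\sigma)$-valued functions modulo $m_\lambda^{d+1}$. Intertwining data. An intertwining datum $(\xi,W)$ is a finite sequence $\xi=((\sigma_i,\lambda_i,d_i))_{i=1}^s$ with $\sigma_i\in\widehat{M}$, $\lambda_i\in\mathfrak{a}^*_{\mathbb{C}}$,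 $d_i\in\mathbb{N}_0$, with a proper closed $G$-subrepresentation $W\subset H_\xi:=\bigoplus_iH^{\sigma_i,\lambda_i}_{\infty,(d_i)}$. For a $K$-representation $\tau$, $D^\tau_W$ is the set of $t=(t_1,\dots,t_s)\in\bigoplus_i\mathrm{Hom}_M(E_\tau,E_{\sigma_i})^{\lambda_i}_{(d_i)}$ whose Frobenius partner $T\in\mathrm{Hom}_K(E_\tau,H_\xi)$, $T(v)_i=[\mu\mapsto(k\mapsto t_{i,\mu}\tau(k)^{-1}v)]$, takes values in $W$. Condition (D.3) for $\varphi\in\mathrm{Hol}(\mathfrak{a}^*_{\mathbb{C}},\mathrm{Hom}_M(E_\gamma,E_\tau))$: for each intertwining datum $(\xi,W)$ and each non-zero $t\in D^\tau_W$, $(t_1\circ\varphi_1,\dots,t_s\circ\varphi_s)\in D^\gamma_W$, where $\varphi_i$ is the class of the germ of $\varphi$ at $\lambda_i$ modulo $m_{\lambda_i}^{d_i+1}$. *)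

theory Defs
  imports "HOL-Analysis.Analysis" "HOL-Library.Function_Algebras"
begin

section \<open>The group \<open>SL(2,\<real>) \<times> SL(2,\<real>)\<close>\<close>

type_synonym mat2 = "real^2^2"
type_synonym grp = "mat2 \<times> mat2"
type_synonym c2 = "complex \<times> complex"

definition SL2 :: "mat2 set" where
  "SL2 = {g. det g = 1}"

definition rot :: "real \<Rightarrow> mat2" where
  "rot \<theta> = vector [vector [cos \<theta>, sin \<theta>], vector [- sin \<theta>, cos \<theta>]]"

definition dg :: "real \<Rightarrow> mat2" where
  "dg t = vector [vector [exp t, 0], vector [0, exp (- t)]]"

definition unip :: "real \<Rightarrow> mat2" where
  "unip x = vector [vector [1, x], vector [0, 1]]"

definition gmul :: "grp \<Rightarrow> grp \<Rightarrow> grp" (infixl "\<odot>" 70) where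
  "x \<odot> y = (fst x ** fst y, snd x ** snd y)"

definition ginv :: "grp \<Rightarrow> grp" where
  "ginv x = (matrix_inv (fst x), matrix_inv (snd x))"

definition rot2 :: "real \<times> real \<Rightarrow> grp" where
  "rot2 \<theta> = (rot (fst \<theta>), rot (snd \<theta>))"

definition dg2 :: "real \<times> real \<Rightarrow> grp" where
  "dg2 t = (dg (fst t), dg (snd t))"

definition unip2 :: "real \<times> real \<Rightarrow> grp" where
  "unip2 x = (unip (fst x), unip (snd x))"

definition GG :: "grp set" where
  "GG = SL2 \<times> SL2"

definition KK :: "grp set" where
  "KK = range rot \<times> range rot"

definition MM :: "grp set" where
  "MM = {mat 1, - mat 1} \<times> {mat 1, - mat 1}"

text \<open>The irreducible representations of the finite abelian group \<open>M\<close>, as characters.\<close>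

definition M_hat :: "(grp \<Rightarrow> complex) set" where
  "M_hat = {\<sigma>. (\<forall>m\<in>MM. \<sigma> m \<noteq> 0) \<and> (\<forall>m\<in>MM. \<forall>m'\<in>MM. \<sigma> (m \<odot> m') = \<sigma> m * \<sigma> m')}"

text \<open>The first row of \<open>rot \<theta>\<close> is \<open>(cos \<theta>, sin \<theta>)\<close>, so \<open>delta n (rot \<theta>) = exp (\<i> n \<theta>)\<close>,
  see \<open>delta_rot\<close> below.\<close>

definition delta :: "int \<Rightarrow> mat2 \<Rightarrow> complex" where
  "delta n k = Complex (k$1$1) (k$1$2) powi n"

definition delta2 :: "int \<times> int \<Rightarrow> grp \<Rightarrow> complex" where
  "delta2 n k = delta (fst n) (fst k) * delta (snd n) (snd k)"

text \<open>\<open>Hom\<^sub>M(E\<^sub>n, E\<^sub>\<sigma>)\<close> for the restriction to \<open>M\<close> of the \<open>K\<close>-type \<open>n\<close>. All spaces are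
  one-dimensional, so linear maps are scalars. With \<open>\<sigma> = delta2 n'\<close> this is
  \<open>Hom\<^sub>M(E\<^sub>n, E\<^bsub>n'\<^esub>)\<close>.\<close>

definition Hom_M :: "int \<times> int \<Rightarrow> (grp \<Rightarrow> complex) \<Rightarrow> complex set" where
  "Hom_M n \<sigma> = {c. \<forall>m\<in>MM. c * delta2 n m = \<sigma> m * c}"

text \<open>Iwasawa components: \<open>g = iwa_K g ** dg (iwa_H g) ** unip x\<close>. Since \<open>dg t ** unip x\<close> fixes the
  direction of the first basis vector, they are read off from the first column of \<open>g\<close>.\<close>

definition iwa_r :: "mat2 \<Rightarrow> real" where
  "iwa_r g = sqrt ((g$1$1)\<^sup>2 + (g$2$1)\<^sup>2)"

definition iwa_H :: "mat2 \<Rightarrow> real" where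
  "iwa_H g = ln (iwa_r g)"

definition iwa_K :: "mat2 \<Rightarrow> mat2" where
  "iwa_K g = vector [vector [g$1$1 / iwa_r g, - (g$2$1 / iwa_r g)],
                     vector [g$2$1 / iwa_r g, g$1$1 / iwa_r g]]"

definition kap :: "grp \<Rightarrow> grp" where
  "kap g = (iwa_K (fst g), iwa_K (snd g))"

definition logA :: "grp \<Rightarrow> real \<times> real" where
  "logA g = (iwa_H (fst g), iwa_H (snd g))"

text \<open>\<open>a_pow \<nu> t\<close> is \<open>a\<^sup>\<nu>\<close> for \<open>a = dg2 t\<close>; the coordinate \<open>z\<close> on the dual of the Lie algebra of the
  diagonal subgroup stands for \<open>z\<alpha>\<close> with \<open>\<alpha> (diag (t, -t)) = 2 t\<close>.\<close>

definition a_pow :: "c2 \<Rightarrow> real \<times> real \<Rightarrow> complex" where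
  "a_pow \<nu> t = exp (2 * (fst \<nu> * of_real (fst t) + snd \<nu> * of_real (snd t)))"

definition rho :: c2 where
  "rho = (1/2, 1/2)"


section \<open>Smooth functions on \<open>K\<close> and the principal series\<close>

definition dir_deriv :: "'a \<Rightarrow> ('a::real_normed_vector \<Rightarrow> 'b::real_normed_vector) \<Rightarrow> 'a \<Rightarrow> 'b" where
  "dir_deriv v F x = frechet_derivative F (at x) v"

primrec C_k :: "nat \<Rightarrow> ('a::real_normed_vector \<Rightarrow> 'b::real_normed_vector) \<Rightarrow> bool" where
  "C_k 0 F \<longleftrightarrow> continuous_on UNIV F"
| "C_k (Suc k) F \<longleftrightarrow> (\<forall>x. F differentiable at x) \<and> (\<forall>v. C_k k (dir_deriv v F))"

definition C_inf :: "('a::real_normed_vector \<Rightarrow> 'b::real_normed_vector) \<Rightarrow> bool" where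
  "C_inf F \<longleftrightarrow> (\<forall>k. C_k k F)"

text \<open>Functions on \<open>K\<close> are functions on all pairs of matrices that vanish outside \<open>K\<close>; smoothness is
  tested in the covering chart \<open>rot2\<close>.\<close>

definition C_inf_K :: "(grp \<Rightarrow> complex) set" where
  "C_inf_K = {f. (\<forall>x. x \<notin> KK \<longrightarrow> f x = 0) \<and> C_inf (\<lambda>\<theta>. f (rot2 \<theta>))}"

definition H_inf :: "(grp \<Rightarrow> complex) \<Rightarrow> (grp \<Rightarrow> complex) set" where
  "H_inf \<sigma> = {f \<in> C_inf_K. \<forall>k\<in>KK. \<forall>m\<in>MM. f (k \<odot> m) = inverse (\<sigma> m) * f k}"

text \<open>The seminorms \<open>sup\<^sub>K |\<partial>\<^sub>1\<^sup>i \<partial>\<^sub>2\<^sup>j f|\<close> defining the Frechet topology of \<open>C\<^sup>\<infinity>(K)\<close>.\<close>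

definition smooth_norm :: "nat \<Rightarrow> nat \<Rightarrow> (grp \<Rightarrow> complex) \<Rightarrow> real" where
  "smooth_norm i j f =
     (SUP \<theta>. norm ((dir_deriv (1, 0) ^^ i) ((dir_deriv (0, 1) ^^ j) (\<lambda>\<theta>. f (rot2 \<theta>))) \<theta>))"

text \<open>The extension of \<open>f\<close> from \<open>K\<close> to \<open>G\<close> as an element of the principal series with parameter
  \<open>\<nu>\<close>, i.e. the inverse of restriction to \<open>K\<close> (see \<open>ps_extend_restrict\<close>, \<open>ps_extend_equivariant\<close>
  and \<open>ps_extend_unique\<close> below), and left translation transported to \<open>K\<close>.\<close>

definition ps_extend :: "c2 \<Rightarrow> (grp \<Rightarrow> complex) \<Rightarrow> grp \<Rightarrow> complex" where
  "ps_extend \<nu> f x = a_pow (- (\<nu> + rho)) (logA x) * f (kap x)"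

definition ps_act :: "c2 \<Rightarrow> grp \<Rightarrow> (grp \<Rightarrow> complex) \<Rightarrow> grp \<Rightarrow> complex" where
  "ps_act \<nu> g f k = (if k \<in> KK then ps_extend \<nu> f (ginv g \<odot> k) else 0)"


section \<open>Holomorphic maps and jets\<close>

definition hol2_on :: "(c2 \<Rightarrow> complex) \<Rightarrow> c2 set \<Rightarrow> bool" where
  "hol2_on f U \<longleftrightarrow>
     (\<forall>z\<in>U. \<exists>a b. (f has_derivative (\<lambda>h. a * fst h + b * snd h)) (at z))"

text \<open>Complex differentiability with values in the Frechet space \<open>H_inf \<sigma>\<close>.\<close>

definition hol_H_on :: "(grp \<Rightarrow> complex) \<Rightarrow> (c2 \<Rightarrow> grp \<Rightarrow> complex) \<Rightarrow> c2 set \<Rightarrow> bool" where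
  "hol_H_on \<sigma> \<phi> U \<longleftrightarrow> (\<forall>\<mu>\<in>U. \<phi> \<mu> \<in> H_inf \<sigma>) \<and>
     (\<forall>\<mu>\<in>U. \<exists>A\<in>H_inf \<sigma>. \<exists>B\<in>H_inf \<sigma>. \<forall>i j.
        ((\<lambda>h. smooth_norm i j (\<lambda>k. \<phi> (\<mu> + h) k - \<phi> \<mu> k - (fst h * A k + snd h * B k)) / norm h)
           \<longlongrightarrow> 0) (at 0))"

text \<open>Germs at \<open>\<nu>\<close> are represented by globally defined functions that are holomorphic near \<open>\<nu>\<close>.
  Germ equality is built into \<open>max_ideal_mult\<close> (rule \<open>cong\<close>) and thereby into \<open>jet_class\<close>.\<close>

definition germ_H :: "(grp \<Rightarrow> complex) \<Rightarrow> c2 \<Rightarrow> (c2 \<Rightarrow> grp \<Rightarrow> complex) set" where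
  "germ_H \<sigma> \<nu> = {\<phi>. \<exists>U. open U \<and> \<nu> \<in> U \<and> hol_H_on \<sigma> \<phi> U}"

definition germ_Hom :: "int \<times> int \<Rightarrow> (grp \<Rightarrow> complex) \<Rightarrow> c2 \<Rightarrow> (c2 \<Rightarrow> complex) set" where
  "germ_Hom n \<sigma> \<nu> = {t. \<exists>U. open U \<and> \<nu> \<in> U \<and> hol2_on t U \<and> (\<forall>\<mu>\<in>U. t \<mu> \<in> Hom_M n \<sigma>)}"

definition max_ideal :: "c2 \<Rightarrow> (c2 \<Rightarrow> complex) set" where
  "max_ideal \<nu> = {f. (\<exists>U. open U \<and> \<nu> \<in> U \<and> hol2_on f U) \<and> f \<nu> = 0}"

text \<open>The submodule \<open>m\<^sub>\<nu> S\<close>; \<open>sc\<close> is the scalar multiplication on the values.\<close>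

inductive_set max_ideal_mult ::
  "(complex \<Rightarrow> 'v::plus \<Rightarrow> 'v) \<Rightarrow> c2 \<Rightarrow> (c2 \<Rightarrow> 'v) set \<Rightarrow> (c2 \<Rightarrow> 'v) set"
  for sc :: "complex \<Rightarrow> 'v::plus \<Rightarrow> 'v" and \<nu> :: c2 and S :: "(c2 \<Rightarrow> 'v) set"
where
  gen: "f \<in> max_ideal \<nu> \<Longrightarrow> \<phi> \<in> S \<Longrightarrow> (\<lambda>\<mu>. sc (f \<mu>) (\<phi> \<mu>)) \<in> max_ideal_mult sc \<nu> S"
| add: "\<phi> \<in> max_ideal_mult sc \<nu> S \<Longrightarrow> \<psi> \<in> max_ideal_mult sc \<nu> S
          \<Longrightarrow> (\<lambda>\<mu>. \<phi> \<mu> + \<psi> \<mu>) \<in> max_ideal_mult sc \<nu> S"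
| cong: "\<phi> \<in> max_ideal_mult sc \<nu> S \<Longrightarrow> (\<forall>\<^sub>F \<mu> in nhds \<nu>. \<psi> \<mu> = \<phi> \<mu>)
          \<Longrightarrow> \<psi> \<in> max_ideal_mult sc \<nu> S"

definition jet_class ::
  "(complex \<Rightarrow> 'v::{plus,minus} \<Rightarrow> 'v) \<Rightarrow> c2 \<Rightarrow> nat \<Rightarrow> (c2 \<Rightarrow> 'v) set \<Rightarrow> (c2 \<Rightarrow> 'v) \<Rightarrow> (c2 \<Rightarrow> 'v) set"
where
  "jet_class sc \<nu> d S \<phi> =
     {\<psi> \<in> S. (\<lambda>\<mu>. \<psi> \<mu> - \<phi> \<mu>) \<in> (max_ideal_mult sc \<nu> ^^ Suc d) S}"


section \<open>Intertwining data\<close>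

type_synonym datum = "(grp \<Rightarrow> complex) \<times> c2 \<times> nat"

fun H_class :: "datum \<Rightarrow> (c2 \<Rightarrow> grp \<Rightarrow> complex) \<Rightarrow> (c2 \<Rightarrow> grp \<Rightarrow> complex) set" where
  "H_class (\<sigma>, \<nu>, d) \<phi> = jet_class (\<lambda>c f k. c * f k) \<nu> d (germ_H \<sigma> \<nu>) \<phi>"

fun Hom_class :: "int \<times> int \<Rightarrow> datum \<Rightarrow> (c2 \<Rightarrow> complex) \<Rightarrow> (c2 \<Rightarrow> complex) set" where
  "Hom_class n (\<sigma>, \<nu>, d) t = jet_class (*) \<nu> d (germ_Hom n \<sigma> \<nu>) t"

text \<open>Tuples of representatives, and the corresponding tuples of classes.\<close>

definition H_tuples :: "datum list \<Rightarrow> (c2 \<Rightarrow> grp \<Rightarrow> complex) list set" where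
  "H_tuples \<xi> = {\<Phi>. list_all2 (\<lambda>(\<sigma>, \<nu>, d) \<phi>. \<phi> \<in> germ_H \<sigma> \<nu>) \<xi> \<Phi>}"

definition Hom_tuples :: "int \<times> int \<Rightarrow> datum list \<Rightarrow> (c2 \<Rightarrow> complex) list set" where
  "Hom_tuples n \<xi> = {ts. list_all2 (\<lambda>(\<sigma>, \<nu>, d) t. t \<in> germ_Hom n \<sigma> \<nu>) \<xi> ts}"

definition H_classes ::
  "datum list \<Rightarrow> (c2 \<Rightarrow> grp \<Rightarrow> complex) list \<Rightarrow> (c2 \<Rightarrow> grp \<Rightarrow> complex) set list" where
  "H_classes \<xi> \<Phi> = map2 H_class \<xi> \<Phi>"

definition Hom_classes ::
  "int \<times> int \<Rightarrow> datum list \<Rightarrow> (c2 \<Rightarrow> complex) list \<Rightarrow> (c2 \<Rightarrow> complex) set list" where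
  "Hom_classes n \<xi> ts = map2 (Hom_class n) \<xi> ts"

definition H_space :: "datum list \<Rightarrow> (c2 \<Rightarrow> grp \<Rightarrow> complex) set list set" where
  "H_space \<xi> = H_classes \<xi> ` H_tuples \<xi>"

text \<open>Iterated partial derivative in the parameter, evaluated at \<open>\<nu>\<close>.\<close>

definition param_deriv ::
  "nat \<Rightarrow> nat \<Rightarrow> c2 \<Rightarrow> (c2 \<Rightarrow> grp \<Rightarrow> complex) \<Rightarrow> grp \<Rightarrow> complex" where
  "param_deriv a b \<nu> \<phi> k =
     (deriv ^^ a) (\<lambda>z. (deriv ^^ b) (\<lambda>w. \<phi> (z, w) k) (snd \<nu>)) (fst \<nu>)"

text \<open>The topology on jets modulo \<open>m\<^sub>\<nu>\<^bsup>d+1\<^esup>\<close> is the Frechet topology given by the Taylor coefficients of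
  order at most \<open>d\<close> in \<open>H_inf \<sigma>\<close>. It is metrizable, so closedness may be tested on sequences.\<close>

fun jet_converges :: "datum \<Rightarrow> (nat \<Rightarrow> c2 \<Rightarrow> grp \<Rightarrow> complex) \<Rightarrow> (c2 \<Rightarrow> grp \<Rightarrow> complex) \<Rightarrow> bool" where
  "jet_converges (\<sigma>, \<nu>, d) \<Phi> \<phi> \<longleftrightarrow>
     (\<forall>a b. a + b \<le> d \<longrightarrow>
        (\<forall>i j. (\<lambda>N. smooth_norm i j (\<lambda>k. param_deriv a b \<nu> (\<Phi> N) k - param_deriv a b \<nu> \<phi> k))
                 \<longlonglongrightarrow> 0))"

definition closed_in_H :: "datum list \<Rightarrow> (c2 \<Rightarrow> grp \<Rightarrow> complex) set list set \<Rightarrow> bool" where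
  "closed_in_H \<xi> W \<longleftrightarrow>
     (\<forall>\<Phi> \<phi>. (\<forall>N::nat. \<Phi> N \<in> H_tuples \<xi> \<and> H_classes \<xi> (\<Phi> N) \<in> W) \<longrightarrow> \<phi> \<in> H_tuples \<xi> \<longrightarrow>
        (\<forall>i<length \<xi>. jet_converges (\<xi> ! i) (\<lambda>N. \<Phi> N ! i) (\<phi> ! i)) \<longrightarrow>
        H_classes \<xi> \<phi> \<in> W)"

definition subrep :: "datum list \<Rightarrow> (c2 \<Rightarrow> grp \<Rightarrow> complex) set list set \<Rightarrow> bool" where
  "subrep \<xi> W \<longleftrightarrow> W \<subseteq> H_space \<xi> \<and> W \<noteq> {} \<and>
     (\<forall>\<Phi>\<in>H_tuples \<xi>. \<forall>\<Psi>\<in>H_tuples \<xi>. \<forall>c. H_classes \<xi> \<Phi> \<in> W \<longrightarrow> H_classes \<xi> \<Psi> \<in> W \<longrightarrow>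
        H_classes \<xi> (map2 (\<lambda>\<phi> \<psi> \<mu> k. \<phi> \<mu> k + c * \<psi> \<mu> k) \<Phi> \<Psi>) \<in> W) \<and>
     (\<forall>\<Phi>\<in>H_tuples \<xi>. \<forall>g\<in>GG. H_classes \<xi> \<Phi> \<in> W \<longrightarrow>
        H_classes \<xi> (map (\<lambda>\<phi> \<mu>. ps_act \<mu> g (\<phi> \<mu>)) \<Phi>) \<in> W)"

definition intertwining_datum :: "datum list \<Rightarrow> (c2 \<Rightarrow> grp \<Rightarrow> complex) set list set \<Rightarrow> bool" where
  "intertwining_datum \<xi> W \<longleftrightarrow>
     (\<forall>(\<sigma>, \<nu>, d)\<in>set \<xi>. \<sigma> \<in> M_hat) \<and> subrep \<xi> W \<and> closed_in_H \<xi> W \<and> W \<noteq> H_space \<xi>"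

definition frobenius :: "int \<times> int \<Rightarrow> complex \<Rightarrow> (c2 \<Rightarrow> complex) \<Rightarrow> c2 \<Rightarrow> grp \<Rightarrow> complex" where
  "frobenius n v t \<mu> k = (if k \<in> KK then t \<mu> * (inverse (delta2 n k) * v) else 0)"

definition D_space ::
  "int \<times> int \<Rightarrow> datum list \<Rightarrow> (c2 \<Rightarrow> grp \<Rightarrow> complex) set list set \<Rightarrow> (c2 \<Rightarrow> complex) set list set" where
  "D_space n \<xi> W =
     {Hom_classes n \<xi> ts | ts. ts \<in> Hom_tuples n \<xi> \<and>
        (\<forall>v. H_classes \<xi> (map (frobenius n v) ts) \<in> W)}"

text \<open>The intertwining condition for \<open>\<phi>\<close> with values in \<open>Hom\<^sub>M(E\<^sub>\<gamma>, E\<^sub>\<tau>)\<close>; composition of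
  homomorphisms is multiplication of scalars.\<close>

definition intertwining_condition :: "int \<times> int \<Rightarrow> int \<times> int \<Rightarrow> (c2 \<Rightarrow> complex) \<Rightarrow> bool" where
  "intertwining_condition \<gamma> \<tau> \<phi> \<longleftrightarrow>
     (\<forall>\<xi> W. intertwining_datum \<xi> W \<longrightarrow>
        (\<forall>ts\<in>Hom_tuples \<tau> \<xi>.
           Hom_classes \<tau> \<xi> ts \<in> D_space \<tau> \<xi> W \<longrightarrow>
           Hom_classes \<tau> \<xi> ts \<noteq> Hom_classes \<tau> \<xi> (map (\<lambda>_ _. 0) \<xi>) \<longrightarrow>
           Hom_classes \<gamma> \<xi> (map (\<lambda>t \<mu>. t \<mu> * \<phi> \<mu>) ts) \<in> D_space \<gamma> \<xi> W))"

definition Hol_Hom :: "int \<times> int \<Rightarrow> int \<times> int \<Rightarrow> (c2 \<Rightarrow> complex) set" where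
  "Hol_Hom l n = {\<phi>. hol2_on \<phi> UNIV \<and> (\<forall>\<mu>. \<phi> \<mu> \<in> Hom_M l (delta2 n))}"


section \<open>The polynomials \<open>q\<^bsub>p,q\<^esub>\<close>\<close>

text \<open>Only used for \<open>p \<equiv> q (mod 2)\<close>, so the divisions in the index bounds are exact. If \<open>p = 0\<close> or
  \<open>q = 0\<close> the last case applies, where it agrees with the second and third one.\<close>

definition qpoly :: "int \<Rightarrow> int \<Rightarrow> complex \<Rightarrow> complex" where
  "qpoly p q z =
     (if p = q then 1
      else if p * q > 0 \<and> \<bar>p\<bar> > \<bar>q\<bar> then
        (\<Prod>j<nat ((\<bar>p\<bar> - \<bar>q\<bar>) div 2). z + ((of_int \<bar>q\<bar> + 1) / 2 + of_nat j))
      else if p * q > 0 \<and> \<bar>p\<bar> < \<bar>q\<bar> then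
        (\<Prod>j<nat ((\<bar>q\<bar> - \<bar>p\<bar>) div 2). z - ((of_int \<bar>p\<bar> + 1) / 2 + of_nat j))
      else
        (\<Prod>j<nat ((\<bar>p\<bar> + \<bar>q\<bar>) div 2). z + ((of_int \<bar>p\<bar> - 1) / 2 - of_nat j)))"


section \<open>Compatibility facts\<close>

lemma delta_rot: "delta n (rot \<theta>) = exp (\<i> * of_int n * of_real \<theta>)"
proof -
  have "Complex (cos \<theta>) (sin \<theta>) = cis \<theta>"
    by (simp add: complex_eq_iff)
  then have "delta n (rot \<theta>) = cis (of_int n * \<theta>)"
    by (simp add: delta_def rot_def cis_power_int)
  then show ?thesis
    by (simp add: cis_conv_exp mult_ac)
qed

lemma mat2_eq_iff:
  "(A::mat2) = B \<longleftrightarrow> A$1$1 = B$1$1 \<and> A$1$2 = B$1$2 \<and> A$2$1 = B$2$1 \<and> A$2$2 = B$2$2"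
  by (auto simp: vec_eq_iff forall_2)

lemma mat2_mult:
  "((A::mat2) ** B)$i$j = A$i$1 * B$1$j + A$i$2 * B$2$j"
  by (simp add: matrix_matrix_mult_def sum_2)

lemma iwa_r_mult:
  "iwa_r (g ** (dg t ** unip x)) = exp t * iwa_r g"
proof -
  have "(g$1$1 * exp t)\<^sup>2 + (g$2$1 * exp t)\<^sup>2 = (exp t)\<^sup>2 * ((g$1$1)\<^sup>2 + (g$2$1)\<^sup>2)"
    by (simp add: algebra_simps power2_eq_square)
  then show ?thesis
    by (simp add: iwa_r_def mat2_mult dg_def unip_def real_sqrt_mult)
qed

lemma iwa_r_pos: "g \<in> SL2 \<Longrightarrow> iwa_r g > 0"
proof -
  assume "g \<in> SL2"
  then have "g$1$1 * g$2$2 - g$1$2 * g$2$1 = 1" by (simp add: SL2_def det_2)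
  then have "g$1$1 \<noteq> 0 \<or> g$2$1 \<noteq> 0" by auto
  then show ?thesis by (simp add: iwa_r_def sum_power2_gt_zero_iff)
qed

lemma iwa_mult:
  assumes "g \<in> SL2"
  shows "iwa_K (g ** (dg t ** unip x)) = iwa_K g" and "iwa_H (g ** (dg t ** unip x)) = iwa_H g + t"
proof -
  show "iwa_K (g ** (dg t ** unip x)) = iwa_K g"
    unfolding iwa_K_def iwa_r_mult mat2_eq_iff by (simp add: mat2_mult dg_def unip_def)
  show "iwa_H (g ** (dg t ** unip x)) = iwa_H g + t"
    unfolding iwa_H_def iwa_r_mult using iwa_r_pos[OF assms] by (simp add: ln_mult)
qed

lemma rot_SL2: "rot \<theta> \<in> SL2"
  using sin_cos_squared_add[of \<theta>] by (simp add: SL2_def rot_def det_2 power2_eq_square)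

lemma iwa_r_rot: "iwa_r (rot \<theta>) = 1"
  by (simp add: iwa_r_def rot_def)

lemma iwa_rot: "iwa_K (rot \<theta>) = rot \<theta>" "iwa_H (rot \<theta>) = 0"
  unfolding iwa_K_def iwa_H_def iwa_r_rot by (simp_all add: rot_def)

lemma iwasawa:
  assumes "g \<in> SL2"
  shows "iwa_K g \<in> range rot" and "\<exists>x. g = iwa_K g ** (dg (iwa_H g) ** unip x)"
proof -
  define a b c d r where "a = g$1$1" "b = g$1$2" "c = g$2$1" "d = g$2$2" "r = iwa_r g"
  have r: "r > 0" using iwa_r_pos[OF assms] by (simp add: a_b_c_d_r_def)
  have r2: "r * r = a * a + c * c"
    using real_sqrt_pow2[of "a\<^sup>2 + c\<^sup>2"] by (simp add: a_b_c_d_r_def iwa_r_def power2_eq_square)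
  have D: "a * d - b * c = 1" using assms by (simp add: SL2_def det_2 a_b_c_d_r_def)
  have "(a / r)\<^sup>2 + (- (c / r))\<^sup>2 = 1"
    using r by (simp add: power2_eq_square flip: add_divide_distrib r2)
  then obtain \<theta> where "a / r = cos \<theta>" "- (c / r) = sin \<theta>"
    using sincos_total_2pi[of "a / r" "- (c / r)"] by metis
  then have "iwa_K g = rot \<theta>"
    by (simp add: mat2_eq_iff iwa_K_def rot_def flip: a_b_c_d_r_def)
  then show "iwa_K g \<in> range rot" by simp
  have e: "exp (iwa_H g) = r" "exp (- iwa_H g) = 1 / r"
    using r by (simp_all add: iwa_H_def exp_minus inverse_eq_divide a_b_c_d_r_def)
  define x where "x = (a * b + c * d) / (r * r)"
  have 1: "b * (r * r) = a * (a * b + c * d) - c" using r2 D by algebra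
  have 2: "d * (r * r) = c * (a * b + c * d) + a" using r2 D by algebra
  have 3: "b = a * x - c / (r * r)"
  proof -
    have "b = (b * (r * r)) / (r * r)" using r by simp
    then show ?thesis unfolding 1 unfolding diff_divide_distrib by (simp add: x_def)
  qed
  have 4: "d = c * x + a / (r * r)"
  proof -
    have "d = (d * (r * r)) / (r * r)" using r by simp
    then show ?thesis unfolding 2 unfolding add_divide_distrib[of _ a] by (simp add: x_def)
  qed
  have "iwa_K g ** (dg (iwa_H g) ** unip x) = g"
    unfolding mat2_eq_iff mat2_mult
    using r by (simp add: iwa_K_def dg_def unip_def e flip: a_b_c_d_r_def)
      (simp flip: 3 4)
  then have "g = iwa_K g ** (dg (iwa_H g) ** unip x)" by simp
  then show "\<exists>x. g = iwa_K g ** (dg (iwa_H g) ** unip x)" by blast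
qed

lemma ps_extend_restrict: "k \<in> KK \<Longrightarrow> ps_extend \<nu> f k = f k"
  by (auto simp: KK_def ps_extend_def a_pow_def logA_def kap_def iwa_rot)

lemma iwa_neg: "iwa_K (- g) = - iwa_K g" "iwa_H (- g) = iwa_H g"
  by (simp_all add: iwa_K_def iwa_H_def iwa_r_def mat2_eq_iff)

lemma mat2_mult_minus: "(g::mat2) ** (- mat 1) = - g"
  by (simp add: mat2_eq_iff mat2_mult mat_def)

lemma SL2_minus: "g \<in> SL2 \<Longrightarrow> - g \<in> SL2"
  by (simp add: SL2_def det_2)

lemma iwa_mult_M:
  assumes "g \<in> SL2" "m \<in> {mat 1, - mat 1}"
  shows "g ** m \<in> SL2" "iwa_K (g ** m) = iwa_K g ** m" "iwa_H (g ** m) = iwa_H g"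
  using assms by (auto simp: iwa_neg mat2_mult_minus SL2_minus)

lemma ps_extend_equivariant:
  assumes "f \<in> H_inf \<sigma>" "g \<in> GG" "m \<in> MM"
  shows "ps_extend \<nu> f (g \<odot> m \<odot> (dg2 t \<odot> unip2 x))
       = a_pow (- (\<nu> + rho)) t * inverse (\<sigma> m) * ps_extend \<nu> f g"
proof -
  obtain g1 g2 m1 m2 where gm: "g = (g1, g2)" "m = (m1, m2)" by (meson surj_pair)
  have g: "g1 \<in> SL2" "g2 \<in> SL2" and m: "m1 \<in> {mat 1, - mat 1}" "m2 \<in> {mat 1, - mat 1}"
    using assms(2,3) by (auto simp: gm GG_def MM_def)
  have k: "kap (g \<odot> m \<odot> (dg2 t \<odot> unip2 x)) = kap g \<odot> m"
    and a: "logA (g \<odot> m \<odot> (dg2 t \<odot> unip2 x)) = logA g + t"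
    using g m by (simp_all add: gm kap_def logA_def gmul_def dg2_def unip2_def iwa_mult iwa_mult_M prod_eq_iff)
  have "kap g \<in> KK" using g by (simp add: gm kap_def KK_def iwasawa(1))
  then have f: "f (kap g \<odot> m) = inverse (\<sigma> m) * f (kap g)"
    using assms by (simp add: H_inf_def)
  have "a_pow \<mu> (s + t) = a_pow \<mu> t * a_pow \<mu> s" for \<mu> s
    by (simp add: a_pow_def flip: exp_add) (simp add: algebra_simps)
  then show ?thesis by (simp add: ps_extend_def k a f)
qed

lemma ps_extend_unique:
  assumes F: "\<And>g t x. g \<in> GG \<Longrightarrow> F (g \<odot> (dg2 t \<odot> unip2 x)) = a_pow (- (\<nu> + rho)) t * F g"
    and f: "\<And>k. k \<in> KK \<Longrightarrow> F k = f k" and "g \<in> GG"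
  shows "F g = ps_extend \<nu> f g"
proof -
  obtain g1 g2 where gg: "g = (g1, g2)" "g1 \<in> SL2" "g2 \<in> SL2" using assms(3) by (auto simp: GG_def)
  obtain x1 x2 where "g1 = iwa_K g1 ** (dg (iwa_H g1) ** unip x1)"
    "g2 = iwa_K g2 ** (dg (iwa_H g2) ** unip x2)" using iwasawa(2) gg by metis
  then have dec: "g = kap g \<odot> (dg2 (logA g) \<odot> unip2 (x1, x2))"
    by (simp add: gg(1) gmul_def kap_def logA_def dg2_def unip2_def)
  have "kap g \<in> KK" using gg by (simp add: kap_def KK_def iwasawa(1))
  moreover from this have "kap g \<in> GG" using rot_SL2 by (auto simp: KK_def GG_def)
  ultimately have "F (kap g \<odot> (dg2 (logA g) \<odot> unip2 (x1, x2))) = ps_extend \<nu> f g"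
    by (simp add: F f ps_extend_def)
  then show ?thesis using dec by simp
qed

end

theory Submission
  imports Defs "HOL-Complex_Analysis.Complex_Analysis" "HOL-Library.Landau_Symbols"
begin

text \<open>
  Sufficiency. Let \<open>t\<close> be a tuple of germs whose Frobenius partner takes values in the closed invariant
  subspace \<open>W\<close>. Differentiating the action along one-parameter subgroups of \<open>A\<close> at \<open>0\<close> and separating
  \<open>K\<close>-types stays in \<open>W\<close>; in each factor this turns a germ for the type \<open>n\<close> into a germ for \<open>n \<plusminus> 2\<close>
  with the factor \<open>\<lambda> + (1 \<plusminus> n)/2\<close>. Going from \<open>n\<close> to \<open>l\<close> produces \<open>q\<^bsub>l,n\<^esub>\<close>, and going up and down once
  produces \<open>\<lambda>\<^sup>2 - ((n+1)/2)\<^sup>2\<close>, so multiplication by polynomials in \<open>\<lambda>\<^sub>1\<^sup>2, \<lambda>\<^sub>2\<^sup>2\<close> is also allowed. By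
  Newton interpolation at the nodes \<open>\<lambda>\<^sub>i\<close> an even entire \<open>h\<close> agrees with such a polynomial modulo the
  powers of the maximal ideals that define the jets.

  Necessity. Take all \<open>d\<^sub>i = 0\<close> and let \<open>W\<close> be the set of tuples for which a fixed linear combination
  of the \<open>l\<close>-th Fourier coefficients of all translates vanishes. Applied to the functions of type \<open>n\<close>, these
  coefficients are analytic on \<open>A\<close>, and by the same ladder relations all their derivatives at the identity are
  \<open>q\<^bsub>l,n\<^esub>\<close> times an even function of \<open>\<lambda>\<close>. Hence linear relations between the values of \<open>q\<^bsub>l,n\<^esub>\<close> times
  an even function must hold for \<open>\<phi>\<close>: it vanishes at the zeros of \<open>q\<^bsub>l,n\<^esub>\<close>, and
  \<open>q\<^bsub>l,n\<^esub>(-\<lambda>) \<phi>(\<lambda>) = q\<^bsub>l,n\<^esub>(\<lambda>) \<phi>(-\<lambda>)\<close> in each variable, so \<open>\<phi>\<close> divided by \<open>q\<^bsub>l,n\<^esub>\<close> is entire and even.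
\<close>

section \<open>Directional derivatives\<close>

text \<open>Closedness is the only analytic property of \<open>W\<close> at hand, and its topology
  is that of jets: a difference quotient of the action must converge in every seminorm on the torus,
  together with its derivatives in the parameter. Two facts make this manageable. In angular
  coordinates an element of A acts on a K-type through the exponential of an expression affine in
  \<lambda>, so all parameter derivatives are explicit; and submultiplicative seminorms allow
  first-order expansions by an O/o calculus that treats all seminorms at once. Jets have finite
  order, so multiplication by an entire even h needs no limit of polynomials: exact agreement modulo
  powers of the maximal ideals suffices. In the converse direction, derivatives at the identity
  determine a Fourier coefficient only through the identity theorem. The variable s on A' is
  therefore complexified to the strip |Im s| < pi/4, where the powers that occur keep their
  principal branch.\<close>

lemma dir_derivI: "(F has_derivative F') (at x) \<Longrightarrow> dir_deriv v F x = F' v"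
  unfolding dir_deriv_def using frechet_derivative_at by metis

lemma dir_deriv_works: "F differentiable at x \<Longrightarrow> (F has_derivative (\<lambda>v. dir_deriv v F x)) (at x)"
  unfolding dir_deriv_def using frechet_derivative_works by (metis (no_types, lifting) ext)

text \<open>Leibniz and chain rule leave some factors undifferentiated; in the inductions below
  these factors have to be regarded as one order less smooth.\<close>

lemma C_k_Suc_imp: "C_k (Suc k) F \<Longrightarrow> C_k k F"
proof (induction k arbitrary: F)
  case 0
  then show ?case
    by (auto simp: continuous_on_eq_continuous_at differentiable_imp_continuous_within)
next
  case (Suc k)
  then have "\<forall>x. F differentiable at x" "\<And>v. C_k (Suc k) (dir_deriv v F)" by auto
  then show ?case using Suc.IH by simp
qed

lemma C_k_continuous: "C_k k F \<Longrightarrow> continuous_on UNIV F"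
  by (induction k) (use C_k_Suc_imp in auto)

lemma C_inf_iff: "C_inf F \<longleftrightarrow> (\<forall>x. F differentiable at x) \<and> (\<forall>v. C_inf (dir_deriv v F))"
  unfolding C_inf_def by (metis C_k.simps(2) C_k_Suc_imp)

lemma C_inf_differentiable: "C_inf F \<Longrightarrow> F differentiable at x"
  using C_inf_iff by blast

lemma C_inf_dir_deriv: "C_inf F \<Longrightarrow> C_inf (dir_deriv v F)"
  using C_inf_iff by blast

lemma C_inf_continuous: "C_inf F \<Longrightarrow> continuous_on A F"
  unfolding C_inf_def using C_k_continuous continuous_on_subset by blast

lemma C_inf_has_derivative: "C_inf F \<Longrightarrow> (F has_derivative (\<lambda>v. dir_deriv v F x)) (at x)"
  by (simp add: C_inf_differentiable dir_deriv_works)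

lemma dir_deriv_const [simp]: "dir_deriv v (\<lambda>_. c) = (\<lambda>_. 0)"
  by (rule ext, rule dir_derivI) auto

lemma C_k_const: "C_k k (\<lambda>_. c)"
  by (induction k arbitrary: c) auto

lemma dir_deriv_linear: "bounded_linear L \<Longrightarrow> dir_deriv v L = (\<lambda>_. L v)"
  by (rule ext, rule dir_derivI) (rule bounded_linear_imp_has_derivative)

lemma C_inf_linear: "bounded_linear L \<Longrightarrow> C_inf L"
  unfolding C_inf_iff[of L]
  by (simp add: dir_deriv_linear C_inf_def C_k_const bounded_linear_imp_differentiable)

lemma dir_deriv_add:
  "F differentiable at x \<Longrightarrow> G differentiable at x \<Longrightarrow>
    dir_deriv v (\<lambda>x. F x + G x) x = dir_deriv v F x + dir_deriv v G x"
  by (rule dir_derivI) (intro has_derivative_add dir_deriv_works)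

lemma dir_deriv_diff:
  "F differentiable at x \<Longrightarrow> G differentiable at x \<Longrightarrow>
    dir_deriv v (\<lambda>x. F x - G x) x = dir_deriv v F x - dir_deriv v G x"
  by (rule dir_derivI) (intro has_derivative_diff dir_deriv_works)

lemma dir_deriv_mult:
  fixes F G :: "'a::real_normed_vector \<Rightarrow> 'b::real_normed_algebra"
  shows "F differentiable at x \<Longrightarrow> G differentiable at x \<Longrightarrow>
    dir_deriv v (\<lambda>x. F x * G x) x = F x * dir_deriv v G x + dir_deriv v F x * G x"
  by (rule dir_derivI) (intro has_derivative_mult dir_deriv_works)

lemma dir_deriv_comp_linear:
  assumes "bounded_linear L" "F differentiable at x"
  shows "dir_deriv v (\<lambda>x. L (F x)) x = L (dir_deriv v F x)"
  by (rule dir_derivI, rule bounded_linear.has_derivative[OF assms(1) dir_deriv_works[OF assms(2)]])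

lemma C_k_add: "C_k k F \<Longrightarrow> C_k k G \<Longrightarrow> C_k k (\<lambda>x. F x + G x)"
proof (induction k arbitrary: F G)
  case 0
  then show ?case by (auto intro: continuous_intros)
next
  case (Suc k)
  have "dir_deriv v (\<lambda>x. F x + G x) = (\<lambda>x. dir_deriv v F x + dir_deriv v G x)" for v
    by (rule ext, rule dir_deriv_add) (use Suc.prems in auto)
  with Suc show ?case by simp
qed

lemma C_k_linear_comp: "bounded_linear L \<Longrightarrow> C_k k F \<Longrightarrow> C_k k (\<lambda>x. L (F x))"
proof (induction k arbitrary: F)
  case 0
  then show ?case by (simp add: bounded_linear.continuous_on)
next
  case (Suc k)
  have "F differentiable at x" for x
    using Suc.prems by simp
  from bounded_linear.has_derivative[OF Suc.prems(1) dir_deriv_works[OF this]]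
  have "(\<lambda>x. L (F x)) differentiable at x" for x
    unfolding differentiable_def by blast
  moreover have "dir_deriv v (\<lambda>x. L (F x)) = (\<lambda>x. L (dir_deriv v F x))" for v
    by (rule ext, rule dir_deriv_comp_linear) (use Suc.prems in auto)
  ultimately show ?case using Suc by simp
qed

lemma C_k_mult:
  fixes F G :: "'a::real_normed_vector \<Rightarrow> 'b::real_normed_algebra"
  shows "C_k k F \<Longrightarrow> C_k k G \<Longrightarrow> C_k k (\<lambda>x. F x * G x)"
proof (induction k arbitrary: F G)
  case 0
  then show ?case by (auto intro: continuous_intros)
next
  case (Suc k)
  have "dir_deriv v (\<lambda>x. F x * G x) = (\<lambda>x. F x * dir_deriv v G x + dir_deriv v F x * G x)" for v
    by (rule ext, rule dir_deriv_mult) (use Suc.prems in auto)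
  moreover have "C_k k (\<lambda>x. F x * dir_deriv v G x + dir_deriv v F x * G x)" for v
    using Suc.prems Suc.prems[THEN C_k_Suc_imp] by (intro C_k_add Suc.IH) auto
  moreover have "(\<lambda>x. F x * G x) differentiable at x" for x
    using Suc.prems by (intro differentiable_mult) auto
  ultimately show ?case by simp
qed

text \<open>The derivative of the composition contains \<open>deriv f\<close>, which is again
  holomorphic on \<open>S\<close>; hence the induction varies \<open>f\<close> as well as
  \<open>F\<close>.\<close>

lemma C_k_holomorphic_comp:
  fixes F :: "'a::real_normed_vector \<Rightarrow> complex"
  assumes "open S" "f holomorphic_on S" "range F \<subseteq> S" "C_k k F"
  shows "C_k k (\<lambda>x. f (F x))"
  using assms(2-)
proof (induction k arbitrary: F f)
  case 0
  then show ?case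
    using continuous_on_compose2[OF holomorphic_on_imp_continuous_on] by (metis C_k.simps(1))
next
  case (Suc k)
  have d: "((\<lambda>x. f (F x)) has_derivative (\<lambda>v. deriv f (F x) * dir_deriv v F x)) (at x)" for x
  proof -
    have "(f has_field_derivative deriv f (F x)) (at (F x))"
      using Suc.prems assms(1) by (meson holomorphic_derivI range_subsetD)
    then show ?thesis
      using has_derivative_compose[of F _ x UNIV f "(*) (deriv f (F x))"] dir_deriv_works[of F x] Suc.prems
      by (auto simp: has_field_derivative_def)
  qed
  then have "dir_deriv v (\<lambda>x. f (F x)) = (\<lambda>x. deriv f (F x) * dir_deriv v F x)" for v
    by (intro ext dir_derivI)
  moreover have "C_k k (\<lambda>x. deriv f (F x) * dir_deriv v F x)" for v
    by (rule C_k_mult, rule Suc.IH)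
      (use Suc.prems Suc.prems(3)[THEN C_k_Suc_imp] assms(1) in \<open>auto intro: holomorphic_deriv\<close>)
  ultimately show ?case using d by (auto simp: differentiable_def)
qed

lemma dir_deriv_holomorphic_comp:
  fixes F :: "'a::real_normed_vector \<Rightarrow> complex"
  assumes "(f has_field_derivative f') (at (F x))" "F differentiable at x"
  shows "dir_deriv v (\<lambda>x. f (F x)) x = f' * dir_deriv v F x"
  using has_derivative_compose[of F _ x UNIV f "(*) f'"] dir_deriv_works[OF assms(2)] assms(1)
  by (intro dir_derivI) (auto simp: has_field_derivative_def)

lemma has_derivative_pair_comp:
  fixes F :: "real \<times> real \<Rightarrow> complex"
  assumes "a differentiable at x" "b differentiable at x" "F differentiable at (a x, b x)"
  shows "((\<lambda>x. F (a x, b x)) has_derivative (\<lambda>v. of_real (dir_deriv v a x) * dir_deriv (1, 0) F (a x, b x)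
    + of_real (dir_deriv v b x) * dir_deriv (0, 1) F (a x, b x))) (at x)"
proof -
  have F: "(F has_derivative (\<lambda>v. dir_deriv v F (a x, b x))) (at (a x, b x))"
    using assms(3) by (rule dir_deriv_works)
  interpret bounded_linear "\<lambda>v. dir_deriv v F (a x, b x)"
    using F by (rule has_derivative_bounded_linear)
  have 1: "dir_deriv (p, q) F (a x, b x)
      = of_real p * dir_deriv (1, 0) F (a x, b x) + of_real q * dir_deriv (0, 1) F (a x, b x)" for p q
    using add[of "p *\<^sub>R (1, 0)" "q *\<^sub>R (0, 1)"] scaleR[of p "(1, 0)"] scaleR[of q "(0, 1)"]
    by (simp add: scaleR_conv_of_real)
  have "((\<lambda>x. (a x, b x)) has_derivative (\<lambda>v. (dir_deriv v a x, dir_deriv v b x))) (at x)"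
    using assms by (intro has_derivative_Pair dir_deriv_works)
  from has_derivative_compose[OF this F] show ?thesis
    by (simp only: 1[of "dir_deriv v a x" "dir_deriv v b x" for v])
qed

lemma C_k_pair_comp:
  fixes F :: "real \<times> real \<Rightarrow> complex"
  shows "C_k k a \<Longrightarrow> C_k k b \<Longrightarrow> C_k k F \<Longrightarrow> C_k k (\<lambda>x. F (a x, b x))"
proof (induction k arbitrary: F)
  case 0
  then show ?case
    by (auto intro!: continuous_on_compose2[of UNIV F] continuous_intros)
next
  case (Suc k)
  have d: "((\<lambda>x. F (a x, b x)) has_derivative (\<lambda>v. of_real (dir_deriv v a x) * dir_deriv (1, 0) F (a x, b x)
    + of_real (dir_deriv v b x) * dir_deriv (0, 1) F (a x, b x))) (at x)" for x
    using Suc.prems by (intro has_derivative_pair_comp) auto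
  then have "dir_deriv v (\<lambda>x. F (a x, b x)) = (\<lambda>x. of_real (dir_deriv v a x) * dir_deriv (1, 0) F (a x, b x)
    + of_real (dir_deriv v b x) * dir_deriv (0, 1) F (a x, b x))" for v
    by (intro ext dir_derivI)
  moreover have "C_k k (\<lambda>x. of_real (dir_deriv v a x) * dir_deriv (1, 0) F (a x, b x)
    + of_real (dir_deriv v b x) * dir_deriv (0, 1) F (a x, b x))" for v
    using Suc.prems Suc.prems[THEN C_k_Suc_imp]
    by (intro C_k_add C_k_mult C_k_linear_comp[OF bounded_linear_of_real] Suc.IH) auto
  ultimately show ?case using d by (auto simp: differentiable_def)
qed

lemma C_inf_const: "C_inf (\<lambda>_. c)"
  by (simp add: C_inf_def C_k_const)

lemma C_inf_add: "C_inf F \<Longrightarrow> C_inf G \<Longrightarrow> C_inf (\<lambda>x. F x + G x)"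
  by (simp add: C_inf_def C_k_add)

lemma C_inf_mult:
  fixes F G :: "'a::real_normed_vector \<Rightarrow> 'b::real_normed_algebra"
  shows "C_inf F \<Longrightarrow> C_inf G \<Longrightarrow> C_inf (\<lambda>x. F x * G x)"
  by (simp add: C_inf_def C_k_mult)

lemma C_inf_linear_comp: "bounded_linear L \<Longrightarrow> C_inf F \<Longrightarrow> C_inf (\<lambda>x. L (F x))"
  by (simp add: C_inf_def C_k_linear_comp)

lemma C_inf_holomorphic_comp:
  fixes F :: "'a::real_normed_vector \<Rightarrow> complex"
  shows "open S \<Longrightarrow> f holomorphic_on S \<Longrightarrow> range F \<subseteq> S \<Longrightarrow> C_inf F \<Longrightarrow> C_inf (\<lambda>x. f (F x))"
  by (simp add: C_inf_def C_k_holomorphic_comp)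

lemma C_inf_exp:
  fixes F :: "'a::real_normed_vector \<Rightarrow> complex"
  shows "C_inf F \<Longrightarrow> C_inf (\<lambda>x. exp (F x))"
  by (rule C_inf_holomorphic_comp[of UNIV]) (auto intro: holomorphic_intros)

lemma C_inf_pair_comp:
  fixes F :: "real \<times> real \<Rightarrow> complex"
  shows "C_inf a \<Longrightarrow> C_inf b \<Longrightarrow> C_inf F \<Longrightarrow> C_inf (\<lambda>x. F (a x, b x))"
  by (simp add: C_inf_def C_k_pair_comp)

section \<open>The algebra of smooth functions on the torus\<close>

text \<open>Smooth functions on K, seen in the covering chart \<open>rot2\<close>, whose fibres are
  the translates by 2 pi in each angle. Working on the plane avoids any manifold structure.\<close>

definition BP :: "(real \<times> real \<Rightarrow> complex) set" where
  "BP = {F. C_inf F \<and> (\<forall>x y. F (x + 2 * pi, y) = F (x, y) \<and> F (x, y + 2 * pi) = F (x, y))}"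

lemma BP_C_inf: "F \<in> BP \<Longrightarrow> C_inf F"
  by (simp add: BP_def)

lemma BP_differentiable: "F \<in> BP \<Longrightarrow> F differentiable at x"
  by (simp add: BP_C_inf C_inf_differentiable)

lemma BP_const: "(\<lambda>_. c) \<in> BP"
  by (simp add: BP_def C_inf_const)

lemma BP_add: "F \<in> BP \<Longrightarrow> G \<in> BP \<Longrightarrow> (\<lambda>x. F x + G x) \<in> BP"
  by (simp add: BP_def C_inf_add)

lemma BP_mult: "F \<in> BP \<Longrightarrow> G \<in> BP \<Longrightarrow> (\<lambda>x. F x * G x) \<in> BP"
  by (simp add: BP_def C_inf_mult)

lemma BP_cmult: "F \<in> BP \<Longrightarrow> (\<lambda>x. c * F x) \<in> BP"
  by (simp add: BP_mult BP_const)

lemma BP_diff: "F \<in> BP \<Longrightarrow> G \<in> BP \<Longrightarrow> (\<lambda>x. F x - G x) \<in> BP"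
  using BP_add[of F "\<lambda>x. -1 * G x"] BP_cmult[of G "-1"] by simp

lemma BP_holomorphic_comp:
  "open S \<Longrightarrow> f holomorphic_on S \<Longrightarrow> range F \<subseteq> S \<Longrightarrow> F \<in> BP \<Longrightarrow> (\<lambda>x. f (F x)) \<in> BP"
  by (simp add: BP_def C_inf_holomorphic_comp)

lemma BP_exp: "F \<in> BP \<Longrightarrow> (\<lambda>x. exp (F x)) \<in> BP"
  by (simp add: BP_def C_inf_exp)

lemma BP_dir_deriv: "F \<in> BP \<Longrightarrow> dir_deriv v F \<in> BP"
proof -
  assume F: "F \<in> BP"
  have "dir_deriv v F (z + p) = dir_deriv v F z" if p: "\<And>z. F (z + p) = F z" for z p
  proof -
    have "(F has_derivative (\<lambda>v. dir_deriv v F (z + p))) (at (z + p))"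
      using F by (intro dir_deriv_works BP_differentiable)
    moreover have "((\<lambda>z. z + p) has_derivative (\<lambda>v. v)) (at z)"
      by (auto intro!: derivative_eq_intros)
    ultimately have "((\<lambda>z. F (z + p)) has_derivative (\<lambda>v. dir_deriv v F (z + p))) (at z)"
      using has_derivative_compose by blast
    then show ?thesis by (simp add: p dir_derivI)
  qed
  from this[of "(2 * pi, 0)"] this[of "(0, 2 * pi)"] F show ?thesis
    by (auto simp: BP_def C_inf_dir_deriv)
qed

text \<open>Both angles are reduced to one compact period square. Without boundedness the supremum
  in \<open>supn\<close> would carry no information.\<close>

lemma BP_bounded: "F \<in> BP \<Longrightarrow> bounded (range F)"
proof -
  assume F: "F \<in> BP"
  have r: "F (x, y) \<in> F ` cbox (0, 0) (2 * pi, 2 * pi)" for x y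
  proof -
    interpret p1: periodic_fun_simple "\<lambda>x. F (x, y)" "2 * pi"
      by standard (use F in \<open>auto simp: BP_def\<close>)
    define x' where "x' = x + of_int (- \<lfloor>x / (2 * pi)\<rfloor>) * (2 * pi)"
    interpret p2: periodic_fun_simple "\<lambda>y. F (x', y)" "2 * pi"
      by standard (use F in \<open>auto simp: BP_def\<close>)
    define y' where "y' = y + of_int (- \<lfloor>y / (2 * pi)\<rfloor>) * (2 * pi)"
    have b: "0 \<le> u + of_int (- \<lfloor>u / (2 * pi)\<rfloor>) * (2 * pi)"
         "u + of_int (- \<lfloor>u / (2 * pi)\<rfloor>) * (2 * pi) \<le> 2 * pi" for u
      using floor_divide_lower[of "2 * pi" u] floor_divide_upper[of "2 * pi" u]
      by (auto simp: algebra_simps)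
    have "F (x, y) = F (x', y')"
      unfolding y'_def p2.plus_of_int unfolding x'_def p1.plus_of_int ..
    moreover have "(x', y') \<in> cbox (0, 0) (2 * pi, 2 * pi)"
      using b[of x] b[of y] by (simp add: x'_def y'_def flip: cbox_Pair_eq)
    ultimately show ?thesis by (rule image_eqI)
  qed
  have "compact (F ` cbox (0, 0) (2 * pi, 2 * pi))"
    using F by (intro compact_continuous_image C_inf_continuous BP_C_inf) auto
  then show ?thesis by (rule bounded_subset[OF compact_imp_bounded]) (use r in auto)
qed

definition supn :: "(real \<times> real \<Rightarrow> complex) \<Rightarrow> real" where
  "supn F = (SUP \<theta>. norm (F \<theta>))"

lemma supn_ge: "F \<in> BP \<Longrightarrow> norm (F x) \<le> supn F"
  unfolding supn_def using BP_bounded[of F]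
  by (intro cSUP_upper) (auto simp: bounded_iff bdd_above_def)

lemma supn_le: "(\<And>x. norm (F x) \<le> c) \<Longrightarrow> supn F \<le> c"
  unfolding supn_def by (rule cSUP_least) auto

lemma supn_nonneg: "F \<in> BP \<Longrightarrow> 0 \<le> supn F"
  using supn_ge[of F 0] norm_ge_zero order_trans by blast

text \<open>The sum of the sup norms of \<open>D\<^sub>v F\<close> over all subwords \<open>v\<close> of \<open>ds\<close>. Because all subwords occur,
  the Leibniz rule makes these seminorms submultiplicative.\<close>

primrec Nrm :: "(real \<times> real) list \<Rightarrow> (real \<times> real \<Rightarrow> complex) \<Rightarrow> real" where
  "Nrm [] F = supn F"
| "Nrm (d # ds) F = Nrm ds F + Nrm ds (dir_deriv d F)"

lemma Nrm_nonneg: "F \<in> BP \<Longrightarrow> 0 \<le> Nrm ds F"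
  by (induction ds arbitrary: F) (auto simp: supn_nonneg BP_dir_deriv)

lemma Nrm_const: "Nrm ds (\<lambda>_. c) = norm c"
proof -
  have "Nrm ds (\<lambda>_. 0) = 0" by (induction ds) (auto simp: supn_def)
  then show ?thesis by (induction ds) (auto simp: supn_def)
qed

lemma dir_deriv_add_BP:
  "F \<in> BP \<Longrightarrow> G \<in> BP \<Longrightarrow> dir_deriv v (\<lambda>x. F x + G x) = (\<lambda>x. dir_deriv v F x + dir_deriv v G x)"
  by (simp add: dir_deriv_add BP_differentiable fun_eq_iff)

lemma dir_deriv_diff_BP:
  "F \<in> BP \<Longrightarrow> G \<in> BP \<Longrightarrow> dir_deriv v (\<lambda>x. F x - G x) = (\<lambda>x. dir_deriv v F x - dir_deriv v G x)"
  by (simp add: dir_deriv_diff BP_differentiable fun_eq_iff)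

lemma dir_deriv_mult_BP:
  "F \<in> BP \<Longrightarrow> G \<in> BP \<Longrightarrow>
    dir_deriv v (\<lambda>x. F x * G x) = (\<lambda>x. F x * dir_deriv v G x + dir_deriv v F x * G x)"
  by (simp add: dir_deriv_mult BP_differentiable fun_eq_iff)

lemma Nrm_add: "F \<in> BP \<Longrightarrow> G \<in> BP \<Longrightarrow> Nrm ds (\<lambda>x. F x + G x) \<le> Nrm ds F + Nrm ds G"
proof (induction ds arbitrary: F G)
  case Nil
  then show ?case
    by (auto intro!: supn_le norm_triangle_le add_mono supn_ge)
next
  case (Cons d ds)
  from Cons.IH[OF Cons.prems] Cons.IH[of "dir_deriv d F" "dir_deriv d G"] Cons.prems show ?case
    by (simp add: dir_deriv_add_BP BP_dir_deriv)
qed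

lemma Nrm_mult: "F \<in> BP \<Longrightarrow> G \<in> BP \<Longrightarrow> Nrm ds (\<lambda>x. F x * G x) \<le> Nrm ds F * Nrm ds G"
proof (induction ds arbitrary: F G)
  case Nil
  then show ?case
    by (auto intro!: supn_le mult_mono supn_ge supn_nonneg simp: norm_mult)
next
  case (Cons d ds)
  define F' G' where "F' = dir_deriv d F" and "G' = dir_deriv d G"
  have [simp]: "F \<in> BP" "G \<in> BP" "F' \<in> BP" "G' \<in> BP"
    using Cons.prems by (auto simp: F'_def G'_def BP_dir_deriv)
  have "Nrm (d # ds) (\<lambda>x. F x * G x) = Nrm ds (\<lambda>x. F x * G x) + Nrm ds (\<lambda>x. F x * G' x + F' x * G x)"
    by (simp add: dir_deriv_mult_BP F'_def G'_def)
  also have "\<dots> \<le> Nrm ds (\<lambda>x. F x * G x) + (Nrm ds (\<lambda>x. F x * G' x) + Nrm ds (\<lambda>x. F' x * G x))"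
    by (intro add_left_mono Nrm_add BP_mult) auto
  also have "\<dots> \<le> Nrm ds F * Nrm ds G + (Nrm ds F * Nrm ds G' + Nrm ds F' * Nrm ds G)"
    by (intro add_mono Cons.IH) auto
  \<comment> \<open>The missing cross term is added so that the sum factors.\<close>
  also have "\<dots> \<le> Nrm ds F * Nrm ds G + (Nrm ds F * Nrm ds G' + Nrm ds F' * Nrm ds G) + Nrm ds F' * Nrm ds G'"
    by (simp add: Nrm_nonneg)
  also have "\<dots> = Nrm (d # ds) F * Nrm (d # ds) G"
    by (simp add: F'_def G'_def algebra_simps)
  finally show ?case .
qed

text \<open>Directions are consumed from the left, so derivatives in the second angle act first, as
  in \<open>smooth_norm\<close>; no exchange of partial derivatives is needed.\<close>

abbreviation word :: "nat \<Rightarrow> nat \<Rightarrow> (real \<times> real) list" where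
  "word i j \<equiv> replicate j (0, 1) @ replicate i (1, 0)"

lemma BP_funpow_dir_deriv: "F \<in> BP \<Longrightarrow> (dir_deriv v ^^ i) F \<in> BP"
  by (induction i) (auto simp: BP_dir_deriv)

lemma supn_le_Nrm_word:
  "F \<in> BP \<Longrightarrow> supn ((dir_deriv (1, 0) ^^ i) ((dir_deriv (0, 1) ^^ j) F)) \<le> Nrm (word i j) F"
proof (induction j arbitrary: F)
  case 0
  then show ?case
  proof (induction i arbitrary: F)
    case (Suc i)
    from Suc.IH[of "dir_deriv (1, 0) F"] Suc.prems show ?case
      using Nrm_nonneg[OF Suc.prems, of "word i 0"] by (simp add: BP_dir_deriv funpow_swap1)
  qed auto
next
  case (Suc j)
  from Suc.IH[of "dir_deriv (0, 1) F"] Suc.prems show ?case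
    using Nrm_nonneg[OF Suc.prems, of "word i j"] by (simp add: BP_dir_deriv funpow_swap1)
qed

text \<open>Each \<open>Nrm (word i j)\<close> is a finite sum of sup norms of derivatives. Together
  with \<open>supn_le_Nrm_word\<close> this shows that the norms \<open>Nrm\<close> and the
  seminorms \<open>smooth_norm\<close> have the same small families.\<close>

lemma Nrm_word_smallo:
  assumes "\<And>i j. (\<lambda>h. supn ((dir_deriv (1, 0) ^^ i) ((dir_deriv (0, 1) ^^ j) (X h)))) \<in> o[Fl](r)"
  shows "(\<lambda>h. Nrm (word i j) (X h)) \<in> o[Fl](r)"
proof -
  have 1: "(\<lambda>h. Nrm (word i 0) (X h)) \<in> o[Fl](r)"
    if "\<And>i. (\<lambda>h. supn ((dir_deriv (1, 0) ^^ i) (X h))) \<in> o[Fl](r)" for i X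
    using that
  proof (induction i arbitrary: X)
    case 0
    from 0[of 0] show ?case by simp
  next
    case (Suc i)
    have "(\<lambda>h. Nrm (word i 0) (dir_deriv (1, 0) (X h))) \<in> o[Fl](r)"
      by (rule Suc.IH) (use Suc.prems[of "Suc _"] in \<open>simp add: funpow_swap1\<close>)
    with Suc.IH[OF Suc.prems] show ?case by (simp add: sum_in_smallo)
  qed
  show ?thesis using assms
  proof (induction j arbitrary: X)
    case 0
    show ?case by (rule 1) (use 0[of _ 0] in simp)
  next
    case (Suc j)
    have "(\<lambda>h. Nrm (word i j) (dir_deriv (0, 1) (X h))) \<in> o[Fl](r)"
      by (rule Suc.IH) (use Suc.prems[of _ "Suc _"] in \<open>simp add: funpow_swap1\<close>)
    with Suc.IH[OF Suc.prems] show ?case by (simp add: sum_in_smallo)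
  qed
qed

section \<open>Families of smooth functions\<close>

text \<open>Landau symbols with values in a Frechet space, so that products, exponentials and
  logarithms of families can be expanded as for numbers. The constants may depend on the
  seminorm.\<close>

definition bigf :: "'h filter \<Rightarrow> ('h \<Rightarrow> real) \<Rightarrow> ('h \<Rightarrow> real \<times> real \<Rightarrow> complex) \<Rightarrow> bool" where
  "bigf Fl r X \<longleftrightarrow> (\<forall>\<^sub>F h in Fl. X h \<in> BP) \<and> (\<forall>i j. (\<lambda>h. Nrm (word i j) (X h)) \<in> O[Fl](r))"

definition smallf :: "'h filter \<Rightarrow> ('h \<Rightarrow> real) \<Rightarrow> ('h \<Rightarrow> real \<times> real \<Rightarrow> complex) \<Rightarrow> bool" where
  "smallf Fl r X \<longleftrightarrow> (\<forall>\<^sub>F h in Fl. X h \<in> BP) \<and> (\<forall>i j. (\<lambda>h. Nrm (word i j) (X h)) \<in> o[Fl](r))"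

lemma bigo_bound:
  fixes f g r :: "'h \<Rightarrow> real"
  assumes "g \<in> O[F](r)" "\<forall>\<^sub>F h in F. 0 \<le> f h \<and> f h \<le> g h"
  shows "f \<in> O[F](r)"
  by (rule landau_o.big_trans[OF _ assms(1)], rule landau_o.big_mono, use assms(2) in eventually_elim) auto

lemma smallo_bound:
  fixes f g r :: "'h \<Rightarrow> real"
  assumes "g \<in> o[F](r)" "\<forall>\<^sub>F h in F. 0 \<le> f h \<and> f h \<le> g h"
  shows "f \<in> o[F](r)"
  by (rule landau_o.big_small_trans[OF _ assms(1)], rule landau_o.big_mono, use assms(2) in eventually_elim) auto

lemma bigf_add:
  assumes "bigf Fl r X" "bigf Fl r Y"
  shows "bigf Fl r (\<lambda>h \<theta>. X h \<theta> + Y h \<theta>)"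
  unfolding bigf_def
proof (intro conjI allI)
  have ev: "\<forall>\<^sub>F h in Fl. X h \<in> BP \<and> Y h \<in> BP" using assms by (simp add: bigf_def eventually_conj)
  then show "\<forall>\<^sub>F h in Fl. (\<lambda>\<theta>. X h \<theta> + Y h \<theta>) \<in> BP" by eventually_elim (simp add: BP_add)
  fix i j
  have "(\<lambda>h. Nrm (word i j) (X h) + Nrm (word i j) (Y h)) \<in> O[Fl](r)"
    using assms by (intro sum_in_bigo) (auto simp: bigf_def)
  then show "(\<lambda>h. Nrm (word i j) (\<lambda>\<theta>. X h \<theta> + Y h \<theta>)) \<in> O[Fl](r)"
    by (rule bigo_bound) (use ev in eventually_elim, simp add: Nrm_add Nrm_nonneg BP_add)
qed

lemma smallf_add:
  assumes "smallf Fl r X" "smallf Fl r Y"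
  shows "smallf Fl r (\<lambda>h \<theta>. X h \<theta> + Y h \<theta>)"
  unfolding smallf_def
proof (intro conjI allI)
  have ev: "\<forall>\<^sub>F h in Fl. X h \<in> BP \<and> Y h \<in> BP" using assms by (simp add: smallf_def eventually_conj)
  then show "\<forall>\<^sub>F h in Fl. (\<lambda>\<theta>. X h \<theta> + Y h \<theta>) \<in> BP" by eventually_elim (simp add: BP_add)
  fix i j
  have "(\<lambda>h. Nrm (word i j) (X h) + Nrm (word i j) (Y h)) \<in> o[Fl](r)"
    using assms by (intro sum_in_smallo) (auto simp: smallf_def)
  then show "(\<lambda>h. Nrm (word i j) (\<lambda>\<theta>. X h \<theta> + Y h \<theta>)) \<in> o[Fl](r)"
    by (rule smallo_bound) (use ev in eventually_elim, simp add: Nrm_add Nrm_nonneg BP_add)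
qed

lemma bigf_mult:
  assumes "bigf Fl r X" "bigf Fl q Y"
  shows "bigf Fl (\<lambda>h. r h * q h) (\<lambda>h \<theta>. X h \<theta> * Y h \<theta>)"
  unfolding bigf_def
proof (intro conjI allI)
  have ev: "\<forall>\<^sub>F h in Fl. X h \<in> BP \<and> Y h \<in> BP" using assms by (simp add: bigf_def eventually_conj)
  then show "\<forall>\<^sub>F h in Fl. (\<lambda>\<theta>. X h \<theta> * Y h \<theta>) \<in> BP" by eventually_elim (simp add: BP_mult)
  fix i j
  have "(\<lambda>h. Nrm (word i j) (X h) * Nrm (word i j) (Y h)) \<in> O[Fl](\<lambda>h. r h * q h)"
    using assms by (intro landau_o.big.mult) (auto simp: bigf_def)
  then show "(\<lambda>h. Nrm (word i j) (\<lambda>\<theta>. X h \<theta> * Y h \<theta>)) \<in> O[Fl](\<lambda>h. r h * q h)"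
    by (rule bigo_bound) (use ev in eventually_elim, simp add: Nrm_mult Nrm_nonneg BP_mult)
qed

lemma smallf_mult:
  assumes "bigf Fl r X" "smallf Fl q Y"
  shows "smallf Fl (\<lambda>h. r h * q h) (\<lambda>h \<theta>. X h \<theta> * Y h \<theta>)"
  unfolding smallf_def
proof (intro conjI allI)
  have ev: "\<forall>\<^sub>F h in Fl. X h \<in> BP \<and> Y h \<in> BP"
    using assms by (simp add: bigf_def smallf_def eventually_conj)
  then show "\<forall>\<^sub>F h in Fl. (\<lambda>\<theta>. X h \<theta> * Y h \<theta>) \<in> BP" by eventually_elim (simp add: BP_mult)
  fix i j
  have "(\<lambda>h. Nrm (word i j) (X h) * Nrm (word i j) (Y h)) \<in> o[Fl](\<lambda>h. r h * q h)"
    using assms by (intro landau_o.big_small_mult) (auto simp: bigf_def smallf_def)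
  then show "(\<lambda>h. Nrm (word i j) (\<lambda>\<theta>. X h \<theta> * Y h \<theta>)) \<in> o[Fl](\<lambda>h. r h * q h)"
    by (rule smallo_bound) (use ev in eventually_elim, simp add: Nrm_mult Nrm_nonneg BP_mult)
qed

lemma bigf_const: "F \<in> BP \<Longrightarrow> bigf Fl (\<lambda>_. 1) (\<lambda>_. F)"
  by (simp add: bigf_def)

lemma bigf_scalar: "bigf Fl (\<lambda>h. norm (c h)) (\<lambda>h \<theta>. c h)"
  by (simp add: bigf_def BP_const Nrm_const)

lemma bigf_mono: "bigf Fl r X \<Longrightarrow> r \<in> O[Fl](q) \<Longrightarrow> bigf Fl q X"
  unfolding bigf_def using landau_o.big_trans by blast

lemma bigf_imp_smallf: "bigf Fl r X \<Longrightarrow> r \<in> o[Fl](q) \<Longrightarrow> smallf Fl q X"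
  unfolding bigf_def smallf_def using landau_o.big_small_trans by blast

lemma smallf_mono: "smallf Fl r X \<Longrightarrow> r \<in> O[Fl](q) \<Longrightarrow> smallf Fl q X"
  unfolding smallf_def using landau_o.small_big_trans by blast

lemma bigf_cmult: "F \<in> BP \<Longrightarrow> bigf Fl (\<lambda>h. norm (c h)) (\<lambda>h \<theta>. c h * F \<theta>)"
  using bigf_mult[OF bigf_scalar[of Fl c] bigf_const[of F]] by simp

lemma smallf_supn:
  assumes "\<forall>\<^sub>F h in Fl. X h \<in> BP"
  shows "smallf Fl r X \<longleftrightarrow>
    (\<forall>i j. (\<lambda>h. supn ((dir_deriv (1, 0) ^^ i) ((dir_deriv (0, 1) ^^ j) (X h)))) \<in> o[Fl](r))"
    (is "_ = ?R")
proof
  assume s: "smallf Fl r X"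
  show ?R
  proof (intro allI)
    fix i j
    have "(\<lambda>h. Nrm (word i j) (X h)) \<in> o[Fl](r)" using s by (simp add: smallf_def)
    then show "(\<lambda>h. supn ((dir_deriv (1, 0) ^^ i) ((dir_deriv (0, 1) ^^ j) (X h)))) \<in> o[Fl](r)"
      by (rule smallo_bound)
        (use assms in eventually_elim, simp add: supn_le_Nrm_word supn_nonneg BP_funpow_dir_deriv)
  qed
next
  assume ?R
  then show "smallf Fl r X" using assms by (auto simp: smallf_def intro!: Nrm_word_smallo)
qed

text \<open>The three families are linked by differentiation: exp(X) - 1 - X yields exp(X) - 1 times
  a derivative of X, and exp(X) - 1 yields exp(X) times it. Induction on the word thus reduces each
  estimate to the preceding one.\<close>

lemma bigf_exp:
  assumes X: "bigf Fl r X" and r: "r \<in> O[Fl](\<lambda>_. 1)"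
  shows "bigf Fl (\<lambda>_. 1) (\<lambda>h \<theta>. exp (X h \<theta>))"
    and "bigf Fl r (\<lambda>h \<theta>. exp (X h \<theta>) - 1)"
    and "bigf Fl (\<lambda>h. r h * r h) (\<lambda>h \<theta>. exp (X h \<theta>) - 1 - X h \<theta>)"
proof -
  have ev: "\<forall>\<^sub>F h in Fl. X h \<in> BP" using X by (simp add: bigf_def)
  have D: "dir_deriv d (\<lambda>\<theta>. exp (F \<theta>)) = (\<lambda>\<theta>. exp (F \<theta>) * dir_deriv d F \<theta>)"
      "dir_deriv d (\<lambda>\<theta>. exp (F \<theta>) - 1) = (\<lambda>\<theta>. exp (F \<theta>) * dir_deriv d F \<theta>)"
      "dir_deriv d (\<lambda>\<theta>. exp (F \<theta>) - 1 - F \<theta>) = (\<lambda>\<theta>. (exp (F \<theta>) - 1) * dir_deriv d F \<theta>)"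
    if F: "F \<in> BP" for F d
  proof -
    show 1: "dir_deriv d (\<lambda>\<theta>. exp (F \<theta>)) = (\<lambda>\<theta>. exp (F \<theta>) * dir_deriv d F \<theta>)"
      using F by (intro ext dir_deriv_holomorphic_comp DERIV_exp BP_differentiable)
    show 2: "dir_deriv d (\<lambda>\<theta>. exp (F \<theta>) - 1) = (\<lambda>\<theta>. exp (F \<theta>) * dir_deriv d F \<theta>)"
      using F by (simp add: dir_deriv_diff_BP BP_exp BP_const 1)
    show "dir_deriv d (\<lambda>\<theta>. exp (F \<theta>) - 1 - F \<theta>) = (\<lambda>\<theta>. (exp (F \<theta>) - 1) * dir_deriv d F \<theta>)"
      unfolding dir_deriv_diff_BP[OF BP_diff[OF BP_exp[OF F] BP_const] F] 2 by (simp add: algebra_simps)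
  qed
  have B: "F \<in> BP \<Longrightarrow> (\<lambda>\<theta>. exp (F \<theta>)) \<in> BP" "F \<in> BP \<Longrightarrow> (\<lambda>\<theta>. exp (F \<theta>) - 1) \<in> BP"
    "F \<in> BP \<Longrightarrow> (\<lambda>\<theta>. exp (F \<theta>) - 1 - F \<theta>) \<in> BP" for F
    by (simp_all add: BP_exp BP_diff BP_const)
  obtain C where C: "\<forall>\<^sub>F h in Fl. supn (X h) \<le> C"
  proof -
    have "(\<lambda>h. Nrm (word 0 0) (X h)) \<in> O[Fl](\<lambda>_. 1)"
      using X r landau_o.big_trans unfolding bigf_def by blast
    then obtain c where "\<forall>\<^sub>F h in Fl. norm (supn (X h)) \<le> c * norm (1::real)"
      by (auto elim!: landau_o.bigE)
    then have "\<forall>\<^sub>F h in Fl. supn (X h) \<le> c" by eventually_elim simp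
    then show ?thesis by (rule that)
  qed
  \<comment> \<open>Pointwise base cases. Taylor's bound carries the factor exp |Re z|, which
    \<open>exp C\<close> dominates because X is eventually bounded by C.\<close>
  have T: "norm (exp z) \<le> exp C" "norm (exp z - 1) \<le> exp C * x" "norm (exp z - 1 - z) \<le> exp C * (x * x)"
    if "norm z \<le> x" "x \<le> C" for z :: complex and x
  proof -
    have 1: "\<bar>Re z\<bar> \<le> C" using that abs_Re_le_cmod[of z] by linarith
    then show "norm (exp z) \<le> exp C" by simp
    have "norm (exp z - 1) \<le> exp \<bar>Re z\<bar> * norm z" using Taylor_exp[of z 0] by simp
    also have "\<dots> \<le> exp C * x" using 1 that by (intro mult_mono) auto
    finally show "norm (exp z - 1) \<le> exp C * x" .
    have "norm (exp z - 1 - z) \<le> exp \<bar>Re z\<bar> * (norm z * norm z)"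
      using Taylor_exp[of z 1] by (simp add: power2_eq_square algebra_simps)
    also have "\<dots> \<le> exp C * (x * x)"
      using 1 that norm_ge_zero[of z] by (intro mult_mono) (auto intro: order_trans[OF norm_ge_zero])
    finally show "norm (exp z - 1 - z) \<le> exp C * (x * x)" .
  qed
  have e1: "(\<lambda>h. Nrm ds (\<lambda>\<theta>. exp (X h \<theta>))) \<in> O[Fl](\<lambda>_. 1)"
    if "(\<lambda>h. Nrm ds (X h)) \<in> O[Fl](\<lambda>_. 1)" for ds
    using that
  proof (induction ds)
    case Nil
    show ?case
    proof (rule landau_o.bigI[of "exp C"])
      show "\<forall>\<^sub>F h in Fl. norm (Nrm [] (\<lambda>\<theta>. exp (X h \<theta>))) \<le> exp C * norm (1::real)"
        using ev C
      proof eventually_elim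
        case (elim h)
        then have "supn (\<lambda>\<theta>. exp (X h \<theta>)) \<le> exp C"
          using supn_ge[of "X h"] by (intro supn_le T(1)) auto
        then show ?case using supn_nonneg[OF B(1)[OF elim(1)]] by simp
      qed
    qed simp
  next
    case (Cons d ds)
    have c: "(\<lambda>h. Nrm ds (X h)) \<in> O[Fl](\<lambda>_. 1)" "(\<lambda>h. Nrm ds (dir_deriv d (X h))) \<in> O[Fl](\<lambda>_. 1)"
      by (rule bigo_bound[OF Cons.prems], use ev in eventually_elim, simp add: Nrm_nonneg BP_dir_deriv)+
    have "(\<lambda>h. Nrm ds (\<lambda>\<theta>. exp (X h \<theta>)) + Nrm ds (\<lambda>\<theta>. exp (X h \<theta>)) * Nrm ds (dir_deriv d (X h)))
        \<in> O[Fl](\<lambda>_. 1)"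
      using landau_o.big.mult[OF Cons.IH[OF c(1)] c(2)] Cons.IH[OF c(1)] by (intro sum_in_bigo) auto
    then show ?case
      by (rule bigo_bound)
        (use ev in eventually_elim, simp add: D B Nrm_mult Nrm_nonneg BP_dir_deriv BP_mult)
  qed
  have e2: "(\<lambda>h. Nrm ds (\<lambda>\<theta>. exp (X h \<theta>) - 1)) \<in> O[Fl](r)"
    if "(\<lambda>h. Nrm ds (X h)) \<in> O[Fl](r)" for ds
    using that
  proof (induction ds)
    case Nil
    have "(\<lambda>h. exp C * supn (X h)) \<in> O[Fl](r)" using Nil by simp
    then show ?case
    proof (rule bigo_bound)
      show "\<forall>\<^sub>F h in Fl. 0 \<le> Nrm [] (\<lambda>\<theta>. exp (X h \<theta>) - 1) \<and>
          Nrm [] (\<lambda>\<theta>. exp (X h \<theta>) - 1) \<le> exp C * supn (X h)"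
        using ev C
        by eventually_elim (auto intro!: supn_nonneg B supn_le T(2) supn_ge)
    qed
  next
    case (Cons d ds)
    have c: "(\<lambda>h. Nrm ds (X h)) \<in> O[Fl](r)" "(\<lambda>h. Nrm ds (dir_deriv d (X h))) \<in> O[Fl](r)"
      by (rule bigo_bound[OF Cons.prems], use ev in eventually_elim, simp add: Nrm_nonneg BP_dir_deriv)+
    have "(\<lambda>h. Nrm ds (\<lambda>\<theta>. exp (X h \<theta>) - 1) + Nrm ds (\<lambda>\<theta>. exp (X h \<theta>)) * Nrm ds (dir_deriv d (X h)))
        \<in> O[Fl](r)"
      using landau_o.big.mult[OF e1[OF landau_o.big_trans[OF c(1) r]] c(2)] Cons.IH[OF c(1)]
      by (intro sum_in_bigo) auto
    then show ?case
      by (rule bigo_bound)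
        (use ev in eventually_elim, simp add: D B Nrm_mult Nrm_nonneg BP_dir_deriv BP_mult)
  qed
  have e3: "(\<lambda>h. Nrm ds (\<lambda>\<theta>. exp (X h \<theta>) - 1 - X h \<theta>)) \<in> O[Fl](\<lambda>h. r h * r h)"
    if "(\<lambda>h. Nrm ds (X h)) \<in> O[Fl](r)" for ds
    using that
  proof (induction ds)
    case Nil
    have "(\<lambda>h. exp C * (supn (X h) * supn (X h))) \<in> O[Fl](\<lambda>h. r h * r h)"
      using landau_o.big.mult[of "\<lambda>h. supn (X h)"] Nil by simp
    then show ?case
    proof (rule bigo_bound)
      show "\<forall>\<^sub>F h in Fl. 0 \<le> Nrm [] (\<lambda>\<theta>. exp (X h \<theta>) - 1 - X h \<theta>) \<and>
          Nrm [] (\<lambda>\<theta>. exp (X h \<theta>) - 1 - X h \<theta>) \<le> exp C * (supn (X h) * supn (X h))"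
        using ev C
        by eventually_elim (auto intro!: supn_nonneg B supn_le T(3) supn_ge)
    qed
  next
    case (Cons d ds)
    have c: "(\<lambda>h. Nrm ds (X h)) \<in> O[Fl](r)" "(\<lambda>h. Nrm ds (dir_deriv d (X h))) \<in> O[Fl](r)"
      by (rule bigo_bound[OF Cons.prems], use ev in eventually_elim, simp add: Nrm_nonneg BP_dir_deriv)+
    have "(\<lambda>h. Nrm ds (\<lambda>\<theta>. exp (X h \<theta>) - 1 - X h \<theta>)
        + Nrm ds (\<lambda>\<theta>. exp (X h \<theta>) - 1) * Nrm ds (dir_deriv d (X h))) \<in> O[Fl](\<lambda>h. r h * r h)"
      using landau_o.big.mult[OF e2[OF c(1)] c(2)] Cons.IH[OF c(1)]
      by (intro sum_in_bigo) auto
    then show ?case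
      by (rule bigo_bound)
        (use ev in eventually_elim, simp add: D B Nrm_mult Nrm_nonneg BP_dir_deriv BP_mult)
  qed
  have X': "(\<lambda>h. Nrm (word i j) (X h)) \<in> O[Fl](r)" for i j using X by (simp add: bigf_def)
  have ev': "\<forall>\<^sub>F h in Fl. (\<lambda>\<theta>. exp (X h \<theta>)) \<in> BP" "\<forall>\<^sub>F h in Fl. (\<lambda>\<theta>. exp (X h \<theta>) - 1) \<in> BP"
    "\<forall>\<^sub>F h in Fl. (\<lambda>\<theta>. exp (X h \<theta>) - 1 - X h \<theta>) \<in> BP"
    by (use ev in eventually_elim, simp add: B)+
  show "bigf Fl (\<lambda>_. 1) (\<lambda>h \<theta>. exp (X h \<theta>))"
    unfolding bigf_def using ev'(1) e1[OF landau_o.big_trans[OF X' r]] by blast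
  show "bigf Fl r (\<lambda>h \<theta>. exp (X h \<theta>) - 1)"
    unfolding bigf_def using ev'(2) e2[OF X'] by blast
  show "bigf Fl (\<lambda>h. r h * r h) (\<lambda>h \<theta>. exp (X h \<theta>) - 1 - X h \<theta>)"
    unfolding bigf_def using ev'(3) e3[OF X'] by blast
qed

section \<open>Change of variables on the torus, and the logarithm of a family close to 1\<close>

lemma C_k_comp_linear:
  assumes "bounded_linear L"
  shows "C_k k F \<Longrightarrow> C_k k (\<lambda>x. F (L x))"
proof (induction k arbitrary: F)
  case 0
  then show ?case
    using continuous_on_compose2[of UNIV F UNIV L] linear_continuous_on[OF assms] by auto
next
  case (Suc k)
  have d: "((\<lambda>x. F (L x)) has_derivative (\<lambda>v. dir_deriv (L v) F (L x))) (at x)" for x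
    using has_derivative_compose[OF bounded_linear_imp_has_derivative[OF assms] dir_deriv_works[of F "L x"]]
      Suc.prems by simp
  then have "dir_deriv v (\<lambda>x. F (L x)) = (\<lambda>x. dir_deriv (L v) F (L x))" for v
    by (intro ext dir_derivI)
  then show ?case using d Suc by (auto simp: differentiable_def)
qed

lemma C_inf_comp_linear: "bounded_linear L \<Longrightarrow> C_inf F \<Longrightarrow> C_inf (\<lambda>x. F (L x))"
  by (simp add: C_inf_def C_k_comp_linear)

lemma dir_deriv_comp_linear_arg:
  assumes "bounded_linear L" "F differentiable at (L x)"
  shows "dir_deriv v (\<lambda>x. F (L x)) x = dir_deriv (L v) F (L x)"
  using has_derivative_compose[OF bounded_linear_imp_has_derivative[OF assms(1)] dir_deriv_works[OF assms(2)]]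
  by (rule dir_derivI)

lemma dir_deriv_zero: "F differentiable at x \<Longrightarrow> dir_deriv 0 F x = 0"
  using dir_deriv_works has_derivative_bounded_linear linear_0 bounded_linear.linear by blast

text \<open>Lifts to the line of smooth degree one maps of the circle.\<close>

definition lift1 :: "(real \<Rightarrow> real) \<Rightarrow> bool" where
  "lift1 a \<longleftrightarrow> C_inf a \<and> (\<forall>x. a (x + 2 * pi) = a x + 2 * pi)"

definition pull :: "(real \<Rightarrow> real) \<Rightarrow> (real \<Rightarrow> real) \<Rightarrow> (real \<times> real \<Rightarrow> complex) \<Rightarrow> real \<times> real \<Rightarrow> complex" where
  "pull a b F \<theta> = F (a (fst \<theta>), b (snd \<theta>))"

lemma BP_pull: "lift1 a \<Longrightarrow> lift1 b \<Longrightarrow> F \<in> BP \<Longrightarrow> pull a b F \<in> BP"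
  using C_inf_pair_comp[OF C_inf_comp_linear[OF bounded_linear_fst] C_inf_comp_linear[OF bounded_linear_snd], of a b F]
  by (auto simp: BP_def lift1_def pull_def[abs_def])

lemma BP_lift1_deriv:
  assumes "lift1 a"
  shows "(\<lambda>\<theta>. of_real (dir_deriv 1 a (fst \<theta>))) \<in> BP" "(\<lambda>\<theta>. of_real (dir_deriv 1 a (snd \<theta>))) \<in> BP"
proof -
  have a: "C_inf a" using assms by (simp add: lift1_def)
  have "dir_deriv 1 a (x + 2 * pi) = dir_deriv 1 a x" for x
  proof -
    have "(a has_derivative (\<lambda>v. dir_deriv v a (x + 2 * pi))) (at (x + 2 * pi))"
      using a by (rule C_inf_has_derivative)
    moreover have "((\<lambda>z. z + 2 * pi) has_derivative (\<lambda>v. v)) (at x)"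
      by (auto intro!: derivative_eq_intros)
    ultimately have "((\<lambda>z. a (z + 2 * pi)) has_derivative (\<lambda>v. dir_deriv v a (x + 2 * pi))) (at x)"
      using has_derivative_compose by blast
    then have "((\<lambda>z. a z + 2 * pi) has_derivative (\<lambda>v. dir_deriv v a (x + 2 * pi))) (at x)"
      using assms by (simp add: lift1_def)
    from has_derivative_diff[OF this has_derivative_const[of "2 * pi"]]
    show ?thesis by (intro dir_derivI[symmetric]) simp
  qed
  moreover have "C_inf (\<lambda>\<theta>. complex_of_real (dir_deriv 1 a (fst \<theta>)))"
    "C_inf (\<lambda>\<theta>. complex_of_real (dir_deriv 1 a (snd \<theta>)))"
    using C_inf_linear_comp[OF bounded_linear_of_real C_inf_comp_linear[OF _ C_inf_dir_deriv[OF a]]]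
      bounded_linear_fst bounded_linear_snd by blast+
  ultimately show "(\<lambda>\<theta>. of_real (dir_deriv 1 a (fst \<theta>))) \<in> BP" "(\<lambda>\<theta>. of_real (dir_deriv 1 a (snd \<theta>))) \<in> BP"
    by (simp_all add: BP_def)
qed

lemma dir_deriv_pull:
  assumes a: "lift1 a" and b: "lift1 b" and F: "F \<in> BP"
  shows "dir_deriv (1, 0) (pull a b F) = (\<lambda>\<theta>. of_real (dir_deriv 1 a (fst \<theta>)) * pull a b (dir_deriv (1, 0) F) \<theta>)"
    and "dir_deriv (0, 1) (pull a b F) = (\<lambda>\<theta>. of_real (dir_deriv 1 b (snd \<theta>)) * pull a b (dir_deriv (0, 1) F) \<theta>)"
proof -
  have ab: "\<And>x. a differentiable at x" "\<And>x. b differentiable at x"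
    using a b by (simp_all add: lift1_def C_inf_differentiable)
  have ab': "(\<lambda>\<theta>. a (fst \<theta>)) differentiable at \<theta>" "(\<lambda>\<theta>. b (snd \<theta>)) differentiable at \<theta>" for \<theta> :: "real \<times> real"
    using a b C_inf_comp_linear[OF bounded_linear_fst, of a] C_inf_comp_linear[OF bounded_linear_snd, of b]
    by (auto simp: lift1_def intro!: C_inf_differentiable)
  have *: "dir_deriv v (pull a b F) \<theta> =
     of_real (dir_deriv (fst v) a (fst \<theta>)) * dir_deriv (1, 0) F (a (fst \<theta>), b (snd \<theta>)) +
     of_real (dir_deriv (snd v) b (snd \<theta>)) * dir_deriv (0, 1) F (a (fst \<theta>), b (snd \<theta>))" for v \<theta>
    using has_derivative_pair_comp[OF ab' BP_differentiable[OF F], of \<theta>]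
    unfolding pull_def[abs_def]
    by (intro dir_derivI) (simp add: dir_deriv_comp_linear_arg[OF bounded_linear_fst] ab
        dir_deriv_comp_linear_arg[OF bounded_linear_snd])
  show "dir_deriv (1, 0) (pull a b F) = (\<lambda>\<theta>. of_real (dir_deriv 1 a (fst \<theta>)) * pull a b (dir_deriv (1, 0) F) \<theta>)"
    "dir_deriv (0, 1) (pull a b F) = (\<lambda>\<theta>. of_real (dir_deriv 1 b (snd \<theta>)) * pull a b (dir_deriv (0, 1) F) \<theta>)"
    by (auto simp: fun_eq_iff * pull_def dir_deriv_zero ab)
qed

lemma Nrm_pull:
  assumes a: "lift1 a" and b: "lift1 b" and "set ds \<subseteq> {(1, 0), (0, 1)}"
  shows "\<exists>C\<ge>0. \<forall>F\<in>BP. Nrm ds (pull a b F) \<le> C * Nrm ds F"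
  using assms(3)
proof (induction ds)
  case Nil
  have "\<forall>F\<in>BP. Nrm [] (pull a b F) \<le> 1 * Nrm [] F"
    by (auto intro!: supn_le simp: supn_ge pull_def)
  then show ?case by (intro exI[of _ 1]) simp
next
  case (Cons d ds)
  then obtain C where C: "C \<ge> 0" "\<And>F. F \<in> BP \<Longrightarrow> Nrm ds (pull a b F) \<le> C * Nrm ds F" by auto
  have "\<exists>P\<in>BP. \<forall>F\<in>BP. dir_deriv d (pull a b F) = (\<lambda>\<theta>. P \<theta> * pull a b (dir_deriv d F) \<theta>)"
    using Cons.prems BP_lift1_deriv(1)[OF a] BP_lift1_deriv(2)[OF b] by (auto simp: dir_deriv_pull[OF a b])
  then obtain P where P: "P \<in> BP"
    "\<And>F. F \<in> BP \<Longrightarrow> dir_deriv d (pull a b F) = (\<lambda>\<theta>. P \<theta> * pull a b (dir_deriv d F) \<theta>)" by blast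
  have "Nrm (d # ds) (pull a b F) \<le> (C + Nrm ds P * C) * Nrm (d # ds) F" if F: "F \<in> BP" for F
  proof -
    have "Nrm (d # ds) (pull a b F) = Nrm ds (pull a b F) + Nrm ds (\<lambda>\<theta>. P \<theta> * pull a b (dir_deriv d F) \<theta>)"
      by (simp add: P(2) F)
    also have "\<dots> \<le> C * Nrm ds F + Nrm ds P * (C * Nrm ds (dir_deriv d F))"
      by (intro add_mono C F order_trans[OF Nrm_mult] mult_left_mono P Nrm_nonneg BP_pull a b BP_dir_deriv)
    also have "\<dots> \<le> C * Nrm (d # ds) F + Nrm ds P * (C * Nrm (d # ds) F)"
      using C(1) F P(1) by (intro add_mono mult_left_mono Nrm_nonneg) (auto simp: Nrm_nonneg BP_dir_deriv)
    finally show ?thesis by (simp add: algebra_simps)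
  qed
  moreover have "C + Nrm ds P * C \<ge> 0" using C(1) P(1) by (simp add: Nrm_nonneg)
  ultimately show ?case by blast
qed

lemma smallf_pull:
  assumes a: "lift1 a" and b: "lift1 b" and X: "smallf Fl r X"
  shows "smallf Fl r (\<lambda>h. pull a b (X h))"
  unfolding smallf_def
proof (intro conjI allI)
  have ev: "\<forall>\<^sub>F h in Fl. X h \<in> BP" using X by (simp add: smallf_def)
  then show "\<forall>\<^sub>F h in Fl. pull a b (X h) \<in> BP" by eventually_elim (simp add: BP_pull a b)
  fix i j
  have "set (word i j) \<subseteq> {(1, 0), (0, 1)}" by (auto simp: set_replicate_conv_if)
  then obtain C where C: "C \<ge> 0" "\<And>F. F \<in> BP \<Longrightarrow> Nrm (word i j) (pull a b F) \<le> C * Nrm (word i j) F"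
    using Nrm_pull[OF a b, of "word i j"] by auto
  have "(\<lambda>h. C * Nrm (word i j) (X h)) \<in> o[Fl](r)" using X by (simp add: smallf_def)
  then show "(\<lambda>h. Nrm (word i j) (pull a b (X h))) \<in> o[Fl](r)"
    by (rule smallo_bound) (use ev in eventually_elim, simp add: C Nrm_nonneg BP_pull a b)
qed

lemma one_plus_notin_nonpos_Reals: "norm (z::complex) < 1 \<Longrightarrow> 1 + z \<notin> \<real>\<^sub>\<le>\<^sub>0"
  using abs_Re_le_cmod[of z] by (auto simp: complex_nonpos_Reals_iff)

text \<open>The derivative of Ln(1 + Y) - Y is -Y Y' / (1 + Y), already of second order in Y; the
  induction on the word needs only that 1 / (1 + Y) is bounded in every norm.\<close>

lemma bigf_Ln:
  assumes Y: "bigf Fl r Y" and r: "r \<in> o[Fl](\<lambda>_. 1)"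
  shows "bigf Fl (\<lambda>h. r h * r h) (\<lambda>h \<theta>. Ln (1 + Y h \<theta>) - Y h \<theta>)"
proof -
  have Y0: "(\<lambda>h. Nrm (word i j) (Y h)) \<in> O[Fl](r)" for i j using Y by (simp add: bigf_def)
  have "(\<lambda>h. Nrm (word 0 0) (Y h)) \<in> o[Fl](\<lambda>_. 1)"
    using Y0 r by (rule landau_o.big_small_trans)
  then have "\<forall>\<^sub>F h in Fl. norm (Nrm (word 0 0) (Y h)) \<le> 1/2 * norm (1::real)"
    by (rule landau_o.smallD) simp
  moreover have "\<forall>\<^sub>F h in Fl. Y h \<in> BP" using Y by (simp add: bigf_def)
  \<comment> \<open>With sup norm at most 1/2 the values 1 + Y stay off the branch cut and their
    inverses are bounded by 2.\<close>
  ultimately have ev: "\<forall>\<^sub>F h in Fl. Y h \<in> BP \<and> supn (Y h) \<le> 1/2"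
    by eventually_elim simp
  have half: "norm (F \<theta>) \<le> 1/2" if "F \<in> BP \<and> supn F \<le> 1/2" for F \<theta>
    using supn_ge[of F \<theta>] that by simp
  have ne: "1 + F \<theta> \<noteq> 0" "1 + F \<theta> \<notin> \<real>\<^sub>\<le>\<^sub>0" "norm (F \<theta>) < 1" "norm (inverse (1 + F \<theta>)) \<le> 2"
    if "F \<in> BP \<and> supn F \<le> 1/2" for F \<theta>
  proof -
    show 1: "norm (F \<theta>) < 1" using half[OF that, of \<theta>] by simp
    show "1 + F \<theta> \<notin> \<real>\<^sub>\<le>\<^sub>0" using 1 by (rule one_plus_notin_nonpos_Reals)
    have "norm (1 + F \<theta>) \<ge> 1/2"
      using half[OF that, of \<theta>] norm_triangle_ineq2[of 1 "- F \<theta>"] by simp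
    then show "1 + F \<theta> \<noteq> 0" by auto
    then show "norm (inverse (1 + F \<theta>)) \<le> 2"
      using \<open>norm (1 + F \<theta>) \<ge> 1/2\<close> by (simp add: norm_inverse norm_divide divide_simps)
  qed
  have B: "(\<lambda>\<theta>. inverse (1 + F \<theta>)) \<in> BP" "(\<lambda>\<theta>. Ln (1 + F \<theta>)) \<in> BP" "(\<lambda>\<theta>. Ln (1 + F \<theta>) - F \<theta>) \<in> BP"
    if F: "F \<in> BP \<and> supn F \<le> 1/2" for F
  proof -
    have 1: "(\<lambda>\<theta>. 1 + F \<theta>) \<in> BP" using F by (simp add: BP_add BP_const)
    show "(\<lambda>\<theta>. inverse (1 + F \<theta>)) \<in> BP"
    proof (rule BP_holomorphic_comp[of "- {0}", OF _ _ _ 1])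
      show "range (\<lambda>\<theta>. 1 + F \<theta>) \<subseteq> - {0}" using ne(1)[OF F] by (metis ComplI image_subsetI singletonD)
    qed (auto intro!: holomorphic_intros)
    show "(\<lambda>\<theta>. Ln (1 + F \<theta>)) \<in> BP"
      by (rule BP_holomorphic_comp[of "- \<real>\<^sub>\<le>\<^sub>0", OF _ _ _ 1])
        (use ne(2)[OF F] in \<open>auto intro!: holomorphic_intros simp: image_def\<close>)
    then show "(\<lambda>\<theta>. Ln (1 + F \<theta>) - F \<theta>) \<in> BP" using F by (simp add: BP_diff)
  qed
  have D: "dir_deriv d (\<lambda>\<theta>. inverse (1 + F \<theta>)) = (\<lambda>\<theta>. - 1 * (inverse (1 + F \<theta>) * inverse (1 + F \<theta>) * dir_deriv d F \<theta>))"
    "dir_deriv d (\<lambda>\<theta>. Ln (1 + F \<theta>) - F \<theta>) = (\<lambda>\<theta>. - 1 * (inverse (1 + F \<theta>) * F \<theta> * dir_deriv d F \<theta>))"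
    if F: "F \<in> BP \<and> supn F \<le> 1/2" for F d
  proof -
    have F1: "dir_deriv d (\<lambda>\<theta>. 1 + F \<theta>) = dir_deriv d F"
      using F by (simp add: dir_deriv_add_BP BP_const)
    have F2: "(\<lambda>\<theta>. 1 + F \<theta>) \<in> BP" using F by (simp add: BP_add BP_const)
    show "dir_deriv d (\<lambda>\<theta>. inverse (1 + F \<theta>)) = (\<lambda>\<theta>. - 1 * (inverse (1 + F \<theta>) * inverse (1 + F \<theta>) * dir_deriv d F \<theta>))"
    proof
      fix \<theta>
      have "(inverse has_field_derivative - (inverse (1 + F \<theta>) * inverse (1 + F \<theta>))) (at (1 + F \<theta>))"
        using ne(1)[OF F, of \<theta>] by (auto intro!: derivative_eq_intros simp: power2_eq_square)
      from dir_deriv_holomorphic_comp[OF this BP_differentiable[OF F2]]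
      show "dir_deriv d (\<lambda>\<theta>. inverse (1 + F \<theta>)) \<theta> = - 1 * (inverse (1 + F \<theta>) * inverse (1 + F \<theta>) * dir_deriv d F \<theta>)"
        by (simp add: F1)
    qed
    show "dir_deriv d (\<lambda>\<theta>. Ln (1 + F \<theta>) - F \<theta>) = (\<lambda>\<theta>. - 1 * (inverse (1 + F \<theta>) * F \<theta> * dir_deriv d F \<theta>))"
    proof
      fix \<theta>
      have "(Ln has_field_derivative inverse (1 + F \<theta>)) (at (1 + F \<theta>))"
        using ne(2)[OF F, of \<theta>] by (auto intro!: derivative_eq_intros simp: inverse_eq_divide)
      from dir_deriv_holomorphic_comp[OF this BP_differentiable[OF F2]]
      have "dir_deriv d (\<lambda>\<theta>. Ln (1 + F \<theta>)) \<theta> = inverse (1 + F \<theta>) * dir_deriv d F \<theta>"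
        by (simp add: F1)
      then show "dir_deriv d (\<lambda>\<theta>. Ln (1 + F \<theta>) - F \<theta>) \<theta> = - 1 * (inverse (1 + F \<theta>) * F \<theta> * dir_deriv d F \<theta>)"
        using ne(1)[OF F, of \<theta>] F B(2)[OF F] by (simp add: dir_deriv_diff_BP field_simps)
    qed
  qed
  have cm: "Nrm ds (\<lambda>\<theta>. - 1 * F \<theta>) \<le> Nrm ds F" if "F \<in> BP" for F ds
    using Nrm_mult[OF BP_const[of "-1"] that, of ds] by (simp add: Nrm_const)
  have i: "(\<lambda>h. Nrm ds (\<lambda>\<theta>. inverse (1 + Y h \<theta>))) \<in> O[Fl](\<lambda>_. 1)"
    if "(\<lambda>h. Nrm ds (Y h)) \<in> O[Fl](\<lambda>_. 1)" for ds
    using that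
  proof (induction ds)
    case Nil
    show ?case
    proof (rule landau_o.bigI[of 2])
      show "\<forall>\<^sub>F h in Fl. norm (Nrm [] (\<lambda>\<theta>. inverse (1 + Y h \<theta>))) \<le> 2 * norm (1::real)"
        using ev
      proof eventually_elim
        case (elim h)
        have "supn (\<lambda>\<theta>. inverse (1 + Y h \<theta>)) \<le> 2" by (intro supn_le ne(4) elim)
        then show ?case using supn_nonneg[OF B(1)[OF elim]] by simp
      qed
    qed simp
  next
    case (Cons d ds)
    have c: "(\<lambda>h. Nrm ds (Y h)) \<in> O[Fl](\<lambda>_. 1)" "(\<lambda>h. Nrm ds (dir_deriv d (Y h))) \<in> O[Fl](\<lambda>_. 1)"
      by (rule bigo_bound[OF Cons.prems], use ev in eventually_elim, simp add: Nrm_nonneg BP_dir_deriv)+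
    let ?N = "\<lambda>h. Nrm ds (\<lambda>\<theta>. inverse (1 + Y h \<theta>))"
    have "(\<lambda>h. ?N h + ?N h * ?N h * Nrm ds (dir_deriv d (Y h))) \<in> O[Fl](\<lambda>_. 1)"
      using landau_o.big.mult[OF landau_o.big.mult[OF Cons.IH[OF c(1)] Cons.IH[OF c(1)]] c(2)] Cons.IH[OF c(1)]
      by (intro sum_in_bigo) auto
    then show ?case
    proof (rule bigo_bound)
      show "\<forall>\<^sub>F h in Fl. 0 \<le> Nrm (d # ds) (\<lambda>\<theta>. inverse (1 + Y h \<theta>)) \<and>
         Nrm (d # ds) (\<lambda>\<theta>. inverse (1 + Y h \<theta>)) \<le> ?N h + ?N h * ?N h * Nrm ds (dir_deriv d (Y h))"
        using ev
      proof eventually_elim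
        case (elim h)
        have b: "Y h \<in> BP" "dir_deriv d (Y h) \<in> BP" "(\<lambda>\<theta>. inverse (1 + Y h \<theta>) * inverse (1 + Y h \<theta>)) \<in> BP"
          "(\<lambda>\<theta>. inverse (1 + Y h \<theta>) * inverse (1 + Y h \<theta>) * dir_deriv d (Y h) \<theta>) \<in> BP"
          using elim B(1)[OF elim] by (auto intro!: BP_mult BP_dir_deriv)
        have "Nrm ds (\<lambda>\<theta>. - 1 * (inverse (1 + Y h \<theta>) * inverse (1 + Y h \<theta>) * dir_deriv d (Y h) \<theta>))
            \<le> ?N h * ?N h * Nrm ds (dir_deriv d (Y h))"
          by (rule order_trans[OF cm[OF b(4)]], rule order_trans[OF Nrm_mult[OF b(3) b(2)]],
              rule mult_right_mono[OF Nrm_mult[OF B(1)[OF elim] B(1)[OF elim]] Nrm_nonneg[OF b(2)]])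
        then show ?case
          using Nrm_nonneg[OF B(1)[OF elim], of "d # ds"] unfolding Nrm.simps D(1)[OF elim]
          by (intro conjI) linarith+
      qed
    qed
  qed
  have l: "(\<lambda>h. Nrm ds (\<lambda>\<theta>. Ln (1 + Y h \<theta>) - Y h \<theta>)) \<in> O[Fl](\<lambda>h. r h * r h)"
    if "(\<lambda>h. Nrm ds (Y h)) \<in> O[Fl](r)" for ds
    using that
  proof (induction ds)
    case Nil
    have "(\<lambda>h. 2 * (supn (Y h) * supn (Y h))) \<in> O[Fl](\<lambda>h. r h * r h)"
      using landau_o.big.mult[of "\<lambda>h. supn (Y h)"] Nil by simp
    then show ?case
    proof (rule bigo_bound)
      show "\<forall>\<^sub>F h in Fl. 0 \<le> Nrm [] (\<lambda>\<theta>. Ln (1 + Y h \<theta>) - Y h \<theta>) \<and>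
          Nrm [] (\<lambda>\<theta>. Ln (1 + Y h \<theta>) - Y h \<theta>) \<le> 2 * (supn (Y h) * supn (Y h))"
        using ev
      proof eventually_elim
        case (elim h)
        have "norm (Ln (1 + Y h \<theta>) - Y h \<theta>) \<le> 2 * (supn (Y h) * supn (Y h))" for \<theta>
        proof -
          have "norm (Ln (1 + Y h \<theta>) - Y h \<theta>) \<le> norm (Y h \<theta>) ^ 2 / (1 - norm (Y h \<theta>))"
            by (intro Ln_approx_linear ne elim)
          also have "\<dots> \<le> norm (Y h \<theta>) ^ 2 / (1/2)"
            using half[OF elim, of \<theta>] by (intro divide_left_mono) auto
          also have "\<dots> = 2 * (norm (Y h \<theta>) * norm (Y h \<theta>))" by (simp add: power2_eq_square)
          also have "\<dots> \<le> 2 * (supn (Y h) * supn (Y h))"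
            using elim by (intro mult_left_mono mult_mono supn_ge supn_nonneg) auto
          finally show ?thesis .
        qed
        then have "supn (\<lambda>\<theta>. Ln (1 + Y h \<theta>) - Y h \<theta>) \<le> 2 * (supn (Y h) * supn (Y h))"
          by (rule supn_le)
        then show ?case using supn_nonneg[OF B(3)[OF elim]] by simp
      qed
    qed
  next
    case (Cons d ds)
    have c: "(\<lambda>h. Nrm ds (Y h)) \<in> O[Fl](r)" "(\<lambda>h. Nrm ds (dir_deriv d (Y h))) \<in> O[Fl](r)"
      by (rule bigo_bound[OF Cons.prems], use ev in eventually_elim, simp add: Nrm_nonneg BP_dir_deriv)+
    have r1: "r \<in> O[Fl](\<lambda>_. 1)" using r by (rule landau_o.small_imp_big)
    let ?N = "\<lambda>h. Nrm ds (\<lambda>\<theta>. inverse (1 + Y h \<theta>))"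
    let ?L = "\<lambda>h. Nrm ds (\<lambda>\<theta>. Ln (1 + Y h \<theta>) - Y h \<theta>)"
    have "(\<lambda>h. ?L h + ?N h * Nrm ds (Y h) * Nrm ds (dir_deriv d (Y h))) \<in> O[Fl](\<lambda>h. r h * r h)"
      using landau_o.big.mult[OF landau_o.big.mult[OF i[OF landau_o.big_trans[OF c(1) r1]] c(1)] c(2)] Cons.IH[OF c(1)]
      by (intro sum_in_bigo) auto
    then show ?case
    proof (rule bigo_bound)
      show "\<forall>\<^sub>F h in Fl. 0 \<le> Nrm (d # ds) (\<lambda>\<theta>. Ln (1 + Y h \<theta>) - Y h \<theta>) \<and>
         Nrm (d # ds) (\<lambda>\<theta>. Ln (1 + Y h \<theta>) - Y h \<theta>) \<le> ?L h + ?N h * Nrm ds (Y h) * Nrm ds (dir_deriv d (Y h))"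
        using ev
      proof eventually_elim
        case (elim h)
        have b: "Y h \<in> BP" "dir_deriv d (Y h) \<in> BP" "(\<lambda>\<theta>. inverse (1 + Y h \<theta>) * Y h \<theta>) \<in> BP"
          "(\<lambda>\<theta>. inverse (1 + Y h \<theta>) * Y h \<theta> * dir_deriv d (Y h) \<theta>) \<in> BP"
          using elim B(1)[OF elim] by (auto intro!: BP_mult BP_dir_deriv)
        have "Nrm ds (\<lambda>\<theta>. - 1 * (inverse (1 + Y h \<theta>) * Y h \<theta> * dir_deriv d (Y h) \<theta>))
            \<le> ?N h * Nrm ds (Y h) * Nrm ds (dir_deriv d (Y h))"
          by (rule order_trans[OF cm[OF b(4)]], rule order_trans[OF Nrm_mult[OF b(3) b(2)]],
              rule mult_right_mono[OF Nrm_mult[OF B(1)[OF elim] b(1)] Nrm_nonneg[OF b(2)]])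
        then show ?case
          using Nrm_nonneg[OF B(3)[OF elim], of "d # ds"] unfolding Nrm.simps D(2)[OF elim]
          by (intro conjI) linarith+
      qed
    qed
  qed
  have "\<forall>\<^sub>F h in Fl. (\<lambda>\<theta>. Ln (1 + Y h \<theta>) - Y h \<theta>) \<in> BP" using ev by eventually_elim (rule B(3))
  then show ?thesis unfolding bigf_def using l[OF Y0] by blast
qed

section \<open>The action in the angular coordinates\<close>

lemma rot_rot: "rot a ** rot b = rot (a + b)"
  by (simp add: mat2_eq_iff mat2_mult rot_def cos_add sin_add)

lemma rot_0: "rot 0 = mat 1"
  by (simp add: mat2_eq_iff rot_def mat_def)

lemma rot_pi: "rot pi = - mat 1"
  by (simp add: mat2_eq_iff rot_def mat_def)

lemma rot2_periodic: "rot2 (x + 2 * pi, y) = rot2 (x, y)" "rot2 (x, y + 2 * pi) = rot2 (x, y)"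
  by (simp_all add: rot2_def rot_def)

lemma rot2_KK: "rot2 \<theta> \<in> KK"
  by (simp add: rot2_def KK_def)

lemma KK_obtain: "k \<in> KK \<Longrightarrow> \<exists>\<theta>. k = rot2 \<theta>"
  by (auto simp: KK_def rot2_def)

lemma MM_KK: "m \<in> MM \<Longrightarrow> m \<in> KK"
proof -
  have "mat 1 \<in> range rot" "- mat 1 \<in> range rot"
    using rangeI[of rot 0] rangeI[of rot pi] by (simp_all add: rot_0 rot_pi)
  then show "m \<in> MM \<Longrightarrow> m \<in> KK" by (auto simp: MM_def KK_def)
qed

lemma rot2_mult: "rot2 \<theta> \<odot> rot2 \<theta>' = rot2 (\<theta> + \<theta>')"
  by (simp add: rot2_def gmul_def rot_rot)

lemma KK_mult: "k \<in> KK \<Longrightarrow> k' \<in> KK \<Longrightarrow> k \<odot> k' \<in> KK"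
  using KK_obtain rot2_KK rot2_mult by metis

lemma KK_GG: "k \<in> KK \<Longrightarrow> k \<in> GG"
  using rot_SL2 by (auto simp: KK_def GG_def)

lemma gmul_assoc: "(x \<odot> y) \<odot> z = x \<odot> (y \<odot> z)"
  by (simp add: gmul_def matrix_mul_assoc)

lemma gmul_1: "x \<odot> (mat 1, mat 1) = x" "(mat 1, mat 1) \<odot> x = x"
  by (simp_all add: gmul_def)

lemma SL2_mult: "g \<in> SL2 \<Longrightarrow> h \<in> SL2 \<Longrightarrow> g ** h \<in> SL2"
  by (simp add: SL2_def det_mul)

lemma matrix_inv_eqI: "(g::mat2) ** h = mat 1 \<Longrightarrow> h ** g = mat 1 \<Longrightarrow> matrix_inv g = h"
proof -
  assume gh: "g ** h = mat 1" "h ** g = mat 1"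
  then have "g ** matrix_inv g = mat 1 \<and> matrix_inv g ** g = mat 1"
    unfolding matrix_inv_def by (intro someI[of "\<lambda>h. g ** h = mat 1 \<and> h ** g = mat 1" h]) simp
  then have "h ** (g ** matrix_inv g) = h" by simp
  then show "matrix_inv g = h" by (simp add: matrix_mul_assoc gh)
qed

lemma SL2_inv: "g \<in> SL2 \<Longrightarrow> matrix_inv g ** g = mat 1" "g \<in> SL2 \<Longrightarrow> g ** matrix_inv g = mat 1"
proof -
  assume "g \<in> SL2"
  then have "invertible g" by (simp add: SL2_def invertible_det_nz)
  then obtain h where "g ** h = mat 1" "h ** g = mat 1" by (auto simp: invertible_def)
  then show "matrix_inv g ** g = mat 1" "g ** matrix_inv g = mat 1"
    using matrix_inv_eqI by metis+
qed

lemma SL2_matrix_inv: "g \<in> SL2 \<Longrightarrow> matrix_inv g \<in> SL2"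
  using SL2_inv(1)[of g] det_mul[of "matrix_inv g" g] by (simp add: SL2_def)

lemma GG_mult: "g \<in> GG \<Longrightarrow> h \<in> GG \<Longrightarrow> g \<odot> h \<in> GG"
  by (auto simp: GG_def gmul_def SL2_mult)

lemma GG_ginv: "g \<in> GG \<Longrightarrow> ginv g \<in> GG"
  by (auto simp: GG_def ginv_def SL2_matrix_inv)

lemma ginv_mult: "g \<in> GG \<Longrightarrow> h \<in> GG \<Longrightarrow> ginv (g \<odot> h) = ginv h \<odot> ginv g"
proof -
  have "matrix_inv (a ** b) = matrix_inv b ** matrix_inv a" if "a \<in> SL2" "b \<in> SL2" for a b
  proof (rule matrix_inv_eqI)
    have "a ** b ** (matrix_inv b ** matrix_inv a) = a ** (b ** matrix_inv b) ** matrix_inv a"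
      by (simp add: matrix_mul_assoc)
    then show "a ** b ** (matrix_inv b ** matrix_inv a) = mat 1"
      using that by (simp add: SL2_inv)
    have "matrix_inv b ** matrix_inv a ** (a ** b) = matrix_inv b ** (matrix_inv a ** a) ** b"
      by (simp add: matrix_mul_assoc)
    then show "matrix_inv b ** matrix_inv a ** (a ** b) = mat 1"
      using that by (simp add: SL2_inv)
  qed
  then show "g \<in> GG \<Longrightarrow> h \<in> GG \<Longrightarrow> ginv (g \<odot> h) = ginv h \<odot> ginv g"
    by (auto simp: GG_def ginv_def gmul_def)
qed

text \<open>With \<open>(x, y)\<close> the first column of \<open>h ** rot t\<close>, we have
  \<open>x - \<i> y = alp h e\<^bsup>\<i>t\<^esup> + bet h e\<^bsup>- \<i>t\<^esup>\<close>. Since \<open>|alp h| > |bet h|\<close>, the logarithm of the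
  quotient by the first summand is a smooth function of \<open>t\<close>.\<close>

definition alp :: "mat2 \<Rightarrow> complex" where
  "alp h = Complex ((h$1$1 + h$2$2) / 2) ((h$1$2 - h$2$1) / 2)"

definition bet :: "mat2 \<Rightarrow> complex" where
  "bet h = Complex ((h$1$1 - h$2$2) / 2) (- (h$1$2 + h$2$1) / 2)"

definition Lam :: "mat2 \<Rightarrow> real \<Rightarrow> complex" where
  "Lam h t = Ln (1 + bet h / alp h * exp (- 2 * \<i> * of_real t))"

definition iwaH_rot :: "mat2 \<Rightarrow> real \<Rightarrow> real" where
  "iwaH_rot h t = ln (norm (alp h)) + Re (Lam h t)"

text \<open>A lift of the K-component to the line. Only the logarithm \<open>Lam\<close> of a number
  near 1 varies nonlinearly with t, so the lift is smooth and of degree one, which an argument of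
  the whole product would not be.\<close>

definition iwaK_rot :: "mat2 \<Rightarrow> real \<Rightarrow> real" where
  "iwaK_rot h t = Arg (alp h) + t + Im (Lam h t)"

lemma alp_bet:
  assumes "h \<in> SL2"
  shows "(norm (alp h))\<^sup>2 - (norm (bet h))\<^sup>2 = 1" "norm (bet h) < norm (alp h)" "alp h \<noteq> 0" "norm (bet h / alp h) < 1"
proof -
  have "h$1$1 * h$2$2 - h$1$2 * h$2$1 = 1" using assms by (simp add: SL2_def det_2)
  then show 1: "(norm (alp h))\<^sup>2 - (norm (bet h))\<^sup>2 = 1"
    by (simp add: alp_def bet_def cmod_power2) (simp add: power2_eq_square field_simps)
  then have "(norm (bet h))\<^sup>2 < (norm (alp h))\<^sup>2" by simp
  then show 2: "norm (bet h) < norm (alp h)" by (rule power2_less_imp_less) simp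
  then show "alp h \<noteq> 0" by auto
  with 2 show "norm (bet h / alp h) < 1" by (simp add: norm_divide)
qed

lemma first_column_rot:
  "Complex ((h ** rot t)$1$1) (- (h ** rot t)$2$1) = alp h * exp (\<i> * of_real t) + bet h * exp (- \<i> * of_real t)"
proof -
  have "exp (\<i> * of_real t) = Complex (cos t) (sin t)" "exp (- \<i> * of_real t) = Complex (cos t) (- sin t)"
    using cis_conv_exp[of t] cis_conv_exp[of "- t"] by (simp_all add: cis.code)
  then show ?thesis
    by (simp add: alp_def bet_def mat2_mult rot_def complex_eq_iff field_simps)
qed

lemma norm_Lam_arg: "h \<in> SL2 \<Longrightarrow> norm (bet h / alp h * exp (- 2 * \<i> * of_real t)) < 1"
  using alp_bet(4)[of h] by (simp only: norm_mult norm_exp_eq_Re) simp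

text \<open>The first column of a rotation by K is (cos K, -sin K), so x - i y has modulus exp H and
  argument K: its logarithm carries both Iwasawa components at once.\<close>

lemma first_column_rot_exp:
  assumes "h \<in> SL2"
  shows "Complex ((h ** rot t)$1$1) (- (h ** rot t)$2$1) = exp (of_real (iwaH_rot h t) + \<i> * of_real (iwaK_rot h t))"
proof -
  have ne: "1 + bet h / alp h * exp (- 2 * \<i> * of_real t) \<noteq> 0"
  proof
    assume "1 + bet h / alp h * exp (- 2 * \<i> * of_real t) = 0"
    then show False
      using one_plus_notin_nonpos_Reals[OF norm_Lam_arg[OF assms, of t]] by (simp only: complex_nonpos_Reals_iff) simp
  qed
  have "of_real (iwaH_rot h t) + \<i> * of_real (iwaK_rot h t) = Ln (alp h) + \<i> * of_real t + Lam h t"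
  proof -
    have "Arg (alp h) = Im (Ln (alp h))" "ln (norm (alp h)) = Re (Ln (alp h))"
      using alp_bet(3)[OF assms] by (simp_all add: Arg_def)
    then show ?thesis by (simp add: iwaH_rot_def iwaK_rot_def complex_eq_iff)
  qed
  also have "exp \<dots> = alp h * exp (\<i> * of_real t) * (1 + bet h / alp h * exp (- 2 * \<i> * of_real t))"
    using alp_bet(3)[OF assms] ne by (simp add: exp_add Lam_def)
  also have "\<dots> = alp h * exp (\<i> * of_real t) + bet h * (exp (\<i> * of_real t) * exp (- 2 * \<i> * of_real t))"
    using alp_bet(3)[OF assms] by (simp add: field_simps)
  also have "exp (\<i> * of_real t) * exp (- 2 * \<i> * of_real t) = exp (- \<i> * of_real t)"
    by (simp flip: exp_add)
  finally show ?thesis unfolding first_column_rot by simp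
qed

lemma iwa_rot_left:
  assumes "h \<in> SL2"
  shows "iwa_H (h ** rot t) = iwaH_rot h t" "iwa_K (h ** rot t) = rot (iwaK_rot h t)"
proof -
  define x y where "x = (h ** rot t)$1$1" and "y = (h ** rot t)$2$1"
  let ?H = "iwaH_rot h t" and ?K = "iwaK_rot h t"
  have e: "Complex x (- y) = of_real (exp ?H) * Complex (cos ?K) (sin ?K)"
    unfolding x_def y_def first_column_rot_exp[OF assms] exp_add cis_conv_exp[symmetric] cis.code[symmetric]
    by (simp add: exp_of_real)
  then have xy: "x = exp ?H * cos ?K" "- y = exp ?H * sin ?K"
    by (simp_all add: complex_eq_iff)
  have "x\<^sup>2 + y\<^sup>2 = x\<^sup>2 + (- y)\<^sup>2" by simp
  also have "\<dots> = (exp ?H)\<^sup>2"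
    unfolding xy power_mult_distrib using sin_cos_squared_add2[of ?K] by (simp flip: distrib_left)
  finally have r: "iwa_r (h ** rot t) = exp ?H"
    by (simp add: iwa_r_def x_def y_def)
  show "iwa_H (h ** rot t) = ?H" by (simp add: iwa_H_def r)
  have "x / exp ?H = cos ?K" "- (y / exp ?H) = sin ?K"
    using xy(1) xy(2) by (simp_all add: minus_divide_left)
  moreover from this(2) have "y / exp ?H = - sin ?K" by simp
  ultimately show "iwa_K (h ** rot t) = rot ?K"
    unfolding iwa_K_def r x_def[symmetric] y_def[symmetric] by (simp add: rot_def)
qed

lemma C_inf_Lam: "h \<in> SL2 \<Longrightarrow> C_inf (Lam h)"
proof -
  assume h: "h \<in> SL2"
  have "bounded_linear (\<lambda>t. - 2 * \<i> * complex_of_real t)"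
    by (intro bounded_linear_compose[OF bounded_linear_mult_right bounded_linear_of_real])
  then have "C_inf (\<lambda>t. 1 + bet h / alp h * exp (- 2 * \<i> * complex_of_real t))"
    by (intro C_inf_add C_inf_const C_inf_mult C_inf_exp C_inf_linear)
  then show "C_inf (Lam h)"
    unfolding Lam_def[abs_def]
    by (rule C_inf_holomorphic_comp[of "- \<real>\<^sub>\<le>\<^sub>0", rotated 3])
      (use one_plus_notin_nonpos_Reals[OF norm_Lam_arg[OF h]] in \<open>auto intro!: holomorphic_intros simp: image_def\<close>)
qed

lemma Lam_periodic: "Lam h (t + 2 * pi) = Lam h t"
proof -
  have "exp (- 2 * \<i> * complex_of_real (t + 2 * pi)) = exp (- 2 * \<i> * of_real t) * exp (of_int (- 2) * (2 * of_real pi * \<i>))"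
    unfolding exp_add[symmetric] by (simp add: algebra_simps)
  also have "exp (of_int (- 2) * (2 * of_real pi * \<i>)) = (1::complex)"
    unfolding exp_eq_1 by (auto intro: exI[of _ "-2"])
  finally show ?thesis by (simp add: Lam_def)
qed

lemma C_inf_Re: "C_inf F \<Longrightarrow> C_inf (\<lambda>x. Re (F x))"
  by (rule C_inf_linear_comp[OF bounded_linear_Re])

lemma C_inf_Im: "C_inf F \<Longrightarrow> C_inf (\<lambda>x. Im (F x))"
  by (rule C_inf_linear_comp[OF bounded_linear_Im])

lemma lift1_iwaK_rot: "h \<in> SL2 \<Longrightarrow> lift1 (iwaK_rot h)"
  unfolding lift1_def iwaK_rot_def[abs_def]
  using C_inf_add[OF C_inf_add[OF C_inf_const C_inf_linear[OF bounded_linear_ident]] C_inf_Im[OF C_inf_Lam]]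
  by (simp add: Lam_periodic)

lemma C_inf_iwaH_rot: "h \<in> SL2 \<Longrightarrow> C_inf (iwaH_rot h)"
  unfolding iwaH_rot_def[abs_def] by (intro C_inf_add C_inf_const C_inf_Re C_inf_Lam)

lemma BP_iwaH_rot:
  assumes "h \<in> SL2"
  shows "(\<lambda>\<theta>. of_real (iwaH_rot h (fst \<theta>))) \<in> BP" "(\<lambda>\<theta>. of_real (iwaH_rot h (snd \<theta>))) \<in> BP"
  using C_inf_linear_comp[OF bounded_linear_of_real C_inf_comp_linear[OF bounded_linear_fst C_inf_iwaH_rot[OF assms]]]
    C_inf_linear_comp[OF bounded_linear_of_real C_inf_comp_linear[OF bounded_linear_snd C_inf_iwaH_rot[OF assms]]]
  by (auto simp: BP_def iwaH_rot_def Lam_periodic)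

section \<open>The action as multiplication by a cocycle after a change of angles\<close>

definition act_factor :: "c2 \<Rightarrow> grp \<Rightarrow> real \<times> real \<Rightarrow> complex" where
  "act_factor \<mu> g \<theta> = exp (- 2 * ((fst \<mu> + 1/2) * of_real (iwaH_rot (matrix_inv (fst g)) (fst \<theta>))
      + (snd \<mu> + 1/2) * of_real (iwaH_rot (matrix_inv (snd g)) (snd \<theta>))))"

definition act_pull :: "grp \<Rightarrow> (real \<times> real \<Rightarrow> complex) \<Rightarrow> real \<times> real \<Rightarrow> complex" where
  "act_pull g = pull (iwaK_rot (matrix_inv (fst g))) (iwaK_rot (matrix_inv (snd g)))"

lemma GG_SL2: "g \<in> GG \<Longrightarrow> matrix_inv (fst g) \<in> SL2" "g \<in> GG \<Longrightarrow> matrix_inv (snd g) \<in> SL2"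
  by (auto simp: GG_def SL2_matrix_inv)

text \<open>The parameter enters only through \<open>act_factor\<close>, as the exponential of an
  affine function, while the change of angles is the same for all parameters. Holomorphy in the
  parameter and the later limits rest on this.\<close>

lemma ps_act_rot2:
  assumes "g \<in> GG"
  shows "ps_act \<mu> g f (rot2 \<theta>) = act_factor \<mu> g \<theta> * act_pull g (\<lambda>\<theta>. f (rot2 \<theta>)) \<theta>"
  using rot2_KK[of \<theta>] by (simp add: ps_act_def ps_extend_def kap_def logA_def ginv_def gmul_def rot2_def
      iwa_rot_left GG_SL2[OF assms] act_factor_def act_pull_def pull_def a_pow_def rho_def algebra_simps)

lemma BP_act_factor: "g \<in> GG \<Longrightarrow> act_factor \<mu> g \<in> BP"
  unfolding act_factor_def[abs_def] by (intro BP_exp BP_cmult BP_add BP_iwaH_rot GG_SL2)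

lemma BP_act_pull: "g \<in> GG \<Longrightarrow> F \<in> BP \<Longrightarrow> act_pull g F \<in> BP"
  unfolding act_pull_def by (intro BP_pull lift1_iwaK_rot GG_SL2)

lemma smallf_act_pull: "g \<in> GG \<Longrightarrow> smallf Fl r X \<Longrightarrow> smallf Fl r (\<lambda>h. act_pull g (X h))"
  unfolding act_pull_def by (intro smallf_pull lift1_iwaK_rot GG_SL2)

lemma H_inf_BP: "f \<in> H_inf \<sigma> \<Longrightarrow> (\<lambda>\<theta>. f (rot2 \<theta>)) \<in> BP"
  by (auto simp: H_inf_def C_inf_K_def BP_def rot2_periodic)

lemma H_infI:
  assumes "\<And>x. x \<notin> KK \<Longrightarrow> f x = 0" "(\<lambda>\<theta>. f (rot2 \<theta>)) \<in> BP"
    "\<And>k m. k \<in> KK \<Longrightarrow> m \<in> MM \<Longrightarrow> f (k \<odot> m) = inverse (\<sigma> m) * f k"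
  shows "f \<in> H_inf \<sigma>"
  using assms by (auto simp: H_inf_def C_inf_K_def BP_def)

lemma H_inf_outside: "f \<in> H_inf \<sigma> \<Longrightarrow> x \<notin> KK \<Longrightarrow> f x = 0"
  unfolding H_inf_def C_inf_K_def by blast

lemma H_inf_equivariant: "f \<in> H_inf \<sigma> \<Longrightarrow> k \<in> KK \<Longrightarrow> m \<in> MM \<Longrightarrow> f (k \<odot> m) = inverse (\<sigma> m) * f k"
  by (simp add: H_inf_def)

lemma H_inf_lincomb: "f \<in> H_inf \<sigma> \<Longrightarrow> f' \<in> H_inf \<sigma> \<Longrightarrow> (\<lambda>k. c * f k + c' * f' k) \<in> H_inf \<sigma>"
  by (rule H_infI)
    (auto simp: H_inf_outside H_inf_equivariant algebra_simps intro!: BP_add BP_cmult dest: H_inf_BP)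

lemma H_inf_ps_act:
  assumes f: "f \<in> H_inf \<sigma>" and g: "g \<in> GG"
  shows "ps_act \<mu> g f \<in> H_inf \<sigma>"
proof (rule H_infI)
  show "x \<notin> KK \<Longrightarrow> ps_act \<mu> g f x = 0" for x by (simp add: ps_act_def)
  show "(\<lambda>\<theta>. ps_act \<mu> g f (rot2 \<theta>)) \<in> BP"
    unfolding ps_act_rot2[OF g] by (intro BP_mult BP_act_factor BP_act_pull g H_inf_BP[OF f])
  fix k m assume k: "k \<in> KK" and m: "m \<in> MM"
  \<comment> \<open>Equivariance under M alone is \<open>ps_extend_equivariant\<close> with trivial
    A- and N-part.\<close>
  have "dg2 0 \<odot> unip2 0 = (mat 1, mat 1)"
    by (simp add: dg2_def unip2_def gmul_def dg_def unip_def mat2_eq_iff mat2_mult mat_def)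
  then have "ps_extend \<mu> f (ginv g \<odot> k \<odot> m) = a_pow (- (\<mu> + rho)) 0 * inverse (\<sigma> m) * ps_extend \<mu> f (ginv g \<odot> k)"
    using ps_extend_equivariant[OF f GG_mult[OF GG_ginv[OF g] KK_GG[OF k]] m, of \<mu> 0 0] by (simp add: gmul_1)
  then show "ps_act \<mu> g f (k \<odot> m) = inverse (\<sigma> m) * ps_act \<mu> g f k"
    using k m by (simp add: ps_act_def KK_mult MM_KK gmul_assoc a_pow_def)
qed

section \<open>The group action preserves germs of holomorphic families\<close>

definition frdiff :: "(c2 \<Rightarrow> real \<times> real \<Rightarrow> complex) \<Rightarrow> c2 \<Rightarrow> (real \<times> real \<Rightarrow> complex)
    \<Rightarrow> (real \<times> real \<Rightarrow> complex) \<Rightarrow> bool" where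
  "frdiff \<phi> \<mu> A B \<longleftrightarrow>
     smallf (at 0) norm (\<lambda>h \<theta>. \<phi> (\<mu> + h) \<theta> - \<phi> \<mu> \<theta> - (fst h * A \<theta> + snd h * B \<theta>))"

lemma smallf_imp_bigf: "smallf Fl r X \<Longrightarrow> bigf Fl r X"
  unfolding bigf_def smallf_def using landau_o.small_imp_big by blast

lemma norm_fst_snd_bigo: "(\<lambda>h::c2. norm (fst h)) \<in> O[Fl](norm)" "(\<lambda>h::c2. norm (snd h)) \<in> O[Fl](norm)"
proof -
  have "norm (fst h) \<le> norm h" "norm (snd h) \<le> norm h" for h :: c2
    by (metis norm_fst_le norm_snd_le prod.collapse)+
  then show "(\<lambda>h::c2. norm (fst h)) \<in> O[Fl](norm)" "(\<lambda>h::c2. norm (snd h)) \<in> O[Fl](norm)"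
    by (auto intro!: landau_o.big_mono always_eventually)
qed

lemma norm_bigo_1: "(norm :: c2 \<Rightarrow> real) \<in> O[at 0](\<lambda>_. 1)"
  by (rule landau_o.small_imp_big, rule smalloI_tendsto) (auto intro!: tendsto_eq_intros)

lemma norm_sq_smallo: "(\<lambda>h::c2. norm h * norm h) \<in> o[at 0](norm)"
  using landau_o.small_big_mult[of norm "at (0::c2)" "\<lambda>_. 1" norm norm] 
  by (simp add: smalloI_tendsto tendsto_norm_zero[OF tendsto_ident_at])

lemma bigf_linear: "A \<in> BP \<Longrightarrow> B \<in> BP \<Longrightarrow> bigf Fl norm (\<lambda>h \<theta>. fst h * A \<theta> + snd h * B \<theta>)"
  for Fl :: "c2 filter"
  by (intro bigf_add bigf_mono[OF bigf_cmult] norm_fst_snd_bigo)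

lemma frdiff_mult:
  assumes m: "frdiff m \<mu> A B" "m \<mu> \<in> BP" "A \<in> BP" "B \<in> BP"
    and p: "frdiff \<phi> \<mu> A' B'" "\<phi> \<mu> \<in> BP" "A' \<in> BP" "B' \<in> BP"
  shows "frdiff (\<lambda>\<mu> \<theta>. m \<mu> \<theta> * \<phi> \<mu> \<theta>) \<mu> (\<lambda>\<theta>. A \<theta> * \<phi> \<mu> \<theta> + m \<mu> \<theta> * A' \<theta>) (\<lambda>\<theta>. B \<theta> * \<phi> \<mu> \<theta> + m \<mu> \<theta> * B' \<theta>)"
proof -
  let ?lm = "\<lambda>h \<theta>. fst h * A \<theta> + snd h * B \<theta>" and ?lp = "\<lambda>h \<theta>. fst h * A' \<theta> + snd h * B' \<theta>"
  let ?dm = "\<lambda>h \<theta>. m (\<mu> + h) \<theta> - m \<mu> \<theta> - ?lm h \<theta>" and ?dp = "\<lambda>h \<theta>. \<phi> (\<mu> + h) \<theta> - \<phi> \<mu> \<theta> - ?lp h \<theta>"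
  have 1: "bigf (at 0) norm ?lm" "bigf (at 0) norm ?lp"
    by (intro bigf_linear assms)+
  have 2: "smallf (at 0) norm ?dm" "smallf (at 0) norm ?dp"
    using m(1) p(1) by (simp_all add: frdiff_def)
  have 3: "bigf (at 0) (\<lambda>_. 1) (\<lambda>h \<theta>. m \<mu> \<theta> + ?lm h \<theta>)"
    by (intro bigf_add bigf_const m bigf_mono[OF 1(1) norm_bigo_1])
  have 4: "bigf (at 0) (\<lambda>_. 1) (\<lambda>h \<theta>. \<phi> \<mu> \<theta> + ?lp h \<theta> + ?dp h \<theta>)"
    by (intro bigf_add bigf_const p bigf_mono[OF 1(2) norm_bigo_1] bigf_mono[OF smallf_imp_bigf[OF 2(2)] norm_bigo_1])
  \<comment> \<open>Each factor is written as value + linear part + remainder; what is left of the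
    product after its value and first-order terms groups into these three products.\<close>
  have "smallf (at 0) norm (\<lambda>h \<theta>. ?lm h \<theta> * ?lp h \<theta> + (m \<mu> \<theta> + ?lm h \<theta>) * ?dp h \<theta>
      + (\<phi> \<mu> \<theta> + ?lp h \<theta> + ?dp h \<theta>) * ?dm h \<theta>)"
    using smallf_mult[OF 3 2(2)] smallf_mult[OF 4 2(1)] bigf_imp_smallf[OF bigf_mult[OF 1] norm_sq_smallo]
    by (intro smallf_add) simp_all
  then show ?thesis
    unfolding frdiff_def by (simp add: algebra_simps)
qed

lemma frdiff_act_factor:
  assumes "g \<in> GG"
  defines "a \<equiv> \<lambda>\<theta>. - 2 * complex_of_real (iwaH_rot (matrix_inv (fst g)) (fst \<theta>))"
    and "b \<equiv> \<lambda>\<theta>. - 2 * complex_of_real (iwaH_rot (matrix_inv (snd g)) (snd \<theta>))"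
  shows "frdiff (\<lambda>\<mu>. act_factor \<mu> g) \<mu> (\<lambda>\<theta>. a \<theta> * act_factor \<mu> g \<theta>) (\<lambda>\<theta>. b \<theta> * act_factor \<mu> g \<theta>)"
proof -
  have [intro]: "a \<in> BP" "b \<in> BP"
    unfolding a_def b_def by (intro BP_cmult BP_iwaH_rot GG_SL2 assms(1))+
  let ?X = "\<lambda>h \<theta>. fst h * a \<theta> + snd h * b \<theta>"
  have "bigf (at 0) norm ?X" by (intro bigf_linear) auto
  from bigf_imp_smallf[OF bigf_exp(3)[OF this norm_bigo_1] norm_sq_smallo]
  have "smallf (at 0) norm (\<lambda>h \<theta>. exp (?X h \<theta>) - 1 - ?X h \<theta>)" .
  from smallf_mult[OF bigf_const[OF BP_act_factor[OF assms(1)], of _ \<mu>] this]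
  have *: "smallf (at 0) norm (\<lambda>h \<theta>. act_factor \<mu> g \<theta> * (exp (?X h \<theta>) - 1 - ?X h \<theta>))" by simp
  have "act_factor (\<mu> + h) g \<theta> = act_factor \<mu> g \<theta> * exp (?X h \<theta>)" for h \<theta>
    by (simp add: act_factor_def a_def b_def algebra_simps flip: exp_add)
  then show ?thesis
    unfolding frdiff_def using * by (simp add: algebra_simps)
qed

lemma frdiff_act_pull:
  assumes "g \<in> GG" "frdiff \<phi> \<mu> A B"
  shows "frdiff (\<lambda>\<mu>. act_pull g (\<phi> \<mu>)) \<mu> (act_pull g A) (act_pull g B)"
  using smallf_act_pull[OF assms(1) assms(2)[unfolded frdiff_def]]
  unfolding frdiff_def by (simp add: act_pull_def pull_def[abs_def])

lemma eventually_at_0_open: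
  assumes "open U" "(\<mu>::'a::real_normed_vector) \<in> U"
  shows "\<forall>\<^sub>F h in at 0. \<mu> + h \<in> U"
proof -
  have "((\<lambda>h. \<mu> + h) \<longlongrightarrow> \<mu> + 0) (at 0)" by (intro tendsto_intros)
  then show ?thesis using assms by (auto dest: topological_tendstoD)
qed

text \<open>Openness of \<open>U\<close> puts the differences eventually into \<open>BP\<close>;
  then the vanishing seminorm quotients of \<open>hol_H_on\<close> say exactly that the family is
  o(norm).\<close>

lemma hol_H_on_iff:
  assumes "open U"
  shows "hol_H_on \<sigma> \<phi> U \<longleftrightarrow> (\<forall>\<mu>\<in>U. \<phi> \<mu> \<in> H_inf \<sigma>) \<and>
    (\<forall>\<mu>\<in>U. \<exists>A\<in>H_inf \<sigma>. \<exists>B\<in>H_inf \<sigma>.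
      frdiff (\<lambda>\<mu> \<theta>. \<phi> \<mu> (rot2 \<theta>)) \<mu> (\<lambda>\<theta>. A (rot2 \<theta>)) (\<lambda>\<theta>. B (rot2 \<theta>)))"
proof -
  have "(\<forall>i j. ((\<lambda>h. smooth_norm i j (\<lambda>k. \<phi> (\<mu> + h) k - \<phi> \<mu> k - (fst h * A k + snd h * B k)) / norm h)
           \<longlongrightarrow> 0) (at 0)) \<longleftrightarrow> frdiff (\<lambda>\<mu> \<theta>. \<phi> \<mu> (rot2 \<theta>)) \<mu> (\<lambda>\<theta>. A (rot2 \<theta>)) (\<lambda>\<theta>. B (rot2 \<theta>))"
    if U: "\<forall>\<mu>\<in>U. \<phi> \<mu> \<in> H_inf \<sigma>" and \<mu>: "\<mu> \<in> U" and AB: "A \<in> H_inf \<sigma>" "B \<in> H_inf \<sigma>" for \<mu> A B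
  proof -
    have "\<forall>\<^sub>F h in at 0. (\<lambda>\<theta>. \<phi> (\<mu> + h) (rot2 \<theta>) - \<phi> \<mu> (rot2 \<theta>) - (fst h * A (rot2 \<theta>) + snd h * B (rot2 \<theta>))) \<in> BP"
      using eventually_at_0_open[OF assms \<mu>]
      by eventually_elim (intro BP_diff BP_add BP_cmult H_inf_BP[OF AB(1)] H_inf_BP[OF AB(2)] H_inf_BP[OF U[rule_format]] \<mu>)
    note S = smallf_supn[OF this, of norm]
    have "f \<in> o[at 0](norm) \<longleftrightarrow> ((\<lambda>h. f h / norm h) \<longlongrightarrow> 0) (at 0)" for f :: "c2 \<Rightarrow> real"
    proof
      assume "((\<lambda>h. f h / norm h) \<longlongrightarrow> 0) (at 0)"
      then show "f \<in> o[at 0](norm)" by (rule smalloI_tendsto) (simp add: eventually_at_filter)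
    qed (rule smalloD_tendsto)
    then show ?thesis
      unfolding frdiff_def S by (simp add: smooth_norm_def supn_def)
  qed
  then show ?thesis unfolding hol_H_on_def by blast
qed

text \<open>Differentiating \<open>act_factor\<close> in the parameter multiplies by the logarithm
  of an A-component. Right multiplication by M does not change that component, so the derivative
  stays in the same representation space.\<close>

lemma H_inf_logA_mult:
  assumes f: "f \<in> H_inf \<sigma>" and g: "g \<in> GG"
  shows "(\<lambda>k. of_real (fst (logA (ginv g \<odot> k))) * f k) \<in> H_inf \<sigma>"
    and "(\<lambda>k. of_real (snd (logA (ginv g \<odot> k))) * f k) \<in> H_inf \<sigma>"
proof -
  have eq: "logA (ginv g \<odot> (k \<odot> m)) = logA (ginv g \<odot> k)" if k: "k \<in> KK" and m: "m \<in> MM" for k m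
  proof -
    have "ginv g \<odot> k \<in> GG" by (rule GG_mult[OF GG_ginv[OF g] KK_GG[OF k]])
    then show ?thesis
      unfolding gmul_assoc[symmetric] using m
      by (auto simp: logA_def gmul_def GG_def MM_def iwa_mult_M iwa_neg mat2_mult_minus)
  qed
  have l: "fst (logA (ginv g \<odot> rot2 \<theta>)) = iwaH_rot (matrix_inv (fst g)) (fst \<theta>)"
    "snd (logA (ginv g \<odot> rot2 \<theta>)) = iwaH_rot (matrix_inv (snd g)) (snd \<theta>)" for \<theta>
    using GG_SL2[OF g] by (simp_all add: logA_def gmul_def ginv_def rot2_def iwa_rot_left)
  show "(\<lambda>k. of_real (fst (logA (ginv g \<odot> k))) * f k) \<in> H_inf \<sigma>"
    by (rule H_infI) (auto simp: H_inf_outside[OF f] H_inf_equivariant[OF f] eq l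
        intro!: BP_mult BP_iwaH_rot GG_SL2 g H_inf_BP[OF f])
  show "(\<lambda>k. of_real (snd (logA (ginv g \<odot> k))) * f k) \<in> H_inf \<sigma>"
    by (rule H_infI) (auto simp: H_inf_outside[OF f] H_inf_equivariant[OF f] eq l
        intro!: BP_mult BP_iwaH_rot GG_SL2 g H_inf_BP[OF f])
qed

lemma hol_H_on_ps_act:
  assumes U: "open U" and h: "hol_H_on \<sigma> \<phi> U" and g: "g \<in> GG"
  shows "hol_H_on \<sigma> (\<lambda>\<mu>. ps_act \<mu> g (\<phi> \<mu>)) U"
  unfolding hol_H_on_iff[OF U]
proof (intro conjI ballI)
  fix \<mu> assume \<mu>: "\<mu> \<in> U"
  have p: "\<phi> \<mu> \<in> H_inf \<sigma>" using h \<mu> unfolding hol_H_on_iff[OF U] by blast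
  then show "ps_act \<mu> g (\<phi> \<mu>) \<in> H_inf \<sigma>" using g by (rule H_inf_ps_act)
  obtain A B where AB: "A \<in> H_inf \<sigma>" "B \<in> H_inf \<sigma>"
    "frdiff (\<lambda>\<mu> \<theta>. \<phi> \<mu> (rot2 \<theta>)) \<mu> (\<lambda>\<theta>. A (rot2 \<theta>)) (\<lambda>\<theta>. B (rot2 \<theta>))"
    using h \<mu> unfolding hol_H_on_iff[OF U] by blast
  let ?A = "\<lambda>k. - 2 * (of_real (fst (logA (ginv g \<odot> k))) * ps_act \<mu> g (\<phi> \<mu>) k) + 1 * ps_act \<mu> g A k"
  let ?B = "\<lambda>k. - 2 * (of_real (snd (logA (ginv g \<odot> k))) * ps_act \<mu> g (\<phi> \<mu>) k) + 1 * ps_act \<mu> g B k"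
  have 1: "?A \<in> H_inf \<sigma>" "?B \<in> H_inf \<sigma>"
    by (intro H_inf_lincomb H_inf_logA_mult H_inf_ps_act p AB g)+
  have l: "fst (logA (ginv g \<odot> rot2 \<theta>)) = iwaH_rot (matrix_inv (fst g)) (fst \<theta>)"
    "snd (logA (ginv g \<odot> rot2 \<theta>)) = iwaH_rot (matrix_inv (snd g)) (snd \<theta>)" for \<theta>
    using GG_SL2[OF g] by (simp_all add: logA_def gmul_def ginv_def rot2_def iwa_rot_left)
  have "frdiff (\<lambda>\<mu> \<theta>. ps_act \<mu> g (\<phi> \<mu>) (rot2 \<theta>)) \<mu> (\<lambda>\<theta>. ?A (rot2 \<theta>)) (\<lambda>\<theta>. ?B (rot2 \<theta>))"
    unfolding ps_act_rot2[OF g] l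
    using frdiff_mult[OF frdiff_act_factor[OF g] BP_act_factor[OF g]
        BP_mult[OF BP_cmult[OF BP_iwaH_rot(1)[OF GG_SL2(1)[OF g]]] BP_act_factor[OF g]]
        BP_mult[OF BP_cmult[OF BP_iwaH_rot(2)[OF GG_SL2(2)[OF g]]] BP_act_factor[OF g]]
        frdiff_act_pull[OF g AB(3)]
        BP_act_pull[OF g H_inf_BP[OF p]] BP_act_pull[OF g H_inf_BP[OF AB(1)]] BP_act_pull[OF g H_inf_BP[OF AB(2)]]]
    by (simp add: algebra_simps)
  then show "\<exists>A\<in>H_inf \<sigma>. \<exists>B\<in>H_inf \<sigma>.
      frdiff (\<lambda>\<mu> \<theta>. ps_act \<mu> g (\<phi> \<mu>) (rot2 \<theta>)) \<mu> (\<lambda>\<theta>. A (rot2 \<theta>)) (\<lambda>\<theta>. B (rot2 \<theta>))"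
    using 1 by (intro bexI[of _ ?A] bexI[of _ ?B])
qed

lemma germ_H_ps_act: "\<phi> \<in> germ_H \<sigma> \<nu> \<Longrightarrow> g \<in> GG \<Longrightarrow> (\<lambda>\<mu>. ps_act \<mu> g (\<phi> \<mu>)) \<in> germ_H \<sigma> \<nu>"
  unfolding germ_H_def using hol_H_on_ps_act by blast

lemma hol_H_on_subset: "hol_H_on \<sigma> \<phi> U \<Longrightarrow> V \<subseteq> U \<Longrightarrow> hol_H_on \<sigma> \<phi> V"
  unfolding hol_H_on_def by blast

lemma germ_H_lincomb:
  assumes "\<phi> \<in> germ_H \<sigma> \<nu>" "\<psi> \<in> germ_H \<sigma> \<nu>"
  shows "(\<lambda>\<mu> k. \<phi> \<mu> k + c * \<psi> \<mu> k) \<in> germ_H \<sigma> \<nu>"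
proof -
  obtain U V where U: "open U" "\<nu> \<in> U" "hol_H_on \<sigma> \<phi> U" and V: "open V" "\<nu> \<in> V" "hol_H_on \<sigma> \<psi> V"
    using assms by (auto simp: germ_H_def)
  have UV: "open (U \<inter> V)" using U V by auto
  have "hol_H_on \<sigma> \<phi> (U \<inter> V)" "hol_H_on \<sigma> \<psi> (U \<inter> V)"
    using U V by (auto intro: hol_H_on_subset)
  then have "hol_H_on \<sigma> (\<lambda>\<mu> k. \<phi> \<mu> k + c * \<psi> \<mu> k) (U \<inter> V)"
    unfolding hol_H_on_iff[OF UV]
  proof (intro conjI ballI, goal_cases)
    case (1 \<mu>)
    then show ?case using H_inf_lincomb[of "\<phi> \<mu>" \<sigma> "\<psi> \<mu>" 1 c] by simp
  next
    case (2 \<mu>)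
    then obtain A B A' B' where *: "A \<in> H_inf \<sigma>" "B \<in> H_inf \<sigma>" "A' \<in> H_inf \<sigma>" "B' \<in> H_inf \<sigma>"
      "frdiff (\<lambda>\<mu> \<theta>. \<phi> \<mu> (rot2 \<theta>)) \<mu> (\<lambda>\<theta>. A (rot2 \<theta>)) (\<lambda>\<theta>. B (rot2 \<theta>))"
      "frdiff (\<lambda>\<mu> \<theta>. \<psi> \<mu> (rot2 \<theta>)) \<mu> (\<lambda>\<theta>. A' (rot2 \<theta>)) (\<lambda>\<theta>. B' (rot2 \<theta>))"
      by blast
    have "smallf (at 0) norm (\<lambda>h \<theta>. c * (\<psi> (\<mu> + h) (rot2 \<theta>) - \<psi> \<mu> (rot2 \<theta>) - (fst h * A' (rot2 \<theta>) + snd h * B' (rot2 \<theta>))))"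
      using smallf_mult[OF bigf_const[OF BP_const[of c]] *(6)[unfolded frdiff_def]] by simp
    from smallf_add[OF *(5)[unfolded frdiff_def] this]
    have "frdiff (\<lambda>\<mu> \<theta>. \<phi> \<mu> (rot2 \<theta>) + c * \<psi> \<mu> (rot2 \<theta>)) \<mu>
        (\<lambda>\<theta>. 1 * A (rot2 \<theta>) + c * A' (rot2 \<theta>)) (\<lambda>\<theta>. 1 * B (rot2 \<theta>) + c * B' (rot2 \<theta>))"
      unfolding frdiff_def by (simp add: algebra_simps)
    moreover have "(\<lambda>k. 1 * A k + c * A' k) \<in> H_inf \<sigma>" "(\<lambda>k. 1 * B k + c * B' k) \<in> H_inf \<sigma>"
      by (intro H_inf_lincomb *)+
    ultimately show ?case
      by (intro bexI[of _ "\<lambda>k. 1 * A k + c * A' k"] bexI[of _ "\<lambda>k. 1 * B k + c * B' k"])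
  qed
  then show ?thesis using U V UV by (auto simp: germ_H_def)
qed

section \<open>K-types as characters of the torus, and their germs\<close>

lemma delta2_rot2: "delta2 n (rot2 \<theta>) = exp (\<i> * (of_int (fst n) * of_real (fst \<theta>) + of_int (snd n) * of_real (snd \<theta>)))"
  by (simp add: delta2_def rot2_def delta_rot algebra_simps flip: exp_add)

lemma delta2_mult: "k \<in> KK \<Longrightarrow> k' \<in> KK \<Longrightarrow> delta2 n (k \<odot> k') = delta2 n k * delta2 n k'"
  by (auto dest!: KK_obtain simp: rot2_mult delta2_rot2 algebra_simps simp flip: exp_add)

lemma delta2_nz: "k \<in> KK \<Longrightarrow> delta2 n k \<noteq> 0"
  by (auto dest!: KK_obtain simp: delta2_rot2)

lemma delta2_M_hat: "delta2 n \<in> M_hat"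
  by (auto simp: M_hat_def delta2_nz MM_KK delta2_mult)

text \<open>The function in the chart that spans the type n. It is the inverse of the character
  \<open>delta2 n\<close> because K acts by left translation.\<close>

definition chr :: "int \<times> int \<Rightarrow> real \<times> real \<Rightarrow> complex" where
  "chr n \<theta> = exp (- \<i> * (of_int (fst n) * of_real (fst \<theta>) + of_int (snd n) * of_real (snd \<theta>)))"

lemma inverse_delta2_rot2: "inverse (delta2 n (rot2 \<theta>)) = chr n \<theta>"
  by (simp add: delta2_rot2 chr_def exp_minus)

lemma BP_chr: "chr n \<in> BP"
proof -
  have "bounded_linear (\<lambda>\<theta>. - \<i> * (of_int (fst n) * complex_of_real (fst \<theta>) + of_int (snd n) * complex_of_real (snd \<theta>)))"
    by (intro bounded_linear_compose[OF bounded_linear_mult_right] bounded_linear_add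
        bounded_linear_compose[OF bounded_linear_of_real] bounded_linear_fst bounded_linear_snd)
  then have "C_inf (chr n)" unfolding chr_def[abs_def] by (intro C_inf_exp C_inf_linear)
  moreover have "exp (- \<i> * (of_int p * of_real (x + 2 * pi) + z)) = exp (- \<i> * (of_int p * of_real x + z))" for p x z
  proof -
    have "- \<i> * (of_int p * of_real (x + 2 * pi) + z) = - \<i> * (of_int p * of_real x + z) + of_int (- p) * (2 * of_real pi * \<i>)"
      by (simp add: algebra_simps)
    moreover have "exp (of_int (- p) * (2 * of_real pi * \<i>)) = (1::complex)"
      unfolding exp_eq_1 by (auto intro: exI[of _ "- p"])
    ultimately show ?thesis by (simp only: exp_add mult_1_right)
  qed
  from this[of "fst n" _ "of_int (snd n) * of_real _"] this[of "snd n" _ "of_int (fst n) * of_real _"]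
  have "chr n (x + 2 * pi, y) = chr n (x, y)" "chr n (x, y + 2 * pi) = chr n (x, y)" for x y
    by (simp_all only: chr_def fst_conv snd_conv) (simp add: add.commute)
  ultimately show ?thesis by (simp add: BP_def)
qed

lemma frobenius_rot2: "frobenius n v t \<mu> (rot2 \<theta>) = t \<mu> * v * chr n \<theta>"
  by (simp add: frobenius_def rot2_KK inverse_delta2_rot2)

lemma frobenius_H_inf:
  assumes "c \<in> Hom_M n \<sigma>" "t \<mu> = c"
  shows "frobenius n v t \<mu> \<in> H_inf \<sigma>"
proof (rule H_infI)
  show "x \<notin> KK \<Longrightarrow> frobenius n v t \<mu> x = 0" for x by (simp add: frobenius_def)
  show "(\<lambda>\<theta>. frobenius n v t \<mu> (rot2 \<theta>)) \<in> BP"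
    unfolding frobenius_rot2 by (intro BP_cmult BP_chr)
  fix k m assume k: "k \<in> KK" and m: "m \<in> MM"
  have "c * delta2 n m = \<sigma> m * c" using assms(1) m unfolding Hom_M_def by blast
  then have "c * inverse (delta2 n m) = inverse (\<sigma> m) * c"
    using delta2_nz[OF MM_KK[OF m], of n] by (cases "c = 0") auto
  then show "frobenius n v t \<mu> (k \<odot> m) = inverse (\<sigma> m) * frobenius n v t \<mu> k"
    using k m by (auto simp: frobenius_def assms KK_mult MM_KK delta2_mult)
qed

lemma hol2_onD: "hol2_on f U \<Longrightarrow> z \<in> U \<Longrightarrow> \<exists>a b. (f has_derivative (\<lambda>h. a * fst h + b * snd h)) (at z)"
  by (simp add: hol2_on_def)

lemma frobenius_germ_H:
  assumes "t \<in> germ_Hom n \<sigma> \<nu>"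
  shows "frobenius n v t \<in> germ_H \<sigma> \<nu>"
proof -
  obtain U where U: "open U" "\<nu> \<in> U" "hol2_on t U" "\<And>\<mu>. \<mu> \<in> U \<Longrightarrow> t \<mu> \<in> Hom_M n \<sigma>"
    using assms by (auto simp: germ_Hom_def)
  have "hol_H_on \<sigma> (frobenius n v t) U"
    unfolding hol_H_on_iff[OF U(1)]
  proof (intro conjI ballI)
    fix \<mu> assume \<mu>: "\<mu> \<in> U"
    show "frobenius n v t \<mu> \<in> H_inf \<sigma>" using U(4)[OF \<mu>] by (rule frobenius_H_inf) simp
    obtain a b where ab: "(t has_derivative (\<lambda>h. a * fst h + b * snd h)) (at \<mu>)"
      using hol2_onD[OF U(3) \<mu>] by blast
    \<comment> \<open>\<open>Hom_M n \<sigma>\<close> is a subspace of the line: one nonzero value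
      of t makes it everything; otherwise t vanishes near \<mu> and both derivatives are 0.\<close>
    have "a \<in> Hom_M n \<sigma> \<and> b \<in> Hom_M n \<sigma>"
    proof (cases "\<exists>\<mu>'\<in>U. t \<mu>' \<noteq> 0")
      case True
      then show ?thesis using U(4) by (auto simp: Hom_M_def)
    next
      case False
      then have "(t has_derivative (\<lambda>h. 0)) (at \<mu>)"
        by (intro has_derivative_transform_within_open[OF has_derivative_const[of 0] U(1) \<mu>]) auto
      from fun_cong[OF has_derivative_unique[OF ab this]] have "a = 0" "b = 0"
        by (metis fst_conv snd_conv mult_zero_right add_0 add_0_right mult.right_neutral)+
      then show ?thesis by (simp add: Hom_M_def)
    qed
    then have 1: "frobenius n v (\<lambda>_. a) \<mu> \<in> H_inf \<sigma>" "frobenius n v (\<lambda>_. b) \<mu> \<in> H_inf \<sigma>"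
      by (auto intro: frobenius_H_inf)
    let ?c = "\<lambda>h. t (\<mu> + h) - t \<mu> - (a * fst h + b * snd h)"
    have "((\<lambda>h. norm (?c h) / norm h) \<longlongrightarrow> 0) (at 0)"
      using ab by (simp add: has_derivative_at)
    then have "(\<lambda>h. norm (?c h)) \<in> o[at 0](norm)"
      by (rule smalloI_tendsto) (simp add: eventually_at_filter)
    from bigf_imp_smallf[OF bigf_cmult[OF BP_cmult[OF BP_chr]] this, of v n]
    have "frdiff (\<lambda>\<mu> \<theta>. frobenius n v t \<mu> (rot2 \<theta>)) \<mu> (\<lambda>\<theta>. frobenius n v (\<lambda>_. a) \<mu> (rot2 \<theta>))
       (\<lambda>\<theta>. frobenius n v (\<lambda>_. b) \<mu> (rot2 \<theta>))"
      unfolding frdiff_def frobenius_rot2 by (simp add: algebra_simps)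
    with 1 show "\<exists>A\<in>H_inf \<sigma>. \<exists>B\<in>H_inf \<sigma>. frdiff (\<lambda>\<mu> \<theta>. frobenius n v t \<mu> (rot2 \<theta>)) \<mu>
        (\<lambda>\<theta>. A (rot2 \<theta>)) (\<lambda>\<theta>. B (rot2 \<theta>))"
      by (intro bexI[of _ "frobenius n v (\<lambda>_. a) \<mu>"] bexI[of _ "frobenius n v (\<lambda>_. b) \<mu>"])
  qed
  then show ?thesis using U by (auto simp: germ_H_def)
qed

section \<open>Holomorphic functions of two variables\<close>

text \<open>A form of holomorphy to which one-variable theory (\<open>deriv\<close>, Cauchy's
  formula) applies directly; \<open>hol2_on_imp_sep_hol\<close> and
  \<open>sep_hol_imp_hol2_on\<close> identify it with total differentiability on products.\<close>

definition sep_hol :: "(complex \<Rightarrow> complex \<Rightarrow> complex) \<Rightarrow> complex set \<Rightarrow> complex set \<Rightarrow> bool" where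
  "sep_hol f A B \<longleftrightarrow> open A \<and> open B \<and> continuous_on (A \<times> B) (\<lambda>(z, w). f z w) \<and>
     (\<forall>z\<in>A. f z holomorphic_on B) \<and> (\<forall>w\<in>B. (\<lambda>z. f z w) holomorphic_on A)"

lemma sep_hol_swap: "sep_hol f A B \<Longrightarrow> sep_hol (\<lambda>z w. f w z) B A"
proof -
  assume f: "sep_hol f A B"
  have "continuous_on (B \<times> A) (\<lambda>x. case prod.swap x of (z, w) \<Rightarrow> f z w)"
    by (rule continuous_on_compose2[of "A \<times> B"]) (use f in \<open>auto simp: sep_hol_def intro: continuous_on_swap\<close>)
  then show ?thesis using f by (simp add: sep_hol_def split_beta)
qed

text \<open>The kernel of Cauchy's formula for the derivative, with the circle parametrised by \<open>[0, 1]\<close>.\<close>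

definition ckernel :: "complex \<Rightarrow> real \<Rightarrow> complex \<Rightarrow> real \<Rightarrow> complex" where
  "ckernel c r w t = of_real r * exp (2 * of_real pi * \<i> * of_real t) / (circlepath c r t - w)\<^sup>2"

lemma deriv_eq_integral:
  assumes g: "g holomorphic_on B" "open B" and r: "cball c r \<subseteq> B" and w: "w \<in> ball c r"
  shows "deriv g w = integral (cbox 0 1) (\<lambda>t. g (circlepath c r t) * ckernel c r w t)"
proof -
  have 1: "continuous_on (cball c r) g" "g holomorphic_on ball c r"
    using g r holomorphic_on_imp_continuous_on continuous_on_subset holomorphic_on_subset ball_subset_cball
    by (metis, metis order_trans)
  have "deriv g w = 1 / (2 * of_real pi * \<i>) * contour_integral (circlepath c r) (\<lambda>u. g u / (u-w)^2)"
    using Cauchy_derivative_integral_circlepath(2)[OF 1 w] by (rule DERIV_imp_deriv)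
  also have "contour_integral (circlepath c r) (\<lambda>u. g u / (u-w)^2) =
      integral {0..1} (\<lambda>t. 2 * of_real pi * \<i> * (g (circlepath c r t) * ckernel c r w t))"
    unfolding contour_integral_integral vector_derivative_circlepath ckernel_def
    by (simp add: algebra_simps)
  also have "\<dots> = 2 * of_real pi * \<i> * integral {0..1} (\<lambda>t. g (circlepath c r t) * ckernel c r w t)"
    by (rule integral_mult_right)
  finally show ?thesis by simp
qed

lemma continuous_on_compose_pair:
  assumes "continuous_on T (\<lambda>(z, w). f z w)" "continuous_on S u" "continuous_on S v"
    "\<And>x. x \<in> S \<Longrightarrow> (u x, v x) \<in> T"
  shows "continuous_on S (\<lambda>x. f (u x) (v x))"
  using continuous_on_compose2[OF assms(1) continuous_on_Pair[OF assms(2,3)]] assms(4) by auto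

lemma continuous_on_circlepath: "continuous_on S u \<Longrightarrow> continuous_on S (\<lambda>x. circlepath c r (u x))"
  unfolding circlepath by (intro continuous_intros)

lemma circlepath_mem: "r > 0 \<Longrightarrow> circlepath c r t \<in> sphere c r"
  by (simp add: circlepath dist_norm norm_mult)

lemma circlepath_ne: "r > 0 \<Longrightarrow> w \<in> ball c r \<Longrightarrow> circlepath c r t - w \<noteq> 0"
  using circlepath_mem[of r c t] by auto

lemma continuous_on_ckernel: "r > 0 \<Longrightarrow> continuous_on (ball c r \<times> S) (\<lambda>(w, t). ckernel c r w t)"
  unfolding ckernel_def circlepath split_beta
  using circlepath_ne[of r _ c] by (intro continuous_intros) (auto simp: circlepath)

text \<open>Cauchy's formula writes the derivative as an integral over a fixed circle in the second
  variable, with an integrand jointly continuous in both variables and the circle parameter.\<close>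

lemma sep_hol_continuous_deriv2:
  assumes f: "sep_hol f A B"
  shows "continuous_on (A \<times> B) (\<lambda>(z, w). deriv (f z) w)"
proof -
  have o: "open A" "open B" and c: "continuous_on (A \<times> B) (\<lambda>(z, w). f z w)"
    and h: "\<And>z. z \<in> A \<Longrightarrow> f z holomorphic_on B"
    using f by (auto simp: sep_hol_def)
  have "isCont (\<lambda>(z, w). deriv (f z) w) (z, w)" if zw: "z \<in> A" "w \<in> B" for z w
  proof -
    obtain r where r: "r > 0" "cball w r \<subseteq> B" using o(2) zw(2) open_contains_cball by blast
    have s: "circlepath w r t \<in> B" for t using circlepath_mem[OF r(1), of w t] r(2) by auto
    let ?U = "A \<times> ball w r"
    have "continuous_on (?U \<times> cbox 0 1) (\<lambda>((x, y), t). f x (circlepath w r t) * ckernel w r y t)"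
      unfolding split_beta
    proof (intro continuous_on_mult)
      show "continuous_on (?U \<times> cbox 0 1) (\<lambda>x. f (fst (fst x)) (circlepath w r (snd x)))"
        by (rule continuous_on_compose_pair[OF c]) (auto intro!: continuous_intros continuous_on_circlepath s)
      show "continuous_on (?U \<times> cbox 0 1) (\<lambda>x. ckernel w r (snd (fst x)) (snd x))"
        by (rule continuous_on_compose_pair[OF continuous_on_ckernel[OF r(1), of w UNIV]]) (auto intro!: continuous_intros)
    qed
    then have "continuous_on ?U (\<lambda>p. integral (cbox 0 1) (\<lambda>t. f (fst p) (circlepath w r t) * ckernel w r (snd p) t))"
      by (intro integral_continuous_on_param) (simp add: split_beta)
    then have "continuous_on ?U (\<lambda>(z, w). deriv (f z) w)"
      by (rule continuous_on_eq) (use deriv_eq_integral[OF h o(2) r(2)] in auto)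
    then show ?thesis
      using zw r o(1) by (auto simp: continuous_on_eq_continuous_at open_Times)
  qed
  then show ?thesis by (intro continuous_at_imp_continuous_on) auto
qed

text \<open>The point is holomorphy in the first variable: the Cauchy integral is differentiated
  under the integral sign, and the derivative of the integrand is continuous by
  \<open>sep_hol_continuous_deriv2\<close> with the variables exchanged.\<close>

lemma sep_hol_deriv2:
  assumes f: "sep_hol f A B"
  shows "sep_hol (\<lambda>z w. deriv (f z) w) A B"
proof -
  have o: "open A" "open B" and c: "continuous_on (A \<times> B) (\<lambda>(z, w). f z w)"
    and h: "\<And>z. z \<in> A \<Longrightarrow> f z holomorphic_on B" and h': "\<And>w. w \<in> B \<Longrightarrow> (\<lambda>z. f z w) holomorphic_on A"
    using f by (auto simp: sep_hol_def)
  have c1: "continuous_on (B \<times> A) (\<lambda>(w, z). deriv (\<lambda>z. f z w) z)"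
    using sep_hol_continuous_deriv2[OF sep_hol_swap[OF f]] .
  have "(\<lambda>z. deriv (f z) w) field_differentiable at z" if zw: "z \<in> A" "w \<in> B" for z w
  proof -
    obtain r where r: "r > 0" "cball w r \<subseteq> B" using o(2) zw(2) open_contains_cball by blast
    obtain q where q: "q > 0" "ball z q \<subseteq> A" using o(1) zw(1) open_contains_ball by blast
    have s: "circlepath w r t \<in> B" for t using circlepath_mem[OF r(1), of w t] r(2) by auto
    have k: "continuous_on (ball z q \<times> cbox 0 1) (\<lambda>x. ckernel w r w (snd x))"
      by (rule continuous_on_compose_pair[OF continuous_on_ckernel[OF r(1), of w UNIV]])
        (use r(1) in \<open>auto intro!: continuous_intros\<close>)
    have "continuous_on (ball z q \<times> cbox 0 1) (\<lambda>(x, t). deriv (\<lambda>z. f z (circlepath w r t)) x * ckernel w r w t)"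
      unfolding split_beta
    proof (intro continuous_on_mult k)
      show "continuous_on (ball z q \<times> cbox 0 1) (\<lambda>x. deriv (\<lambda>z. f z (circlepath w r (snd x))) (fst x))"
        by (rule continuous_on_compose_pair[OF c1])
          (use q in \<open>auto intro!: continuous_intros continuous_on_circlepath s\<close>)
    qed
    moreover have "((\<lambda>x. f x (circlepath w r t) * ckernel w r w t) has_field_derivative
        deriv (\<lambda>z. f z (circlepath w r t)) x * ckernel w r w t) (at x within ball z q)" if "x \<in> ball z q" for x t
    proof -
      have "((\<lambda>x. f x (circlepath w r t)) has_field_derivative deriv (\<lambda>z. f z (circlepath w r t)) x) (at x within ball z q)"
        using holomorphic_derivI[OF h'[OF s] o(1)] q that has_field_derivative_at_within by blast
      then show ?thesis by (rule DERIV_cmult_right)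
    qed
    moreover have "(\<lambda>t. f x (circlepath w r t) * ckernel w r w t) integrable_on cbox 0 1" if "x \<in> ball z q" for x
    proof (intro integrable_continuous continuous_on_mult)
      show "continuous_on (cbox 0 1) (\<lambda>t. f x (circlepath w r t))"
        by (rule continuous_on_compose_pair[OF c])
          (use q that in \<open>auto intro!: continuous_intros continuous_on_circlepath s\<close>)
      show "continuous_on (cbox 0 1) (ckernel w r w)"
        by (rule continuous_on_compose_pair[OF continuous_on_ckernel[OF r(1), of w UNIV]])
          (use r(1) in \<open>auto intro!: continuous_intros\<close>)
    qed
    ultimately have L: "(\<lambda>x. integral (cbox 0 1) (\<lambda>t. f x (circlepath w r t) * ckernel w r w t)) holomorphic_on ball z q"
      unfolding holomorphic_on_def
      by (intro ballI leibniz_rule_field_differentiable[where fx = "\<lambda>x t. deriv (\<lambda>z. f z (circlepath w r t)) x * ckernel w r w t"]) auto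
    have eq: "deriv (f x) w = integral (cbox 0 1) (\<lambda>t. f x (circlepath w r t) * ckernel w r w t)"
      if "x \<in> ball z q" for x
    proof (rule deriv_eq_integral[OF h o(2) r(2)])
      show "x \<in> A" using that q(2) by blast
      show "w \<in> ball w r" using r(1) by simp
    qed
    have "(\<lambda>x. deriv (f x) w) holomorphic_on ball z q"
      by (rule holomorphic_transform[OF L]) (simp only: eq)
    then show ?thesis using q(1) by (intro holomorphic_on_imp_differentiable_at[of _ "ball z q"]) auto
  qed
  then have "\<forall>w\<in>B. (\<lambda>z. deriv (f z) w) holomorphic_on A"
    by (auto simp: holomorphic_on_def intro: field_differentiable_at_within)
  moreover have "\<forall>z\<in>A. deriv (f z) holomorphic_on B"
    using h o(2) holomorphic_deriv by blast
  ultimately show ?thesis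
    using sep_hol_continuous_deriv2[OF f] o by (simp add: sep_hol_def)
qed

lemma sep_hol_higher_deriv2: "sep_hol f A B \<Longrightarrow> sep_hol (\<lambda>z w. (deriv ^^ b) (f z) w) A B"
  by (induction b) (auto dest: sep_hol_deriv2)

text \<open>Both partial derivatives exist and the second is jointly continuous, which suffices for
  a total derivative.\<close>

lemma sep_hol_imp_hol2_on:
  assumes f: "sep_hol f A B"
  shows "hol2_on (\<lambda>(z, w). f z w) (A \<times> B)"
  unfolding hol2_on_def
proof (safe)
  fix z w assume zw: "z \<in> A" "w \<in> B"
  have o: "open A" "open B"
    and h: "\<And>z. z \<in> A \<Longrightarrow> f z holomorphic_on B" and h': "\<And>w. w \<in> B \<Longrightarrow> (\<lambda>z. f z w) holomorphic_on A"
    using f by (auto simp: sep_hol_def)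
  obtain r where r: "r > 0" "ball w r \<subseteq> B" using o(2) zw(2) open_contains_ball by blast
  have "continuous (at (z, w) within A \<times> ball w r) (\<lambda>(x, y). blinfun_mult_right (deriv (f x) y))"
  proof -
    have "continuous_on (A \<times> B) (\<lambda>x. blinfun_mult_right (case x of (x, y) \<Rightarrow> deriv (f x) y))"
      by (intro bounded_linear.continuous_on[OF bounded_linear_blinfun_mult_right] sep_hol_continuous_deriv2 f)
    then have "continuous_on (A \<times> ball w r) (\<lambda>x. blinfun_mult_right (case x of (x, y) \<Rightarrow> deriv (f x) y))"
      by (rule continuous_on_subset) (use r in auto)
    then have "continuous_on (A \<times> ball w r) (\<lambda>(x, y). blinfun_mult_right (deriv (f x) y))"
      by (simp add: split_beta)
    then show ?thesis using zw r by (simp add: continuous_on_eq_continuous_within)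
  qed
  moreover have "((\<lambda>x. f x w) has_derivative (*) (deriv (\<lambda>x. f x w) z)) (at z within A)"
    using holomorphic_derivI[OF h'[OF zw(2)] o(1) zw(1)]
    by (simp add: has_field_derivative_def has_derivative_at_withinI)
  moreover have "(f x has_derivative blinfun_apply (blinfun_mult_right (deriv (f x) y))) (at y within ball w r)"
    if "x \<in> A" "y \<in> ball w r" for x y
    using holomorphic_derivI[OF h[OF that(1)] o(2)] that r
    by (auto simp: has_field_derivative_def has_derivative_at_withinI)
  ultimately have "((\<lambda>(x, y). f x y) has_derivative
      (\<lambda>(tx, ty). deriv (\<lambda>x. f x w) z * tx + blinfun_apply (blinfun_mult_right (deriv (f z) w)) ty)) (at (z, w) within A \<times> ball w r)"
    using r by (intro has_derivative_partialsI[where fy = "\<lambda>x y. blinfun_mult_right (deriv (f x) y)"]) auto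
  moreover have "at (z, w) within A \<times> ball w r = at (z, w)"
    using zw r o by (intro at_within_open) (auto intro: open_Times)
  moreover have "(\<lambda>(tx, ty). deriv (\<lambda>x. f x w) z * tx + blinfun_apply (blinfun_mult_right (deriv (f z) w)) ty)
      = (\<lambda>h. deriv (\<lambda>x. f x w) z * fst h + deriv (f z) w * snd h)"
    by (auto simp: fun_eq_iff)
  ultimately have "((\<lambda>(z, w). f z w) has_derivative
      (\<lambda>h. deriv (\<lambda>x. f x w) z * fst h + deriv (f z) w * snd h)) (at (z, w))"
    by simp
  then show "\<exists>a b. ((\<lambda>(z, w). f z w) has_derivative (\<lambda>h. a * fst h + b * snd h)) (at (z, w))"
    by blast
qed

lemma hol2_on_continuous: "hol2_on f U \<Longrightarrow> continuous_on U f"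
  unfolding hol2_on_def
  by (meson continuous_at_imp_continuous_on has_derivative_continuous)

lemma hol2_on_imp_sep_hol:
  assumes f: "hol2_on f (A \<times> B)" and o: "open A" "open B"
  shows "sep_hol (\<lambda>z w. f (z, w)) A B"
proof -
  have "(\<lambda>z. f (z, w)) field_differentiable at z \<and> (\<lambda>w. f (z, w)) field_differentiable at w"
    if zw: "z \<in> A" "w \<in> B" for z w
  proof -
    obtain a b where ab: "(f has_derivative (\<lambda>h. a * fst h + b * snd h)) (at (z, w))"
      using hol2_onD[OF f, of "(z, w)"] zw by auto
    have "((\<lambda>z. (z, w)) has_derivative (\<lambda>h. (h, 0))) (at z)" "((\<lambda>w. (z, w)) has_derivative (\<lambda>h. (0, h))) (at w)"
      by (auto intro!: derivative_eq_intros)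
    from this(1)[THEN has_derivative_compose, OF ab] this(2)[THEN has_derivative_compose, OF ab]
    have "((\<lambda>z. f (z, w)) has_field_derivative a) (at z)" "((\<lambda>w. f (z, w)) has_field_derivative b) (at w)"
      by (simp_all add: has_field_derivative_def)
    then show ?thesis by (auto simp: field_differentiable_def)
  qed
  then show ?thesis
    using o hol2_on_continuous[OF f]
    by (auto simp: sep_hol_def split_beta holomorphic_on_def intro: field_differentiable_at_within)
qed

lemma hol2_on_UNIV: "hol2_on f UNIV \<longleftrightarrow> sep_hol (\<lambda>z w. f (z, w)) UNIV UNIV"
  using hol2_on_imp_sep_hol[of f UNIV UNIV] sep_hol_imp_hol2_on[of "\<lambda>z w. f (z, w)" UNIV UNIV] by auto

lemma hol2_on_subset: "hol2_on f U \<Longrightarrow> V \<subseteq> U \<Longrightarrow> hol2_on f V"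
  by (auto simp: hol2_on_def)

lemma hol2_on_swap: "hol2_on f UNIV \<Longrightarrow> hol2_on (\<lambda>p. f (snd p, fst p)) UNIV"
  unfolding hol2_on_UNIV using sep_hol_swap by fastforce

lemma hol2_on_const: "hol2_on (\<lambda>_. c) U"
  unfolding hol2_on_def by (auto intro!: exI[of _ 0])

lemma hol2_on_add: "hol2_on f U \<Longrightarrow> hol2_on g U \<Longrightarrow> hol2_on (\<lambda>p. f p + g p) U"
  unfolding hol2_on_def
proof
  fix z assume fg: "\<forall>z\<in>U. \<exists>a b. (f has_derivative (\<lambda>h. a * fst h + b * snd h)) (at z)"
    "\<forall>z\<in>U. \<exists>a b. (g has_derivative (\<lambda>h. a * fst h + b * snd h)) (at z)" and "z \<in> U"
  then obtain a b a' b' where "(f has_derivative (\<lambda>h. a * fst h + b * snd h)) (at z)"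
    "(g has_derivative (\<lambda>h. a' * fst h + b' * snd h)) (at z)" by blast
  from has_derivative_add[OF this]
  have "((\<lambda>p. f p + g p) has_derivative (\<lambda>h. (a + a') * fst h + (b + b') * snd h)) (at z)"
    by (simp add: algebra_simps)
  then show "\<exists>a b. ((\<lambda>p. f p + g p) has_derivative (\<lambda>h. a * fst h + b * snd h)) (at z)" by blast
qed

lemma hol2_on_mult: "hol2_on f U \<Longrightarrow> hol2_on g U \<Longrightarrow> hol2_on (\<lambda>p. f p * g p) U"
  unfolding hol2_on_def
proof
  fix z assume fg: "\<forall>z\<in>U. \<exists>a b. (f has_derivative (\<lambda>h. a * fst h + b * snd h)) (at z)"
    "\<forall>z\<in>U. \<exists>a b. (g has_derivative (\<lambda>h. a * fst h + b * snd h)) (at z)" and "z \<in> U"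
  then obtain a b a' b' where "(f has_derivative (\<lambda>h. a * fst h + b * snd h)) (at z)"
    "(g has_derivative (\<lambda>h. a' * fst h + b' * snd h)) (at z)" by blast
  from has_derivative_mult[OF this]
  have "((\<lambda>p. f p * g p) has_derivative (\<lambda>h. (f z * a' + a * g z) * fst h + (f z * b' + b * g z) * snd h)) (at z)"
    by (simp add: algebra_simps)
  then show "\<exists>a b. ((\<lambda>p. f p * g p) has_derivative (\<lambda>h. a * fst h + b * snd h)) (at z)" by blast
qed

lemma hol2_on_fst: "hol2_on fst U" and hol2_on_snd: "hol2_on snd U"
proof -
  have "(fst has_derivative (\<lambda>h. 1 * fst h + 0 * snd h)) (at z)"
    "(snd has_derivative (\<lambda>h. 0 * fst h + 1 * snd h)) (at z)" for z :: c2
    by (auto intro!: derivative_eq_intros)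
  then show "hol2_on fst U" "hol2_on snd U" unfolding hol2_on_def by blast+
qed

lemma hol2_on_diff: "hol2_on f U \<Longrightarrow> hol2_on g U \<Longrightarrow> hol2_on (\<lambda>p. f p - g p) U"
  using hol2_on_add[OF _ hol2_on_mult[OF hol2_on_const[of "-1"]], of f U g] by simp

lemma hol2_on_prod: "(\<And>i. i \<in> I \<Longrightarrow> hol2_on (f i) U) \<Longrightarrow> hol2_on (\<lambda>p. \<Prod>i\<in>I. f i p) U"
  by (induction I rule: infinite_finite_induct) (auto intro: hol2_on_const hol2_on_mult)

lemmas hol2_intros = hol2_on_const hol2_on_add hol2_on_mult hol2_on_fst hol2_on_snd hol2_on_diff hol2_on_prod

text \<open>Serves to cancel polynomial factors from an identity: at their finitely many zeros it
  persists by continuity.\<close>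

lemma continuous_eq_off_finite:
  fixes u v :: "complex \<Rightarrow> complex"
  assumes "continuous_on UNIV u" "continuous_on UNIV v" "finite K" "\<And>z. z \<notin> K \<Longrightarrow> u z = v z"
  shows "u z = v z"
proof -
  have "(u \<longlongrightarrow> u z) (at z)" "(v \<longlongrightarrow> v z) (at z)"
    using assms(1,2) by (auto simp: continuous_on_def)
  moreover have "\<forall>\<^sub>F x in at z. x \<notin> K - {z}"
    unfolding eventually_at_topological using assms(3) finite_imp_closed[of "K - {z}"]
    by (intro exI[of _ "- (K - {z})"] conjI open_Compl) auto
  then have "\<forall>\<^sub>F x in at z. u x = v x"
    using eventually_neq_at_within[of z z UNIV] by eventually_elim (use assms(4) in auto)
  then have "(u \<longlongrightarrow> u z) (at z) \<longleftrightarrow> (v \<longlongrightarrow> u z) (at z)" by (rule tendsto_cong)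
  ultimately show ?thesis using tendsto_unique[OF at_neq_bot, of v "u z" z "v z"] by simp
qed

lemma hol2_section_continuous:
  assumes "hol2_on f UNIV"
  shows "continuous_on UNIV (\<lambda>z. f (z, w))" "continuous_on UNIV (\<lambda>w. f (z, w))"
  by (rule continuous_on_compose2[OF hol2_on_continuous[OF assms]]; auto intro!: continuous_intros)+

text \<open>The quotient is the mean of the first partial derivative over the segment from a to z
  (Hadamard's lemma). This formula gives joint continuity across z = a. Holomorphy in z then follows
  by removing the singularity, and holomorphy in w from the quotient off z = a and from the
  derivative on it.\<close>

lemma hol2_divide:
  assumes f: "hol2_on f UNIV" and z: "\<And>w. f (a, w) = 0"
  shows "\<exists>g. hol2_on g UNIV \<and> (\<forall>z w. f (z, w) = (z - a) * g (z, w))"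
proof -
  define F where "F z w = f (z, w)" for z w
  have "F = (\<lambda>z w. f (z, w))" by (simp add: F_def fun_eq_iff)
  then have F: "sep_hol F UNIV UNIV" using f by (simp add: hol2_on_UNIV)
  have F1: "sep_hol (\<lambda>z w. deriv (\<lambda>z. F z w) z) UNIV UNIV"
    using sep_hol_swap[OF sep_hol_deriv2[OF sep_hol_swap[OF F]]] .
  define G where "G z w = integral (cbox 0 1) (\<lambda>t::real. deriv (\<lambda>z. F z w) (a + of_real t * (z - a)))" for z w
  have cont: "continuous_on UNIV (\<lambda>x. deriv (\<lambda>z. F z (snd x)) (fst x))"
    using F1 by (simp add: sep_hol_def split_beta)
  have eq: "F z w = (z - a) * G z w" for z w
  proof -
    have "((\<lambda>t. F (a + of_real t * (z - a)) w) has_vector_derivative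
        (z - a) * deriv (\<lambda>z. F z w) (a + of_real t * (z - a))) (at t within {0..1})" for t :: real
    proof -
      have 1: "((\<lambda>z. F z w) has_field_derivative deriv (\<lambda>z. F z w) (a + of_real t * (z - a))) (at (a + of_real t * (z - a)))"
        using F by (intro holomorphic_derivI[of _ UNIV]) (auto simp: sep_hol_def)
      have "((\<lambda>t. a + of_real t * (z - a)) has_vector_derivative (z - a)) (at t within {0..1})"
        by (auto intro!: derivative_eq_intros simp: has_vector_derivative_def scaleR_conv_of_real)
      from field_vector_diff_chain_within[OF this has_field_derivative_at_within[OF 1]]
      show ?thesis by (simp add: o_def)
    qed
    from fundamental_theorem_of_calculus[OF _ this]
    have "((\<lambda>t. (z - a) * deriv (\<lambda>z. F z w) (a + of_real t * (z - a))) has_integral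
        F (a + of_real 1 * (z - a)) w - F (a + of_real 0 * (z - a)) w) {0..1}" by simp
    then show ?thesis by (simp add: G_def F_def z integral_unique flip: integral_mult_right)
  qed
  have "sep_hol G UNIV UNIV"
    unfolding sep_hol_def
  proof (intro conjI ballI)
    have "continuous_on (UNIV \<times> cbox 0 1) (\<lambda>(p, t). deriv (\<lambda>z. F z (snd p)) (a + of_real t * (fst p - a)))"
      unfolding split_beta
      by (rule continuous_on_compose_pair[of UNIV "\<lambda>z w. deriv (\<lambda>z. F z w) z"])
        (use cont in \<open>auto simp: split_beta intro!: continuous_intros\<close>)
    from integral_continuous_on_param[OF this]
    show G: "continuous_on (UNIV \<times> UNIV) (\<lambda>(z, w). G z w)" by (simp add: G_def split_beta)
    show "(\<lambda>z. G z w) holomorphic_on UNIV" for w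
    proof (rule no_isolated_singularity[of UNIV _ "{a}"])
      show "continuous_on UNIV (\<lambda>z. G z w)"
        by (rule continuous_on_compose_pair[OF G]) (auto intro!: continuous_intros)
      have "(\<lambda>z. F z w / (z - a)) holomorphic_on UNIV - {a}"
        using F by (intro holomorphic_intros) (auto simp: sep_hol_def intro: holomorphic_on_subset)
      then show "(\<lambda>z. G z w) holomorphic_on UNIV - {a}"
        by (rule holomorphic_transform) (auto simp: eq)
    qed auto
    show "G z holomorphic_on UNIV" for z
    proof (cases "z = a")
      case True
      then have "G z = (\<lambda>w. deriv (\<lambda>z. F z w) a)" by (auto simp: G_def)
      then show ?thesis using F1 by (simp add: sep_hol_def)
    next
      case False
      then have "G z = (\<lambda>w. F z w / (z - a))" by (auto simp: eq)
      then show ?thesis using F False by (auto simp: sep_hol_def intro!: holomorphic_intros)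
    qed
  qed auto
  then have "hol2_on (\<lambda>(z, w). G z w) UNIV" by (simp add: hol2_on_UNIV)
  then show ?thesis using eq by (intro exI[of _ "\<lambda>(z, w). G z w"]) (auto simp: F_def)
qed

definition even2 :: "(c2 \<Rightarrow> complex) \<Rightarrow> bool" where
  "even2 h \<longleftrightarrow> hol2_on h UNIV \<and> (\<forall>z w. h (- z, w) = h (z, w) \<and> h (z, - w) = h (z, w))"

lemma hol2_on_comp_snd: "c holomorphic_on UNIV \<Longrightarrow> hol2_on (\<lambda>p. c (snd p)) UNIV"
  unfolding hol2_on_UNIV sep_hol_def split_beta
  using continuous_on_compose2[OF holomorphic_on_imp_continuous_on continuous_on_snd[OF continuous_on_id], of c UNIV UNIV]
  by simp

text \<open>The difference h(z, w) - h(a, w) vanishes at z = a and, h being even, at z = -a, so both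
  linear factors split off; the quotient inherits evenness because z^2 - a^2 is even.\<close>

lemma even2_divide:
  assumes h: "even2 h"
  shows "\<exists>g. even2 g \<and> (\<forall>z w. h (z, w) = h (a, w) + (z\<^sup>2 - a\<^sup>2) * g (z, w))"
proof -
  have hol: "hol2_on h UNIV" and ev: "\<And>z w. h (- z, w) = h (z, w)" "\<And>z w. h (z, - w) = h (z, w)"
    using h by (auto simp: even2_def)
  have "(\<lambda>w. h (a, w)) holomorphic_on UNIV" using hol by (simp add: hol2_on_UNIV sep_hol_def)
  then have "hol2_on (\<lambda>p. h (a, snd p)) UNIV" by (rule hol2_on_comp_snd)
  then have "hol2_on (\<lambda>p. h p - h (a, snd p)) UNIV" using hol by (intro hol2_intros)
  from hol2_divide[OF this, of a] obtain g1 where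
    g1: "hol2_on g1 UNIV" "\<And>z w. h (z, w) - h (a, w) = (z - a) * g1 (z, w)" by auto
  have "g1 (- a, w) = 0" for w
  proof (cases "a = 0")
    \<comment> \<open>For a = 0 the two zeros coincide; the second factor z comes from oddness of
      the first quotient.\<close>
    case True
    have "g1 (z, w) = - g1 (- z, w)" if "z \<notin> {0}" for z
    proof -
      have "z * (g1 (z, w) + g1 (- z, w)) = 0"
        using g1(2)[of z w] g1(2)[of "- z" w] ev(1)[of z w] True by (simp add: algebra_simps)
      then show ?thesis using that by (simp add: eq_neg_iff_add_eq_0)
    qed
    moreover have "continuous_on UNIV (\<lambda>z. - g1 (- z, w))"
      by (intro continuous_intros continuous_on_compose2[OF hol2_section_continuous(1)[OF g1(1)]]) auto
    ultimately have "g1 (0, w) = - g1 (- 0, w)"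
      using continuous_eq_off_finite[OF hol2_section_continuous(1)[OF g1(1)], of "\<lambda>z. - g1 (- z, w)" "{0}" w 0] by blast
    then show ?thesis using True by simp
  next
    case False
    have "- 2 * a * g1 (- a, w) = 0" using g1(2)[of "- a" w] ev(1)[of a w] by simp
    then show ?thesis using False by simp
  qed
  from hol2_divide[OF g1(1) this] obtain g where
    g: "hol2_on g UNIV" "\<And>z w. g1 (z, w) = (z + a) * g (z, w)" by auto
  have eq: "h (z, w) = h (a, w) + (z\<^sup>2 - a\<^sup>2) * g (z, w)" for z w
    using g1(2)[of z w] g(2)[of z w] by (simp add: algebra_simps power2_eq_square)
  have ne: "z\<^sup>2 - a\<^sup>2 \<noteq> 0" if "z \<notin> {a, - a}" for z
    using that by (simp add: power2_eq_iff)
  have "g (- z, w) = g (z, w)" for z w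
  proof (rule continuous_eq_off_finite[of "\<lambda>z. g (- z, w)" "\<lambda>z. g (z, w)" "{a, - a}"])
    show "continuous_on UNIV (\<lambda>z. g (- z, w))"
      by (intro continuous_intros continuous_on_compose2[OF hol2_section_continuous(1)[OF g(1)]]) auto
    show "g (- z, w) = g (z, w)" if "z \<notin> {a, - a}" for z
      using eq[of z w] eq[of "- z" w] ev(1)[of z w] ne[OF that] by simp
  qed (simp_all add: hol2_section_continuous[OF g(1)])
  moreover have "g (z, - w) = g (z, w)" for z w
  proof (rule continuous_eq_off_finite[of "\<lambda>z. g (z, - w)" "\<lambda>z. g (z, w)" "{a, - a}"])
    show "g (z, - w) = g (z, w)" if "z \<notin> {a, - a}" for z
      using eq[of z w] eq[of z "- w"] ev(2)[of z w] ev(2)[of a w] ne[OF that] by simp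
  qed (simp_all add: hol2_section_continuous[OF g(1)])
  ultimately have "even2 g" using g(1) by (simp add: even2_def)
  then show ?thesis using eq by blast
qed

section \<open>Jets\<close>

definition hol_at :: "(c2 \<Rightarrow> complex) \<Rightarrow> c2 \<Rightarrow> bool" where
  "hol_at f \<nu> \<longleftrightarrow> (\<exists>U. open U \<and> \<nu> \<in> U \<and> hol2_on f U)"

lemma hol_at_UNIV: "hol2_on f UNIV \<Longrightarrow> hol_at f \<nu>"
  unfolding hol_at_def by (intro exI[of _ UNIV]) simp

lemma hol_at_mult:
  assumes "hol_at f \<nu>" "hol_at g \<nu>"
  shows "hol_at (\<lambda>\<mu>. f \<mu> * g \<mu>) \<nu>"
proof -
  obtain U V where "open U" "\<nu> \<in> U" "hol2_on f U" "open V" "\<nu> \<in> V" "hol2_on g V"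
    using assms by (auto simp: hol_at_def)
  then show ?thesis
    unfolding hol_at_def
    by (intro exI[of _ "U \<inter> V"]) (auto intro!: hol2_on_mult intro: hol2_on_subset)
qed

lemma max_ideal_iff: "f \<in> max_ideal \<nu> \<longleftrightarrow> hol_at f \<nu> \<and> f \<nu> = 0"
  by (simp add: max_ideal_def hol_at_def)

lemma max_ideal_mult_hol_at: "hol_at f \<nu> \<Longrightarrow> g \<in> max_ideal \<nu> \<Longrightarrow> (\<lambda>\<mu>. f \<mu> * g \<mu>) \<in> max_ideal \<nu>"
  by (simp add: max_ideal_iff hol_at_mult)

lemma zero_max_ideal: "(\<lambda>_. 0) \<in> max_ideal \<nu>"
  by (simp add: max_ideal_iff hol_at_UNIV hol2_on_const)

abbreviation sc_H :: "complex \<Rightarrow> (grp \<Rightarrow> complex) \<Rightarrow> grp \<Rightarrow> complex" where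
  "sc_H \<equiv> (\<lambda>c f k. c * f k)"

text \<open>The inductive set has no rule for zero: zero arises as 0 times an element of the module,
  so each power must first be shown inhabited.\<close>

lemma max_ideal_mult_nonempty: "\<phi> \<in> S \<Longrightarrow> \<exists>\<psi>. \<psi> \<in> (max_ideal_mult sc \<nu> ^^ k) S"
proof (induction k)
  case (Suc k)
  then obtain \<psi> where "\<psi> \<in> (max_ideal_mult sc \<nu> ^^ k) S" by blast
  from max_ideal_mult.gen[OF zero_max_ideal this, of sc]
  have "(\<lambda>\<mu>. sc 0 (\<psi> \<mu>)) \<in> (max_ideal_mult sc \<nu> ^^ Suc k) S" by simp
  then show ?case by blast
qed auto

lemma zero_max_ideal_mult:
  assumes "\<phi> \<in> S"
  shows "(\<lambda>_. 0) \<in> (max_ideal_mult (*) \<nu> ^^ Suc k) S"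
proof -
  obtain \<psi> where "\<psi> \<in> (max_ideal_mult (*) \<nu> ^^ k) S" using max_ideal_mult_nonempty[OF assms] by blast
  from max_ideal_mult.gen[OF zero_max_ideal this, of "(*)"] show ?thesis by simp
qed

lemma zero_max_ideal_mult_H:
  assumes "\<phi> \<in> S"
  shows "(\<lambda>_. 0) \<in> (max_ideal_mult sc_H \<nu> ^^ Suc k) S"
proof -
  obtain \<psi> where "\<psi> \<in> (max_ideal_mult sc_H \<nu> ^^ k) S" using max_ideal_mult_nonempty[OF assms] by blast
  from max_ideal_mult.gen[OF zero_max_ideal this, of sc_H] show ?thesis by (simp add: zero_fun_def)
qed

text \<open>With its vector-valued form below, it makes the value at \<nu> well defined on jets,
  which is what the necessity direction evaluates.\<close>

lemma max_ideal_mult_eval: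
  assumes "\<psi> \<in> (max_ideal_mult (*) \<nu> ^^ Suc k) S"
  shows "\<psi> \<nu> = 0"
proof -
  have "\<psi> \<nu> = 0" if "\<psi> \<in> max_ideal_mult (*) \<nu> S'" for S'
    using that by induction (auto simp: max_ideal_iff dest: eventually_nhds_x_imp_x)
  with assms show ?thesis by auto
qed

lemma max_ideal_mult_eval_H:
  assumes "\<psi> \<in> (max_ideal_mult sc_H \<nu> ^^ Suc k) S"
  shows "\<psi> \<nu> = (\<lambda>_. 0)"
proof -
  have "\<psi> \<nu> = (\<lambda>_. 0)" if "\<psi> \<in> max_ideal_mult sc_H \<nu> S'" for S'
    using that by induction (auto simp: max_ideal_iff fun_eq_iff dest: eventually_nhds_x_imp_x)
  with assms show ?thesis by auto
qed

lemma jet_class_self_H: "\<phi> \<in> S \<Longrightarrow> \<phi> \<in> jet_class sc_H \<nu> d S \<phi>"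
  using zero_max_ideal_mult_H[where \<phi> = \<phi> and S = S and \<nu> = \<nu> and k = d] by (simp add: jet_class_def zero_fun_def)

lemma jet_class_eq_imp_eval_H:
  assumes "\<phi> \<in> S" "jet_class sc_H \<nu> d S \<phi> = jet_class sc_H \<nu> d S \<psi>"
  shows "\<phi> \<nu> = \<psi> \<nu>"
proof -
  have "(\<lambda>\<mu>. \<phi> \<mu> - \<psi> \<mu>) \<in> (max_ideal_mult sc_H \<nu> ^^ Suc d) S"
    using jet_class_self_H[where \<nu> = \<nu> and d = d, OF assms(1)] unfolding assms(2) by (simp add: jet_class_def)
  from max_ideal_mult_eval_H[OF this] show ?thesis by (auto simp: fun_eq_iff)
qed

lemma jet_class_self: "\<phi> \<in> S \<Longrightarrow> \<phi> \<in> jet_class (*) \<nu> d S \<phi>"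
  using zero_max_ideal_mult[where \<phi> = \<phi> and S = S and \<nu> = \<nu> and k = d] by (simp add: jet_class_def)

lemma jet_class_eq_imp:
  assumes "\<phi> \<in> S" "jet_class (*) \<nu> d S \<phi> = jet_class (*) \<nu> d S \<psi>"
  shows "(\<lambda>\<mu>. \<phi> \<mu> - \<psi> \<mu>) \<in> (max_ideal_mult (*) \<nu> ^^ Suc d) S"
  using jet_class_self[where \<nu> = \<nu> and d = d, OF assms(1)] unfolding assms(2) by (simp add: jet_class_def)

lemma max_ideal_mult_hol_at_mult:
  assumes f: "hol_at f \<nu>" and "\<psi> \<in> (max_ideal_mult (*) \<nu> ^^ Suc k) S"
  shows "(\<lambda>\<mu>. f \<mu> * \<psi> \<mu>) \<in> (max_ideal_mult (*) \<nu> ^^ Suc k) S"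
proof -
  have "(\<lambda>\<mu>. f \<mu> * \<psi> \<mu>) \<in> max_ideal_mult (*) \<nu> S'" if "\<psi> \<in> max_ideal_mult (*) \<nu> S'" for S'
    using that
  proof induction
    case (gen g \<phi>)
    from max_ideal_mult.gen[OF max_ideal_mult_hol_at[OF f gen(1)] gen(2), of "(*)"]
    show ?case by (simp add: mult.assoc)
  next
    case (add \<phi> \<psi>)
    from max_ideal_mult.add[OF add.IH] show ?case by (simp add: algebra_simps)
  next
    case (cong \<phi> \<psi>)
    show ?case
      by (rule max_ideal_mult.cong[OF cong.IH]) (use cong.hyps(2) in \<open>eventually_elim, simp\<close>)
  qed
  with assms show ?thesis by auto
qed

lemma jet_class_eqI:
  assumes "(\<lambda>\<mu>. \<phi> \<mu> - \<psi> \<mu>) \<in> (max_ideal_mult (*) \<nu> ^^ Suc d) S"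
  shows "jet_class (*) \<nu> d S \<phi> = jet_class (*) \<nu> d S \<psi>"
proof -
  have *: "(\<lambda>\<mu>. \<omega> \<mu> - \<psi> \<mu>) \<in> (max_ideal_mult (*) \<nu> ^^ Suc d) S"
    if "(\<lambda>\<mu>. \<omega> \<mu> - \<phi> \<mu>) \<in> (max_ideal_mult (*) \<nu> ^^ Suc d) S"
      "(\<lambda>\<mu>. \<phi> \<mu> - \<psi> \<mu>) \<in> (max_ideal_mult (*) \<nu> ^^ Suc d) S" for \<phi> \<psi> \<omega> :: "c2 \<Rightarrow> complex"
    using max_ideal_mult.add[OF that[simplified]] by simp
  have "(\<lambda>\<mu>. \<psi> \<mu> - \<phi> \<mu>) \<in> (max_ideal_mult (*) \<nu> ^^ Suc d) S"
    using max_ideal_mult_hol_at_mult[OF hol_at_UNIV[OF hol2_on_const[of "-1"]] assms] by simp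
  then show ?thesis using *[OF _ assms] * by (auto simp: jet_class_def simp del: funpow.simps)
qed

text \<open>Places the interpolation error, divisible by a (d+1)-st power, into the submodule that
  defines jets of order d.\<close>

lemma power_max_ideal_mult:
  assumes "f \<in> max_ideal \<nu>" "\<psi> \<in> S"
  shows "(\<lambda>\<mu>. f \<mu> ^ k * \<psi> \<mu>) \<in> (max_ideal_mult (*) \<nu> ^^ k) S"
proof (induction k)
  case (Suc k)
  from max_ideal_mult.gen[OF assms(1) Suc, of "(*)"] show ?case by (simp add: mult.assoc)
qed (use assms in simp)

lemma hol_at_germ_Hom:
  assumes "hol_at f \<nu>" "t \<in> germ_Hom n \<sigma> \<nu>"
  shows "(\<lambda>\<mu>. f \<mu> * t \<mu>) \<in> germ_Hom n \<sigma> \<nu>"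
proof -
  obtain U V where "open U" "\<nu> \<in> U" "hol2_on f U" "open V" "\<nu> \<in> V" "hol2_on t V" "\<forall>\<mu>\<in>V. t \<mu> \<in> Hom_M n \<sigma>"
    using assms by (auto simp: hol_at_def germ_Hom_def)
  then show ?thesis
    unfolding germ_Hom_def
    by (intro CollectI exI[of _ "U \<inter> V"])
      (auto intro!: hol2_on_mult intro: hol2_on_subset simp: Hom_M_def algebra_simps)
qed

section \<open>Restriction of K-types to M\<close>

lemma delta_minus_1: "delta n (mat 1) = 1" "delta n (- mat 1) = (-1) powi n"
  by (simp_all add: delta_def mat_def one_complex.code[symmetric]) (simp add: complex_eq_iff power_int_def)

lemma delta_parity:
  assumes "l mod 2 = n mod 2" "m \<in> {mat 1, - mat 1}"
  shows "delta l m = delta n m"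
proof -
  have "(-1 :: complex) powi l = (-1) powi n"
  proof -
    have "even l \<longleftrightarrow> even n" using assms(1) by presburger
    then show ?thesis by (simp add: power_int_minus_left)
  qed
  with assms(2) show ?thesis by (auto simp: delta_minus_1)
qed

lemma delta2_parity:
  assumes "fst l mod 2 = fst n mod 2" "snd l mod 2 = snd n mod 2" "m \<in> MM"
  shows "delta2 l m = delta2 n m"
  using assms by (auto simp: delta2_def MM_def delta_parity[OF assms(1)] delta_parity[OF assms(2)])

lemma Hom_M_parity:
  assumes "fst l mod 2 = fst n mod 2" "snd l mod 2 = snd n mod 2"
  shows "Hom_M l \<sigma> = Hom_M n \<sigma>"
  using delta2_parity[OF assms] by (simp add: Hom_M_def)

text \<open>M consists of signs and sees only the parities of a type, so ladder steps by 2 do not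
  leave the space of admissible germs.\<close>

lemma germ_Hom_parity:
  assumes "fst l mod 2 = fst n mod 2" "snd l mod 2 = snd n mod 2"
  shows "germ_Hom l \<sigma> \<nu> = germ_Hom n \<sigma> \<nu>"
  by (simp add: germ_Hom_def Hom_M_parity[OF assms])

section \<open>Interpolation of even functions\<close>

text \<open>\<open>Q\<close> plays the role of the interpolants and \<open>H\<close> that of the
  functions being divided. They are kept abstract because, in two variables, the remainder
  \<open>c\<close> at a node is still a function of the other variable.\<close>

lemma newton_interpolation:
  fixes x :: "c2 \<Rightarrow> complex"
  assumes div: "\<And>h a. h \<in> H \<Longrightarrow> \<exists>c\<in>Q. \<exists>g\<in>H. \<forall>p. h p = c p + ((x p)\<^sup>2 - a\<^sup>2) * g p"
    and zero: "(\<lambda>_. 0) \<in> Q"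
    and add: "\<And>f g. f \<in> Q \<Longrightarrow> g \<in> Q \<Longrightarrow> (\<lambda>p. f p + g p) \<in> Q"
    and mult: "\<And>f a. f \<in> Q \<Longrightarrow> (\<lambda>p. ((x p)\<^sup>2 - a\<^sup>2) * f p) \<in> Q"
    and h: "h \<in> H"
  shows "\<exists>P\<in>Q. \<exists>g\<in>H. \<forall>p. h p = P p + (\<Prod>a\<leftarrow>as. (x p)\<^sup>2 - a\<^sup>2) * g p"
  using h
proof (induction as arbitrary: h)
  case Nil
  then show ?case using zero by (intro bexI[of _ "\<lambda>_. 0"] bexI[of _ h]) auto
next
  case (Cons a as)
  obtain c h' where c: "c \<in> Q" "h' \<in> H" "\<And>p. h p = c p + ((x p)\<^sup>2 - a\<^sup>2) * h' p"
    using div[OF Cons.prems] by blast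
  obtain P g where P: "P \<in> Q" "g \<in> H" "\<And>p. h' p = P p + (\<Prod>a\<leftarrow>as. (x p)\<^sup>2 - a\<^sup>2) * g p"
    using Cons.IH[OF c(2)] by blast
  have "h p = (c p + ((x p)\<^sup>2 - a\<^sup>2) * P p) + (\<Prod>a\<leftarrow>a # as. (x p)\<^sup>2 - a\<^sup>2) * g p" for p
    by (simp add: c(3) P(3) algebra_simps)
  then show ?case using P(1,2) c(1)
    by (intro bexI[of _ "\<lambda>p. c p + ((x p)\<^sup>2 - a\<^sup>2) * P p"] bexI[of _ g] allI add mult)
qed

lemma even2_section_snd: "even2 h \<Longrightarrow> even2 (\<lambda>p. h (a, snd p))"
proof -
  assume h: "even2 h"
  have "(\<lambda>w. h (a, w)) holomorphic_on UNIV" using h by (simp add: even2_def hol2_on_UNIV sep_hol_def)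
  from hol2_on_comp_snd[OF this] h show ?thesis by (simp add: even2_def)
qed

lemma even2_divide_snd:
  assumes h: "even2 h" "\<And>z w. h (z, w) = h (0, w)"
  shows "\<exists>g. even2 g \<and> (\<forall>z w. g (z, w) = g (0, w)) \<and> (\<forall>z w. h (z, w) = h (0, a) + (w\<^sup>2 - a\<^sup>2) * g (z, w))"
proof -
  let ?k = "\<lambda>p. h (snd p, fst p)"
  have "even2 ?k" using h(1) hol2_on_swap[of h] by (simp add: even2_def)
  from even2_divide[OF this, of a] obtain g where
    g: "even2 g" "\<And>z w. h (w, z) = h (w, a) + (z\<^sup>2 - a\<^sup>2) * g (z, w)" by auto
  let ?g = "\<lambda>p. g (snd p, 0)"
  have "(\<lambda>z. g (z, 0)) holomorphic_on UNIV" using g(1) by (simp add: even2_def hol2_on_UNIV sep_hol_def)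
  from hol2_on_comp_snd[OF this] have "even2 ?g" using g(1) by (simp add: even2_def)
  moreover have "h (z, w) = h (0, a) + (w\<^sup>2 - a\<^sup>2) * ?g (z, w)" for z w
    using g(2)[of 0 w] h(2)[of z w] by simp
  moreover have "?g (z, w) = ?g (0, w)" for z w by simp
  ultimately show ?thesis by (intro exI[of _ ?g] conjI allI)
qed

text \<open>\<open>P\<close> is any algebra containing the constants and both squares;
  \<open>sufficiency\<close> takes for it the multipliers that preserve a space of germs.\<close>

lemma even2_interpolation:
  assumes h: "even2 h"
    and const: "\<And>c. (\<lambda>_. c) \<in> P"
    and add: "\<And>f g. f \<in> P \<Longrightarrow> g \<in> P \<Longrightarrow> (\<lambda>p. f p + g p) \<in> P"
    and mult: "\<And>f g. f \<in> P \<Longrightarrow> g \<in> P \<Longrightarrow> (\<lambda>p. f p * g p) \<in> P"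
    and sq: "(\<lambda>p. (fst p)\<^sup>2) \<in> P" "(\<lambda>p. (snd p)\<^sup>2) \<in> P"
  shows "\<exists>p\<in>P. \<exists>g g'. hol2_on g UNIV \<and> hol2_on g' UNIV \<and>
    (\<forall>\<mu>. h \<mu> = p \<mu> + (\<Prod>a\<leftarrow>as. (fst \<mu>)\<^sup>2 - a\<^sup>2) * g \<mu> + (\<Prod>a\<leftarrow>bs. (snd \<mu>)\<^sup>2 - a\<^sup>2) * g' \<mu>)"
proof -
  let ?A = "\<lambda>\<mu>::c2. \<Prod>a\<leftarrow>as. (fst \<mu>)\<^sup>2 - a\<^sup>2" and ?B = "\<lambda>\<mu>::c2. \<Prod>a\<leftarrow>bs. (snd \<mu>)\<^sup>2 - a\<^sup>2"
  have sub: "(\<lambda>p. (fst p)\<^sup>2 - a\<^sup>2) \<in> P" "(\<lambda>p. (snd p)\<^sup>2 - a\<^sup>2) \<in> P" for a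
    using add[OF sq(1) const[of "- a\<^sup>2"]] add[OF sq(2) const[of "- a\<^sup>2"]] by simp_all
  \<comment> \<open>Functions congruent to an element of \<open>P\<close> modulo the ideal generated
    by the two node products.\<close>
  define Q where "Q = {f. \<exists>p\<in>P. \<exists>g g'. hol2_on g UNIV \<and> hol2_on g' UNIV \<and>
    (\<forall>\<mu>. f \<mu> = p \<mu> + ?A \<mu> * g \<mu> + ?B \<mu> * g' \<mu>)}"
  have QI: "f \<in> Q" if "p \<in> P" "hol2_on g UNIV" "hol2_on g' UNIV" "\<And>\<mu>. f \<mu> = p \<mu> + ?A \<mu> * g \<mu> + ?B \<mu> * g' \<mu>"
    for f p g g'
    using that unfolding Q_def by blast
  have "\<exists>p\<in>Q. \<exists>g\<in>Collect even2. \<forall>\<mu>. h \<mu> = p \<mu> + ?A \<mu> * g \<mu>"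
  proof (rule newton_interpolation)
    show "h \<in> Collect even2" using h by simp
    have PQ: "f \<in> Q" if "f \<in> P" for f
      by (rule QI[of f "\<lambda>_. 0" "\<lambda>_. 0"]) (simp_all add: that hol2_on_const)
    show "(\<lambda>_. 0) \<in> Q" by (intro PQ const)
    show "(\<lambda>p. f p + g p) \<in> Q" if "f \<in> Q" "g \<in> Q" for f g
    proof -
      obtain p g1 g2 q h1 h2 where *: "p \<in> P" "hol2_on g1 UNIV" "hol2_on g2 UNIV" "q \<in> P" "hol2_on h1 UNIV" "hol2_on h2 UNIV"
        "\<And>\<mu>. f \<mu> = p \<mu> + ?A \<mu> * g1 \<mu> + ?B \<mu> * g2 \<mu>" "\<And>\<mu>. g \<mu> = q \<mu> + ?A \<mu> * h1 \<mu> + ?B \<mu> * h2 \<mu>"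
        using \<open>f \<in> Q\<close> \<open>g \<in> Q\<close> unfolding Q_def by blast
      show ?thesis
        by (rule QI[OF add[OF *(1,4)] hol2_on_add[OF *(2,5)] hol2_on_add[OF *(3,6)]])
          (simp add: *(7,8) algebra_simps)
    qed
    show "(\<lambda>p. ((fst p)\<^sup>2 - a\<^sup>2) * f p) \<in> Q" if "f \<in> Q" for f a
    proof -
      obtain p g1 g2 where *: "p \<in> P" "hol2_on g1 UNIV" "hol2_on g2 UNIV"
        "\<And>\<mu>. f \<mu> = p \<mu> + ?A \<mu> * g1 \<mu> + ?B \<mu> * g2 \<mu>"
        using \<open>f \<in> Q\<close> unfolding Q_def by blast
      have "hol2_on (\<lambda>\<mu>. (fst \<mu>)\<^sup>2 - a\<^sup>2) UNIV"
        unfolding power2_eq_square by (intro hol2_intros)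
      then show ?thesis
      proof (rule_tac QI[OF mult[OF sub(1)[of a] *(1)] hol2_on_mult[OF _ *(2)] hol2_on_mult[OF _ *(3)]])
        have "x * (p + A * g + B * g') = x * p + A * (x * g) + B * (x * g')" for x p A B g g' :: complex
          by algebra
        then show "((fst \<mu>)\<^sup>2 - a\<^sup>2) * f \<mu> = ((fst \<mu>)\<^sup>2 - a\<^sup>2) * p \<mu>
          + ?A \<mu> * (((fst \<mu>)\<^sup>2 - a\<^sup>2) * g1 \<mu>) + ?B \<mu> * (((fst \<mu>)\<^sup>2 - a\<^sup>2) * g2 \<mu>)" for \<mu>
          by (simp only: *(4))
      qed
    qed
    show "\<exists>c\<in>Q. \<exists>g\<in>Collect even2. \<forall>p. h p = c p + ((fst p)\<^sup>2 - a\<^sup>2) * g p" if "h \<in> Collect even2" for h a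
    proof -
      have "even2 h" using that by simp
      from even2_divide[OF this, of a] obtain g where
        g: "even2 g" "\<And>z w. h (z, w) = h (a, w) + (z\<^sup>2 - a\<^sup>2) * g (z, w)" by blast
      let ?c = "\<lambda>p. h (a, snd p)"
      \<comment> \<open>At a node a of the first variable the remainder h(a, w) still depends on w;
        it is interpolated in turn at the nodes \<open>bs\<close>, and its error is the term with
        \<open>g'\<close>.\<close>
      have "\<exists>p\<in>P. \<exists>g\<in>{h. even2 h \<and> (\<forall>z w. h (z, w) = h (0, w))}. \<forall>\<mu>. ?c \<mu> = p \<mu> + ?B \<mu> * g \<mu>"
      proof (rule newton_interpolation)
        show "?c \<in> {h. even2 h \<and> (\<forall>z w. h (z, w) = h (0, w))}" using even2_section_snd[OF \<open>even2 h\<close>] by simp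
        show "\<exists>c\<in>P. \<exists>g\<in>{h. even2 h \<and> (\<forall>z w. h (z, w) = h (0, w))}. \<forall>p. f p = c p + ((snd p)\<^sup>2 - b\<^sup>2) * g p"
          if "f \<in> {h. even2 h \<and> (\<forall>z w. h (z, w) = h (0, w))}" for f b
        proof -
          have "even2 f" "\<And>z w. f (z, w) = f (0, w)" using that by auto
          from even2_divide_snd[OF this, of b] obtain g where
            g: "even2 g" "\<forall>z w. g (z, w) = g (0, w)" "\<And>z w. f (z, w) = f (0, b) + (w\<^sup>2 - b\<^sup>2) * g (z, w)" by blast
          have "f p = f (0, b) + ((snd p)\<^sup>2 - b\<^sup>2) * g p" for p
            using g(3)[of "fst p" "snd p"] by simp
          then show ?thesis using g(1,2)
            by (intro bexI[of _ "\<lambda>_. f (0, b)"] bexI[of _ g] const CollectI conjI allI) blast+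
        qed
      qed (auto intro: const add mult sub)
      then obtain p g' where "p \<in> P" "even2 g'" "\<And>\<mu>. ?c \<mu> = p \<mu> + ?B \<mu> * g' \<mu>" by blast
      then have "?c \<in> Q" by (intro QI[of p "\<lambda>_. 0" g']) (simp_all add: even2_def hol2_on_const)
      moreover have "h p = ?c p + ((fst p)\<^sup>2 - a\<^sup>2) * g p" for p
        using g(2)[of "fst p" "snd p"] by simp
      ultimately show ?thesis using g(1) by (intro bexI[of _ ?c] bexI[of _ g] CollectI allI)
    qed
  qed
  then obtain p g where pg: "p \<in> Q" "even2 g" "\<And>\<mu>. h \<mu> = p \<mu> + ?A \<mu> * g \<mu>" by auto
  then obtain p' g1 g2 where *: "p' \<in> P" "hol2_on g1 UNIV" "hol2_on g2 UNIV"
    "\<And>\<mu>. p \<mu> = p' \<mu> + ?A \<mu> * g1 \<mu> + ?B \<mu> * g2 \<mu>" unfolding Q_def by blast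
  have "h \<mu> = p' \<mu> + ?A \<mu> * (g1 \<mu> + g \<mu>) + ?B \<mu> * g2 \<mu>" for \<mu>
    by (simp add: pg(3) * algebra_simps)
  moreover have "hol2_on (\<lambda>\<mu>. g1 \<mu> + g \<mu>) UNIV" using * pg(2) by (simp add: even2_def hol2_on_add)
  ultimately show ?thesis using *(1,3)
    by (intro bexI[of _ p'] exI[of _ "\<lambda>\<mu>. g1 \<mu> + g \<mu>"] exI[of _ g2]) simp_all
qed

section \<open>The derivative of the action along the diagonal subgroup\<close>

lemma BP_cnj: "F \<in> BP \<Longrightarrow> (\<lambda>\<theta>. cnj (F \<theta>)) \<in> BP"
  by (simp add: BP_def C_inf_linear_comp[OF bounded_linear_cnj])

lemma Nrm_cnj: "F \<in> BP \<Longrightarrow> Nrm ds (\<lambda>\<theta>. cnj (F \<theta>)) = Nrm ds F"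
proof (induction ds arbitrary: F)
  case Nil
  then show ?case by (simp add: supn_def)
next
  case (Cons d ds)
  have "dir_deriv d (\<lambda>\<theta>. cnj (F \<theta>)) = (\<lambda>\<theta>. cnj (dir_deriv d F \<theta>))"
    using Cons.prems by (intro ext dir_deriv_comp_linear bounded_linear_cnj BP_differentiable)
  then show ?case using Cons by (simp add: BP_dir_deriv)
qed

lemma smallf_cmult: "smallf Fl r X \<Longrightarrow> smallf Fl r (\<lambda>h \<theta>. c * X h \<theta>)"
  using smallf_mult[OF bigf_const[OF BP_const[of c]], of Fl r X] by simp

lemma smallf_diff: "smallf Fl r X \<Longrightarrow> smallf Fl r Y \<Longrightarrow> smallf Fl r (\<lambda>h \<theta>. X h \<theta> - Y h \<theta>)"
  using smallf_add[OF _ smallf_cmult[of Fl r Y "-1"], of X] by simp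

lemma smallf_cnj: "smallf Fl r X \<Longrightarrow> smallf Fl r (\<lambda>h \<theta>. cnj (X h \<theta>))"
  unfolding smallf_def
proof (elim conjE, intro conjI allI)
  assume ev: "\<forall>\<^sub>F h in Fl. X h \<in> BP" and *: "\<forall>i j. (\<lambda>h. Nrm (word i j) (X h)) \<in> o[Fl](r)"
  show "\<forall>\<^sub>F h in Fl. (\<lambda>\<theta>. cnj (X h \<theta>)) \<in> BP" using ev by eventually_elim (rule BP_cnj)
  fix i j
  have "(\<lambda>h. Nrm (word i j) (X h)) \<in> o[Fl](r)" using * by blast
  then show "(\<lambda>h. Nrm (word i j) (\<lambda>\<theta>. cnj (X h \<theta>))) \<in> o[Fl](r)"
    by (rule smallo_bound) (use ev in eventually_elim, simp add: Nrm_cnj Nrm_nonneg)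
qed

text \<open>Real and imaginary part of \<open>Lam\<close> give the A- and the K-component, so the
  calculus must pass to them; it does so through conjugation.\<close>

lemma smallf_Re: "smallf Fl r X \<Longrightarrow> smallf Fl r (\<lambda>h \<theta>. of_real (Re (X h \<theta>)))"
proof -
  assume X: "smallf Fl r X"
  have "of_real (Re z) = 1/2 * (z + cnj z)" for z by (simp add: complex_eq_iff)
  then show ?thesis using smallf_cmult[OF smallf_add[OF X smallf_cnj[OF X]], of "1/2"] by (simp only:)
qed

lemma smallf_Im: "smallf Fl r X \<Longrightarrow> smallf Fl r (\<lambda>h \<theta>. of_real (Im (X h \<theta>)))"
proof -
  assume X: "smallf Fl r X"
  have "of_real (Im z) = - \<i>/2 * (z - cnj z)" for z by (simp add: complex_eq_iff)
  then show ?thesis using smallf_cmult[OF smallf_diff[OF X smallf_cnj[OF X]], of "- \<i>/2"] by simp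
qed

lemma smallf_sum:
  "finite I \<Longrightarrow> (\<And>i. i \<in> I \<Longrightarrow> smallf Fl r (X i)) \<Longrightarrow> smallf Fl r (\<lambda>h \<theta>. \<Sum>i\<in>I. X i h \<theta>)"
proof (induction I rule: finite_induct)
  case empty
  show ?case by (simp add: smallf_def BP_const Nrm_const)
next
  case (insert x I)
  have "smallf Fl r (X x)" "smallf Fl r (\<lambda>h \<theta>. \<Sum>i\<in>I. X i h \<theta>)" using insert by auto
  from smallf_add[OF this] show ?case using insert by simp
qed

lemma real_derivative_smallo:
  assumes "(f has_real_derivative c) (at 0)" "f 0 = 0"
  shows "(\<lambda>s. norm (f s - s * c)) \<in> o[at 0](norm)" "(\<lambda>s. norm (f s)) \<in> O[at 0](norm)"
proof -
  have "((\<lambda>h. norm (f h - h * c) / norm h) \<longlongrightarrow> 0) (at 0)"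
    using assms by (simp add: has_field_derivative_def has_derivative_at mult.commute)
  then show 1: "(\<lambda>s. norm (f s - s * c)) \<in> o[at 0](norm)"
    by (rule smalloI_tendsto) (simp add: eventually_at_filter)
  have "(\<lambda>s. norm (f s - s * c) + \<bar>c\<bar> * norm s) \<in> O[at 0](norm)"
    by (intro sum_in_bigo landau_o.small_imp_big[OF 1]) (rule bigoI[of _ "\<bar>c\<bar>"], simp add: abs_mult)
  then show "(\<lambda>s. norm (f s)) \<in> O[at 0](norm)"
  proof (rule bigo_bound)
    have "norm (f s) \<le> norm (f s - s * c) + \<bar>c\<bar> * norm s" for s
      using norm_triangle_ineq[of "f s - s * c" "s * c"] by (simp add: abs_mult mult.commute)
    then show "\<forall>\<^sub>F s in at 0. 0 \<le> norm (f s) \<and> norm (f s) \<le> norm (f s - s * c) + \<bar>c\<bar> * norm s"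
      by (intro always_eventually) auto
  qed
qed

lemma real_norm_smallo_1: "(norm :: real \<Rightarrow> real) \<in> o[at 0](\<lambda>_. 1)"
  by (rule smalloI_tendsto) (auto intro!: tendsto_eq_intros)

lemma real_norm_sq_smallo: "(\<lambda>s::real. norm s * norm s) \<in> o[at 0](norm)"
  using landau_o.small_big_mult[OF real_norm_smallo_1 landau_o.big_refl[of norm]] by (simp only: mult_1)

section \<open>First-order expansion of the Iwasawa components at the identity of A\<close>

lemma matrix_inv_dg: "matrix_inv (dg s) = dg (- s)"
  by (rule matrix_inv_eqI) (simp_all add: mat2_eq_iff mat2_mult dg_def mat_def flip: exp_add)

lemma dg_SL2: "dg s \<in> SL2"
  by (simp add: SL2_def det_2 dg_def flip: exp_add)

lemma alp_dg: "alp (dg (- s)) = of_real (cosh s)" and bet_dg: "bet (dg (- s)) = - of_real (sinh s)"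
  by (simp_all add: alp_def bet_def dg_def cosh_def sinh_def complex_eq_iff field_simps)

lemma Lam_dg: "Lam (dg (- s)) t = Ln (1 + - of_real (tanh s) * exp (- 2 * \<i> * of_real t))"
  by (simp add: Lam_def alp_dg bet_dg tanh_def)

lemma iwaH_rot_dg: "iwaH_rot (dg (- s)) t = ln (cosh s) + Re (Lam (dg (- s)) t)"
  by (simp add: iwaH_rot_def alp_dg)

lemma iwaK_rot_dg: "iwaK_rot (dg (- s)) t = t + Im (Lam (dg (- s)) t)"
  by (simp add: iwaK_rot_def alp_dg Arg_of_real not_less less_imp_le)

text \<open>For h = dg(-s) the quotient \<open>bet h / alp h\<close> is -tanh s, so
  \<open>Lam\<close> equals -s exp(-2 i x) to first order. The abstract coordinate \<open>x\<close>
  allows either angle.\<close>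

lemma smallf_Lam_dg:
  assumes e: "e \<in> BP" "\<And>\<theta>. exp (- 2 * \<i> * of_real (x \<theta>)) = e \<theta>"
  shows "smallf (at 0) norm (\<lambda>s \<theta>. Lam (dg (- (s * c))) (x \<theta>) + of_real (s * c) * e \<theta>)"
proof -
  have t: "((\<lambda>s. tanh (s * c)) has_real_derivative c) (at 0)"
    by (auto intro!: derivative_eq_intros)
  note t = real_derivative_smallo[OF this, simplified]
  let ?Y = "\<lambda>s \<theta>. - of_real (tanh (s * c)) * e \<theta>"
  have 1: "bigf (at 0) norm ?Y"
    using bigf_mono[OF bigf_cmult[OF e(1), of _ "\<lambda>s. - of_real (tanh (s * c))"]] t(2) by simp
  have 2: "smallf (at 0) norm (\<lambda>s \<theta>. Ln (1 + ?Y s \<theta>) - ?Y s \<theta>)"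
    by (rule bigf_imp_smallf[OF bigf_Ln[OF 1 real_norm_smallo_1] real_norm_sq_smallo])
  have "norm (- (of_real (tanh (s * c) - s * c)) :: complex) = \<bar>tanh (s * c) - s * c\<bar>" for s
    unfolding norm_minus_cancel norm_of_real ..
  then have 3: "smallf (at 0) norm (\<lambda>s \<theta>. - of_real (tanh (s * c) - s * c) * e \<theta>)"
    using bigf_imp_smallf[OF bigf_cmult[OF e(1), of _ "\<lambda>s. - of_real (tanh (s * c) - s * c)"], of _ norm] t(1)
    by simp
  show ?thesis
    using smallf_add[OF 2 3] unfolding Lam_dg e(2) by (simp add: algebra_simps)
qed

text \<open>Since ln(cosh s) has derivative 0 at 0, only the real part of \<open>Lam\<close>
  contributes.\<close>

lemma smallf_iwaH_dg:
  assumes e: "e \<in> BP" "\<And>\<theta>. exp (- 2 * \<i> * of_real (x \<theta>)) = e \<theta>"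
  shows "smallf (at 0) norm (\<lambda>s \<theta>. of_real (iwaH_rot (dg (- (s * c))) (x \<theta>)) + of_real (s * c) * of_real (Re (e \<theta>)))"
proof -
  have t: "((\<lambda>s. ln (cosh (s * c))) has_real_derivative 0) (at 0)"
    by (auto intro!: derivative_eq_intros)
  have "smallf (at 0) norm (\<lambda>s (\<theta> :: real \<times> real). complex_of_real (ln (cosh (s * c))))"
    using bigf_imp_smallf[OF bigf_scalar[of _ "\<lambda>s. complex_of_real (ln (cosh (s * c)))"], of "at 0" norm]
      real_derivative_smallo(1)[OF t] by simp
  from smallf_add[OF this smallf_Re[OF smallf_Lam_dg[OF e, of c]]]
  show ?thesis by (simp add: iwaH_rot_dg algebra_simps)
qed

section \<open>Mixed parameter derivatives of the difference quotient\<close>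

definition pd :: "(complex \<Rightarrow> complex \<Rightarrow> complex) \<Rightarrow> nat \<Rightarrow> nat \<Rightarrow> complex \<Rightarrow> complex \<Rightarrow> complex" where
  "pd f a b z0 w0 = (deriv ^^ a) (\<lambda>z. (deriv ^^ b) (f z) w0) z0"

lemma higher_deriv_sum:
  "finite I \<Longrightarrow> open S \<Longrightarrow> z \<in> S \<Longrightarrow> (\<And>i. i \<in> I \<Longrightarrow> f i holomorphic_on S) \<Longrightarrow>
    (deriv ^^ n) (\<lambda>w. \<Sum>i\<in>I. f i w) z = (\<Sum>i\<in>I. (deriv ^^ n) (f i) z)"
proof (induction I rule: finite_induct)
  case (insert x I)
  then show ?case
    using higher_deriv_add[of "f x" S "\<lambda>w. \<Sum>i\<in>I. f i w" z n] by (simp add: holomorphic_on_sum)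
qed simp

context
  fixes A B :: "complex set" and z0 w0 :: complex
  assumes AB: "z0 \<in> A" "w0 \<in> B"
begin

lemma pd_diff:
  assumes f: "sep_hol f A B" and g: "sep_hol g A B"
  shows "pd (\<lambda>z w. f z w - g z w) a b z0 w0 = pd f a b z0 w0 - pd g a b z0 w0"
proof -
  have o: "open A" "open B" using f by (auto simp: sep_hol_def)
  have h: "(\<lambda>z. (deriv ^^ b) (f z) w0) holomorphic_on A" "(\<lambda>z. (deriv ^^ b) (g z) w0) holomorphic_on A"
    using sep_hol_higher_deriv2[OF f, of b] sep_hol_higher_deriv2[OF g, of b] AB by (auto simp: sep_hol_def)
  have eq: "(deriv ^^ b) (\<lambda>w. f z w - g z w) w0 = (deriv ^^ b) (f z) w0 - (deriv ^^ b) (g z) w0" if "z \<in> A" for z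
    using f g that AB o by (intro higher_deriv_diff) (auto simp: sep_hol_def)
  have "pd (\<lambda>z w. f z w - g z w) a b z0 w0 = (deriv ^^ a) (\<lambda>z. (deriv ^^ b) (f z) w0 - (deriv ^^ b) (g z) w0) z0"
    unfolding pd_def
    by (rule higher_deriv_transform_within_open[OF _ _ o(1) AB(1)])
      (auto simp: eq h intro!: holomorphic_intros intro: holomorphic_transform[OF holomorphic_on_diff[OF h]])
  also have "\<dots> = pd f a b z0 w0 - pd g a b z0 w0"
    unfolding pd_def by (rule higher_deriv_diff[OF h o(1) AB(1)])
  finally show ?thesis .
qed

lemma pd_mult:
  assumes f: "sep_hol f A B" and g: "sep_hol g A B"
  shows "pd (\<lambda>z w. f z w * g z w) a b z0 w0 = (\<Sum>j=0..b. \<Sum>i=0..a. of_nat (b choose j) * of_nat (a choose i)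
      * pd f i j z0 w0 * pd g (a - i) (b - j) z0 w0)"
proof -
  have o: "open A" "open B" using f by (auto simp: sep_hol_def)
  have h: "(\<lambda>z. (deriv ^^ j) (f z) w0) holomorphic_on A" "(\<lambda>z. (deriv ^^ j) (g z) w0) holomorphic_on A" for j
    using sep_hol_higher_deriv2[OF f, of j] sep_hol_higher_deriv2[OF g, of j] AB by (auto simp: sep_hol_def)
  have eq: "(deriv ^^ b) (\<lambda>w. f z w * g z w) w0
      = (\<Sum>j=0..b. of_nat (b choose j) * (deriv ^^ j) (f z) w0 * (deriv ^^ (b - j)) (g z) w0)" if "z \<in> A" for z
    using f g that AB o by (intro higher_deriv_mult) (auto simp: sep_hol_def)
  have hs: "(\<lambda>z. of_nat (b choose j) * (deriv ^^ j) (f z) w0 * (deriv ^^ (b - j)) (g z) w0) holomorphic_on A" for j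
    by (intro holomorphic_intros h)
  have "pd (\<lambda>z w. f z w * g z w) a b z0 w0
      = (deriv ^^ a) (\<lambda>z. \<Sum>j=0..b. of_nat (b choose j) * (deriv ^^ j) (f z) w0 * (deriv ^^ (b - j)) (g z) w0) z0"
    unfolding pd_def
    by (rule higher_deriv_transform_within_open[OF _ _ o(1) AB(1)])
      (auto simp: eq intro!: holomorphic_on_sum hs intro: holomorphic_transform[OF holomorphic_on_sum[OF hs]])
  also have "\<dots> = (\<Sum>j=0..b. (deriv ^^ a) (\<lambda>z. of_nat (b choose j) * (deriv ^^ j) (f z) w0 * (deriv ^^ (b - j)) (g z) w0) z0)"
    by (rule higher_deriv_sum[OF _ o(1) AB(1) hs]) simp
  also have "\<dots> = (\<Sum>j=0..b. of_nat (b choose j) *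
      (deriv ^^ a) (\<lambda>z. (deriv ^^ j) (f z) w0 * (deriv ^^ (b - j)) (g z) w0) z0)"
    using higher_deriv_cmult[OF holomorphic_on_mult[OF h] AB(1) o(1)] by (simp add: mult.assoc)
  also have "\<dots> = (\<Sum>j=0..b. of_nat (b choose j) *
      (\<Sum>i=0..a. of_nat (a choose i) * pd f i j z0 w0 * pd g (a - i) (b - j) z0 w0))"
    unfolding higher_deriv_mult[OF h o(1) AB(1)] pd_def ..
  finally show ?thesis by (simp add: sum_distrib_left mult.assoc)
qed

end

lemma higher_deriv_exp_affine:
  "(deriv ^^ b) (\<lambda>w. K * exp (w * Q + R)) = (\<lambda>w. K * Q ^ b * exp (w * Q + R :: complex))"
proof (induction b)
  case (Suc b)
  have "deriv (\<lambda>w. K * Q ^ b * exp (w * Q + R)) w = K * Q ^ Suc b * exp (w * Q + R)" for w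
    by (rule DERIV_imp_deriv) (auto intro!: derivative_eq_intros)
  then show ?case by (simp only: funpow.simps o_apply Suc.IH)
qed simp

lemma higher_deriv_affine:
  "(deriv ^^ b) (\<lambda>w. w * Q + R) = (\<lambda>w. if b = 0 then w * Q + R else if b = 1 then Q else (0::complex))"
proof (induction b)
  case (Suc b)
  have "deriv (\<lambda>w. w * Q + R) w = Q" for w
    by (rule DERIV_imp_deriv) (auto intro!: derivative_eq_intros)
  then show ?case
    unfolding funpow.simps o_apply Suc.IH by (cases "b = 0"; cases "b = 1") simp_all
qed simp

lemma pd_exp: "pd (\<lambda>z w. K * exp (z * P + w * Q + R)) a b z0 w0 = K * P ^ a * Q ^ b * exp (z0 * P + w0 * Q + R)"
proof -
  have "(deriv ^^ b) (\<lambda>w. K * exp (z * P + w * Q + R)) w0 = K * Q ^ b * exp (z * P + (w0 * Q + R))" for z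
    using fun_cong[OF higher_deriv_exp_affine[of b K Q "z * P + R"], of w0] by (simp add: algebra_simps)
  then show ?thesis
    unfolding pd_def using fun_cong[OF higher_deriv_exp_affine[of a "K * Q ^ b" P "w0 * Q + R"], of z0]
    by (simp add: algebra_simps)
qed

lemma pd_affine: "pd (\<lambda>z w. z * P + w * Q + R) a b z0 w0 =
    (if b = 0 then if a = 0 then z0 * P + w0 * Q + R else if a = 1 then P else 0
     else if b = 1 \<and> a = 0 then Q else 0)"
proof -
  have 1: "(deriv ^^ b) (\<lambda>w. z * P + w * Q + R) w0 = (if b = 0 then z * P + (w0 * Q + R) else if b = 1 then Q else 0)" for z
    using fun_cong[OF higher_deriv_affine[of b Q "z * P + R"], of w0] by (simp add: algebra_simps)
  show ?thesis
    unfolding pd_def 1 using fun_cong[OF higher_deriv_affine[of a P "w0 * Q + R"], of z0]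
    by (simp add: algebra_simps)
qed

lemma sep_hol_UNIV_I: "hol2_on (\<lambda>p. f (fst p) (snd p)) UNIV \<Longrightarrow> sep_hol f UNIV UNIV"
  by (simp add: hol2_on_UNIV)

lemma hol2_on_exp: "hol2_on f U \<Longrightarrow> hol2_on (\<lambda>p. exp (f p)) U"
  unfolding hol2_on_def
proof
  fix z assume "\<forall>z\<in>U. \<exists>a b. (f has_derivative (\<lambda>h. a * fst h + b * snd h)) (at z)" "z \<in> U"
  then obtain a b where "(f has_derivative (\<lambda>h. a * fst h + b * snd h)) (at z)" by blast
  from has_derivative_compose[OF this, of exp] DERIV_exp[of "f z"]
  have "((\<lambda>p. exp (f p)) has_derivative (\<lambda>h. exp (f z) * (a * fst h + b * snd h))) (at z)"
    by (simp add: has_field_derivative_def)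
  then have "((\<lambda>p. exp (f p)) has_derivative (\<lambda>h. (exp (f z) * a) * fst h + (exp (f z) * b) * snd h)) (at z)"
    by (simp add: algebra_simps)
  then show "\<exists>a b. ((\<lambda>p. exp (f p)) has_derivative (\<lambda>h. a * fst h + b * snd h)) (at z)" by blast
qed

lemma smallf_div:
  assumes "smallf (at 0) norm X"
  shows "smallf (at 0) (\<lambda>_. 1) (\<lambda>s \<theta>. of_real (1 / s) * X s \<theta>)"
proof -
  have "(\<lambda>s::real. norm (complex_of_real (1 / s)) * norm s) \<in> O[at 0](\<lambda>_. 1)"
    by (rule landau_o.big_mono) (auto simp: eventually_at_filter norm_divide)
  from smallf_mono[OF smallf_mult[OF bigf_scalar assms] this] show ?thesis .
qed

text \<open>P', Q', R' are the velocities at s = 0 of the coefficients of the exponent. With at most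
  one parameter derivative the quotient has the affine expression or its coefficient as limit. Two
  or more derivatives kill the affine part and bring down at least two factors P or Q, each O(s), so
  division by s still leaves a null family.\<close>

lemma smallf_pd_exp:
  fixes P Q R :: "real \<Rightarrow> real \<times> real \<Rightarrow> complex"
  assumes BP: "P' \<in> BP" "Q' \<in> BP" "R' \<in> BP"
    and P: "smallf (at 0) norm (\<lambda>s \<theta>. P s \<theta> - of_real s * P' \<theta>)"
    and Q: "smallf (at 0) norm (\<lambda>s \<theta>. Q s \<theta> - of_real s * Q' \<theta>)"
    and R: "smallf (at 0) norm (\<lambda>s \<theta>. R s \<theta> - of_real s * R' \<theta>)"
  shows "smallf (at 0) (\<lambda>_. 1) (\<lambda>s \<theta>. pd (\<lambda>z w. of_real (1 / s) * (exp (z * P s \<theta> + w * Q s \<theta> + R s \<theta>) - 1)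
      - (z * P' \<theta> + w * Q' \<theta> + R' \<theta>)) a b z0 w0)"
proof -
  define X where "X s \<theta> = z0 * P s \<theta> + w0 * Q s \<theta> + R s \<theta>" for s \<theta>
  define X' where "X' \<theta> = z0 * P' \<theta> + w0 * Q' \<theta> + R' \<theta>" for \<theta>
  have X': "X' \<in> BP" unfolding X'_def[abs_def] by (intro BP_add BP_cmult BP)
  have "smallf (at 0) norm (\<lambda>s \<theta>. z0 * (P s \<theta> - of_real s * P' \<theta>) + w0 * (Q s \<theta> - of_real s * Q' \<theta>) + (R s \<theta> - of_real s * R' \<theta>))"
    by (intro smallf_add smallf_cmult P Q R)
  then have X: "smallf (at 0) norm (\<lambda>s \<theta>. X s \<theta> - of_real s * X' \<theta>)"
    by (simp add: X_def X'_def algebra_simps)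
  have big: "bigf (at 0) norm Y" if "smallf (at 0) norm (\<lambda>s \<theta>. Y s \<theta> - of_real s * Y' \<theta>)" "Y' \<in> BP"
    for Y :: "real \<Rightarrow> real \<times> real \<Rightarrow> complex" and Y'
  proof -
    have "bigf (at 0) norm (\<lambda>s \<theta>. of_real s * Y' \<theta>)"
      using bigf_cmult[OF that(2), of "at 0" "\<lambda>s. complex_of_real s"] by (simp only: norm_of_real real_norm_def[abs_def])
    from bigf_add[OF smallf_imp_bigf[OF that(1)] this] show ?thesis by simp
  qed
  note bP = big[OF P BP(1)] and bQ = big[OF Q BP(2)] and bX = big[OF X X']
  note O1 = landau_o.small_imp_big[OF real_norm_smallo_1]
  note e = bigf_exp[OF bX O1]
  have sq: "smallf (at 0) norm Z" if "bigf (at 0) (\<lambda>s. norm s * norm s) Z"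
    for Z :: "real \<Rightarrow> real \<times> real \<Rightarrow> complex"
    using that real_norm_sq_smallo by (rule bigf_imp_smallf)
  have pw: "bigf (at 0) (\<lambda>_. 1) (\<lambda>s \<theta>. Y s \<theta> ^ k)" if "bigf (at 0) norm Y" for Y :: "real \<Rightarrow> real \<times> real \<Rightarrow> complex" and k
  proof (induction k)
    case 0
    show ?case using bigf_const[OF BP_const[of 1], of "at 0"] by simp
  next
    case (Suc k)
    from bigf_mult[OF bigf_mono[OF that O1] Suc] show ?case by simp
  qed
  \<comment> \<open>The constant -1/s is moved into the affine part, so that \<open>pd_exp\<close>
    and \<open>pd_affine\<close> apply to the two terms.\<close>
  have hol: "sep_hol (\<lambda>z w. of_real (1 / s) * exp (z * P s \<theta> + w * Q s \<theta> + R s \<theta>)) UNIV UNIV"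
    "sep_hol (\<lambda>z w. z * P' \<theta> + w * Q' \<theta> + (R' \<theta> + of_real (1 / s))) UNIV UNIV" for s \<theta>
    by (intro sep_hol_UNIV_I hol2_intros hol2_on_exp)+
  have "pd (\<lambda>z w. of_real (1 / s) * (exp (z * P s \<theta> + w * Q s \<theta> + R s \<theta>) - 1) - (z * P' \<theta> + w * Q' \<theta> + R' \<theta>)) a b z0 w0
      = pd (\<lambda>z w. of_real (1 / s) * exp (z * P s \<theta> + w * Q s \<theta> + R s \<theta>)) a b z0 w0
      - pd (\<lambda>z w. z * P' \<theta> + w * Q' \<theta> + (R' \<theta> + of_real (1 / s))) a b z0 w0" for s \<theta>
    using pd_diff[OF _ _ hol(1)[of s \<theta>] hol(2)[of \<theta> s], of z0 w0 a b] by (simp add: algebra_simps)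
  note * = this[unfolded pd_exp pd_affine, folded X_def]
  have s_nz: "\<forall>\<^sub>F s in at (0::real). s \<noteq> 0" by (simp add: eventually_at_filter)
  \<comment> \<open>The filter at 0 does not see s = 0, where 1 / s takes its default value.\<close>
  have cong: "smallf (at 0) (\<lambda>_. 1) Z'" if "smallf (at 0) (\<lambda>_. 1) Z" "\<And>s \<theta>. s \<noteq> 0 \<Longrightarrow> Z' s \<theta> = Z s \<theta>"
    for Z Z' :: "real \<Rightarrow> real \<times> real \<Rightarrow> complex"
  proof -
    have eq: "\<forall>\<^sub>F s in at 0. Z' s = Z s" using s_nz by eventually_elim (simp add: that(2) fun_eq_iff)
    show ?thesis
      unfolding smallf_def
    proof (intro conjI allI)
      have "\<forall>\<^sub>F s in at 0. Z s \<in> BP" using that(1) by (simp add: smallf_def)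
      with eq show "\<forall>\<^sub>F s in at 0. Z' s \<in> BP" by eventually_elim simp
      fix i j
      have "(\<lambda>s. Nrm (word i j) (Z' s)) \<in> o[at 0](\<lambda>_. 1) \<longleftrightarrow> (\<lambda>s. Nrm (word i j) (Z s)) \<in> o[at 0](\<lambda>_. 1)"
        by (rule landau_o.small.in_cong) (use eq in eventually_elim, simp)
      then show "(\<lambda>s. Nrm (word i j) (Z' s)) \<in> o[at 0](\<lambda>_. 1)" using that(1) by (simp add: smallf_def)
    qed
  qed
  consider "a = 0" "b = 0" | "a = 1" "b = 0" | "a = 0" "b = 1" | "a = 1" "b = 1"
    | k where "a = Suc (Suc k)" | k where "b = Suc (Suc k)"
    by (metis One_nat_def not0_implies_Suc)
  then show ?thesis
  proof cases
    case 1
    have "smallf (at 0) norm (\<lambda>s \<theta>. (exp (X s \<theta>) - 1 - X s \<theta>) + (X s \<theta> - of_real s * X' \<theta>))"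
      by (intro smallf_add X sq e(3))
    from smallf_div[OF this] show ?thesis
      by (rule cong) (unfold *, simp add: 1 X'_def field_simps)
  next
    case 2
    have "smallf (at 0) norm (\<lambda>s \<theta>. P s \<theta> * (exp (X s \<theta>) - 1) + (P s \<theta> - of_real s * P' \<theta>))"
      by (intro smallf_add P sq bigf_mult[OF bP e(2)])
    from smallf_div[OF this] show ?thesis
      by (rule cong) (unfold *, simp add: 2 field_simps)
  next
    case 3
    have "smallf (at 0) norm (\<lambda>s \<theta>. Q s \<theta> * (exp (X s \<theta>) - 1) + (Q s \<theta> - of_real s * Q' \<theta>))"
      by (intro smallf_add Q sq bigf_mult[OF bQ e(2)])
    from smallf_div[OF this] show ?thesis
      by (rule cong) (unfold *, simp add: 3 field_simps)
  next
    case 4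
    have "smallf (at 0) norm (\<lambda>s \<theta>. (P s \<theta> * Q s \<theta>) * exp (X s \<theta>))"
      using bigf_mult[OF bigf_mult[OF bP bQ] e(1)] by (intro sq) simp
    from smallf_div[OF this] show ?thesis
      by (rule cong) (unfold *, simp add: 4 field_simps)
  next
    case 5
    have "smallf (at 0) norm (\<lambda>s \<theta>. (P s \<theta> * P s \<theta>) * (P s \<theta> ^ k * Q s \<theta> ^ b * exp (X s \<theta>)))"
      using bigf_mult[OF bigf_mult[OF bP bP] bigf_mult[OF bigf_mult[OF pw[OF bP, of k] pw[OF bQ, of b]] e(1)]]
      by (intro sq) simp
    from smallf_div[OF this] show ?thesis
      by (rule cong) (unfold *, simp add: 5 field_simps)
  next
    case 6
    have "smallf (at 0) norm (\<lambda>s \<theta>. (Q s \<theta> * Q s \<theta>) * (P s \<theta> ^ a * Q s \<theta> ^ k * exp (X s \<theta>)))"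
      using bigf_mult[OF bigf_mult[OF bQ bQ] bigf_mult[OF bigf_mult[OF pw[OF bP, of a] pw[OF bQ, of k]] e(1)]]
      by (intro sq) simp
    from smallf_div[OF this] show ?thesis
      by (rule cong) (unfold *, simp add: 6 field_simps)
  qed
qed

lemma pd_cmult:
  assumes f: "sep_hol f A B" and AB: "z0 \<in> A" "w0 \<in> B"
  shows "pd (\<lambda>z w. c * f z w) a b z0 w0 = c * pd f a b z0 w0"
proof -
  have o: "open A" "open B" using f by (auto simp: sep_hol_def)
  have h: "(\<lambda>z. (deriv ^^ b) (f z) w0) holomorphic_on A"
    using sep_hol_higher_deriv2[OF f, of b] AB by (auto simp: sep_hol_def)
  have eq: "(deriv ^^ b) (\<lambda>w. c * f z w) w0 = c * (deriv ^^ b) (f z) w0" if "z \<in> A" for z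
    by (rule higher_deriv_cmult[of _ B]) (use f that AB o in \<open>auto simp: sep_hol_def\<close>)
  have hc: "(\<lambda>z. c * (deriv ^^ b) (f z) w0) holomorphic_on A" by (intro holomorphic_intros h)
  have "pd (\<lambda>z w. c * f z w) a b z0 w0 = (deriv ^^ a) (\<lambda>z. c * (deriv ^^ b) (f z) w0) z0"
    unfolding pd_def
    by (rule higher_deriv_transform_within_open[OF holomorphic_transform[OF hc] hc o(1) AB(1)]) (simp_all add: eq)
  also have "\<dots> = c * pd f a b z0 w0"
    unfolding pd_def by (rule higher_deriv_cmult[OF h AB(1) o(1)])
  finally show ?thesis .
qed

lemma sep_hol_mult: "sep_hol f A B \<Longrightarrow> sep_hol g A B \<Longrightarrow> sep_hol (\<lambda>z w. f z w * g z w) A B"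
  unfolding sep_hol_def split_beta by (auto intro!: continuous_on_mult holomorphic_on_mult)

lemma sep_hol_subset: "sep_hol f UNIV UNIV \<Longrightarrow> open A \<Longrightarrow> open B \<Longrightarrow> sep_hol f A B"
  unfolding sep_hol_def by (auto intro: continuous_on_subset holomorphic_on_subset)

lemma param_deriv_pd: "param_deriv a b \<nu> \<phi> k = pd (\<lambda>z w. \<phi> (z, w) k) a b (fst \<nu>) (snd \<nu>)"
  by (simp add: param_deriv_def pd_def)

lemma cnj_chr: "cnj (chr n \<theta>) = chr (- n) \<theta>"
  by (simp add: chr_def exp_cnj algebra_simps)

lemma chr_add: "chr (m + n) \<theta> = chr m \<theta> * chr n \<theta>"
  by (simp add: chr_def algebra_simps flip: exp_add)

section \<open>The infinitesimal action of A on a K-type\<close>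

context
  fixes c d :: real and n :: "int \<times> int"
begin

text \<open>Translation by the diagonal element with logarithm (s c, s d) multiplies the type n by
  the exponential of \<mu>_1 dgP + \<mu>_2 dgQ + dgR (\<open>ps_act_dg_frobenius\<close>). Primes
  denote derivatives at s = 0.\<close>

definition dgP :: "real \<Rightarrow> real \<times> real \<Rightarrow> complex" where
  "dgP s \<theta> = - 2 * of_real (iwaH_rot (dg (- (s * c))) (fst \<theta>))"

definition dgQ :: "real \<Rightarrow> real \<times> real \<Rightarrow> complex" where
  "dgQ s \<theta> = - 2 * of_real (iwaH_rot (dg (- (s * d))) (snd \<theta>))"

text \<open>The halves come from the shift by \<open>rho\<close>; the imaginary parts of
  \<open>Lam\<close> are the changes of the angles, paired with the type.\<close>

definition dgR :: "real \<Rightarrow> real \<times> real \<Rightarrow> complex" where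
  "dgR s \<theta> = 1/2 * dgP s \<theta> + 1/2 * dgQ s \<theta>
    + ((- \<i> * of_int (fst n)) * of_real (Im (Lam (dg (- (s * c))) (fst \<theta>)))
      + (- \<i> * of_int (snd n)) * of_real (Im (Lam (dg (- (s * d))) (snd \<theta>))))"

text \<open>This is 2 c times the cosine of twice the first angle. Written in characters it shows
  why the limit moves a type by exactly 2.\<close>

definition dgP' :: "real \<times> real \<Rightarrow> complex" where
  "dgP' \<theta> = of_real c * (chr (2, 0) \<theta> + chr (-2, 0) \<theta>)"

definition dgQ' :: "real \<times> real \<Rightarrow> complex" where
  "dgQ' \<theta> = of_real d * (chr (0, 2) \<theta> + chr (0, -2) \<theta>)"

definition dgR' :: "real \<times> real \<Rightarrow> complex" where
  "dgR' \<theta> = 1/2 * dgP' \<theta> + 1/2 * dgQ' \<theta>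
    + ((of_int (fst n) / 2) * (of_real c * (chr (2, 0) \<theta> - chr (-2, 0) \<theta>))
      + (of_int (snd n) / 2) * (of_real d * (chr (0, 2) \<theta> - chr (0, -2) \<theta>)))"

lemma ps_act_dg_frobenius:
  "ps_act \<mu> (dg2 (s * c, s * d)) (frobenius n v t \<mu>) (rot2 \<theta>)
    = t \<mu> * v * chr n \<theta> * exp (fst \<mu> * dgP s \<theta> + snd \<mu> * dgQ s \<theta> + dgR s \<theta>)"
proof -
  have g: "dg2 (s * c, s * d) \<in> GG" by (simp add: GG_def dg2_def dg_SL2)
  let ?L1 = "of_real (Im (Lam (dg (- (s * c))) (fst \<theta>)))" and ?L2 = "of_real (Im (Lam (dg (- (s * d))) (snd \<theta>)))"
  have "chr n (iwaK_rot (dg (- (s * c))) (fst \<theta>), iwaK_rot (dg (- (s * d))) (snd \<theta>))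
      = chr n \<theta> * exp ((- \<i> * of_int (fst n)) * ?L1 + (- \<i> * of_int (snd n)) * ?L2)"
    by (simp add: chr_def iwaK_rot_dg algebra_simps flip: exp_add)
  moreover have "act_factor \<mu> (dg2 (s * c, s * d)) \<theta> = exp (fst \<mu> * dgP s \<theta> + snd \<mu> * dgQ s \<theta>
      + (1/2 * dgP s \<theta> + 1/2 * dgQ s \<theta>))"
    by (simp add: act_factor_def dg2_def matrix_inv_dg dgP_def dgQ_def algebra_simps)
  ultimately show ?thesis
    unfolding ps_act_rot2[OF g] dgR_def exp_add
    by (simp add: act_pull_def pull_def frobenius_rot2 dg2_def matrix_inv_dg)
qed

lemma smallf_dgPQR:
  "smallf (at 0) norm (\<lambda>s \<theta>. dgP s \<theta> - of_real s * dgP' \<theta>)"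
  "smallf (at 0) norm (\<lambda>s \<theta>. dgQ s \<theta> - of_real s * dgQ' \<theta>)"
  "smallf (at 0) norm (\<lambda>s \<theta>. dgR s \<theta> - of_real s * dgR' \<theta>)"
proof -
  have e: "exp (- 2 * \<i> * of_real (fst \<theta>)) = chr (2, 0) \<theta>" "exp (- 2 * \<i> * of_real (snd \<theta>)) = chr (0, 2) \<theta>" for \<theta>
    by (simp_all add: chr_def algebra_simps)
  have re: "2 * complex_of_real (Re (chr m \<theta>)) = chr m \<theta> + chr (- m) \<theta>"
    and im: "2 * \<i> * complex_of_real (Im (chr m \<theta>)) = chr m \<theta> - chr (- m) \<theta>" for m \<theta>
    unfolding cnj_chr[symmetric] by (simp_all add: complex_eq_iff)
  have reP: "dgP' \<theta> = of_real c * (2 * of_real (Re (chr (2, 0) \<theta>)))"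
    and reQ: "dgQ' \<theta> = of_real d * (2 * of_real (Re (chr (0, 2) \<theta>)))" for \<theta>
    using re[of "(2, 0)" \<theta>] re[of "(0, 2)" \<theta>] by (simp_all add: dgP'_def dgQ'_def)
  have 1: "smallf (at 0) norm (\<lambda>s \<theta>. - 2 * (of_real (iwaH_rot (dg (- (s * c))) (fst \<theta>)) + of_real (s * c) * of_real (Re (chr (2, 0) \<theta>))))"
    by (intro smallf_cmult smallf_iwaH_dg BP_chr e)
  then show P: "smallf (at 0) norm (\<lambda>s \<theta>. dgP s \<theta> - of_real s * dgP' \<theta>)"
    by (simp add: dgP_def reP algebra_simps)
  have 2: "smallf (at 0) norm (\<lambda>s \<theta>. - 2 * (of_real (iwaH_rot (dg (- (s * d))) (snd \<theta>)) + of_real (s * d) * of_real (Re (chr (0, 2) \<theta>))))"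
    by (intro smallf_cmult smallf_iwaH_dg BP_chr e)
  then show Q: "smallf (at 0) norm (\<lambda>s \<theta>. dgQ s \<theta> - of_real s * dgQ' \<theta>)"
    by (simp add: dgQ_def reQ algebra_simps)
  have I: "smallf (at 0) norm (\<lambda>s \<theta>. of_real (Im (Lam (dg (- (s * c))) (fst \<theta>) + of_real (s * c) * chr (2, 0) \<theta>)))"
     "smallf (at 0) norm (\<lambda>s \<theta>. of_real (Im (Lam (dg (- (s * d))) (snd \<theta>) + of_real (s * d) * chr (0, 2) \<theta>)))"
    by (intro smallf_Im smallf_Lam_dg BP_chr e)+
  have R: "smallf (at 0) norm (\<lambda>s \<theta>. 1/2 * (dgP s \<theta> - of_real s * dgP' \<theta>) + 1/2 * (dgQ s \<theta> - of_real s * dgQ' \<theta>)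
     + ((- \<i> * of_int (fst n)) * of_real (Im (Lam (dg (- (s * c))) (fst \<theta>) + of_real (s * c) * chr (2, 0) \<theta>))
      + (- \<i> * of_int (snd n)) * of_real (Im (Lam (dg (- (s * d))) (snd \<theta>) + of_real (s * d) * chr (0, 2) \<theta>))))"
    by (intro smallf_add smallf_cmult P Q I)
  have imI: "\<i> * of_real (Im (of_real r * chr m \<theta>)) = 1/2 * of_real r * (chr m \<theta> - chr (- m) \<theta>)" for r m \<theta>
  proof -
    have "\<i> * of_real (Im (of_real r * chr m \<theta>)) = 1/2 * of_real r * (2 * \<i> * of_real (Im (chr m \<theta>)))" by simp
    then show ?thesis by (simp only: im)
  qed
  have "dgR s \<theta> - of_real s * dgR' \<theta> = 1/2 * (dgP s \<theta> - of_real s * dgP' \<theta>) + 1/2 * (dgQ s \<theta> - of_real s * dgQ' \<theta>)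
     + ((- \<i> * of_int (fst n)) * of_real (Im (Lam (dg (- (s * c))) (fst \<theta>) + of_real (s * c) * chr (2, 0) \<theta>))
      + (- \<i> * of_int (snd n)) * of_real (Im (Lam (dg (- (s * d))) (snd \<theta>) + of_real (s * d) * chr (0, 2) \<theta>)))" for s \<theta>
  proof -
    have "(- \<i> * of_int p) * of_real (Im (L + of_real r * chr m \<theta>))
       = (- \<i> * of_int p) * of_real (Im L) - of_int p * (1/2 * of_real r * (chr m \<theta> - chr (- m) \<theta>))" for p L r m
      unfolding imI[symmetric] by (simp add: algebra_simps)
    note * = this[of _ _ _ "(2, 0)"] this[of _ _ _ "(0, 2)"]
    show ?thesis unfolding * dgR_def dgR'_def by (simp add: algebra_simps)
  qed
  then show "smallf (at 0) norm (\<lambda>s \<theta>. dgR s \<theta> - of_real s * dgR' \<theta>)" using R by (simp only:)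
qed

lemma BP_dgPQR: "dgP' \<in> BP" "dgQ' \<in> BP" "dgR' \<in> BP"
proof -
  show 1: "dgP' \<in> BP" "dgQ' \<in> BP"
    unfolding dgP'_def[abs_def] dgQ'_def[abs_def] by (intro BP_cmult BP_add BP_chr)+
  show "dgR' \<in> BP"
    unfolding dgR'_def[abs_def] by (intro BP_add BP_cmult BP_diff 1 BP_chr)
qed

text \<open>The Lie algebra of A acting in direction (c, d). Multiplying \<open>chr n\<close> by the
  characters in dgP' and dgR' shifts the type by 2, and the coefficients collect \<lambda> from
  dgP', 1/2 from \<open>rho\<close> and n/2 or -n/2 from the angle.\<close>

definition dg_limit :: "complex \<Rightarrow> (c2 \<Rightarrow> complex) \<Rightarrow> c2 \<Rightarrow> grp \<Rightarrow> complex" where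
  "dg_limit v t \<mu> k =
     of_real c * (frobenius (n + (2, 0)) v (\<lambda>\<mu>. (fst \<mu> + (1 + of_int (fst n)) / 2) * t \<mu>) \<mu> k
                + frobenius (n - (2, 0)) v (\<lambda>\<mu>. (fst \<mu> + (1 - of_int (fst n)) / 2) * t \<mu>) \<mu> k) +
     of_real d * (frobenius (n + (0, 2)) v (\<lambda>\<mu>. (snd \<mu> + (1 + of_int (snd n)) / 2) * t \<mu>) \<mu> k
                + frobenius (n - (0, 2)) v (\<lambda>\<mu>. (snd \<mu> + (1 - of_int (snd n)) / 2) * t \<mu>) \<mu> k)"

lemma dg_limit_rot2:
  "dg_limit v t \<mu> (rot2 \<theta>) = t \<mu> * (v * chr n \<theta> * (fst \<mu> * dgP' \<theta> + snd \<mu> * dgQ' \<theta> + dgR' \<theta>))"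
proof -
  have "chr (n + (2, 0)) \<theta> = chr n \<theta> * chr (2, 0) \<theta>" "chr (n - (2, 0)) \<theta> = chr n \<theta> * chr (-2, 0) \<theta>"
    "chr (n + (0, 2)) \<theta> = chr n \<theta> * chr (0, 2) \<theta>" "chr (n - (0, 2)) \<theta> = chr n \<theta> * chr (0, -2) \<theta>"
    using chr_add[of n] by (simp_all add: diff_conv_add_uminus del: add_uminus_conv_diff)
  then show ?thesis
    unfolding dg_limit_def frobenius_rot2 dgR'_def dgP'_def dgQ'_def by (simp add: field_simps)
qed

text \<open>The germ t does not depend on s, so Leibniz' rule in the parameter reduces the claim to
  \<open>smallf_pd_exp\<close> for the derivatives of the other factor.\<close>

lemma dg_quotient_converges:
  assumes t: "t \<in> germ_Hom n \<sigma> \<nu>"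
  shows "((\<lambda>s. smooth_norm i j (\<lambda>k. param_deriv a b \<nu>
       (\<lambda>\<mu> k. of_real (1 / s) * (ps_act \<mu> (dg2 (s * c, s * d)) (frobenius n v t \<mu>) k + - 1 * frobenius n v t \<mu> k)) k
       - param_deriv a b \<nu> (dg_limit v t) k)) \<longlongrightarrow> 0) (at 0)"
proof -
  obtain U where U: "open U" "\<nu> \<in> U" "hol2_on t U" using t by (auto simp: germ_Hom_def)
  obtain A B where AB: "open A" "open B" "\<nu> \<in> A \<times> B" "A \<times> B \<subseteq> U"
    using open_prod_elim[OF U(1,2)] by metis
  have tAB: "sep_hol (\<lambda>z w. t (z, w)) A B"
    using hol2_on_imp_sep_hol[OF hol2_on_subset[OF U(3) AB(4)] AB(1,2)] .
  have zw: "fst \<nu> \<in> A" "snd \<nu> \<in> B" using AB(3) by auto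
  define K where "K s \<theta> z w = of_real (1 / s) * (exp (z * dgP s \<theta> + w * dgQ s \<theta> + dgR s \<theta>) - 1)
      - (z * dgP' \<theta> + w * dgQ' \<theta> + dgR' \<theta>)" for s \<theta> z w
  define G where "G s \<theta> z w = v * chr n \<theta> * (of_real (1 / s) * (exp (z * dgP s \<theta> + w * dgQ s \<theta> + dgR s \<theta>) - 1))" for s \<theta> z w
  define G' where "G' \<theta> z w = v * chr n \<theta> * (z * dgP' \<theta> + w * dgQ' \<theta> + dgR' \<theta>)" for \<theta> z w
  have sh: "sep_hol (K s \<theta>) A B" "sep_hol (G s \<theta>) A B" "sep_hol (G' \<theta>) A B" for s \<theta>
    unfolding K_def G_def G'_def
    by (rule sep_hol_subset[OF sep_hol_UNIV_I AB(1,2)], intro hol2_intros hol2_on_exp)+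
  let ?D = "\<lambda>s k. param_deriv a b \<nu>
       (\<lambda>\<mu> k. of_real (1 / s) * (ps_act \<mu> (dg2 (s * c, s * d)) (frobenius n v t \<mu>) k + - 1 * frobenius n v t \<mu> k)) k
       - param_deriv a b \<nu> (dg_limit v t) k"
  have eq: "?D s (rot2 \<theta>) = (\<Sum>j=0..b. \<Sum>i=0..a. (of_nat (b choose j) * of_nat (a choose i)
      * pd (\<lambda>z w. t (z, w)) i j (fst \<nu>) (snd \<nu>) * v * chr n \<theta>) * pd (K s \<theta>) (a - i) (b - j) (fst \<nu>) (snd \<nu>))" for s \<theta>
  proof -
    have "?D s (rot2 \<theta>) = pd (\<lambda>z w. t (z, w) * G s \<theta> z w) a b (fst \<nu>) (snd \<nu>)
        - pd (\<lambda>z w. t (z, w) * G' \<theta> z w) a b (fst \<nu>) (snd \<nu>)"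
      unfolding param_deriv_pd ps_act_dg_frobenius frobenius_rot2 dg_limit_rot2 G_def G'_def
      by (simp add: algebra_simps)
    also have "\<dots> = pd (\<lambda>z w. t (z, w) * G s \<theta> z w - t (z, w) * G' \<theta> z w) a b (fst \<nu>) (snd \<nu>)"
      by (rule pd_diff[OF zw sep_hol_mult[OF tAB sh(2)] sep_hol_mult[OF tAB sh(3)], symmetric])
    also have "(\<lambda>z w. t (z, w) * G s \<theta> z w - t (z, w) * G' \<theta> z w) = (\<lambda>z w. v * chr n \<theta> * (t (z, w) * K s \<theta> z w))"
      by (simp add: fun_eq_iff K_def G_def G'_def algebra_simps)
    also have "pd \<dots> a b (fst \<nu>) (snd \<nu>) = v * chr n \<theta> * pd (\<lambda>z w. t (z, w) * K s \<theta> z w) a b (fst \<nu>) (snd \<nu>)"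
      by (rule pd_cmult[OF sep_hol_mult[OF tAB sh(1)] zw])
    finally show ?thesis
      unfolding pd_mult[OF zw tAB sh(1)] by (simp add: sum_distrib_left mult_ac)
  qed
  have "smallf (at 0) (\<lambda>_. 1) (\<lambda>s \<theta>. ?D s (rot2 \<theta>))"
    unfolding eq
  proof (intro smallf_sum finite_atLeastAtMost)
    fix i j
    have "smallf (at 0) (\<lambda>_. 1) (\<lambda>s \<theta>. pd (K s \<theta>) (a - i) (b - j) (fst \<nu>) (snd \<nu>))"
      unfolding K_def by (rule smallf_pd_exp[OF BP_dgPQR smallf_dgPQR])
    from smallf_mult[OF bigf_const[OF BP_cmult[OF BP_chr]] this]
    show "smallf (at 0) (\<lambda>_. 1) (\<lambda>s \<theta>. (of_nat (b choose j) * of_nat (a choose i)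
      * pd (\<lambda>z w. t (z, w)) i j (fst \<nu>) (snd \<nu>) * v * chr n \<theta>) * pd (K s \<theta>) (a - i) (b - j) (fst \<nu>) (snd \<nu>))"
      by simp
  qed
  then have "(\<lambda>s. smooth_norm i j (?D s)) \<in> o[at 0](\<lambda>_. 1)"
    using smallf_supn[of "\<lambda>s \<theta>. ?D s (rot2 \<theta>)" "at 0" "\<lambda>_. 1"]
    by (simp add: smallf_def smooth_norm_def supn_def)
  from smalloD_tendsto[OF this] show ?thesis by simp
qed

end

lemma ps_act_rot2_frobenius:
  assumes "k \<in> KK"
  shows "ps_act \<mu> (rot2 \<alpha>) (frobenius m v t \<mu>) k = inverse (chr m \<alpha>) * frobenius m v t \<mu> k"
proof -
  obtain \<theta> where k: "k = rot2 \<theta>" using assms KK_obtain by blast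
  have "matrix_inv (rot x) = rot (- x)" for x
    by (rule matrix_inv_eqI) (simp_all add: rot_rot rot_0)
  then have "ginv (rot2 \<alpha>) \<odot> rot2 \<theta> = rot2 (\<theta> - \<alpha>)"
    by (simp add: ginv_def rot2_def gmul_def rot_rot)
  moreover have "chr m (\<theta> - \<alpha>) = inverse (chr m \<alpha>) * chr m \<theta>"
    by (simp add: chr_def algebra_simps flip: exp_add exp_minus)
  ultimately show ?thesis
    by (simp add: k ps_act_def rot2_KK ps_extend_restrict frobenius_rot2)
qed

lemma hol2_on_power: "hol2_on f U \<Longrightarrow> hol2_on (\<lambda>\<mu>. f \<mu> ^ k) U"
  by (induction k) (auto intro: hol2_intros)

section \<open>Ladder operators on an intertwining datum\<close>

locale intertwining =
  fixes \<xi> :: "datum list" and W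
  assumes datum: "intertwining_datum \<xi> W"
begin

abbreviation "len \<equiv> length \<xi>"

definition sg :: "nat \<Rightarrow> grp \<Rightarrow> complex" where "sg i = fst (\<xi> ! i)"
definition nu :: "nat \<Rightarrow> c2" where "nu i = fst (snd (\<xi> ! i))"
definition dd :: "nat \<Rightarrow> nat" where "dd i = snd (snd (\<xi> ! i))"

lemma nth_datum: "\<xi> ! i = (sg i, nu i, dd i)"
  by (simp add: sg_def nu_def dd_def)

abbreviation tup :: "(nat \<Rightarrow> 'b) \<Rightarrow> 'b list" where "tup f \<equiv> map f [0..<len]"

lemma H_tuples_iff: "tup \<Phi> \<in> H_tuples \<xi> \<longleftrightarrow> (\<forall>i<len. \<Phi> i \<in> germ_H (sg i) (nu i))"
  by (simp add: H_tuples_def list_all2_conv_all_nth nth_datum)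

lemma Hom_tuples_iff: "tup t \<in> Hom_tuples n \<xi> \<longleftrightarrow> (\<forall>i<len. t i \<in> germ_Hom n (sg i) (nu i))"
  by (simp add: Hom_tuples_def list_all2_conv_all_nth nth_datum)

lemma Hom_classes_tup:
  "Hom_classes n \<xi> (tup t) = tup (\<lambda>i. jet_class (*) (nu i) (dd i) (germ_Hom n (sg i) (nu i)) (t i))"
  by (rule nth_equalityI) (auto simp: Hom_classes_def nth_datum)

lemma Hom_classes_eq_iff:
  "Hom_classes n \<xi> (tup t) = Hom_classes n \<xi> (tup t') \<longleftrightarrow>
    (\<forall>i<len. jet_class (*) (nu i) (dd i) (germ_Hom n (sg i) (nu i)) (t i)
           = jet_class (*) (nu i) (dd i) (germ_Hom n (sg i) (nu i)) (t' i))"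
  unfolding Hom_classes_tup map_eq_conv by auto

definition V :: "(nat \<Rightarrow> c2 \<Rightarrow> grp \<Rightarrow> complex) set" where
  "V = {\<Phi>. tup \<Phi> \<in> H_tuples \<xi> \<and> H_classes \<xi> (tup \<Phi>) \<in> W}"

lemma subrep: "subrep \<xi> W"
  using datum by (simp add: intertwining_datum_def)

lemma V_lincomb:
  assumes "\<Phi> \<in> V" "\<Psi> \<in> V"
  shows "(\<lambda>i \<mu> k. \<Phi> i \<mu> k + c * \<Psi> i \<mu> k) \<in> V"
proof -
  have "H_classes \<xi> (map2 (\<lambda>\<phi> \<psi> \<mu> k. \<phi> \<mu> k + c * \<psi> \<mu> k) (tup \<Phi>) (tup \<Psi>)) \<in> W"
    using subrep assms by (simp add: subrep_def V_def)
  then show ?thesis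
    using assms germ_H_lincomb by (simp add: V_def map2_map_map H_tuples_iff)
qed

lemma V_act:
  assumes "\<Phi> \<in> V" "g \<in> GG"
  shows "(\<lambda>i \<mu>. ps_act \<mu> g (\<Phi> i \<mu>)) \<in> V"
proof -
  have "H_classes \<xi> (map (\<lambda>\<phi> \<mu>. ps_act \<mu> g (\<phi> \<mu>)) (tup \<Phi>)) \<in> W"
    using subrep assms unfolding subrep_def V_def by blast
  then show ?thesis
    using assms germ_H_ps_act by (simp add: V_def o_def H_tuples_iff)
qed

lemma V_scale:
  assumes "\<Phi> \<in> V"
  shows "(\<lambda>i \<mu> k. c * \<Phi> i \<mu> k) \<in> V"
  using V_lincomb[OF assms assms, of "c - 1"] by (simp add: algebra_simps)

lemma V_closed:
  assumes "\<And>N. \<Phi> N \<in> V" "\<And>i. i < len \<Longrightarrow> \<phi> i \<in> germ_H (sg i) (nu i)"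
    and "\<And>i a b p q. i < len \<Longrightarrow>
      (\<lambda>N. smooth_norm p q (\<lambda>k. param_deriv a b (nu i) (\<Phi> N i) k - param_deriv a b (nu i) (\<phi> i) k)) \<longlonglongrightarrow> 0"
  shows "\<phi> \<in> V"
proof -
  have cl: "closed_in_H \<xi> W" using datum by (simp add: intertwining_datum_def)
  have t: "tup \<phi> \<in> H_tuples \<xi>" using assms(2) by (simp add: H_tuples_iff)
  have "H_classes \<xi> (tup \<phi>) \<in> W"
  proof (rule cl[unfolded closed_in_H_def, rule_format, of "\<lambda>N. tup (\<Phi> N)"])
    show "tup (\<Phi> N) \<in> H_tuples \<xi> \<and> H_classes \<xi> (tup (\<Phi> N)) \<in> W" for N
      using assms(1)[of N] by (simp add: V_def)
    show "jet_converges (\<xi> ! i) (\<lambda>N. tup (\<Phi> N) ! i) (tup \<phi> ! i)" if "i < len" for i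
      using assms(3)[OF that] that by (simp add: nth_datum)
  qed (rule t)
  with t show ?thesis by (simp add: V_def)
qed

text \<open>The germs behind \<open>D_space n \<xi> W\<close>. With germs in place of classes the
  ladder multiplies actual functions, and classes return only at the end.\<close>

definition T :: "int \<times> int \<Rightarrow> (nat \<Rightarrow> c2 \<Rightarrow> complex) set" where
  "T n = {t. (\<forall>i<len. t i \<in> germ_Hom n (sg i) (nu i)) \<and> (\<forall>v. (\<lambda>i. frobenius n v (t i)) \<in> V)}"

lemma T_dg_limit:
  assumes t: "t \<in> T n"
  shows "(\<lambda>i. dg_limit c d n v (t i)) \<in> V"
proof -
  let ?s = "\<lambda>N. inverse (real (Suc N))"
  let ?\<Phi> = "\<lambda>s i \<mu> k. of_real (1 / s) * (ps_act \<mu> (dg2 (s * c, s * d)) (frobenius n v (t i) \<mu>) k + - 1 * frobenius n v (t i) \<mu> k)"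
  have s: "filterlim ?s (at 0) sequentially"
    unfolding filterlim_at using LIMSEQ_inverse_real_of_nat by simp
  have g: "dg2 x \<in> GG" for x by (simp add: GG_def dg2_def dg_SL2)
  have f: "(\<lambda>i. frobenius n v (t i)) \<in> V" using t by (simp add: T_def)
  have ti: "t i \<in> germ_Hom n (sg i) (nu i)" if "i < len" for i using t that by (simp add: T_def)
  show ?thesis
  proof (rule V_closed[of "\<lambda>N. ?\<Phi> (?s N)"])
    show "?\<Phi> (?s N) \<in> V" for N
      using V_scale[OF V_lincomb[OF V_act[OF f g[of "(?s N * c, ?s N * d)"]] f, of "- 1"], of "of_real (1 / ?s N)"] by simp
    show "(\<lambda>N. smooth_norm p q (\<lambda>k. param_deriv a b (nu i) (?\<Phi> (?s N) i) k
        - param_deriv a b (nu i) (dg_limit c d n v (t i)) k)) \<longlonglongrightarrow> 0" if "i < len" for i a b p q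
      by (rule filterlim_compose[OF dg_quotient_converges[OF ti[OF that]] s])
    show "dg_limit c d n v (t i) \<in> germ_H (sg i) (nu i)" if i: "i < len" for i
    proof -
      have *: "frobenius m v (\<lambda>\<mu>. f \<mu> * t i \<mu>) \<in> germ_H (sg i) (nu i)"
        if "hol2_on f UNIV" "fst m mod 2 = fst n mod 2" "snd m mod 2 = snd n mod 2" for m f
        using hol_at_germ_Hom[OF hol_at_UNIV[OF that(1)] ti[OF i]] germ_Hom_parity[OF that(2,3)]
        by (intro frobenius_germ_H) simp
      \<comment> \<open>The zero germ, a germ minus itself, starts the combination because
        \<open>germ_H_lincomb\<close> scales only its second argument.\<close>
      have z: "(\<lambda>\<mu> k. 0) \<in> germ_H (sg i) (nu i)"
        using germ_H_lincomb[OF frobenius_germ_H[OF ti[OF i]] frobenius_germ_H[OF ti[OF i]], of 0 "-1" 0] by simp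
      have h: "hol2_on (\<lambda>\<mu>. fst \<mu> + x) UNIV" "hol2_on (\<lambda>\<mu>. snd \<mu> + x) UNIV" for x
        by (intro hol2_intros)+
      have "(\<lambda>\<mu> k. (((0 + of_real c * frobenius (n + (2, 0)) v (\<lambda>\<mu>. (fst \<mu> + (1 + of_int (fst n)) / 2) * t i \<mu>) \<mu> k)
         + of_real c * frobenius (n - (2, 0)) v (\<lambda>\<mu>. (fst \<mu> + (1 - of_int (fst n)) / 2) * t i \<mu>) \<mu> k)
         + of_real d * frobenius (n + (0, 2)) v (\<lambda>\<mu>. (snd \<mu> + (1 + of_int (snd n)) / 2) * t i \<mu>) \<mu> k)
         + of_real d * frobenius (n - (0, 2)) v (\<lambda>\<mu>. (snd \<mu> + (1 - of_int (snd n)) / 2) * t i \<mu>) \<mu> k) \<in> germ_H (sg i) (nu i)"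
        by (intro germ_H_lincomb z * h) simp_all
      then show ?thesis by (simp add: dg_limit_def[abs_def] algebra_simps)
    qed
  qed
qed

text \<open>The rotation by \<alpha> multiplies the two summands by different scalars, so a 2 by 2
  linear system recovers each of them from the sum and its translate.\<close>

lemma V_frobenius_separate:
  assumes V: "(\<lambda>i \<mu> k. frobenius m v (t i) \<mu> k + frobenius m' v (t' i) \<mu> k) \<in> V"
    and \<alpha>: "chr m \<alpha> \<noteq> chr m' \<alpha>"
  shows "(\<lambda>i. frobenius m v (t i)) \<in> V" "(\<lambda>i. frobenius m' v (t' i)) \<in> V"
proof -
  let ?A = "\<lambda>i. frobenius m v (t i)" and ?B = "\<lambda>i. frobenius m' v (t' i)"
  let ?a = "inverse (chr m \<alpha>)" and ?b = "inverse (chr m' \<alpha>)"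
  have g: "rot2 \<alpha> \<in> GG" by (intro KK_GG rot2_KK)
  have act: "ps_act \<mu> (rot2 \<alpha>) (\<lambda>k. ?A i \<mu> k + ?B i \<mu> k) = (\<lambda>k. ?a * ?A i \<mu> k + ?b * ?B i \<mu> k)" for i \<mu>
  proof
    fix k
    show "ps_act \<mu> (rot2 \<alpha>) (\<lambda>k. ?A i \<mu> k + ?B i \<mu> k) k = ?a * ?A i \<mu> k + ?b * ?B i \<mu> k"
    proof (cases "k \<in> KK")
    case True
    have "ps_act \<mu> (rot2 \<alpha>) (\<lambda>k. ?A i \<mu> k + ?B i \<mu> k) k = ps_act \<mu> (rot2 \<alpha>) (?A i \<mu>) k + ps_act \<mu> (rot2 \<alpha>) (?B i \<mu>) k"
      using True by (simp add: ps_act_def ps_extend_def algebra_simps)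
    then show ?thesis using True by (simp add: ps_act_rot2_frobenius)
    qed (simp add: ps_act_def frobenius_def)
  qed
  have 1: "(\<lambda>i \<mu> k. ?a * ?A i \<mu> k + ?b * ?B i \<mu> k) \<in> V"
    using V_act[OF V g] by (simp only: act)
  have ab: "?a - ?b \<noteq> 0" "?b - ?a \<noteq> 0" using \<alpha> by auto
  have "(\<lambda>i \<mu> k. inverse (?a - ?b) * ((?a * ?A i \<mu> k + ?b * ?B i \<mu> k) + (- ?b) * (?A i \<mu> k + ?B i \<mu> k))) \<in> V"
    by (intro V_scale V_lincomb V 1)
  moreover have "inverse (?a - ?b) * ((?a * x + ?b * y) + (- ?b) * (x + y)) = x" for x y
  proof -
    have "(?a * x + ?b * y) + (- ?b) * (x + y) = (?a - ?b) * x" by (simp add: algebra_simps)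
    then show ?thesis using ab by simp
  qed
  ultimately show "?A \<in> V" by simp
  have "(\<lambda>i \<mu> k. inverse (?b - ?a) * ((?a * ?A i \<mu> k + ?b * ?B i \<mu> k) + (- ?a) * (?A i \<mu> k + ?B i \<mu> k))) \<in> V"
    by (intro V_scale V_lincomb V 1)
  moreover have "inverse (?b - ?a) * ((?a * x + ?b * y) + (- ?a) * (x + y)) = y" for x y
  proof -
    have "(?a * x + ?b * y) + (- ?a) * (x + y) = (?b - ?a) * y" by (simp add: algebra_simps)
    then show ?thesis using ab by simp
  qed
  ultimately show "?B \<in> V" by simp
qed

text \<open>The types p + 2 and p - 2 differ by 4, so at the angle pi/4 their characters differ by
  the factor exp(-i pi) = -1.\<close>

lemma exp_i_half_pi_shift: "exp (- \<i> * (of_int (p + 2) * of_real (pi / 4) + z)) \<noteq> exp (- \<i> * (of_int (p - 2) * of_real (pi / 4) + z))"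
proof -
  have "exp (- \<i> * (of_int (p + 2) * of_real (pi / 4) + z))
      = exp (- \<i> * (of_int (p - 2) * of_real (pi / 4) + z)) * exp (- (of_real pi * \<i>))"
    by (simp add: field_simps flip: exp_add)
  then show ?thesis by (simp add: exp_minus)
qed

lemma germ_Hom_hol2_mult:
  assumes "t i \<in> germ_Hom n (sg i) (nu i)" "hol2_on f UNIV" "fst m mod 2 = fst n mod 2" "snd m mod 2 = snd n mod 2"
  shows "(\<lambda>\<mu>. f \<mu> * t i \<mu>) \<in> germ_Hom m (sg i) (nu i)"
  using hol_at_germ_Hom[OF hol_at_UNIV[OF assms(2)] assms(1)] germ_Hom_parity[OF assms(3,4)] by simp

lemma T_step:
  assumes t: "t \<in> T n"
  shows "(\<lambda>i \<mu>. (fst \<mu> + (1 + of_int (fst n)) / 2) * t i \<mu>) \<in> T (n + (2, 0))"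
    "(\<lambda>i \<mu>. (fst \<mu> + (1 - of_int (fst n)) / 2) * t i \<mu>) \<in> T (n - (2, 0))"
    "(\<lambda>i \<mu>. (snd \<mu> + (1 + of_int (snd n)) / 2) * t i \<mu>) \<in> T (n + (0, 2))"
    "(\<lambda>i \<mu>. (snd \<mu> + (1 - of_int (snd n)) / 2) * t i \<mu>) \<in> T (n - (0, 2))"
proof -
  have ti: "t i \<in> germ_Hom n (sg i) (nu i)" if "i < len" for i using t that by (simp add: T_def)
  have h: "hol2_on (\<lambda>\<mu>. fst \<mu> + x) UNIV" "hol2_on (\<lambda>\<mu>. snd \<mu> + x) UNIV" for x
    by (intro hol2_intros)+
  have c1: "chr (n + (2, 0)) (pi / 4, 0) \<noteq> chr (n - (2, 0)) (pi / 4, 0)"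
    using exp_i_half_pi_shift[of "fst n" 0] by (simp add: chr_def)
  have c2: "chr (n + (0, 2)) (0, pi / 4) \<noteq> chr (n - (0, 2)) (0, pi / 4)"
    using exp_i_half_pi_shift[of "snd n" 0] by (simp add: chr_def)
  \<comment> \<open>The direction (c, d) = (1, 0) moves only the first factor, (0, 1) only the
    second.\<close>
  note 1 = V_frobenius_separate[OF T_dg_limit[OF t, of 1 0, unfolded dg_limit_def[abs_def], simplified] c1]
  note 2 = V_frobenius_separate[OF T_dg_limit[OF t, of 0 1, unfolded dg_limit_def[abs_def], simplified] c2]
  show "(\<lambda>i \<mu>. (fst \<mu> + (1 + of_int (fst n)) / 2) * t i \<mu>) \<in> T (n + (2, 0))"
    "(\<lambda>i \<mu>. (fst \<mu> + (1 - of_int (fst n)) / 2) * t i \<mu>) \<in> T (n - (2, 0))"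
    "(\<lambda>i \<mu>. (snd \<mu> + (1 + of_int (snd n)) / 2) * t i \<mu>) \<in> T (n + (0, 2))"
    "(\<lambda>i \<mu>. (snd \<mu> + (1 - of_int (snd n)) / 2) * t i \<mu>) \<in> T (n - (0, 2))"
    using 1 2 by (auto simp: T_def intro!: germ_Hom_hol2_mult[OF ti] h)
qed

end

section \<open>The ladder polynomials\<close>

definition up :: "nat \<Rightarrow> int \<Rightarrow> complex \<Rightarrow> complex" where
  "up k n z = (\<Prod>j<k. z + (1 + of_int n) / 2 + of_nat j)"

text \<open>Despite the distinction of signs, \<open>qpoly\<close> is one product of the raising
  factors z + (1 + m)/2 for m = n, n + 2, up to n + 2 k - 2. Its definition lists them in increasing
  order for n > 0 and in decreasing order in the other cases, hence the reindexing.\<close>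

lemma qpoly_up: "qpoly (n + 2 * int k) n z = up k n z"
proof -
  let ?l = "n + 2 * int k"
  consider "k = 0" | "k > 0" "n > 0" | "k > 0" "?l < 0" | "k > 0" "n \<le> 0" "0 \<le> ?l" by linarith
  then show ?thesis
  proof cases
    case 2
    then have "nat ((\<bar>?l\<bar> - \<bar>n\<bar>) div 2) = k" "?l * n > 0" by auto
    then show ?thesis using 2 by (simp add: qpoly_def up_def add_ac add_divide_distrib)
  next
    case 3
    then have *: "nat ((\<bar>n\<bar> - \<bar>?l\<bar>) div 2) = k" "?l * n > 0" "\<bar>?l\<bar> < \<bar>n\<bar>" by (auto simp: mult_neg_neg)
    have "up k n z = (\<Prod>j<k. z + (1 + of_int n) / 2 + of_nat (k - Suc j))"
      unfolding up_def by (rule prod.nat_diff_reindex[symmetric])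
    also have "\<dots> = (\<Prod>j<k. z - ((of_int \<bar>?l\<bar> + 1) / 2 + of_nat j))"
    proof (rule prod.cong)
      fix j assume "j \<in> {..<k}"
      then have e1: "of_nat (k - Suc j) = (of_nat k - 1 - of_nat j :: complex)" by (simp add: of_nat_diff algebra_simps)
      have "\<bar>?l\<bar> = - n - 2 * int k" using 3 by simp
      then have e2: "of_int \<bar>?l\<bar> = (- of_int n - 2 * of_nat k :: complex)" by simp
      show "z + (1 + of_int n) / 2 + of_nat (k - Suc j) = z - ((of_int \<bar>?l\<bar> + 1) / 2 + of_nat j)"
        unfolding e1 e2 by (simp add: field_simps)
    qed simp
    finally show ?thesis using * 3 by (simp add: qpoly_def)
  next
    case 4
    then have *: "nat ((\<bar>?l\<bar> + \<bar>n\<bar>) div 2) = k" "\<not> ?l * n > 0" by (auto simp: mult_nonneg_nonpos not_less)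
    have "up k n z = (\<Prod>j<k. z + (1 + of_int n) / 2 + of_nat (k - Suc j))"
      unfolding up_def by (rule prod.nat_diff_reindex[symmetric])
    also have "\<dots> = (\<Prod>j<k. z + ((of_int \<bar>?l\<bar> - 1) / 2 - of_nat j))"
    proof (rule prod.cong)
      fix j assume "j \<in> {..<k}"
      then have e1: "of_nat (k - Suc j) = (of_nat k - 1 - of_nat j :: complex)" by (simp add: of_nat_diff algebra_simps)
      have "\<bar>?l\<bar> = n + 2 * int k" using 4 by simp
      then have e2: "of_int \<bar>?l\<bar> = (of_int n + 2 * of_nat k :: complex)" by simp
      show "z + (1 + of_int n) / 2 + of_nat (k - Suc j) = z + ((of_int \<bar>?l\<bar> - 1) / 2 - of_nat j)"
        unfolding e1 e2 by (simp add: field_simps)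
    qed simp
    finally show ?thesis using * 4 by (simp add: qpoly_def)
  qed (simp add: qpoly_def up_def)
qed

lemma qpoly_minus: "qpoly (- p) (- q) z = qpoly p q z"
  by (simp add: qpoly_def)

lemma qpoly_down: "qpoly (n - 2 * int k) n z = up k (- n) z"
  using qpoly_up[of "- n" k z] qpoly_minus[of "n - 2 * int k" n z] by simp

lemma parity_cases:
  assumes "(l::int) mod 2 = n mod 2"
  obtains k where "l = n + 2 * int k" | k where "l = n - 2 * int k"
proof -
  obtain m where m: "l = n + 2 * m" using assms by (metis mod_eqE add.commute add_diff_cancel_left' diff_add_cancel)
  show ?thesis
  proof (cases "m \<ge> 0")
    case True
    then show ?thesis using that(1)[of "nat m"] m by simp
  next
    case False
    then show ?thesis using that(2)[of "nat (- m)"] m by simp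
  qed
qed

lemma up_Suc: "up (Suc k) n z = up k n z * (z + (1 + of_int n) / 2 + of_nat k)"
  by (simp add: up_def)

lemma hol2_on_up: "hol2_on (\<lambda>\<mu>. up k n (fst \<mu>)) U" "hol2_on (\<lambda>\<mu>. up k n (snd \<mu>)) U"
  unfolding up_def by (intro hol2_intros)+

section \<open>Sufficiency: multiplication by q and by even entire functions\<close>

context intertwining
begin

lemma T_up_fst: "t \<in> T n \<Longrightarrow> (\<lambda>i \<mu>. up k (fst n) (fst \<mu>) * t i \<mu>) \<in> T (n + (2 * int k, 0))"
proof (induction k)
  case (Suc k)
  have "n + (2 * int k, 0) + (2, 0) = n + (2 * int (Suc k), 0)" by (simp add: prod_eq_iff)
  then show ?case
    using T_step(1)[OF Suc.IH[OF Suc.prems]] by (simp add: up_Suc field_simps)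
qed (simp add: up_def flip: zero_prod_def)

lemma T_down_fst: "t \<in> T n \<Longrightarrow> (\<lambda>i \<mu>. up k (- fst n) (fst \<mu>) * t i \<mu>) \<in> T (n - (2 * int k, 0))"
proof (induction k)
  case (Suc k)
  have "n - (2 * int k, 0) - (2, 0) = n - (2 * int (Suc k), 0)" by (simp add: prod_eq_iff)
  then show ?case
    using T_step(2)[OF Suc.IH[OF Suc.prems]] by (simp add: up_Suc field_simps)
qed (simp add: up_def flip: zero_prod_def)

lemma T_up_snd: "t \<in> T n \<Longrightarrow> (\<lambda>i \<mu>. up k (snd n) (snd \<mu>) * t i \<mu>) \<in> T (n + (0, 2 * int k))"
proof (induction k)
  case (Suc k)
  have "n + (0, 2 * int k) + (0, 2) = n + (0, 2 * int (Suc k))" by (simp add: prod_eq_iff)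
  then show ?case
    using T_step(3)[OF Suc.IH[OF Suc.prems]] by (simp add: up_Suc field_simps)
qed (simp add: up_def flip: zero_prod_def)

lemma T_down_snd: "t \<in> T n \<Longrightarrow> (\<lambda>i \<mu>. up k (- snd n) (snd \<mu>) * t i \<mu>) \<in> T (n - (0, 2 * int k))"
proof (induction k)
  case (Suc k)
  have "n - (0, 2 * int k) - (0, 2) = n - (0, 2 * int (Suc k))" by (simp add: prod_eq_iff)
  then show ?case
    using T_step(4)[OF Suc.IH[OF Suc.prems]] by (simp add: up_Suc field_simps)
qed (simp add: up_def flip: zero_prod_def)

lemma T_qpoly:
  assumes "fst l mod 2 = fst n mod 2" "snd l mod 2 = snd n mod 2" "t \<in> T n"
  shows "(\<lambda>i \<mu>. (qpoly (fst l) (fst n) (fst \<mu>) * qpoly (snd l) (snd n) (snd \<mu>)) * t i \<mu>) \<in> T l"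
proof -
  have fst_step: "(\<lambda>i \<mu>. qpoly (fst l) (fst n) (fst \<mu>) * t i \<mu>) \<in> T (fst l, snd n)"
    using assms(1)
  proof (cases rule: parity_cases)
    case (1 k)
    then have "n + (2 * int k, 0) = (fst l, snd n)" by (simp add: prod_eq_iff)
    then show ?thesis using T_up_fst[OF assms(3), of k] 1 by (simp add: qpoly_up)
  next
    case (2 k)
    then have "n - (2 * int k, 0) = (fst l, snd n)" by (simp add: prod_eq_iff)
    then show ?thesis using T_down_fst[OF assms(3), of k] 2 by (simp add: qpoly_down)
  qed
  from assms(2) show ?thesis
  proof (cases rule: parity_cases)
    case (1 k)
    then have "(fst l, snd n) + (0, 2 * int k) = l" by (simp add: prod_eq_iff)
    moreover have "qpoly (snd l) (snd n) = up k (snd n)" using 1 by (simp only: qpoly_up fun_eq_iff) simp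
    ultimately show ?thesis using T_up_snd[OF fst_step, of k] by (simp add: mult_ac)
  next
    case (2 k)
    then have "(fst l, snd n) - (0, 2 * int k) = l" by (simp add: prod_eq_iff)
    moreover have "qpoly (snd l) (snd n) = up k (- snd n)" using 2 by (simp only: qpoly_down fun_eq_iff) simp
    ultimately show ?thesis using T_down_snd[OF fst_step, of k] by (simp add: mult_ac)
  qed
qed

lemma T_add:
  assumes "t \<in> T n" "t' \<in> T n"
  shows "(\<lambda>i \<mu>. t i \<mu> + c * t' i \<mu>) \<in> T n"
proof -
  have "(\<lambda>\<mu>. t i \<mu> + c * t' i \<mu>) \<in> germ_Hom n (sg i) (nu i)" if "i < len" for i
  proof -
    have "t i \<in> germ_Hom n (sg i) (nu i)" "t' i \<in> germ_Hom n (sg i) (nu i)"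
      using assms that by (auto simp: T_def)
    then obtain U U' where "open U" "nu i \<in> U" "hol2_on (t i) U" "\<forall>\<mu>\<in>U. t i \<mu> \<in> Hom_M n (sg i)"
      "open U'" "nu i \<in> U'" "hol2_on (t' i) U'" "\<forall>\<mu>\<in>U'. t' i \<mu> \<in> Hom_M n (sg i)"
      unfolding germ_Hom_def by blast
    then show ?thesis
      unfolding germ_Hom_def
      by (intro CollectI exI[of _ "U \<inter> U'"])
        (auto intro!: hol2_intros intro: hol2_on_subset simp: Hom_M_def algebra_simps)
  qed
  moreover have "(\<lambda>i. frobenius n v (\<lambda>\<mu>. t i \<mu> + c * t' i \<mu>)) \<in> V" for v
  proof -
    have "(\<lambda>i \<mu> k. frobenius n v (t i) \<mu> k + c * frobenius n v (t' i) \<mu> k) \<in> V"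
      using assms by (intro V_lincomb) (auto simp: T_def)
    moreover have "frobenius n v (\<lambda>\<mu>. t i \<mu> + c * t' i \<mu>) = (\<lambda>\<mu> k. frobenius n v (t i) \<mu> k + c * frobenius n v (t' i) \<mu> k)" for i
      by (auto simp: frobenius_def fun_eq_iff algebra_simps)
    ultimately show ?thesis by simp
  qed
  ultimately show ?thesis by (simp add: T_def)
qed

lemma T_scale: "t \<in> T n \<Longrightarrow> (\<lambda>i \<mu>. c * t i \<mu>) \<in> T n"
  using T_add[of t n t "c - 1"] by (simp add: algebra_simps)

text \<open>Raising and then lowering multiplies by \<open>z\<^sup>2 - ((n+1)/2)\<^sup>2\<close>.\<close>

lemma T_square:
  assumes "t \<in> T n"
  shows "(\<lambda>i \<mu>. (fst \<mu>)\<^sup>2 * t i \<mu>) \<in> T n" "(\<lambda>i \<mu>. (snd \<mu>)\<^sup>2 * t i \<mu>) \<in> T n"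
  using T_add[OF T_step(2)[OF T_step(1)[OF assms], simplified] assms, of "((of_int (fst n) + 1) / 2)\<^sup>2"]
    T_add[OF T_step(4)[OF T_step(3)[OF assms], simplified] assms, of "((of_int (snd n) + 1) / 2)\<^sup>2"]
  by (simp_all add: field_simps power2_eq_square)

lemma prod_list_concat_replicate:
  "(\<Prod>a\<leftarrow>concat (map (\<lambda>i. replicate (k i) (x i)) [0..<m]). f a :: complex) = (\<Prod>i<m. f (x i) ^ k i)"
  by (induction m) (auto simp: prod_list_replicate)

lemma sufficiency:
  assumes par: "fst l mod 2 = fst n mod 2" "snd l mod 2 = snd n mod 2"
    and h: "even2 h"
    and ts: "ts \<in> Hom_tuples n \<xi>" "Hom_classes n \<xi> ts \<in> D_space n \<xi> W"
  shows "Hom_classes l \<xi> (map (\<lambda>t \<mu>. t \<mu> * (h \<mu> * (qpoly (fst l) (fst n) (fst \<mu>) * qpoly (snd l) (snd n) (snd \<mu>)))) ts) \<in> D_space l \<xi> W"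
proof -
  let ?q = "\<lambda>\<mu>. qpoly (fst l) (fst n) (fst \<mu>) * qpoly (snd l) (snd n) (snd \<mu>)"
  \<comment> \<open>Membership in \<open>D_space\<close> provides some representative
    \<open>us\<close> of the class whose Frobenius partner lies in \<open>W\<close>;
    \<open>ts\<close> may differ from it by an element of the ideal power.\<close>
  obtain us where us: "Hom_classes n \<xi> ts = Hom_classes n \<xi> us" "us \<in> Hom_tuples n \<xi>"
    "\<And>v. H_classes \<xi> (map (frobenius n v) us) \<in> W"
    using ts(2) unfolding D_space_def by blast
  have len: "length ts = len" "length us = len"
    using ts(1) us(2) by (auto simp: Hom_tuples_def dest: list_all2_lengthD)
  define t u where "t i = ts ! i" and "u i = us ! i" for i
  have tup: "ts = tup t" "us = tup u"
    using map_nth[of ts] map_nth[of us] unfolding len t_def[abs_def] u_def[abs_def] by simp_all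
  have germ: "t i \<in> germ_Hom n (sg i) (nu i)" "u i \<in> germ_Hom n (sg i) (nu i)" if "i < len" for i
    using ts(1) us(2) that by (simp_all add: tup Hom_tuples_iff)
  have "u \<in> T n"
    unfolding T_def V_def using us(3) germ(2)
    by (auto simp: tup o_def H_tuples_iff frobenius_germ_H)
  then have qu: "(\<lambda>i \<mu>. ?q \<mu> * u i \<mu>) \<in> T l" by (rule T_qpoly[OF par])
  \<comment> \<open>The entire multipliers that preserve \<open>T l\<close>. They form an algebra,
    which by \<open>T_square\<close> contains both squares.\<close>
  define P where "P = {f. hol2_on f UNIV \<and> (\<forall>t\<in>T l. (\<lambda>i \<mu>. f \<mu> * t i \<mu>) \<in> T l)}"
  \<comment> \<open>Each node is repeated d_i + 1 times, one more than the order of its jet, so that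
    both products lie in the (d_i + 1)-st power of the maximal ideal at \<nu>_i.\<close>
  let ?as = "concat (map (\<lambda>i. replicate (Suc (dd i)) (fst (nu i))) [0..<len])"
  let ?bs = "concat (map (\<lambda>i. replicate (Suc (dd i)) (snd (nu i))) [0..<len])"
  have "\<exists>p\<in>P. \<exists>g g'. hol2_on g UNIV \<and> hol2_on g' UNIV \<and>
    (\<forall>\<mu>. h \<mu> = p \<mu> + (\<Prod>a\<leftarrow>?as. (fst \<mu>)\<^sup>2 - a\<^sup>2) * g \<mu> + (\<Prod>a\<leftarrow>?bs. (snd \<mu>)\<^sup>2 - a\<^sup>2) * g' \<mu>)"
  proof (rule even2_interpolation[OF h])
    show "(\<lambda>_. c) \<in> P" for c unfolding P_def using T_scale hol2_on_const by blast
    show "(\<lambda>p. f p + g p) \<in> P" if "f \<in> P" "g \<in> P" for f g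
    proof -
      have "(\<lambda>i \<mu>. (f \<mu> + g \<mu>) * t i \<mu>) \<in> T l" if "t \<in> T l" for t
      proof -
        have "(\<lambda>i \<mu>. f \<mu> * t i \<mu>) \<in> T l" "(\<lambda>i \<mu>. g \<mu> * t i \<mu>) \<in> T l"
          using \<open>f \<in> P\<close> \<open>g \<in> P\<close> that by (auto simp: P_def)
        from T_add[OF this, of 1] show ?thesis by (simp add: algebra_simps)
      qed
      then show ?thesis using that hol2_on_add by (auto simp: P_def)
    qed
    show "(\<lambda>p. f p * g p) \<in> P" if "f \<in> P" "g \<in> P" for f g
    proof -
      have "(\<lambda>i \<mu>. f \<mu> * g \<mu> * t i \<mu>) \<in> T l" if "t \<in> T l" for t
      proof -
        have "(\<lambda>i \<mu>. g \<mu> * t i \<mu>) \<in> T l" using \<open>g \<in> P\<close> that by (auto simp: P_def)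
        then have "(\<lambda>i \<mu>. f \<mu> * (g \<mu> * t i \<mu>)) \<in> T l" using \<open>f \<in> P\<close> by (auto simp: P_def)
        then show ?thesis by (simp add: mult.assoc)
      qed
      then show ?thesis using that hol2_on_mult by (auto simp: P_def)
    qed
    show "(\<lambda>p. (fst p)\<^sup>2) \<in> P" "(\<lambda>p. (snd p)\<^sup>2) \<in> P"
      unfolding P_def using T_square by (auto simp: power2_eq_square intro!: hol2_intros)
  qed
  then obtain p g g' where p: "p \<in> P" and g: "hol2_on g UNIV" "hol2_on g' UNIV"
    and hp: "\<And>\<mu>. h \<mu> = p \<mu> + (\<Prod>i<len. ((fst \<mu>)\<^sup>2 - (fst (nu i))\<^sup>2) ^ Suc (dd i)) * g \<mu>
        + (\<Prod>i<len. ((snd \<mu>)\<^sup>2 - (snd (nu i))\<^sup>2) ^ Suc (dd i)) * g' \<mu>"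
    unfolding prod_list_concat_replicate by blast
  define r where "r i \<mu> = p \<mu> * (?q \<mu> * u i \<mu>)" for i \<mu>
  have "\<forall>t\<in>T l. (\<lambda>i \<mu>. p \<mu> * t i \<mu>) \<in> T l" using p by (simp add: P_def)
  from bspec[OF this qu] have r: "r \<in> T l" unfolding r_def[abs_def] .
  have hh: "hol2_on h UNIV" using h by (simp add: even2_def)
  have qh: "hol2_on ?q UNIV"
  proof -
    have "hol2_on (\<lambda>\<mu>. qpoly (fst l) (fst n) (fst \<mu>)) UNIV" "hol2_on (\<lambda>\<mu>. qpoly (snd l) (snd n) (snd \<mu>)) UNIV"
      using par by (auto elim!: parity_cases simp: qpoly_up qpoly_down hol2_on_up)
    then show ?thesis by (rule hol2_on_mult)
  qed
  have "jet_class (*) (nu i) (dd i) (germ_Hom l (sg i) (nu i)) (\<lambda>\<mu>. t i \<mu> * (h \<mu> * ?q \<mu>))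
      = jet_class (*) (nu i) (dd i) (germ_Hom l (sg i) (nu i)) (r i)" if i: "i < len" for i
  proof (rule jet_class_eqI)
    let ?S = "germ_Hom l (sg i) (nu i)"
    note add = max_ideal_mult.add[of _ "(*)" "nu i" "(max_ideal_mult (*) (nu i) ^^ dd i) ?S"]
    have S: "germ_Hom n (sg i) (nu i) = ?S" using germ_Hom_parity[OF par] by simp
    have "jet_class (*) (nu i) (dd i) (germ_Hom n (sg i) (nu i)) (t i)
        = jet_class (*) (nu i) (dd i) (germ_Hom n (sg i) (nu i)) (u i)"
      by (rule us(1)[unfolded tup Hom_classes_eq_iff, rule_format, OF i])
    then have "jet_class (*) (nu i) (dd i) ?S (t i) = jet_class (*) (nu i) (dd i) ?S (u i)"
      by (simp only: S)
    from jet_class_eq_imp[OF _ this] germ(1)[OF i]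
    have "(\<lambda>\<mu>. t i \<mu> - u i \<mu>) \<in> (max_ideal_mult (*) (nu i) ^^ Suc (dd i)) ?S" by (simp add: S)
    from max_ideal_mult_hol_at_mult[OF hol_at_UNIV[OF hol2_on_mult[OF hh qh]] this]
    have 1: "(\<lambda>\<mu>. h \<mu> * ?q \<mu> * (t i \<mu> - u i \<mu>)) \<in> (max_ideal_mult (*) (nu i) ^^ Suc (dd i)) ?S" .
    have qus: "(\<lambda>\<mu>. ?q \<mu> * u i \<mu>) \<in> ?S" using qu i by (simp add: T_def)
    have m: "(\<lambda>\<mu>. (fst \<mu>)\<^sup>2 - (fst (nu i))\<^sup>2) \<in> max_ideal (nu i)" "(\<lambda>\<mu>. (snd \<mu>)\<^sup>2 - (snd (nu i))\<^sup>2) \<in> max_ideal (nu i)"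
      unfolding max_ideal_iff power2_eq_square by (auto intro!: hol_at_UNIV hol2_intros)
    have f: "hol2_on (\<lambda>\<mu>. \<Prod>i\<in>{..<len} - {i}. ((fst \<mu>)\<^sup>2 - (fst (nu i))\<^sup>2) ^ Suc (dd i)) UNIV"
      "hol2_on (\<lambda>\<mu>. \<Prod>i\<in>{..<len} - {i}. ((snd \<mu>)\<^sup>2 - (snd (nu i))\<^sup>2) ^ Suc (dd i)) UNIV"
      by (intro hol2_on_prod hol2_on_power hol2_on_diff hol2_on_fst hol2_on_snd hol2_on_const)+
    have 2: "(\<lambda>\<mu>. ((\<Prod>i\<in>{..<len} - {i}. ((fst \<mu>)\<^sup>2 - (fst (nu i))\<^sup>2) ^ Suc (dd i)) * g \<mu>) *
        (((fst \<mu>)\<^sup>2 - (fst (nu i))\<^sup>2) ^ Suc (dd i) * (?q \<mu> * u i \<mu>))) \<in> (max_ideal_mult (*) (nu i) ^^ Suc (dd i)) ?S"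
      by (intro max_ideal_mult_hol_at_mult hol_at_UNIV hol2_on_mult f g power_max_ideal_mult m qus)
    have 3: "(\<lambda>\<mu>. ((\<Prod>i\<in>{..<len} - {i}. ((snd \<mu>)\<^sup>2 - (snd (nu i))\<^sup>2) ^ Suc (dd i)) * g' \<mu>) *
        (((snd \<mu>)\<^sup>2 - (snd (nu i))\<^sup>2) ^ Suc (dd i) * (?q \<mu> * u i \<mu>))) \<in> (max_ideal_mult (*) (nu i) ^^ Suc (dd i)) ?S"
      by (intro max_ideal_mult_hol_at_mult hol_at_UNIV hol2_on_mult f g power_max_ideal_mult m qus)
    have rm: "(\<Prod>i<len. F i) = F i * (\<Prod>i\<in>{..<len} - {i}. F i)" for F :: "nat \<Rightarrow> complex"
      using i by (intro prod.remove) auto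
    \<comment> \<open>Passing from t to u and from h to its interpolant p leaves three error terms,
      and each lies in the ideal power.\<close>
    have "t i \<mu> * (h \<mu> * ?q \<mu>) - r i \<mu> = (h \<mu> * ?q \<mu> * (t i \<mu> - u i \<mu>)
      + ((\<Prod>i\<in>{..<len} - {i}. ((fst \<mu>)\<^sup>2 - (fst (nu i))\<^sup>2) ^ Suc (dd i)) * g \<mu>) *
        (((fst \<mu>)\<^sup>2 - (fst (nu i))\<^sup>2) ^ Suc (dd i) * (?q \<mu> * u i \<mu>)))
      + ((\<Prod>i\<in>{..<len} - {i}. ((snd \<mu>)\<^sup>2 - (snd (nu i))\<^sup>2) ^ Suc (dd i)) * g' \<mu>) *
        (((snd \<mu>)\<^sup>2 - (snd (nu i))\<^sup>2) ^ Suc (dd i) * (?q \<mu> * u i \<mu>))" for \<mu>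
    proof -
      have "t * (h * q) - p * (q * u) = (h * q * (t - u) + (X' * g) * (X * (q * u))) + (Y' * g') * (Y * (q * u))"
        if "h = p + X * X' * g + Y * Y' * g'" for t h q p u X X' g Y Y' g' :: complex
        unfolding that by algebra
      then show ?thesis unfolding r_def using hp[of \<mu>] unfolding rm .
    qed
    then show "(\<lambda>\<mu>. t i \<mu> * (h \<mu> * ?q \<mu>) - r i \<mu>) \<in> (max_ideal_mult (*) (nu i) ^^ Suc (dd i)) ?S"
      using add[OF add[OF 1[simplified] 2[simplified]] 3[simplified]] by simp
  qed
  then have "Hom_classes l \<xi> (tup (\<lambda>i \<mu>. t i \<mu> * (h \<mu> * ?q \<mu>))) = Hom_classes l \<xi> (tup r)"
    unfolding Hom_classes_eq_iff by blast
  moreover have "Hom_classes l \<xi> (tup r) \<in> D_space l \<xi> W"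
    unfolding D_space_def
    using r by (intro CollectI exI[of _ "tup r"]) (auto simp: T_def V_def Hom_tuples_iff o_def)
  ultimately show ?thesis by (simp add: tup o_def)
qed

end

section \<open>Fourier coefficients of translated \<open>K\<close>-types\<close>

text \<open>For real s this is x - i y for the first column (x, y) of
  \<open>dg (- s) ** rot t\<close>, and \<open>vv\<close> is its conjugate (\<open>vv_cnj\<close>).
  Unlike conjugation, the formula for \<open>vv\<close> remains holomorphic in s.\<close>

definition uu :: "complex \<Rightarrow> real \<Rightarrow> complex" where
  "uu s t = cosh s * exp (\<i> * of_real t) - sinh s * exp (- \<i> * of_real t)"

definition vv :: "complex \<Rightarrow> real \<Rightarrow> complex" where
  "vv s t = cosh s * exp (- \<i> * of_real t) - sinh s * exp (\<i> * of_real t)"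

text \<open>The width is chosen so that cos(2 Im s) > 0. Then \<open>uu s t * vv s t\<close> has
  positive real part for all real t (\<open>uu_vv_Re\<close>), and its principal powers are
  holomorphic in s.\<close>

definition strip :: "complex set" where
  "strip = {s. \<bar>Im s\<bar> < pi / 4}"

lemma open_strip: "open strip" and convex_strip: "convex strip" and zero_strip: "0 \<in> strip"
  and real_strip: "of_real x \<in> strip"
proof -
  have eq: "strip = {s. Im s < pi / 4} \<inter> {s. - (pi / 4) < Im s}" by (auto simp: strip_def)
  show "open strip" unfolding eq by (intro open_Int open_Collect_less continuous_intros)
  show "convex strip" unfolding eq
    using convex_halfspace_Im_lt[of "pi / 4"] convex_halfspace_Im_gt[of "- (pi / 4)"] by (intro convex_Int) auto
qed (simp_all add: strip_def)

lemma uu_vv: "uu s t * vv s t = exp (- 2 * s) * of_real ((cos t)\<^sup>2) + exp (2 * s) * of_real ((sin t)\<^sup>2)"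
proof -
  define e e' where "e = exp (\<i> * of_real t)" and "e' = exp (- \<i> * of_real t)"
  define x y where "x = exp s" and "y = exp (- s)"
  have c: "of_real (cos t) = (e + e') / 2" and s: "of_real (sin t) = (e - e') / (2 * \<i>)"
    by (simp_all add: e_def e'_def cos_exp_eq sin_exp_eq flip: cos_of_real sin_of_real)
  have "uu s t = (x + y) / 2 * e - (x - y) / 2 * e'" "vv s t = (x + y) / 2 * e' - (x - y) / 2 * e"
    by (simp_all add: uu_def vv_def e_def e'_def x_def y_def cosh_field_def sinh_field_def)
  moreover have "exp (- 2 * s) = y\<^sup>2" "exp (2 * s) = x\<^sup>2"
    by (simp_all add: x_def y_def power2_eq_square flip: exp_add)
  moreover have "((x + y) / 2 * e - (x - y) / 2 * e') * ((x + y) / 2 * e' - (x - y) / 2 * e)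
      = (((x + y) * e - (x - y) * e') * ((x + y) * e' - (x - y) * e)) / 4"
    by (simp add: field_simps)
  moreover have "((x + y) * e - (x - y) * e') * ((x + y) * e' - (x - y) * e) = y\<^sup>2 * (e + e')\<^sup>2 - x\<^sup>2 * (e - e')\<^sup>2"
    by algebra
  moreover have "of_real ((cos t)\<^sup>2) = (e + e')\<^sup>2 / 4" "of_real ((sin t)\<^sup>2) = - (e - e')\<^sup>2 / 4"
    unfolding of_real_power c s by (simp_all add: power_divide power_mult_distrib)
  ultimately show ?thesis by (simp add: diff_divide_distrib)
qed

lemma uu_vv_Re: "s \<in> strip \<Longrightarrow> Re (uu s t * vv s t) > 0"
proof -
  assume "s \<in> strip"
  then have c: "cos (2 * Im s) > 0" by (intro cos_gt_zero_pi) (auto simp: strip_def)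
  have "exp (- 2 * Re s) * (cos t)\<^sup>2 + exp (2 * Re s) * (sin t)\<^sup>2 > 0"
    using sin_cos_squared_add[of t] by (cases "cos t = 0") (auto intro: add_pos_nonneg)
  moreover have "Re (uu s t * vv s t) = cos (2 * Im s) * (exp (- 2 * Re s) * (cos t)\<^sup>2 + exp (2 * Re s) * (sin t)\<^sup>2)"
    unfolding uu_vv by (simp add: Re_exp algebra_simps)
  ultimately show ?thesis using c by simp
qed

lemma uu_vv_ne: "s \<in> strip \<Longrightarrow> uu s t \<noteq> 0" "s \<in> strip \<Longrightarrow> vv s t \<noteq> 0" "s \<in> strip \<Longrightarrow> uu s t * vv s t \<notin> \<real>\<^sub>\<le>\<^sub>0"
  using uu_vv_Re[of s t] by (auto simp: complex_nonpos_Reals_iff)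

text \<open>For real s this is |u|^(-(2 z + 1)) (u / |u|)^(-n) with u = \<open>uu s t\<close>
  (\<open>kty_real\<close>), the function of type n translated along A'. Replacing |u|^2 by the
  product of \<open>uu\<close> and \<open>vv\<close> makes it holomorphic in s.\<close>

definition kty :: "complex \<Rightarrow> int \<Rightarrow> complex \<Rightarrow> real \<Rightarrow> complex" where
  "kty z n s t = exp ((of_int n / 2 - (z + 1/2)) * Ln (uu s t * vv s t)) * uu s t powi (- n)"

lemma kty_shift:
  assumes "s \<in> strip"
  shows "kty z (n + 2) s t = kty z n s t * (vv s t / uu s t)" "kty z (n - 2) s t = kty z n s t * (uu s t / vv s t)"
proof -
  note ne = uu_vv_ne[OF assms, of t]
  have L: "exp (Ln (uu s t * vv s t)) = uu s t * vv s t" using ne by simp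
  define k where "k = of_int n / 2 - (z + 1/2)"
  define l where "l = Ln (uu s t * vv s t)"
  have K: "kty z n s t = exp (k * l) * uu s t powi (- n)" by (simp add: kty_def k_def l_def)
  have e: "exp ((k + 1) * l) = exp (k * l) * (uu s t * vv s t)" "exp ((k - 1) * l) = exp (k * l) / (uu s t * vv s t)"
    using L by (simp_all add: distrib_right left_diff_distrib exp_add exp_diff flip: l_def)
  have "of_int (n + 2) / 2 - (z + 1/2) = k + 1" "of_int (n - 2) / 2 - (z + 1/2) = k - 1"
    by (simp_all add: k_def field_simps)
  then have K2: "kty z (n + 2) s t = exp ((k + 1) * l) * uu s t powi (- n - 2)"
    "kty z (n - 2) s t = exp ((k - 1) * l) * uu s t powi (- n + 2)"
    by (simp_all add: kty_def l_def)
  have p: "uu s t powi (- n - 2) = uu s t powi (- n) / (uu s t)\<^sup>2" "uu s t powi (- n + 2) = uu s t powi (- n) * (uu s t)\<^sup>2"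
    using ne(1) by (simp_all only: power_int_diff power_int_add power_int_numeral simp_thms)
  show "kty z (n + 2) s t = kty z n s t * (vv s t / uu s t)"
    unfolding K2 K e p using ne(1) by (simp add: power2_eq_square)
  show "kty z (n - 2) s t = kty z n s t * (uu s t / vv s t)"
    unfolding K2 K e p using ne(1,2) by (simp add: power2_eq_square)
qed

text \<open>Since uu' = -vv and vv' = -uu, the logarithmic derivative combines vv/uu and uu/vv, and
  by \<open>kty_shift\<close> these quotients are the steps from n to n + 2 and to n - 2. The
  coefficients are the ladder factors of \<open>dg_limit\<close>.\<close>

lemma kty_deriv:
  assumes "s \<in> strip"
  shows "((\<lambda>s. kty z n s t) has_field_derivative
    (z + (1 - of_int n) / 2) * kty z (n - 2) s t + (z + (1 + of_int n) / 2) * kty z (n + 2) s t) (at s)"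
proof -
  note ne = uu_vv_ne[OF assms, of t]
  have u: "((\<lambda>s. uu s t) has_field_derivative - vv s t) (at s)"
    unfolding uu_def vv_def by (auto intro!: derivative_eq_intros)
  have v: "((\<lambda>s. vv s t) has_field_derivative - uu s t) (at s)"
    unfolding uu_def vv_def by (auto intro!: derivative_eq_intros)
  let ?k = "of_int n / 2 - (z + 1/2)"
  note L = DERIV_chain2[OF has_field_derivative_Ln[OF ne(3)] DERIV_mult[OF u v]]
  note E = DERIV_chain2[OF DERIV_exp DERIV_cmult[OF L, of ?k]]
  note P = DERIV_power_int[OF u disjI2[OF ne(1)], of "- n"]
  have "((\<lambda>s. kty z n s t) has_field_derivative
      kty z n s t * (- ?k * (vv s t / uu s t + uu s t / vv s t) + of_int n * (vv s t / uu s t))) (at s)"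
    unfolding kty_def
  proof (rule DERIV_cong[OF DERIV_mult[OF E P]])
    have alg: "E * (k * (inverse (u * v) * (- v * v + - u * u))) * U + (- m * (U / u) * (- v)) * E
        = E * U * (- k * (v / u + u / v) + m * (v / u))" if "u \<noteq> 0" "v \<noteq> 0" for E k u v U m :: complex
      using that by (simp add: field_simps)
    have "uu s t powi (- n - 1) = uu s t powi (- n) / uu s t"
      using ne(1) by (simp only: power_int_diff power_int_1_right simp_thms)
    then show "exp (?k * Ln (uu s t * vv s t)) * (?k * (inverse (uu s t * vv s t) * (- vv s t * vv s t + - uu s t * uu s t))) * uu s t powi - n +
      of_int (- n) * uu s t powi (- n - 1) * - vv s t * exp (?k * Ln (uu s t * vv s t)) =
      exp (?k * Ln (uu s t * vv s t)) * uu s t powi - n * (- ?k * (vv s t / uu s t + uu s t / vv s t) + of_int n * (vv s t / uu s t))"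
      unfolding of_int_minus by (simp only: alg[OF ne(1,2)])
  qed
  also have "kty z n s t * (- ?k * (vv s t / uu s t + uu s t / vv s t) + of_int n * (vv s t / uu s t))
      = (z + (1 - of_int n) / 2) * kty z (n - 2) s t + (z + (1 + of_int n) / 2) * kty z (n + 2) s t"
  proof -
    have "K * (- (m / 2 - (z + 1/2)) * (a + b) + m * a) = (z + (1 - m) / 2) * (K * b) + (z + (1 + m) / 2) * (K * a)"
      for K a b m :: complex by (simp add: field_simps)
    then show ?thesis unfolding kty_shift[OF assms] .
  qed
  finally show ?thesis .
qed

lemma continuous_on_kty:
  assumes "continuous_on X f" "continuous_on X g" "\<And>x. x \<in> X \<Longrightarrow> f x \<in> strip"
  shows "continuous_on X (\<lambda>x. kty z n (f x) (g x))"
  unfolding kty_def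
proof (intro continuous_intros)
  show u: "continuous_on X (\<lambda>x. uu (f x) (g x))"
    unfolding uu_def cosh_field_def sinh_field_def by (intro continuous_intros assms) auto
  then show "continuous_on X (\<lambda>x. uu (f x) (g x))" .
  show "continuous_on X (\<lambda>x. vv (f x) (g x))"
    unfolding vv_def cosh_field_def sinh_field_def by (intro continuous_intros assms) auto
qed (use uu_vv_ne[OF assms(3)] in auto)

definition fcoef :: "int \<Rightarrow> int \<Rightarrow> complex \<Rightarrow> complex \<Rightarrow> complex" where
  "fcoef l n z s = integral (cbox 0 (2 * pi)) (\<lambda>t. kty z n s t * exp (\<i> * of_int l * of_real t))"

lemma kty_integrable:
  "s \<in> strip \<Longrightarrow> (\<lambda>t. kty z n s t * exp (\<i> * of_int l * of_real t)) integrable_on cbox 0 (2 * pi)"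
  by (intro integrable_continuous continuous_intros continuous_on_kty) auto

lemma fcoef_deriv:
  assumes s: "s \<in> strip"
  shows "(fcoef l n z has_field_derivative
    (z + (1 - of_int n) / 2) * fcoef l (n - 2) z s + (z + (1 + of_int n) / 2) * fcoef l (n + 2) z s) (at s)"
proof -
  let ?e = "\<lambda>t. exp (\<i> * of_int l * complex_of_real t)"
  let ?D = "\<lambda>s t. ((z + (1 - of_int n) / 2) * kty z (n - 2) s t + (z + (1 + of_int n) / 2) * kty z (n + 2) s t) * ?e t"
  have "(fcoef l n z has_field_derivative integral (cbox 0 (2 * pi)) (?D s)) (at s within strip)"
    unfolding fcoef_def
  proof (rule leibniz_rule_field_derivative[OF _ _ _ s convex_strip])
    show "((\<lambda>s. kty z n s t * ?e t) has_field_derivative ?D s t) (at s within strip)" if "s \<in> strip" for s t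
      by (intro DERIV_cmult_right has_field_derivative_at_within[OF kty_deriv] that)
    show "(\<lambda>t. kty z n s t * ?e t) integrable_on cbox 0 (2 * pi)" if "s \<in> strip" for s
      by (rule kty_integrable[OF that])
    show "continuous_on (strip \<times> cbox 0 (2 * pi)) (\<lambda>(s, t). ?D s t)"
      unfolding split_beta by (intro continuous_intros continuous_on_kty) auto
  qed
  also have "integral (cbox 0 (2 * pi)) (?D s) = integral (cbox 0 (2 * pi)) (\<lambda>t.
      (z + (1 - of_int n) / 2) * (kty z (n - 2) s t * ?e t) + (z + (1 + of_int n) / 2) * (kty z (n + 2) s t * ?e t))"
    by (simp add: algebra_simps)
  also have "\<dots> = (z + (1 - of_int n) / 2) * fcoef l (n - 2) z s + (z + (1 + of_int n) / 2) * fcoef l (n + 2) z s"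
    unfolding fcoef_def
    unfolding integral_mult_right[symmetric]
    by (rule integral_add[OF integrable_on_mult_right[OF kty_integrable[OF s]] integrable_on_mult_right[OF kty_integrable[OF s]]])
  finally show ?thesis unfolding at_within_open[OF s open_strip] .
qed

lemma fcoef_holomorphic: "fcoef l n z holomorphic_on strip"
  unfolding holomorphic_on_open[OF open_strip] using fcoef_deriv by blast

section \<open>Effect of one ladder step on q\<close>

lemma up_Suc_left: "up (Suc k) n z = (z + (1 + of_int n) / 2) * up k (n + 2) z"
  unfolding up_def prod.lessThan_Suc_shift by (simp add: field_simps)

text \<open>A step towards l supplies a factor already present in q, so e = 1. A step from l itself
  or away from it forces the opposite step later, with factor z - (1 + n)/2, and the two factors
  multiply to an even polynomial.\<close>

lemma qpoly_raise:
  assumes "l mod 2 = n mod 2"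
  shows "\<exists>e. (\<forall>z. e (- z) = e z) \<and> (\<forall>z. (z + (1 + of_int n) / 2) * qpoly l (n + 2) z = qpoly l n z * e z)"
  using assms
proof (cases rule: parity_cases)
  case (1 k)
  show ?thesis
  proof (cases k)
    case 0
    have q: "qpoly l (n + 2) z = z - (1 + of_int n) / 2" "qpoly l n z = 1" for z
    proof -
      have l: "l = n" using 1 0 by simp
      have "up 1 (- (n + 2)) z = z - (1 + of_int n) / 2" by (simp add: up_def field_simps)
      then show "qpoly l (n + 2) z = z - (1 + of_int n) / 2" using qpoly_down[of "n + 2" 1 z] by (simp add: l)
      show "qpoly l n z = 1" by (simp add: l qpoly_def)
    qed
    have "(z + (1 + of_int n) / 2) * qpoly l (n + 2) z = qpoly l n z * (z\<^sup>2 - ((1 + of_int n) / 2)\<^sup>2)" for z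
    proof -
      have "(z + a) * (z - a) = 1 * (z\<^sup>2 - a\<^sup>2)" for a :: complex by (simp add: power2_eq_square algebra_simps)
      then show ?thesis unfolding q .
    qed
    then show ?thesis by (intro exI[of _ "\<lambda>z. z\<^sup>2 - ((1 + of_int n) / 2)\<^sup>2"]) simp
  next
    case (Suc m)
    have l: "l = (n + 2) + 2 * int m" "l = n + 2 * int (Suc m)" using 1 Suc by simp_all
    have "qpoly l (n + 2) z = up m (n + 2) z" "qpoly l n z = up (Suc m) n z" for z
      by (subst l(1), rule qpoly_up) (subst l(2), rule qpoly_up)
    then show ?thesis by (intro exI[of _ "\<lambda>_. 1"]) (simp add: up_Suc_left)
  qed
next
  case (2 k)
  have "l = (n + 2) - 2 * int (Suc k)" using 2 by simp
  then have "\<And>z. qpoly l (n + 2) z = up (Suc k) (- (n + 2)) z" and "\<And>z. qpoly l n z = up k (- n) z"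
    using qpoly_down[of "n + 2" "Suc k"] qpoly_down[of n k] 2 by simp_all
  have "(z + (1 + of_int n) / 2) * qpoly l (n + 2) z = qpoly l n z * (z\<^sup>2 - ((1 + of_int n) / 2)\<^sup>2)" for z
  proof -
    have m: "(1 + of_int (- (n + 2))) / 2 = - ((1 + of_int n) / 2 :: complex)" "- (n + 2) + 2 = - n" by (simp_all add: field_simps)
    have alg: "(z + a) * ((z + - a) * b) = b * (z\<^sup>2 - a\<^sup>2)" for a b :: complex by algebra
    show ?thesis
      unfolding \<open>\<And>z. qpoly l (n + 2) z = _\<close> \<open>\<And>z. qpoly l n z = _\<close> up_Suc_left m by (rule alg)
  qed
  then show ?thesis by (intro exI[of _ "\<lambda>z. z\<^sup>2 - ((1 + of_int n) / 2)\<^sup>2"]) simp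
qed

lemma qpoly_lower:
  assumes "l mod 2 = n mod 2"
  shows "\<exists>e. (\<forall>z. e (- z) = e z) \<and> (\<forall>z. (z + (1 - of_int n) / 2) * qpoly l (n - 2) z = qpoly l n z * e z)"
proof -
  have "(- l) mod 2 = (- n) mod 2" using assms by presburger
  from qpoly_raise[OF this] show ?thesis
    using qpoly_minus[of l "n - 2"] qpoly_minus[of l n] by simp
qed

lemma integral_exp_int:
  "integral (cbox 0 (2 * pi)) (\<lambda>t. exp (\<i> * of_int m * of_real t)) = (if m = 0 then 2 * of_real pi else 0)"
proof (cases "m = 0")
  case True
  then show ?thesis by (simp add: scaleR_conv_of_real)
next
  case False
  have "((\<lambda>t. exp (\<i> * of_int m * of_real t) / (\<i> * of_int m)) has_vector_derivative exp (\<i> * of_int m * of_real t)) (at t within {0..2 * pi})" for t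
  proof -
    have "((\<lambda>w. exp (\<i> * of_int m * w) / (\<i> * of_int m)) has_field_derivative exp (\<i> * of_int m * of_real t)) (at (of_real t))"
      using False by (auto intro!: derivative_eq_intros)
    then show ?thesis
      by (intro has_vector_derivative_real_field)
  qed
  from fundamental_theorem_of_calculus[OF _ this]
  have "((\<lambda>t. exp (\<i> * of_int m * of_real t)) has_integral
      exp (\<i> * of_int m * of_real (2 * pi)) / (\<i> * of_int m) - exp (\<i> * of_int m * of_real 0) / (\<i> * of_int m)) {0..2 * pi}"
    by simp
  moreover have "exp (\<i> * of_int m * of_real (2 * pi)) = (1 :: complex)"
    unfolding exp_eq_1 by (auto intro: exI[of _ m])
  ultimately show ?thesis using False by (simp add: integral_unique)
qed

lemma fcoef_0: "fcoef l n z 0 = (if l = n then 2 * of_real pi else 0)"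
proof -
  have "kty z n 0 t = exp (- \<i> * of_int n * of_real t)" for t
  proof -
    have "uu 0 t * vv 0 t = 1" by (simp add: uu_def vv_def flip: exp_add)
    moreover have "uu 0 t = exp (\<i> * of_real t)" by (simp add: uu_def)
    ultimately show ?thesis by (simp add: kty_def exp_power_int) (simp add: mult_ac)
  qed
  then have "fcoef l n z 0 = integral (cbox 0 (2 * pi)) (\<lambda>t. exp (\<i> * of_int (l - n) * of_real t))"
    unfolding fcoef_def by (simp add: algebra_simps flip: exp_add)
  then show ?thesis unfolding integral_exp_int by simp
qed

text \<open>All derivatives at \<open>0\<close> are \<open>qpoly l n\<close> times an even function of \<open>z\<close>, because by the differential
  equation each of them comes from paths of raising and lowering steps from \<open>n\<close> to \<open>l\<close>.\<close>

lemma fcoef_higher_deriv: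
  assumes "l mod 2 = n mod 2"
  shows "\<exists>p. (\<forall>z. p (- z) = p z) \<and> (\<forall>z. (deriv ^^ m) (fcoef l n z) 0 = qpoly l n z * p z)"
  using assms
proof (induction m arbitrary: n)
  case 0
  show ?case
    by (rule exI[of _ "\<lambda>_. if l = n then 2 * of_real pi else 0"]) (simp add: fcoef_0 qpoly_def)
next
  case (Suc m)
  have "l mod 2 = (n - 2) mod 2" "l mod 2 = (n + 2) mod 2" using Suc.prems by presburger+
  then obtain p p' where p: "\<And>z. p (- z) = p z" "\<And>z. (deriv ^^ m) (fcoef l (n - 2) z) 0 = qpoly l (n - 2) z * p z"
    "\<And>z. p' (- z) = p' z" "\<And>z. (deriv ^^ m) (fcoef l (n + 2) z) 0 = qpoly l (n + 2) z * p' z"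
    using Suc.IH by metis
  obtain e e' where e: "\<And>z. e (- z) = e z" "\<And>z. (z + (1 - of_int n) / 2) * qpoly l (n - 2) z = qpoly l n z * e z"
    "\<And>z. e' (- z) = e' z" "\<And>z. (z + (1 + of_int n) / 2) * qpoly l (n + 2) z = qpoly l n z * e' z"
    using qpoly_raise[OF Suc.prems] qpoly_lower[OF Suc.prems] by metis
  have "(deriv ^^ Suc m) (fcoef l n z) 0 = qpoly l n z * (e z * p z + e' z * p' z)" for z
  proof -
    let ?a = "z + (1 - of_int n) / 2" and ?b = "z + (1 + of_int n) / 2"
    have h: "(\<lambda>s. ?a * fcoef l (n - 2) z s) holomorphic_on strip" "(\<lambda>s. ?b * fcoef l (n + 2) z s) holomorphic_on strip"
      by (intro holomorphic_intros fcoef_holomorphic)+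
    have "(deriv ^^ Suc m) (fcoef l n z) 0 = (deriv ^^ m) (deriv (fcoef l n z)) 0"
      by (simp add: funpow_swap1)
    also have "\<dots> = (deriv ^^ m) (\<lambda>s. ?a * fcoef l (n - 2) z s + ?b * fcoef l (n + 2) z s) 0"
      by (rule higher_deriv_transform_within_open[OF holomorphic_deriv[OF fcoef_holomorphic open_strip]
            holomorphic_on_add[OF h] open_strip zero_strip]) (rule DERIV_imp_deriv[OF fcoef_deriv])
    also have "\<dots> = ?a * (deriv ^^ m) (fcoef l (n - 2) z) 0 + ?b * (deriv ^^ m) (fcoef l (n + 2) z) 0"
      unfolding higher_deriv_add[OF h open_strip zero_strip]
        higher_deriv_cmult[OF fcoef_holomorphic zero_strip open_strip] ..
    also have "\<dots> = (?a * qpoly l (n - 2) z) * p z + (?b * qpoly l (n + 2) z) * p' z"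
      by (simp add: p)
    finally show ?thesis unfolding e by (simp add: algebra_simps)
  qed
  then show ?case using p e by (intro exI[of _ "\<lambda>z. e z * p z + e' z * p' z"]) simp
qed

text \<open>By \<open>fcoef_higher_deriv\<close> all derivatives at 0 vanish, and the strip is
  connected.\<close>

lemma fcoef_zero:
  assumes "l mod 2 = n mod 2" "qpoly l n z = 0" "s \<in> strip"
  shows "fcoef l n z s = 0"
proof (rule holomorphic_fun_eq_0_on_connected[OF fcoef_holomorphic open_strip convex_connected[OF convex_strip] _ zero_strip assms(3)])
  show "(deriv ^^ m) (fcoef l n z) 0 = 0" for m
    using fcoef_higher_deriv[OF assms(1), of m] assms(2) by auto
qed

text \<open>Both sides have m-th derivative \<open>qpoly l n z * qpoly l n (- z) * p z\<close> at 0
  with the even p of \<open>fcoef_higher_deriv\<close>; the identity theorem gives equality on the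
  strip.\<close>

lemma fcoef_symmetry:
  assumes "l mod 2 = n mod 2" "s \<in> strip"
  shows "qpoly l n (- z) * fcoef l n z s = qpoly l n z * fcoef l n (- z) s"
proof -
  let ?a = "qpoly l n (- z)" and ?b = "qpoly l n z"
  have h: "(\<lambda>s. ?a * fcoef l n z s) holomorphic_on strip" "(\<lambda>s. ?b * fcoef l n (- z) s) holomorphic_on strip"
    by (intro holomorphic_intros fcoef_holomorphic)+
  have "?a * fcoef l n z s - ?b * fcoef l n (- z) s = 0"
  proof (rule holomorphic_fun_eq_0_on_connected[OF holomorphic_on_diff[OF h] open_strip convex_connected[OF convex_strip] _ zero_strip assms(2)])
    show "(deriv ^^ m) (\<lambda>s. ?a * fcoef l n z s - ?b * fcoef l n (- z) s) 0 = 0" for m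
    proof -
      obtain p where p: "\<And>z. p (- z) = p z" "\<And>z. (deriv ^^ m) (fcoef l n z) 0 = qpoly l n z * p z"
        using fcoef_higher_deriv[OF assms(1), of m] by metis
      show ?thesis
        unfolding higher_deriv_diff[OF h open_strip zero_strip]
          higher_deriv_cmult[OF fcoef_holomorphic zero_strip open_strip] p by simp
    qed
  qed
  then show ?thesis by simp
qed

text \<open>By \<open>G' = K'A'K'\<close> these coefficients reduce to the functions \<open>fcoef\<close> on \<open>A'\<close>.\<close>

definition gcoef :: "int \<Rightarrow> int \<Rightarrow> mat2 \<Rightarrow> complex \<Rightarrow> complex" where
  "gcoef l n h z = integral (cbox 0 (2 * pi)) (\<lambda>t. exp (- (2 * z + 1) * of_real (iwaH_rot h t)
     - \<i> * of_int n * of_real (iwaK_rot h t)) * exp (\<i> * of_int l * of_real t))"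

text \<open>Common form of the integrands of \<open>gcoef\<close> and of \<open>kty\<close> at real
  s; multiplication of u by a unimodular number only produces a scalar
  (\<open>nrm_ty_mult\<close>).\<close>

definition nrm_ty :: "complex \<Rightarrow> int \<Rightarrow> complex \<Rightarrow> complex" where
  "nrm_ty z n u = exp (- (2 * z + 1) * of_real (ln (norm u))) * (u / of_real (norm u)) powi (- n)"

lemma nrm_ty_iwa:
  assumes "h \<in> SL2"
  shows "exp (- (2 * z + 1) * of_real (iwaH_rot h t) - \<i> * of_int n * of_real (iwaK_rot h t))
    = nrm_ty z n (alp h * exp (\<i> * of_real t) + bet h * exp (- \<i> * of_real t))"
proof -
  have u: "alp h * exp (\<i> * of_real t) + bet h * exp (- \<i> * of_real t)
      = exp (of_real (iwaH_rot h t)) * exp (\<i> * of_real (iwaK_rot h t))"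
    using first_column_rot_exp[OF assms, of t] unfolding first_column_rot exp_add .
  have nu: "norm (exp (complex_of_real (iwaH_rot h t)) * exp (\<i> * of_real (iwaK_rot h t))) = exp (iwaH_rot h t)"
    by (simp add: norm_mult)
  have "exp (complex_of_real (iwaH_rot h t)) * exp (\<i> * of_real (iwaK_rot h t)) / of_real (exp (iwaH_rot h t)) = exp (\<i> * of_real (iwaK_rot h t))"
    by (simp add: exp_of_real)
  then show ?thesis
    unfolding nrm_ty_def u nu by (simp add: exp_power_int mult_ac flip: exp_add)
qed

lemma nrm_ty_mult: "norm c = 1 \<Longrightarrow> nrm_ty z n (c * u) = c powi (- n) * nrm_ty z n u"
  by (simp add: nrm_ty_def norm_mult power_int_mult_distrib flip: times_divide_eq_right)

lemma cosh_of_real_complex: "cosh (of_real s) = complex_of_real (cosh s)"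
  and sinh_of_real_complex: "sinh (of_real s) = complex_of_real (sinh s)"
  by (simp_all add: cosh_field_def sinh_field_def exp_of_real flip: of_real_minus)

lemma vv_cnj: "vv (of_real s) t = cnj (uu (of_real s) t)"
proof -
  show ?thesis by (simp add: uu_def vv_def exp_cnj cosh_of_real_complex sinh_of_real_complex)
qed

lemma kty_real: "kty z n (of_real s) t = nrm_ty z n (uu (of_real s) t)"
proof -
  let ?u = "uu (of_real s) t"
  have ne: "?u \<noteq> 0" using uu_vv_ne(1)[OF real_strip] .
  have "?u * vv (of_real s) t = of_real ((norm ?u)\<^sup>2)"
    by (simp only: vv_cnj complex_norm_square)
  then have L: "Ln (?u * vv (of_real s) t) = 2 * of_real (ln (norm ?u))"
    using ne by (simp add: Ln_of_real ln_realpow del: of_real_power)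
  have "exp (of_int n * of_real (ln (norm ?u))) = complex_of_real (norm ?u) powi n"
    using ne by (simp add: exp_of_real flip: exp_power_int)
  then have "kty z n (of_real s) t = exp (- (2 * z + 1) * of_real (ln (norm ?u))) * (of_real (norm ?u) powi n * ?u powi (- n))"
  proof -
    have "(of_int n / 2 - (z + 1/2)) * (2 * x) = - (2 * z + 1) * x + of_int n * x" for x by (simp add: field_simps)
    then show ?thesis unfolding kty_def L using \<open>exp (of_int n * _) = _\<close> by (simp only: exp_add mult.assoc)
  qed
  also have "of_real (norm ?u) powi n * ?u powi (- n) = (?u / of_real (norm ?u)) powi (- n)"
    by (simp add: power_int_minus power_int_divide_distrib field_simps)
  finally show ?thesis by (simp add: nrm_ty_def)
qed

lemma integral_periodic_shift:
  fixes f :: "real \<Rightarrow> complex"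
  assumes f: "continuous_on UNIV f" "\<And>t. f (t + 2 * pi) = f t" and d: "- (2 * pi) \<le> d" "d \<le> 2 * pi"
  shows "integral {0..2 * pi} (\<lambda>t. f (t + d)) = integral {0..2 * pi} f"
proof -
  have *: "integral {0..2 * pi} (\<lambda>t. f (t + d)) = integral {0..2 * pi} f" if d: "0 \<le> d" "d \<le> 2 * pi" for d
  proof -
    have int: "f integrable_on {a..b}" for a b
      by (rule integrable_continuous_interval) (rule continuous_on_subset[OF f(1)], simp)
    have sh: "integral {a..b} f = integral {a - c..b - c} (\<lambda>t. f (t + c))" for a b c
      by (rule integral_shift_real_ivl[symmetric])
    have "integral {0..2 * pi} (\<lambda>t. f (t + d)) = integral {d..2 * pi + d} f"
      using sh[of d "2 * pi + d" d] by simp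
    also have "\<dots> = integral {d..2 * pi} f + integral {2 * pi..2 * pi + d} f"
      using d by (intro Henstock_Kurzweil_Integration.integral_combine[symmetric] int) auto
    also have "integral {2 * pi..2 * pi + d} f = integral {0..d} f"
      using sh[of "2 * pi" "2 * pi + d" "2 * pi"] by (simp add: f(2))
    also have "integral {d..2 * pi} f + integral {0..d} f = integral {0..2 * pi} f"
      using Henstock_Kurzweil_Integration.integral_combine[OF d int] by (simp add: add.commute)
    finally show ?thesis .
  qed
  show ?thesis
  proof (cases "d \<ge> 0")
    case False
    have "f (t + d) = f (t + (d + 2 * pi))" for t using f(2)[of "t + d"] by (simp add: add_ac)
    then show ?thesis using *[of "d + 2 * pi"] False d by simp
  qed (use * d in auto)
qed

text \<open>An explicit KAK decomposition: |alp|^2 - |bet|^2 = 1 yields s, half the sum of the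
  phases of alp and -bet a unimodular scalar, half their difference a shift of the angle. The sign
  of bet matches the minus sign in \<open>uu\<close>. The constants do not depend on z, so relations
  between different z carry over.\<close>

lemma gcoef_fcoef:
  assumes h: "h \<in> SL2"
  shows "\<exists>c s. \<forall>z. gcoef l n h z = c * fcoef l n z (of_real s)"
proof -
  obtain s where s: "norm (alp h) = cosh s" "norm (bet h) = sinh s"
  proof
    define s where "s = arsinh (norm (bet h))"
    show 1: "norm (bet h) = sinh s" by (simp add: s_def)
    have "(norm (alp h))\<^sup>2 = (cosh s)\<^sup>2" using alp_bet(1)[OF h] unfolding 1 cosh_square_eq by simp
    then show "norm (alp h) = cosh s"
      by (rule power2_eq_imp_eq) (simp_all add: less_imp_le)
  qed
  define A B where "A = Arg (alp h)" and "B = Arg (- bet h)"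
  have al: "alp h = of_real (cosh s) * exp (\<i> * of_real A)"
    using Arg_eq[of "alp h"] alp_bet(3)[OF h] s by (simp add: A_def)
  have be: "bet h = - (of_real (sinh s) * exp (\<i> * of_real B))"
  proof (cases "bet h = 0")
    case True
    then show ?thesis using s by simp
  next
    case False
    then have "- bet h = of_real (norm (- bet h)) * exp (\<i> * of_real B)" unfolding B_def by (intro Arg_eq) simp
    then show ?thesis using s by (metis minus_minus norm_minus_cancel)
  qed
  define d where "d = (A - B) / 2"
  define c where "c = exp (\<i> * of_real ((A + B) / 2))"
  have U: "alp h * exp (\<i> * of_real t) + bet h * exp (- \<i> * of_real t) = c * uu (of_real s) (t + d)" for t
  proof -
    note ch = cosh_of_real_complex sinh_of_real_complex
    have "c * exp (\<i> * of_real (t + d)) = exp (\<i> * of_real A) * exp (\<i> * of_real t)"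
      "c * exp (- \<i> * of_real (t + d)) = exp (\<i> * of_real B) * exp (- \<i> * of_real t)"
    proof -
      have "\<i> * of_real ((A + B) / 2) + \<i> * of_real (t + d) = \<i> * of_real A + \<i> * of_real t"
        "\<i> * of_real ((A + B) / 2) + - \<i> * of_real (t + d) = \<i> * of_real B + - \<i> * of_real t"
        by (simp_all add: d_def complex_eq_iff field_simps)
      then show "c * exp (\<i> * of_real (t + d)) = exp (\<i> * of_real A) * exp (\<i> * of_real t)"
        "c * exp (- \<i> * of_real (t + d)) = exp (\<i> * of_real B) * exp (- \<i> * of_real t)"
        unfolding c_def exp_add[symmetric] by (simp_all only:)
    qed
    note * = this[symmetric]
    have "alp h * exp (\<i> * of_real t) + bet h * exp (- \<i> * of_real t)
      = of_real (cosh s) * (exp (\<i> * of_real A) * exp (\<i> * of_real t)) - of_real (sinh s) * (exp (\<i> * of_real B) * exp (- \<i> * of_real t))"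
      by (simp add: al be)
    then show ?thesis unfolding * uu_def ch by (simp add: algebra_simps)
  qed
  have nc: "norm c = 1" by (simp add: c_def)
  have ab: "- (2 * pi) \<le> d" "d \<le> 2 * pi"
    using Arg_bounded[of "alp h"] Arg_bounded[of "- bet h"] by (auto simp: d_def A_def B_def)
  have per: "uu (of_real s) (t + 2 * pi) = uu (of_real s) t" for t
  proof -
    have "\<i> * of_real (t + 2 * pi) = \<i> * of_real t + 2 * of_real pi * \<i>" by (simp add: algebra_simps)
    then have "exp (\<i> * of_real (t + 2 * pi)) = exp (\<i> * of_real t)"
      by (simp only: exp_add exp_two_pi_i mult_1_right)
    moreover from this have "exp (- \<i> * of_real (t + 2 * pi)) = exp (- \<i> * of_real t)"
      by (simp only: mult_minus_left exp_minus)
    ultimately have "exp (\<i> * of_real (t + 2 * pi)) = exp (\<i> * of_real t)"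
      "exp (- \<i> * of_real (t + 2 * pi)) = exp (- \<i> * of_real t)" by blast+
    then show ?thesis by (simp only: uu_def)
  qed
  have "gcoef l n h z = (c powi (- n) * exp (- \<i> * of_int l * of_real d)) * fcoef l n z (of_real s)" for z
  proof -
    let ?f = "\<lambda>t. kty z n (of_real s) t * exp (\<i> * of_int l * of_real t)"
    have e: "exp (\<i> * of_int l * of_real t) = exp (- \<i> * of_int l * of_real d) * exp (\<i> * of_int l * of_real (t + d))" for t
      by (simp add: algebra_simps flip: exp_add)
    have "c powi (- n) * kty z n (of_real s) (t + d) * exp (\<i> * of_int l * of_real t)
        = (c powi (- n) * exp (- \<i> * of_int l * of_real d)) * ?f (t + d)" for t
      unfolding e[of t] by (simp only: mult_ac)
    then have "gcoef l n h z = integral (cbox 0 (2 * pi)) (\<lambda>t. (c powi (- n) * exp (- \<i> * of_int l * of_real d)) * ?f (t + d))"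
      unfolding gcoef_def nrm_ty_iwa[OF h] U nrm_ty_mult[OF nc] kty_real[symmetric] by (simp only:)
    also have "\<dots> = (c powi (- n) * exp (- \<i> * of_int l * of_real d)) * integral {0..2 * pi} (\<lambda>t. ?f (t + d))"
      by simp
    also have "integral {0..2 * pi} (\<lambda>t. ?f (t + d)) = integral {0..2 * pi} ?f"
    proof (rule integral_periodic_shift[OF _ _ ab])
      show "continuous_on UNIV ?f" by (intro continuous_intros continuous_on_kty real_strip)
      have "exp (\<i> * of_int l * of_real (t + 2 * pi)) = exp (\<i> * of_int l * of_real t) * exp (of_int l * (2 * of_real pi * \<i>))" for t
        by (simp add: algebra_simps flip: exp_add)
      moreover have "exp (of_int l * (2 * of_real pi * \<i>)) = (1 :: complex)"
        unfolding exp_eq_1 by (auto intro: exI[of _ l])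
      ultimately show "?f (t + 2 * pi) = ?f t" for t unfolding kty_real per by simp
    qed
    finally show ?thesis by (simp add: fcoef_def)
  qed
  then show ?thesis by blast
qed

lemma gcoef_zero: "h \<in> SL2 \<Longrightarrow> l mod 2 = n mod 2 \<Longrightarrow> qpoly l n z = 0 \<Longrightarrow> gcoef l n h z = 0"
  using gcoef_fcoef[of h l n] fcoef_zero[of l n z] real_strip by auto

lemma gcoef_symmetry:
  assumes "h \<in> SL2" "l mod 2 = n mod 2"
  shows "qpoly l n (- z) * gcoef l n h z = qpoly l n z * gcoef l n h (- z)"
proof -
  obtain c s where "\<And>z. gcoef l n h z = c * fcoef l n z (of_real s)" using gcoef_fcoef[OF assms(1)] by blast
  then show ?thesis using fcoef_symmetry[OF assms(2) real_strip, of z s] by (simp add: algebra_simps)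
qed

section \<open>Intertwining data defined by a Fourier coefficient\<close>

text \<open>Pairing with the type l: \<open>chr (- l)\<close> is the conjugate of the function
  \<open>chr l\<close> that spans it.\<close>

definition fourier :: "int \<times> int \<Rightarrow> (grp \<Rightarrow> complex) \<Rightarrow> complex" where
  "fourier l f = integral (cbox (0, 0) (2 * pi, 2 * pi)) (\<lambda>\<theta>. f (rot2 \<theta>) * chr (- l) \<theta>)"

lemma fourier_integrable:
  "(\<lambda>\<theta>. f (rot2 \<theta>)) \<in> BP \<Longrightarrow> (\<lambda>\<theta>. f (rot2 \<theta>) * chr (- l) \<theta>) integrable_on cbox (0, 0) (2 * pi, 2 * pi)"
  by (intro integrable_continuous continuous_intros C_inf_continuous BP_C_inf BP_chr)

lemma fourier_lincomb:
  assumes "(\<lambda>\<theta>. f (rot2 \<theta>)) \<in> BP" "(\<lambda>\<theta>. f' (rot2 \<theta>)) \<in> BP"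
  shows "fourier l (\<lambda>k. f k + c * f' k) = fourier l f + c * fourier l f'"
proof -
  note i = fourier_integrable[OF assms(1), of l] fourier_integrable[OF assms(2), of l]
  have "fourier l (\<lambda>k. f k + c * f' k) = integral (cbox (0, 0) (2 * pi, 2 * pi))
      (\<lambda>\<theta>. f (rot2 \<theta>) * chr (- l) \<theta> + c * (f' (rot2 \<theta>) * chr (- l) \<theta>))"
    unfolding fourier_def by (simp only: distrib_right mult.assoc)
  also have "\<dots> = fourier l f + c * fourier l f'"
    unfolding fourier_def integral_mult_right[symmetric]
    by (rule integral_add[OF i(1) integrable_on_mult_right[OF i(2)]])
  finally show ?thesis .
qed

lemma norm_chr: "norm (chr n \<theta>) = 1"
  by (simp add: chr_def)

lemma fourier_bound:
  assumes "(\<lambda>\<theta>. f (rot2 \<theta>)) \<in> BP" "\<And>\<theta>. norm (f (rot2 \<theta>)) \<le> B"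
  shows "norm (fourier l f) \<le> B * measure lborel (cbox (0, 0) (2 * pi, 2 * pi) :: (real \<times> real) set)"
proof (rule has_integral_bound[OF _ integrable_integral[OF fourier_integrable[OF assms(1), of l]], folded fourier_def])
  show "0 \<le> B" using assms(2)[of 0] norm_ge_zero order_trans by blast
  show "norm (f (rot2 \<theta>) * chr (- l) \<theta>) \<le> B" for \<theta> using assms(2)[of \<theta>] by (simp add: norm_mult norm_chr)
qed

lemma fourier_prod:
  assumes f: "\<And>x y. f (rot2 (x, y)) * chr (- l) (x, y) = F x * G y"
    and F: "continuous_on UNIV F" and G: "continuous_on UNIV G"
  shows "fourier l f = integral (cbox 0 (2 * pi)) F * integral (cbox 0 (2 * pi)) G"
proof -
  have eq: "(\<lambda>\<theta>. f (rot2 \<theta>) * chr (- l) \<theta>) = (\<lambda>\<theta>. F (fst \<theta>) * G (snd \<theta>))"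
    using f by (auto simp: fun_eq_iff)
  have "continuous_on (cbox (0, 0) (2 * pi, 2 * pi)) (\<lambda>\<theta>. F (fst \<theta>) * G (snd \<theta>))"
    by (intro continuous_intros continuous_on_compose2[OF F] continuous_on_compose2[OF G]) auto
  from integral_prod_continuous[OF this] show ?thesis
    unfolding fourier_def eq by simp
qed

text \<open>Cocycle and change of angle of each SL(2)-factor depend on its own angle only, so the
  double integral splits.\<close>

lemma fourier_ps_act_frobenius:
  assumes g: "g \<in> GG"
  shows "fourier l (ps_act \<nu> g (frobenius n v t \<nu>)) = t \<nu> * v *
    (gcoef (fst l) (fst n) (matrix_inv (fst g)) (fst \<nu>) * gcoef (snd l) (snd n) (matrix_inv (snd g)) (snd \<nu>))"
proof -
  let ?h1 = "matrix_inv (fst g)" and ?h2 = "matrix_inv (snd g)"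
  let ?E = "\<lambda>z n h x. exp (- (2 * z + 1) * of_real (iwaH_rot h x) - \<i> * of_int n * of_real (iwaK_rot h x))"
  let ?F = "\<lambda>x. ?E (fst \<nu>) (fst n) ?h1 x * exp (\<i> * of_int (fst l) * of_real x)"
  let ?G = "\<lambda>x. ?E (snd \<nu>) (snd n) ?h2 x * exp (\<i> * of_int (snd l) * of_real x)"
  have h: "?h1 \<in> SL2" "?h2 \<in> SL2" using GG_SL2[OF g] by auto
  have c: "continuous_on UNIV (\<lambda>x. ?E z m h x * exp (\<i> * of_int p * of_real x))" if "h \<in> SL2" for z m h p
  proof -
    have a: "continuous_on UNIV (iwaH_rot h)" "continuous_on UNIV (iwaK_rot h)"
      using C_inf_continuous[OF C_inf_iwaH_rot[OF that]] C_inf_continuous[OF lift1_iwaK_rot[OF that, unfolded lift1_def, THEN conjunct1]]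
      by auto
    show ?thesis by (intro continuous_intros a)
  qed
  have "fourier l (ps_act \<nu> g (frobenius n v t \<nu>)) = integral (cbox 0 (2 * pi)) (\<lambda>x. t \<nu> * v * ?F x) * integral (cbox 0 (2 * pi)) ?G"
  proof (rule fourier_prod)
    fix x y
    have "act_factor \<nu> g (x, y) * chr n (iwaK_rot ?h1 x, iwaK_rot ?h2 y) = ?E (fst \<nu>) (fst n) ?h1 x * ?E (snd \<nu>) (snd n) ?h2 y"
      unfolding act_factor_def chr_def exp_add[symmetric] by (rule arg_cong[of _ _ exp]) (simp add: algebra_simps)
    moreover have "chr (- l) (x, y) = exp (\<i> * of_int (fst l) * of_real x) * exp (\<i> * of_int (snd l) * of_real y)"
      unfolding chr_def exp_add[symmetric] by (rule arg_cong[of _ _ exp]) (simp add: algebra_simps)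
    moreover have "ps_act \<nu> g (frobenius n v t \<nu>) (rot2 (x, y)) = t \<nu> * v * (act_factor \<nu> g (x, y) * chr n (iwaK_rot ?h1 x, iwaK_rot ?h2 y))"
      unfolding ps_act_rot2[OF g] act_pull_def pull_def frobenius_rot2 by simp
    ultimately have "ps_act \<nu> g (frobenius n v t \<nu>) (rot2 (x, y)) * chr (- l) (x, y)
        = t \<nu> * v * (?E (fst \<nu>) (fst n) ?h1 x * ?E (snd \<nu>) (snd n) ?h2 y)
          * (exp (\<i> * of_int (fst l) * of_real x) * exp (\<i> * of_int (snd l) * of_real y))"
      by (simp only:)
    moreover have "c * (a * b) * (a' * b') = c * (a * a') * (b * b')" for c a b a' b' :: complex by simp
    ultimately show "ps_act \<nu> g (frobenius n v t \<nu>) (rot2 (x, y)) * chr (- l) (x, y) = t \<nu> * v * ?F x * ?G y"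
      by (rule trans)
  next
    show "continuous_on UNIV (\<lambda>x. t \<nu> * v * ?F x)" by (rule continuous_on_mult_left[OF c[OF h(1)]])
    show "continuous_on UNIV ?G" by (rule c[OF h(2)])
  qed
  then show ?thesis unfolding gcoef_def integral_mult_right by (simp only: mult_ac)
qed

text \<open>At the identity the pairing detects the type l; one factor 2 pi for each circle gives
  the constant in \<open>L_one_frobenius\<close>.\<close>

lemma gcoef_one: "gcoef l l (mat 1) z = 2 * of_real pi"
proof -
  have m: "mat 1 \<in> SL2" by (simp add: SL2_def)
  have "mat 1 ** rot t = rot t" for t by simp
  then have "complex_of_real (iwaH_rot (mat 1) t) = 0" for t
    using iwa_rot_left(1)[OF m, of t] iwa_rot(2)[of t] by simp
  \<comment> \<open>The exponential formula fixes the lifted angle only modulo 2 pi, so exponentials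
    are compared instead of angles.\<close>
  moreover have "exp (\<i> * of_real (iwaK_rot (mat 1) t)) = exp (\<i> * of_real t)" for t
    using first_column_rot_exp[OF m, of t] \<open>complex_of_real (iwaH_rot (mat 1) t) = 0\<close>
    by (simp add: rot_def cis_conv_exp[symmetric] cis.code)
  then have "exp (- (\<i> * of_int l * of_real (iwaK_rot (mat 1) t))) = exp (- (\<i> * of_int l * of_real t))" for t
    using exp_power_int[of "\<i> * of_real (iwaK_rot (mat 1) t)" "- l"] exp_power_int[of "\<i> * of_real t" "- l"] by (simp add: mult_ac)
  ultimately have "gcoef l l (mat 1) z = integral (cbox 0 (2 * pi)) (\<lambda>t. exp (\<i> * of_int 0 * of_real t))"
    unfolding gcoef_def by (simp flip: exp_add)
  then show ?thesis unfolding integral_exp_int by simp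
qed

text \<open>The left translate of an extension to G transforms under A and N as extensions do, so by
  \<open>ps_extend_unique\<close> it is the extension of its restriction to K.\<close>

lemma ps_act_mult:
  assumes f: "f \<in> H_inf \<sigma>" and g: "g \<in> GG" and g': "g' \<in> GG"
  shows "ps_act \<nu> g (ps_act \<nu> g' f) = ps_act \<nu> (g \<odot> g') f"
proof
  fix k
  show "ps_act \<nu> g (ps_act \<nu> g' f) k = ps_act \<nu> (g \<odot> g') f k"
  proof (cases "k \<in> KK")
    case True
    have "ps_extend \<nu> f (ginv g' \<odot> x) = ps_extend \<nu> (ps_act \<nu> g' f) x" if "x \<in> GG" for x
    proof (rule ps_extend_unique[OF _ _ that])
      fix y t u assume "y \<in> GG"
      \<comment> \<open>\<open>ps_extend_equivariant\<close> carries a factor from M; the identity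
        is inserted, and \<open>\<sigma>\<close> at the identity fixes all values of f.\<close>
      have m: "(mat 1, mat 1) \<in> MM" by (simp add: MM_def)
      have "f (k \<odot> (mat 1, mat 1)) = inverse (\<sigma> (mat 1, mat 1)) * f k" if "k \<in> KK" for k
        using H_inf_equivariant[OF f that m] .
      then have s: "inverse (\<sigma> (mat 1, mat 1)) * f k = f k" if "k \<in> KK" for k using that by (simp add: gmul_1)
      have G: "ginv g' \<odot> y \<in> GG" by (intro GG_mult GG_ginv g' \<open>y \<in> GG\<close>)
      then have K: "kap (ginv g' \<odot> y) \<in> KK" by (auto simp: GG_def kap_def KK_def iwasawa(1))
      have "ps_extend \<nu> f (ginv g' \<odot> (y \<odot> (dg2 t \<odot> unip2 u))) = ps_extend \<nu> f ((ginv g' \<odot> y) \<odot> (mat 1, mat 1) \<odot> (dg2 t \<odot> unip2 u))"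
        by (simp add: gmul_assoc gmul_1)
      also have "\<dots> = a_pow (- (\<nu> + rho)) t * inverse (\<sigma> (mat 1, mat 1)) * ps_extend \<nu> f (ginv g' \<odot> y)"
        by (rule ps_extend_equivariant[OF f G m])
      also have "\<dots> = a_pow (- (\<nu> + rho)) t * ps_extend \<nu> f (ginv g' \<odot> y)"
      proof -
        have alg: "a * i * (b * F) = a * (b * (i * F))" for a i b F :: complex by simp
        show ?thesis unfolding ps_extend_def alg s[OF K] ..
      qed
      finally show "ps_extend \<nu> f (ginv g' \<odot> (y \<odot> (dg2 t \<odot> unip2 u))) = a_pow (- (\<nu> + rho)) t * ps_extend \<nu> f (ginv g' \<odot> y)" .
    qed (simp add: ps_act_def)
    from this[OF GG_mult[OF GG_ginv[OF g] KK_GG[OF True]]] show ?thesis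
      using True by (simp add: ps_act_def ginv_mult[OF g g'] gmul_assoc)
  qed (simp add: ps_act_def)
qed

lemma ps_act_lincomb: "ps_act \<nu> g (\<lambda>k. f k + c * f' k) = (\<lambda>k. ps_act \<nu> g f k + c * ps_act \<nu> g f' k)"
  by (auto simp: ps_act_def ps_extend_def fun_eq_iff algebra_simps)

lemma germ_H_value: "\<phi> \<in> germ_H \<sigma> \<nu> \<Longrightarrow> \<phi> \<nu> \<in> H_inf \<sigma>"
  by (auto simp: germ_H_def hol_H_on_def)

lemma fourier_ps_act_lincomb:
  assumes "f \<in> H_inf \<sigma>" "f' \<in> H_inf \<sigma>" "g \<in> GG"
  shows "fourier l (ps_act \<nu> g (\<lambda>k. f k + c * f' k)) = fourier l (ps_act \<nu> g f) + c * fourier l (ps_act \<nu> g f')"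
  unfolding ps_act_lincomb
  by (rule fourier_lincomb[OF H_inf_BP[OF H_inf_ps_act[OF assms(1,3)]] H_inf_BP[OF H_inf_ps_act[OF assms(2,3)]]])

text \<open>The translate is bounded by the sup norm of the function times that of
  \<open>act_factor\<close>, so the seminorm without derivatives suffices.\<close>

lemma fourier_ps_act_continuous:
  assumes f: "\<And>N. f N \<in> H_inf \<sigma>" "f' \<in> H_inf \<sigma>" and g: "g \<in> GG"
    and lim: "(\<lambda>N. smooth_norm 0 0 (\<lambda>k. f N k - f' k)) \<longlonglongrightarrow> 0"
  shows "(\<lambda>N. fourier l (ps_act \<nu> g (f N))) \<longlonglongrightarrow> fourier l (ps_act \<nu> g f')"
proof -
  define d where "d N k = f N k + - 1 * f' k" for N k
  have d: "d N \<in> H_inf \<sigma>" for N using H_inf_lincomb[OF f(1) f(2), of 1 N "- 1"] by (simp add: d_def[abs_def])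
  let ?C = "supn (act_factor \<nu> g)"
  let ?c = "measure lborel (cbox (0, 0) (2 * pi, 2 * pi) :: (real \<times> real) set)"
  have "norm (fourier l (ps_act \<nu> g (f N)) - fourier l (ps_act \<nu> g f')) \<le> ?C * smooth_norm 0 0 (\<lambda>k. f N k - f' k) * ?c" for N
  proof -
    have "fourier l (ps_act \<nu> g (f N)) - fourier l (ps_act \<nu> g f') = fourier l (ps_act \<nu> g (d N))"
      unfolding d_def using fourier_ps_act_lincomb[OF f(1)[of N] f(2) g, of l \<nu> "- 1"] by simp
    also have "norm \<dots> \<le> ?C * smooth_norm 0 0 (\<lambda>k. f N k - f' k) * ?c"
    proof (rule fourier_bound[OF H_inf_BP[OF H_inf_ps_act[OF d g]]])
      fix \<theta>
      have "smooth_norm 0 0 (\<lambda>k. f N k - f' k) = supn (\<lambda>\<theta>. d N (rot2 \<theta>))"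
        by (simp add: smooth_norm_def supn_def d_def)
      then have "norm (act_pull g (\<lambda>\<theta>. d N (rot2 \<theta>)) \<theta>) \<le> smooth_norm 0 0 (\<lambda>k. f N k - f' k)"
        using supn_ge[OF H_inf_BP[OF d]] by (simp add: act_pull_def pull_def)
      then show "norm (ps_act \<nu> g (d N) (rot2 \<theta>)) \<le> ?C * smooth_norm 0 0 (\<lambda>k. f N k - f' k)"
        unfolding ps_act_rot2[OF g] norm_mult
        by (intro mult_mono supn_ge BP_act_factor g supn_nonneg) auto
    qed
    finally show ?thesis .
  qed
  then show ?thesis
    unfolding LIM_zero_iff[symmetric, of _ "fourier l (ps_act \<nu> g f')"]
    by (rule Lim_null_comparison[OF always_eventually, OF allI])
      (use tendsto_mult_right_zero[OF tendsto_mult_left_zero[OF lim], of ?C] in \<open>auto intro!: tendsto_eq_intros lim\<close>)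
qed

section \<open>The closed subrepresentation cut out by one linear relation between Fourier
  coefficients\<close>

locale fourier_datum =
  fixes n l :: "int \<times> int" and \<nu>s :: "c2 list" and \<alpha> :: "nat \<Rightarrow> complex"
begin

definition \<xi> :: "datum list" where "\<xi> = map (\<lambda>\<nu>. (delta2 n, \<nu>, 0)) \<nu>s"

abbreviation "len \<equiv> length \<nu>s"

definition L :: "grp \<Rightarrow> (c2 \<Rightarrow> grp \<Rightarrow> complex) list \<Rightarrow> complex" where
  "L g \<Phi> = (\<Sum>i<len. \<alpha> i * fourier l (ps_act (\<nu>s ! i) g ((\<Phi> ! i) (\<nu>s ! i))))"

text \<open>Imposing the relation on all translates makes it invariant under G. Only the values at
  the given points enter, so it descends to jets of order 0 (\<open>W_iff\<close>).\<close>

definition W :: "(c2 \<Rightarrow> grp \<Rightarrow> complex) set list set" where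
  "W = H_classes \<xi> ` {\<Phi> \<in> H_tuples \<xi>. \<forall>g\<in>GG. L g \<Phi> = 0}"

lemma len_\<xi>: "length \<xi> = len" and nth_\<xi>: "i < len \<Longrightarrow> \<xi> ! i = (delta2 n, \<nu>s ! i, 0)"
  by (simp_all add: \<xi>_def)

lemma H_tuples_iff: "\<Phi> \<in> H_tuples \<xi> \<longleftrightarrow> length \<Phi> = len \<and> (\<forall>i<len. \<Phi> ! i \<in> germ_H (delta2 n) (\<nu>s ! i))"
  by (auto simp: H_tuples_def list_all2_conv_all_nth len_\<xi> nth_\<xi>)

lemma Hom_tuples_iff: "ts \<in> Hom_tuples m \<xi> \<longleftrightarrow> length ts = len \<and> (\<forall>i<len. ts ! i \<in> germ_Hom m (delta2 n) (\<nu>s ! i))"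
  by (auto simp: Hom_tuples_def list_all2_conv_all_nth len_\<xi> nth_\<xi>)

lemma H_value: "\<Phi> \<in> H_tuples \<xi> \<Longrightarrow> i < len \<Longrightarrow> (\<Phi> ! i) (\<nu>s ! i) \<in> H_inf (delta2 n)"
  using H_tuples_iff germ_H_value by blast

lemma H_classes_eq:
  assumes "\<Phi> \<in> H_tuples \<xi>" "\<Psi> \<in> H_tuples \<xi>" "H_classes \<xi> \<Phi> = H_classes \<xi> \<Psi>" "i < len"
  shows "(\<Phi> ! i) (\<nu>s ! i) = (\<Psi> ! i) (\<nu>s ! i)"
proof -
  have l: "length \<Phi> = len" "length \<Psi> = len" using assms(1,2) by (auto simp: H_tuples_iff)
  have "H_classes \<xi> \<Phi> ! i = H_classes \<xi> \<Psi> ! i" using assms(3) by simp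
  then have "jet_class sc_H (\<nu>s ! i) 0 (germ_H (delta2 n) (\<nu>s ! i)) (\<Phi> ! i) = jet_class sc_H (\<nu>s ! i) 0 (germ_H (delta2 n) (\<nu>s ! i)) (\<Psi> ! i)"
    using assms(4) l by (simp add: H_classes_def len_\<xi> nth_\<xi>)
  from jet_class_eq_imp_eval_H[OF _ this] show ?thesis using assms(1,4) by (simp add: H_tuples_iff)
qed

lemma W_iff:
  assumes "\<Phi> \<in> H_tuples \<xi>"
  shows "H_classes \<xi> \<Phi> \<in> W \<longleftrightarrow> (\<forall>g\<in>GG. L g \<Phi> = 0)"
proof
  assume "H_classes \<xi> \<Phi> \<in> W"
  then obtain \<Psi> where \<Psi>: "H_classes \<xi> \<Phi> = H_classes \<xi> \<Psi>" "\<Psi> \<in> H_tuples \<xi>" "\<forall>g\<in>GG. L g \<Psi> = 0"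
    unfolding W_def by blast
  have "L g \<Phi> = L g \<Psi>" for g
    unfolding L_def by (rule sum.cong) (use H_classes_eq[OF assms \<Psi>(2,1)] in auto)
  then show "\<forall>g\<in>GG. L g \<Phi> = 0" using \<Psi>(3) by simp
qed (use assms in \<open>auto simp: W_def\<close>)

lemma L_lincomb:
  assumes \<Phi>: "\<Phi> \<in> H_tuples \<xi>" and \<Psi>: "\<Psi> \<in> H_tuples \<xi>" and g: "g \<in> GG"
  shows "L g (map2 (\<lambda>\<phi> \<psi> \<mu> k. \<phi> \<mu> k + c * \<psi> \<mu> k) \<Phi> \<Psi>) = L g \<Phi> + c * L g \<Psi>"
proof -
  have l: "length \<Phi> = len" "length \<Psi> = len" using \<Phi> \<Psi> by (auto simp: H_tuples_iff)
  show ?thesis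
    unfolding L_def sum_distrib_left sum.distrib[symmetric]
    by (rule sum.cong)
      (use l fourier_ps_act_lincomb[OF H_value[OF \<Phi>] H_value[OF \<Psi>] g] in \<open>simp_all add: algebra_simps\<close>)
qed

lemma H_tuples_lincomb:
  "\<Phi> \<in> H_tuples \<xi> \<Longrightarrow> \<Psi> \<in> H_tuples \<xi> \<Longrightarrow> map2 (\<lambda>\<phi> \<psi> \<mu> k. \<phi> \<mu> k + c * \<psi> \<mu> k) \<Phi> \<Psi> \<in> H_tuples \<xi>"
  by (simp add: H_tuples_iff germ_H_lincomb)

lemma subrep_W: "subrep \<xi> W"
  unfolding subrep_def
proof (intro conjI ballI allI impI)
  show "W \<subseteq> H_space \<xi>" by (auto simp: W_def H_space_def)
  have one: "(\<lambda>_. 1) \<in> germ_Hom n (delta2 n) \<nu>" for \<nu>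
    unfolding germ_Hom_def by (auto intro!: exI[of _ UNIV] hol2_on_const simp: Hom_M_def)
  let ?Z = "map (\<lambda>_. frobenius n 0 (\<lambda>_. 1)) \<nu>s"
  have Z: "?Z \<in> H_tuples \<xi>" by (simp add: H_tuples_iff frobenius_germ_H one)
  have "L g ?Z = 0" if "g \<in> GG" for g
    unfolding L_def by (rule sum.neutral) (simp add: fourier_ps_act_frobenius[OF that])
  then show "W \<noteq> {}" using Z by (auto simp: W_def)
  show "H_classes \<xi> (map2 (\<lambda>\<phi> \<psi> \<mu> k. \<phi> \<mu> k + c * \<psi> \<mu> k) \<Phi> \<Psi>) \<in> W"
    if "\<Phi> \<in> H_tuples \<xi>" "\<Psi> \<in> H_tuples \<xi>" "H_classes \<xi> \<Phi> \<in> W" "H_classes \<xi> \<Psi> \<in> W" for \<Phi> \<Psi> c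
    using that by (simp add: W_iff H_tuples_lincomb L_lincomb)
  show "H_classes \<xi> (map (\<lambda>\<phi> \<mu>. ps_act \<mu> g (\<phi> \<mu>)) \<Phi>) \<in> W"
    if \<Phi>: "\<Phi> \<in> H_tuples \<xi>" "H_classes \<xi> \<Phi> \<in> W" and g: "g \<in> GG" for \<Phi> g
  proof -
    have l: "length \<Phi> = len" using \<Phi> by (simp add: H_tuples_iff)
    have t: "map (\<lambda>\<phi> \<mu>. ps_act \<mu> g (\<phi> \<mu>)) \<Phi> \<in> H_tuples \<xi>"
      using \<Phi>(1) g by (simp add: H_tuples_iff germ_H_ps_act)
    have "L g' (map (\<lambda>\<phi> \<mu>. ps_act \<mu> g (\<phi> \<mu>)) \<Phi>) = L (g' \<odot> g) \<Phi>" if "g' \<in> GG" for g'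
      unfolding L_def by (rule sum.cong) (use l ps_act_mult[OF H_value[OF \<Phi>(1)] that g] in simp_all)
    then show ?thesis using \<Phi> g by (simp add: W_iff[OF t] W_iff GG_mult)
  qed
qed

lemma closed_W: "closed_in_H \<xi> W"
  unfolding closed_in_H_def
proof (intro allI impI)
  fix \<Phi> \<phi>
  assume \<Phi>: "\<forall>N::nat. \<Phi> N \<in> H_tuples \<xi> \<and> H_classes \<xi> (\<Phi> N) \<in> W" and \<phi>: "\<phi> \<in> H_tuples \<xi>"
    and conv: "\<forall>i<length \<xi>. jet_converges (\<xi> ! i) (\<lambda>N. \<Phi> N ! i) (\<phi> ! i)"
  have "L g \<phi> = 0" if g: "g \<in> GG" for g
  proof -
    have "(\<lambda>N. L g (\<Phi> N)) \<longlonglongrightarrow> L g \<phi>"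
      unfolding L_def
    proof (intro tendsto_sum tendsto_mult tendsto_const)
      fix i assume "i \<in> {..<len}"
      then have i: "i < len" by simp
      have "jet_converges (delta2 n, \<nu>s ! i, 0) (\<lambda>N. \<Phi> N ! i) (\<phi> ! i)"
        using conv i by (metis len_\<xi> nth_\<xi>)
      then have "(\<lambda>N. smooth_norm 0 0 (\<lambda>k. (\<Phi> N ! i) (\<nu>s ! i) k - (\<phi> ! i) (\<nu>s ! i) k)) \<longlonglongrightarrow> 0"
        by (simp add: param_deriv_def)
      then show "(\<lambda>N. fourier l (ps_act (\<nu>s ! i) g ((\<Phi> N ! i) (\<nu>s ! i)))) \<longlonglongrightarrow> fourier l (ps_act (\<nu>s ! i) g ((\<phi> ! i) (\<nu>s ! i)))"
        using \<Phi> \<phi> i H_value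
        by (intro fourier_ps_act_continuous[where \<sigma> = "delta2 n" and f = "\<lambda>N. (\<Phi> N ! i) (\<nu>s ! i)" and f' = "(\<phi> ! i) (\<nu>s ! i)"] g) blast+
    qed
    moreover have "L g (\<Phi> N) = 0" for N using \<Phi> g W_iff by blast
    ultimately show ?thesis by (simp add: LIMSEQ_const_iff)
  qed
  then show "H_classes \<xi> \<phi> \<in> W" using W_iff[OF \<phi>] by blast
qed

lemma one_GG: "(mat 1, mat 1) \<in> GG"
  by (simp add: GG_def SL2_def)

lemma L_one_frobenius:
  assumes "length us = len"
  shows "L (mat 1, mat 1) (map (frobenius l v) us) = (\<Sum>i<len. \<alpha> i * ((us ! i) (\<nu>s ! i) * v * (2 * of_real pi)\<^sup>2))"
proof -
  have "matrix_inv (mat 1 :: mat2) = mat 1" by (rule matrix_inv_eqI) simp_all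
  then show ?thesis
    unfolding L_def using assms
    by (intro sum.cong) (simp_all add: fourier_ps_act_frobenius[OF one_GG] gcoef_one power2_eq_square)
qed

text \<open>By \<open>van\<close> the constant tuple of type n lies in \<open>W\<close>. The
  condition carries it to the tuple with values \<phi>(\<nu>_i) of type l, on which \<open>L\<close>
  at the identity is the asserted sum times (2 pi)^2.\<close>

lemma necessity:
  assumes par: "fst l mod 2 = fst n mod 2" "snd l mod 2 = snd n mod 2"
    and cond: "intertwining_condition l n \<phi>" and \<phi>: "hol2_on \<phi> UNIV"
    and \<alpha>: "\<exists>i<len. \<alpha> i \<noteq> 0"
    and van: "\<And>h1 h2. h1 \<in> SL2 \<Longrightarrow> h2 \<in> SL2 \<Longrightarrow> (\<Sum>i<len. \<alpha> i *
       (gcoef (fst l) (fst n) h1 (fst (\<nu>s ! i)) * gcoef (snd l) (snd n) h2 (snd (\<nu>s ! i)))) = 0"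
  shows "(\<Sum>i<len. \<alpha> i * \<phi> (\<nu>s ! i)) = 0"
proof -
  have hom: "c \<in> Hom_M n (delta2 n)" "c \<in> Hom_M l (delta2 n)" for c
    using Hom_M_parity[OF par, of "delta2 n"] by (auto simp: Hom_M_def)
  have germ: "f \<in> germ_Hom n (delta2 n) \<nu>" "f \<in> germ_Hom l (delta2 n) \<nu>" if "hol2_on f UNIV" for f \<nu>
    unfolding germ_Hom_def using that by (auto intro!: exI[of _ UNIV] hom)
  let ?ts = "map (\<lambda>_ _. 1) \<nu>s :: (c2 \<Rightarrow> complex) list"
  obtain j where j: "j < len" "\<alpha> j \<noteq> 0" using \<alpha> by blast
  have datum: "intertwining_datum \<xi> W"
    unfolding intertwining_datum_def
  proof (intro conjI subrep_W closed_W)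
    show "\<forall>(\<sigma>, \<nu>, d)\<in>set \<xi>. \<sigma> \<in> M_hat" by (auto simp: \<xi>_def delta2_M_hat)
    \<comment> \<open>For properness: a tuple of type l supported at one position with nonzero
      coefficient violates the relation at the identity.\<close>
    let ?us = "map (\<lambda>i _. if i = j then 1 else 0) [0..<len] :: (c2 \<Rightarrow> complex) list"
    have t: "map (frobenius l 1) ?us \<in> H_tuples \<xi>"
      by (auto simp: H_tuples_iff intro!: frobenius_germ_H germ hol2_on_const)
    have "length ?us = len" by simp
    from L_one_frobenius[OF this, of 1]
    have "L (mat 1, mat 1) (map (frobenius l 1) ?us)
        = (\<Sum>i<len. \<alpha> i * ((?us ! i) (\<nu>s ! i) * 1 * (2 * of_real pi)\<^sup>2))" .
    also have "\<dots> = (\<Sum>i<len. if i = j then \<alpha> j * (2 * of_real pi)\<^sup>2 else 0)"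
      by (rule sum.cong) auto
    also have "\<dots> = \<alpha> j * (2 * of_real pi)\<^sup>2" using j(1) by simp
    finally have "L (mat 1, mat 1) (map (frobenius l 1) ?us) \<noteq> 0"
      using j(2) by simp
    then have "H_classes \<xi> (map (frobenius l 1) ?us) \<notin> W"
      using one_GG W_iff[OF t] by blast
    then show "W \<noteq> H_space \<xi>" using t by (auto simp: H_space_def)
  qed
  have ts: "?ts \<in> Hom_tuples n \<xi>" by (auto simp: Hom_tuples_iff intro!: germ hol2_on_const)
  have tsW: "H_classes \<xi> (map (frobenius n v) ?ts) \<in> W" for v
  proof -
    have t: "map (frobenius n v) ?ts \<in> H_tuples \<xi>"
      by (auto simp: H_tuples_iff intro!: frobenius_germ_H germ hol2_on_const)
    have "L g (map (frobenius n v) ?ts) = 0" if g: "g \<in> GG" for g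
    proof -
      have "L g (map (frobenius n v) ?ts) = v * (\<Sum>i<len. \<alpha> i *
       (gcoef (fst l) (fst n) (matrix_inv (fst g)) (fst (\<nu>s ! i)) * gcoef (snd l) (snd n) (matrix_inv (snd g)) (snd (\<nu>s ! i))))"
        unfolding L_def sum_distrib_left by (rule sum.cong) (simp_all add: fourier_ps_act_frobenius[OF g])
      then show ?thesis using van[OF GG_SL2[OF g]] by simp
    qed
    then show ?thesis using W_iff[OF t] by blast
  qed
  have "Hom_classes n \<xi> ?ts \<in> D_space n \<xi> W" unfolding D_space_def using ts tsW by blast
  moreover have "Hom_classes n \<xi> ?ts \<noteq> Hom_classes n \<xi> (map (\<lambda>_ _. 0) \<xi>)"
  proof
    assume "Hom_classes n \<xi> ?ts = Hom_classes n \<xi> (map (\<lambda>_ _. 0) \<xi>)"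
    then have "Hom_classes n \<xi> ?ts ! j = Hom_classes n \<xi> (map (\<lambda>_ _. 0) \<xi>) ! j" by simp
    then have "jet_class (*) (\<nu>s ! j) 0 (germ_Hom n (delta2 n) (\<nu>s ! j)) (\<lambda>_. 1) = jet_class (*) (\<nu>s ! j) 0 (germ_Hom n (delta2 n) (\<nu>s ! j)) (\<lambda>_. 0)"
      using j(1) by (simp add: Hom_classes_def len_\<xi> nth_\<xi>)
    from max_ideal_mult_eval[OF jet_class_eq_imp[OF germ(1)[OF hol2_on_const] this]] show False by simp
  qed
  ultimately have "Hom_classes l \<xi> (map (\<lambda>t \<mu>. t \<mu> * \<phi> \<mu>) ?ts) \<in> D_space l \<xi> W"
    using cond datum ts unfolding intertwining_condition_def by blast
  then obtain us where us: "Hom_classes l \<xi> (map (\<lambda>t \<mu>. t \<mu> * \<phi> \<mu>) ?ts) = Hom_classes l \<xi> us" "us \<in> Hom_tuples l \<xi>"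
    "\<And>v. H_classes \<xi> (map (frobenius l v) us) \<in> W"
    unfolding D_space_def by blast
  have lu: "length us = len" and gu: "\<And>i. i < len \<Longrightarrow> us ! i \<in> germ_Hom l (delta2 n) (\<nu>s ! i)"
    using us(2) by (auto simp: Hom_tuples_iff)
  have u: "(us ! i) (\<nu>s ! i) = \<phi> (\<nu>s ! i)" if i: "i < len" for i
  proof -
    have "Hom_classes l \<xi> us ! i = Hom_classes l \<xi> (map (\<lambda>t \<mu>. t \<mu> * \<phi> \<mu>) ?ts) ! i" using us(1) by simp
    then have "jet_class (*) (\<nu>s ! i) 0 (germ_Hom l (delta2 n) (\<nu>s ! i)) (us ! i) = jet_class (*) (\<nu>s ! i) 0 (germ_Hom l (delta2 n) (\<nu>s ! i)) (\<lambda>\<mu>. \<phi> \<mu>)"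
      using i lu by (simp add: Hom_classes_def len_\<xi> nth_\<xi>)
    from max_ideal_mult_eval[OF jet_class_eq_imp[OF gu[OF i] this]] show ?thesis by simp
  qed
  have t: "map (frobenius l 1) us \<in> H_tuples \<xi>"
    using lu gu by (simp add: H_tuples_iff frobenius_germ_H)
  have "L (mat 1, mat 1) (map (frobenius l 1) us) = 0" using us(3)[of 1] one_GG W_iff[OF t] by blast
  then have "(\<Sum>i<len. \<alpha> i * \<phi> (\<nu>s ! i)) * (2 * of_real pi)\<^sup>2 = 0"
    unfolding L_one_frobenius[OF lu] sum_distrib_right using u by (simp add: mult_ac)
  then show ?thesis by simp
qed

end

section \<open>Division by q, and the equivalence\<close>

lemma up_root: "up k n z = 0 \<longleftrightarrow> (\<exists>j<k. z = - ((1 + of_int n) / 2 + of_nat j))"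
proof -
  have "z + x + y = 0 \<longleftrightarrow> z = - (x + y)" for x y by (simp add: eq_neg_iff_add_eq_0 add.assoc del: minus_add_distrib)
  then show ?thesis by (simp only: up_def prod_zero_iff[OF finite_lessThan]) auto
qed

lemma finite_up_roots: "finite {z. up k n z = 0}" "finite {z. up k n (- z) = 0}"
proof -
  have "{z. up k n z = 0} = (\<lambda>j. - ((1 + of_int n) / 2 + of_nat j)) ` {..<k}" by (auto simp: up_root)
  then show 1: "finite {z. up k n z = 0}" by simp
  have "{z. up k n (- z) = 0} = uminus ` {z. up k n z = 0}" by (force simp: image_iff)
  with 1 show "finite {z. up k n (- z) = 0}" by simp
qed

lemma hol2_divide_up:
  assumes f: "hol2_on f UNIV" and z: "\<And>a w. up k n a = 0 \<Longrightarrow> f (a, w) = 0"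
  shows "\<exists>g. hol2_on g UNIV \<and> (\<forall>z w. f (z, w) = up k n z * g (z, w))"
  using z
proof (induction k)
  case 0
  then show ?case using f by (intro exI[of _ f]) (simp add: up_def)
next
  case (Suc k)
  obtain g where g: "hol2_on g UNIV" "\<And>z w. f (z, w) = up k n z * g (z, w)"
    using Suc.IH Suc.prems by (auto simp: up_Suc)
  let ?a = "- ((1 + of_int n) / 2 + of_nat k)"
  \<comment> \<open>The roots are pairwise distinct, so the quotient by the first k factors still
    vanishes at the next root.\<close>
  have "up k n ?a \<noteq> 0" by (auto simp: up_root)
  moreover have "f (?a, w) = 0" for w by (rule Suc.prems) (simp add: up_Suc)
  ultimately have "g (?a, w) = 0" for w using g(2)[of ?a w] by simp
  from hol2_divide[OF g(1) this] obtain g' where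
    g': "hol2_on g' UNIV" "\<And>z w. g (z, w) = (z - ?a) * g' (z, w)" by blast
  have "f (z, w) = up (Suc k) n z * g' (z, w)" for z w
    by (simp add: g(2) g'(2) up_Suc algebra_simps)
  then show ?case using g'(1) by blast
qed

lemma qpoly_eq_up:
  assumes "l mod 2 = n mod 2"
  obtains k m where "qpoly l n = up k m"
  using assms by (cases rule: parity_cases) (metis qpoly_up qpoly_down ext)+

theorem theorem8:
  fixes l n :: "int \<times> int" and \<phi> :: "complex \<times> complex \<Rightarrow> complex"
  assumes "fst l mod 2 = fst n mod 2" and "snd l mod 2 = snd n mod 2"
    and "\<phi> \<in> Hol_Hom l n"
  shows "intertwining_condition l n \<phi> \<longleftrightarrow>
    (\<exists>h. hol2_on h UNIV \<and>
       (\<forall>z w. h (z, w) = h (- z, w) \<and> h (z, w) = h (z, - w)) \<and>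
       (\<forall>z w. \<phi> (z, w) = h (z, w) * (qpoly (fst l) (fst n) z * qpoly (snd l) (snd n) w)))"
proof
  assume "\<exists>h. hol2_on h UNIV \<and>
       (\<forall>z w. h (z, w) = h (- z, w) \<and> h (z, w) = h (z, - w)) \<and>
       (\<forall>z w. \<phi> (z, w) = h (z, w) * (qpoly (fst l) (fst n) z * qpoly (snd l) (snd n) w))"
  then obtain h where h: "hol2_on h UNIV" "\<And>z w. h (z, w) = h (- z, w)" "\<And>z w. h (z, w) = h (z, - w)"
    and \<phi>: "\<And>z w. \<phi> (z, w) = h (z, w) * (qpoly (fst l) (fst n) z * qpoly (snd l) (snd n) w)" by blast
  have "even2 h" unfolding even2_def using h(1) h(2)[symmetric] h(3)[symmetric] by blast
  have eq: "\<phi> = (\<lambda>\<mu>. h \<mu> * (qpoly (fst l) (fst n) (fst \<mu>) * qpoly (snd l) (snd n) (snd \<mu>)))"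
  proof
    fix \<mu>
    show "\<phi> \<mu> = h \<mu> * (qpoly (fst l) (fst n) (fst \<mu>) * qpoly (snd l) (snd n) (snd \<mu>))"
      using \<phi>[of "fst \<mu>" "snd \<mu>"] by simp
  qed
  show "intertwining_condition l n \<phi>"
    unfolding intertwining_condition_def eq
  proof (intro allI impI ballI)
    fix \<xi> W ts
    assume d: "intertwining_datum \<xi> W" and ts: "ts \<in> Hom_tuples n \<xi>" "Hom_classes n \<xi> ts \<in> D_space n \<xi> W"
    interpret intertwining \<xi> W by standard (rule d)
    show "Hom_classes l \<xi> (map (\<lambda>t \<mu>. t \<mu> * (h \<mu> * (qpoly (fst l) (fst n) (fst \<mu>) * qpoly (snd l) (snd n) (snd \<mu>)))) ts) \<in> D_space l \<xi> W"
      by (rule sufficiency[OF assms(1,2) \<open>even2 h\<close> ts])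
  qed
next
  assume cond: "intertwining_condition l n \<phi>"
  have \<phi>: "hol2_on \<phi> UNIV" using assms(3) by (simp add: Hol_Hom_def)
  note nec = fourier_datum.necessity[OF assms(1,2) cond \<phi>]
  let ?p = "qpoly (fst l) (fst n)" and ?q = "qpoly (snd l) (snd n)"
  \<comment> \<open>A one-point datum: at a zero of q all coefficients of type l vanish, whatever
    the other coordinate is.\<close>
  have root1: "\<phi> (z, w) = 0" if "?p z = 0" for z w
    using nec[of "[(z, w)]" "\<lambda>_. 1"] gcoef_zero[OF _ assms(1) that] by simp
  have root2: "\<phi> (z, w) = 0" if "?q w = 0" for z w
    using nec[of "[(z, w)]" "\<lambda>_. 1"] gcoef_zero[OF _ assms(2) that] by simp
  \<comment> \<open>A two-point datum with coefficients q(-z) and -q(z). \<open>necessity\<close>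
    requires one of them to be nonzero; if both vanish, the claim reads 0 = 0.\<close>
  have sym1: "?p (- z) * \<phi> (z, w) = ?p z * \<phi> (- z, w)" for z w
  proof (cases "?p z = 0 \<and> ?p (- z) = 0")
    case False
    have "?p (- z) * \<phi> (z, w) + - ?p z * \<phi> (- z, w) = 0"
      using nec[of "[(z, w), (- z, w)]" "\<lambda>i. if i = 0 then ?p (- z) else - ?p z"] False
        gcoef_symmetry[OF _ assms(1), of _ z]
      by (simp add: lessThan_Suc Ex_less_Suc numeral_2_eq_2 mult.assoc[symmetric])
    then show ?thesis by simp
  qed simp
  have sym2: "?q (- w) * \<phi> (z, w) = ?q w * \<phi> (z, - w)" for z w
  proof (cases "?q w = 0 \<and> ?q (- w) = 0")
    case False
    have "?q (- w) * \<phi> (z, w) + - ?q w * \<phi> (z, - w) = 0"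
      using nec[of "[(z, w), (z, - w)]" "\<lambda>i. if i = 0 then ?q (- w) else - ?q w"] False
        gcoef_symmetry[OF _ assms(2), of _ w]
      by (simp add: lessThan_Suc Ex_less_Suc numeral_2_eq_2 mult.left_commute[of _ "gcoef (fst l) _ _ _"])
    then show ?thesis by simp
  qed simp
  obtain k m where p: "?p = up k m" using qpoly_eq_up[OF assms(1)] by blast
  obtain k' m' where q: "?q = up k' m'" using qpoly_eq_up[OF assms(2)] by blast
  obtain f where f: "hol2_on f UNIV" "\<And>z w. \<phi> (z, w) = ?p z * f (z, w)"
    using hol2_divide_up[OF \<phi>, of k m] root1 unfolding p by blast
  \<comment> \<open>The zeros of \<phi> in the second variable pass to f away from the zeros of
    \<open>?p\<close>, and by continuity to all z.\<close>
  have "f (z, b) = 0" if "?q b = 0" for z b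
  proof (rule continuous_eq_off_finite[of "\<lambda>z. f (z, b)" "\<lambda>_. 0" "{z. ?p z = 0}"])
    show "finite {z. ?p z = 0}" unfolding p by (rule finite_up_roots)
    show "f (z, b) = 0" if "z \<notin> {z. ?p z = 0}" for z
      using root2[OF \<open>?q b = 0\<close>, of z] f(2)[of z b] that by simp
  qed (auto intro: hol2_section_continuous f continuous_on_const)
  then obtain g where g: "hol2_on g UNIV" "\<And>z w. f (w, z) = ?q z * g (z, w)"
    using hol2_divide_up[OF hol2_on_swap[OF f(1)], of k' m'] unfolding q by auto
  define h where "h = (\<lambda>p. g (snd p, fst p))"
  have h: "hol2_on h UNIV" unfolding h_def by (rule hol2_on_swap[OF g(1)])
  have \<phi>h: "\<phi> (z, w) = h (z, w) * (?p z * ?q w)" for z w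
    using f(2)[of z w] g(2)[of z w] by (simp add: h_def)
  note fin = finite_up_roots[of k m, folded p] finite_up_roots[of k' m', folded q]
  have hc: "continuous_on UNIV (\<lambda>z. h (z, w))" "continuous_on UNIV (\<lambda>w. h (z, w))"
    "continuous_on UNIV (\<lambda>z. h (- z, w))" "continuous_on UNIV (\<lambda>w. h (z, - w))" for z w
    using hol2_section_continuous[OF h]
    by (auto intro!: continuous_intros continuous_on_compose2[OF hol2_section_continuous(1)[OF h]]
        continuous_on_compose2[OF hol2_section_continuous(2)[OF h]])
  \<comment> \<open>In terms of h, \<open>sym1\<close> is the claim multiplied by p(z) p(-z) q(w);
    these factors are cancelled off finite sets, once in w and once in z.\<close>
  have e1: "h (z, w) = h (- z, w)" for z w
  proof (rule continuous_eq_off_finite[OF hc(2) hc(2) fin(3)])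
    fix w assume w: "w \<notin> {w. ?q w = 0}"
    show "h (z, w) = h (- z, w)"
    proof (rule continuous_eq_off_finite[OF hc(1) hc(3) finite_UnI[OF fin(1,2)]])
      fix z assume "z \<notin> {z. ?p z = 0} \<union> {z. ?p (- z) = 0}"
      then show "h (z, w) = h (- z, w)" using sym1[of z w] w by (simp add: \<phi>h)
    qed
  qed
  have e2: "h (z, w) = h (z, - w)" for z w
  proof (rule continuous_eq_off_finite[OF hc(1) hc(1) fin(1)])
    fix z assume z: "z \<notin> {z. ?p z = 0}"
    show "h (z, w) = h (z, - w)"
    proof (rule continuous_eq_off_finite[OF hc(2) hc(4) finite_UnI[OF fin(3,4)]])
      fix w assume "w \<notin> {w. ?q w = 0} \<union> {w. ?q (- w) = 0}"
      then show "h (z, w) = h (z, - w)" using sym2[of w z] z by (simp add: \<phi>h)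
    qed
  qed
  show "\<exists>h. hol2_on h UNIV \<and>
       (\<forall>z w. h (z, w) = h (- z, w) \<and> h (z, w) = h (z, - w)) \<and>
       (\<forall>z w. \<phi> (z, w) = h (z, w) * (?p z * ?q w))"
    by (rule exI[of _ h]) (intro conjI allI h e1 e2 \<phi>h)
qed

end
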